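(* Let $\Gamma\subset SL_2(\mathbb R)$ be a Fuchsian group of the first kind, $\chi:\Gamma\to\mathbb C^\times$ a character of finite order, and $m\ge 1$ an integer. Let $\Xi\subset M_m(\Gamma,\chi)$ be a complex subspace with $\dim\Xi\ge 3$, equipped with the Zariski topology, and assume that $\Xi$ determines the field of rational functions $\mathbb C(\mathfrak R_\Gamma)$. Let $f,g\in\Xi$ be linearly independent. For $l\ge1$ let $X_l$ be the set of all $h\in\Xi-(\mathbb C f+\mathbb C g)$ with $\deg\mathcal C(f,g,h)=l$, and let $Z_1$ be the set of all $h\in\Xi-(\mathbb C f+\mathbb C g)$ with $d(f,g,h)=1$. Let $L$ be the largest integer such that $X_L\ne\emptyset$. Then $Z_1\cap X_L$ contains a non-empty open set. In other words, the set of all $h\in\Xi-(\mathbb C f+\mathbb C g)$ such that $\deg\mathcal C(f,g,h)$ is largest possible and $d(f,g,h)=1$ is a non-empty open set.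
   Context: Let $\mathbb H$ be the upper half-plane with the action of $SL_2(\mathbb R)$ by $\gamma.z=(az+b)/(cz+d)$ and $j(\gamma,z)=cz+d$ for $\gamma=\begin{pmatrix}a&b\\c&d\end{pmatrix}$. A discrete subgroup $\Gamma\subset SL_2(\mathbb R)$ is a Fuchsian group of the first kind if $\iint_{\Gamma\backslash\mathbb H}\frac{dx\,dy}{y^2}<\infty$. $\mathfrak R_\Gamma$ denotes the compact Riemann surface obtained from $\Gamma\backslash\mathbb H$ by adding the finitely many cusps; it is regarded as a smooth irreducible projective curve over $\mathbb C$, and $\mathbb C(\mathfrak R_\Gamma)$ is its field of rational (equivalently, meromorphic) functions. $M_m(\Gamma,\chi)$ is the (finite-dimensional) complex vector space of holomorphic $f:\mathbb H\to\mathbb C$ with $f(\gamma.z)=\chi(\gamma)j(\gamma,z)^mf(z)$ for all $z\in\mathbb H$, $\gamma\in\Gamma$, that are holomorphic at every cusp of $\Gamma$. For linearly independent $f,g,h\in M_m(\Gamma,\chi)$, there is a unique holomorphic map $\mathfrak R_\Gamma\to\mathbb P^2$ given by $z\mapsto(f(z):g(z):h(z))$ on the complement of a finite set of $\Gamma$-orbits of common zeros of $f,g,h$. Its image is an irreducible projective plane curve denoted $\mathcal C(f,g,h)$. Its degree as a plane curve (the number of points of intersection with a line in general position) is denoted $\deg\mathcal C(f,g,h)$. The field of rational functions $\mathbb C(\mathcal C(f,g,h))$ is identified with the subfield $\mathbb C(g/f,h/f)$ of $\mathbb C(\mathfrak R_\Gamma)$, and $d(f,g,h)=[\mathbb C(\mathfrak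 R_\Gamma):\mathbb C(\mathcal C(f,g,h))]$ is the degree of the map. The subspace $\Xi$ is said to determine the field of rational functions $\mathbb C(\mathfrak R_\Gamma)$ if there exists a basis $f_0,\dots,f_{s-1}$ of $\Xi$ such that $\mathbb C(\mathfrak R_\Gamma)$ is generated over $\mathbb C$ by the quotients $f_i/f_0$, $1\le i\le s-1$ (this is independent of the choice of basis). The Zariski topology on $\Xi$ is that of an affine space $\mathbb C^s$, $s=\dim\Xi$. The set $X_l$ is empty for all $l>\frac{m}{4\pi}\iint_{\Gamma\backslash\mathbb H}\frac{dx\,dy}{y^2}$, so $L$ is well defined. *)

theory Defs
  imports
    "HOL-Complex_Analysis.Complex_Analysis"
    "HOL-Algebra.Algebra"
    "HOL-Library.Function_Algebras"
begin

unbundle no fps_syntax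

section \<open>Fuchsian groups of the first kind\<close>

definition upper_half_plane :: "complex set" where
  "upper_half_plane = {z. Im z > 0}"

definition mat2 :: "real \<Rightarrow> real \<Rightarrow> real \<Rightarrow> real \<Rightarrow> real^2^2" where
  "mat2 a b c d = vector [vector [a, b], vector [c, d]]"

definition SL2R :: "(real^2^2) monoid" where
  "SL2R = \<lparr>carrier = {A. det A = 1}, monoid.mult = (**), one = mat 1\<rparr>"

definition mob :: "real^2^2 \<Rightarrow> complex \<Rightarrow> complex" where
  "mob \<gamma> = moebius (of_real (\<gamma>$1$1)) (of_real (\<gamma>$1$2)) (of_real (\<gamma>$2$1)) (of_real (\<gamma>$2$2))"

definition cocyc :: "real^2^2 \<Rightarrow> complex \<Rightarrow> complex" where
  "cocyc \<gamma> z = of_real (\<gamma>$2$1) * z + of_real (\<gamma>$2$2)"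

text \<open>A Borel set of representatives for \<open>\<Gamma>\<close> on the upper half-plane. The integral of the invariant
  measure over the quotient is the integral over such a set and does not depend on its choice.\<close>

definition fundamental_set :: "(real^2^2) set \<Rightarrow> complex set \<Rightarrow> bool" where
  "fundamental_set \<Gamma> D \<longleftrightarrow> D \<in> sets borel \<and> D \<subseteq> upper_half_plane \<and>
     (\<forall>z\<in>upper_half_plane. \<exists>!w. w \<in> D \<and> (\<exists>\<gamma>\<in>\<Gamma>. w = mob \<gamma> z))"

definition hyperbolic_area :: "complex set \<Rightarrow> ennreal" where
  "hyperbolic_area D = (\<integral>\<^sup>+z\<in>D. ennreal (1 / (Im z)\<^sup>2) \<partial>lborel)"

definition fuchsian_first_kind :: "(real^2^2) set \<Rightarrow> bool" where
  "fuchsian_first_kind \<Gamma> \<longleftrightarrow> subgroup \<Gamma> SL2R \<and> discrete \<Gamma> \<and>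
     (\<exists>D. fundamental_set \<Gamma> D \<and> hyperbolic_area D < \<infinity>)"

definition finite_order_character :: "(real^2^2) set \<Rightarrow> (real^2^2 \<Rightarrow> complex) \<Rightarrow> bool" where
  "finite_order_character \<Gamma> chi \<longleftrightarrow>
     (\<forall>\<gamma>\<in>\<Gamma>. chi \<gamma> \<noteq> 0) \<and> (\<forall>\<gamma>\<in>\<Gamma>. \<forall>\<delta>\<in>\<Gamma>. chi (\<gamma> ** \<delta>) = chi \<gamma> * chi \<delta>) \<and>
     (\<exists>N::nat. N \<ge> 1 \<and> (\<forall>\<gamma>\<in>\<Gamma>. chi \<gamma> ^ N = 1))"

section \<open>Cusps and the compactified quotient\<close>

datatype riemann_sphere = Fin complex | Infty

fun act :: "real^2^2 \<Rightarrow> riemann_sphere \<Rightarrow> riemann_sphere" where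
  "act \<gamma> (Fin z) = (if cocyc \<gamma> z = 0 then Infty else Fin (mob \<gamma> z))"
| "act \<gamma> Infty = (if \<gamma>$2$1 = 0 then Infty else Fin (of_real (\<gamma>$1$1 / \<gamma>$2$1)))"

definition parabolic :: "real^2^2 \<Rightarrow> bool" where
  "parabolic \<gamma> \<longleftrightarrow> \<gamma> \<noteq> mat 1 \<and> \<gamma> \<noteq> - mat 1 \<and> \<bar>trace \<gamma>\<bar> = 2"

definition cusps :: "(real^2^2) set \<Rightarrow> riemann_sphere set" where
  "cusps \<Gamma> = {s \<in> insert Infty (Fin ` \<real>). \<exists>\<gamma>\<in>\<Gamma>. parabolic \<gamma> \<and> act \<gamma> s = s}"

definition extended_half_plane :: "(real^2^2) set \<Rightarrow> riemann_sphere set" where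
  "extended_half_plane \<Gamma> = Fin ` upper_half_plane \<union> cusps \<Gamma>"

definition orb :: "(real^2^2) set \<Rightarrow> riemann_sphere \<Rightarrow> riemann_sphere set" where
  "orb \<Gamma> P = (\<lambda>\<gamma>. act \<gamma> P) ` \<Gamma>"

text \<open>The points of the compact Riemann surface. Its complex structure is given
  below by a local parameter at every point and by the filter of punctured neighbourhoods.\<close>

definition RSurf :: "(real^2^2) set \<Rightarrow> riemann_sphere set set" where
  "RSurf \<Gamma> = orb \<Gamma> ` extended_half_plane \<Gamma>"

abbreviation proj_pt :: "(real^2^2) set \<Rightarrow> complex \<Rightarrow> riemann_sphere set" where
  "proj_pt \<Gamma> z \<equiv> orb \<Gamma> (Fin z)"

text \<open>A matrix in \<open>SL\<^sub>2(\<real>)\<close> taking \<open>\<infinity>\<close> to the given point of \<open>\<real> \<union> {\<infinity>}\<close>.\<close>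

fun scaling :: "riemann_sphere \<Rightarrow> real^2^2" where
  "scaling Infty = mat 1"
| "scaling (Fin x) = mat2 (Re x) (- 1) 1 0"

definition cusp_width :: "(real^2^2) set \<Rightarrow> riemann_sphere \<Rightarrow> real" where
  "cusp_width \<Gamma> s = (LEAST h. h > 0 \<and>
     (let \<gamma> = scaling s ** mat2 1 h 0 1 ** matrix_inv (scaling s) in \<gamma> \<in> \<Gamma> \<or> - \<gamma> \<in> \<Gamma>))"

text \<open>Order of the stabilizer in the image of \<open>\<Gamma>\<close> in \<open>PSL\<^sub>2(\<real>)\<close>.\<close>

definition ramification :: "(real^2^2) set \<Rightarrow> complex \<Rightarrow> nat" where
  "ramification \<Gamma> a = card {\<gamma>\<in>\<Gamma>. mob \<gamma> a = a} div card (\<Gamma> \<inter> {mat 1, - mat 1})"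

definition cusp_param :: "(real^2^2) set \<Rightarrow> riemann_sphere \<Rightarrow> complex \<Rightarrow> complex" where
  "cusp_param \<Gamma> s z =
     exp (2 * of_real pi * \<i> * mob (matrix_inv (scaling s)) z / of_real (cusp_width \<Gamma> s))"

definition local_param :: "(real^2^2) set \<Rightarrow> riemann_sphere \<Rightarrow> complex \<Rightarrow> complex" where
  "local_param \<Gamma> P z =
     (case P of
        Fin a \<Rightarrow> if a \<in> upper_half_plane then ((z - a) / (z - cnj a)) ^ ramification \<Gamma> a
                 else cusp_param \<Gamma> P z
      | Infty \<Rightarrow> cusp_param \<Gamma> P z)"

definition horoball_filter :: "riemann_sphere \<Rightarrow> complex filter" where
  "horoball_filter s = filtermap (mob (scaling s)) (filtercomap Im at_top)"

definition punctured_nhds :: "riemann_sphere \<Rightarrow> complex filter" where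
  "punctured_nhds P =
     (case P of
        Fin a \<Rightarrow> if a \<in> upper_half_plane then at a else horoball_filter P
      | Infty \<Rightarrow> horoball_filter P)"

section \<open>Modular forms with character\<close>

text \<open>Holomorphy at the cusp \<open>s\<close>: with \<open>\<sigma>\<close> taking \<open>\<infinity>\<close> to \<open>s\<close>, the function \<open>f |\<^sub>m \<sigma>\<close> has a Fourier
  expansion with no negative terms. Because of the character its period may be a proper
  multiple of the width of the cusp.\<close>

definition holomorphic_at_cusp :: "nat \<Rightarrow> riemann_sphere \<Rightarrow> (complex \<Rightarrow> complex) \<Rightarrow> bool" where
  "holomorphic_at_cusp m s f \<longleftrightarrow>
     (\<exists>(w::real) (a::nat \<Rightarrow> complex). w > 0 \<and>
        (\<forall>z\<in>upper_half_plane.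
           (\<lambda>n. a n * exp (2 * of_real pi * \<i> * of_nat n * z / of_real w)) sums
             (f (mob (scaling s) z) / cocyc (scaling s) z ^ m)))"

text \<open>Forms are extended by \<open>0\<close> outside the upper half-plane, so that they are determined by their
  values on it.\<close>

definition modular_forms ::
    "(real^2^2) set \<Rightarrow> (real^2^2 \<Rightarrow> complex) \<Rightarrow> nat \<Rightarrow> (complex \<Rightarrow> complex) set" where
  "modular_forms \<Gamma> chi m =
     {f. f holomorphic_on upper_half_plane \<and> (\<forall>z. z \<notin> upper_half_plane \<longrightarrow> f z = 0) \<and>
         (\<forall>\<gamma>\<in>\<Gamma>. \<forall>z\<in>upper_half_plane. f (mob \<gamma> z) = chi \<gamma> * cocyc \<gamma> z ^ m * f z) \<and>
         (\<forall>s\<in>cusps \<Gamma>. holomorphic_at_cusp m s f)}"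

definition cfun_scale :: "complex \<Rightarrow> (complex \<Rightarrow> complex) \<Rightarrow> complex \<Rightarrow> complex" where
  "cfun_scale c f = (\<lambda>z. c * f z)"

global_interpretation cfun: vector_space cfun_scale
  by unfold_locales (auto simp: cfun_scale_def fun_eq_iff algebra_simps)

section \<open>The field of meromorphic functions on the surface\<close>

definition meromorphic_at_point ::
    "(real^2^2) set \<Rightarrow> (riemann_sphere set \<Rightarrow> riemann_sphere) \<Rightarrow> riemann_sphere \<Rightarrow> bool" where
  "meromorphic_at_point \<Gamma> F P \<longleftrightarrow>
     (\<exists>\<phi>. \<phi> meromorphic_on {0} \<and>
        eventually (\<lambda>z. F (proj_pt \<Gamma> z) = Fin (\<phi> (local_param \<Gamma> P z))) (punctured_nhds P) \<and>
        (is_pole \<phi> 0 \<and> F (orb \<Gamma> P) = Infty \<or> (\<exists>c. \<phi> \<midarrow>0\<rightarrow> c \<and> F (orb \<Gamma> P) = Fin c)))"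

definition mero_funs :: "(real^2^2) set \<Rightarrow> (riemann_sphere set \<Rightarrow> riemann_sphere) set" where
  "mero_funs \<Gamma> =
     {F \<in> extensional (RSurf \<Gamma>). \<forall>P\<in>extended_half_plane \<Gamma>. meromorphic_at_point \<Gamma> F P}"

text \<open>Field operations are pointwise away from the poles of the operands.\<close>

definition mero_op :: "(real^2^2) set \<Rightarrow> (complex \<Rightarrow> complex \<Rightarrow> complex) \<Rightarrow>
    (riemann_sphere set \<Rightarrow> riemann_sphere) \<Rightarrow> (riemann_sphere set \<Rightarrow> riemann_sphere) \<Rightarrow>
    (riemann_sphere set \<Rightarrow> riemann_sphere)" where
  "mero_op \<Gamma> opn F G =
     (THE K. K \<in> mero_funs \<Gamma> \<and>
        (\<forall>p\<in>RSurf \<Gamma>. \<forall>a b. F p = Fin a \<and> G p = Fin b \<longrightarrow> K p = Fin (opn a b)))"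

definition mero_const :: "(real^2^2) set \<Rightarrow> complex \<Rightarrow> riemann_sphere set \<Rightarrow> riemann_sphere" where
  "mero_const \<Gamma> c = restrict (\<lambda>_. Fin c) (RSurf \<Gamma>)"

definition function_field :: "(real^2^2) set \<Rightarrow> (riemann_sphere set \<Rightarrow> riemann_sphere) ring" where
  "function_field \<Gamma> =
     \<lparr>carrier = mero_funs \<Gamma>, monoid.mult = mero_op \<Gamma> (*), monoid.one = mero_const \<Gamma> 1,
      ring.zero = mero_const \<Gamma> 0, ring.add = mero_op \<Gamma> (+)\<rparr>"

definition form_quot :: "(real^2^2) set \<Rightarrow> (complex \<Rightarrow> complex) \<Rightarrow> (complex \<Rightarrow> complex) \<Rightarrow>
    riemann_sphere set \<Rightarrow> riemann_sphere" where
  "form_quot \<Gamma> f g =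
     (THE K. K \<in> mero_funs \<Gamma> \<and>
        (\<forall>z\<in>upper_half_plane. g z \<noteq> 0 \<longrightarrow> K (proj_pt \<Gamma> z) = Fin (f z / g z)))"

definition generated_over_C :: "(real^2^2) set \<Rightarrow> (riemann_sphere set \<Rightarrow> riemann_sphere) set \<Rightarrow>
    (riemann_sphere set \<Rightarrow> riemann_sphere) set" where
  "generated_over_C \<Gamma> S = generate_field (function_field \<Gamma>) (range (mero_const \<Gamma>) \<union> S)"

definition determines_function_field :: "(real^2^2) set \<Rightarrow> (complex \<Rightarrow> complex) set \<Rightarrow> bool" where
  "determines_function_field \<Gamma> \<Xi> \<longleftrightarrow>
     (\<exists>B f0. cfun.independent B \<and> cfun.span B = \<Xi> \<and> f0 \<in> B \<and>
        generated_over_C \<Gamma> ((\<lambda>f. form_quot \<Gamma> f f0) ` (B - {f0})) = carrier (function_field \<Gamma>))"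

section \<open>Zariski topology\<close>

inductive_set polynomial_funs :: "(complex \<Rightarrow> 'v \<Rightarrow> 'v) \<Rightarrow> ('v::ab_group_add \<Rightarrow> complex) set"
  for scl where
  lin: "Vector_Spaces.linear scl (*) l \<Longrightarrow> l \<in> polynomial_funs scl"
| const: "(\<lambda>_. c) \<in> polynomial_funs scl"
| add: "p \<in> polynomial_funs scl \<Longrightarrow> q \<in> polynomial_funs scl \<Longrightarrow>
     (\<lambda>v. p v + q v) \<in> polynomial_funs scl"
| mult: "p \<in> polynomial_funs scl \<Longrightarrow> q \<in> polynomial_funs scl \<Longrightarrow>
     (\<lambda>v. p v * q v) \<in> polynomial_funs scl"

text \<open>The closed subsets of the subspace \<open>V\<close> are the common zero sets in \<open>V\<close> of polynomial functions.
  Linear functionals on \<open>V\<close> extend to the ambient space, so for finite-dimensional \<open>V\<close> this is the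
  Zariski topology of affine space in any linear coordinates on \<open>V\<close>.\<close>

definition zariski :: "(complex \<Rightarrow> 'v \<Rightarrow> 'v) \<Rightarrow> ('v::ab_group_add) set \<Rightarrow> 'v topology" where
  "zariski scl V =
     topology (\<lambda>U. \<exists>S \<subseteq> polynomial_funs scl. U = {v\<in>V. \<exists>p\<in>S. p v \<noteq> 0})"

lemma openin_zariski:
  "openin (zariski scl V) U \<longleftrightarrow>
     (\<exists>S \<subseteq> polynomial_funs scl. U = {v\<in>V. \<exists>p\<in>S. p v \<noteq> 0})"
proof -
  define P where "P = polynomial_funs scl"
  define D where "D = (\<lambda>S. {v\<in>V. \<exists>p\<in>S. p v \<noteq> (0::complex)})"
  define opn where "opn = (\<lambda>U. \<exists>S\<subseteq>P. U = D S)"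
  have 1: "opn (D S \<inter> D T)" if S: "S \<subseteq> P" and T: "T \<subseteq> P" for S T
  proof -
    define R where "R = (\<lambda>(p, q) v. p v * q v) ` (S \<times> T)"
    have "R \<subseteq> P"
      unfolding R_def
    proof (rule image_subsetI)
      fix x assume "x \<in> S \<times> T"
      then obtain p q where "x = (p, q)" "p \<in> P" "q \<in> P"
        using S T by blast
      thus "(case x of (p, q) \<Rightarrow> \<lambda>v. p v * q v) \<in> P"
        unfolding P_def by (simp only: prod.case) (rule polynomial_funs.mult)
    qed
    moreover have "D S \<inter> D T = D R"
    proof (rule Set.set_eqI)
      fix v
      have "(\<exists>r\<in>R. r v \<noteq> 0) \<longleftrightarrow> (\<exists>x\<in>S \<times> T. fst x v * snd x v \<noteq> 0)"
        by (simp add: R_def case_prod_beta)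
      also have "\<dots> \<longleftrightarrow> (\<exists>p\<in>S. \<exists>q\<in>T. p v \<noteq> 0 \<and> q v \<noteq> 0)"
        by simp
      finally show "v \<in> D S \<inter> D T \<longleftrightarrow> v \<in> D R"
        unfolding D_def by blast
    qed
    ultimately show ?thesis
      unfolding opn_def by blast
  qed
  have 2: "opn (\<Union>K)" if K: "\<forall>U\<in>K. opn U" for K
  proof -
    from bchoice[OF K[unfolded opn_def]]
    obtain S where S: "\<forall>U\<in>K. S U \<subseteq> P \<and> U = D (S U)" ..
    have "(\<Union>U\<in>K. D (S U)) = (\<Union>U\<in>K. U)"
      using S by (intro SUP_cong refl) (drule (1) bspec, erule conjE, erule sym)
    hence "\<Union>K = (\<Union>U\<in>K. D (S U))"
      by simp
    also have "\<dots> = D (\<Union>U\<in>K. S U)"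
      unfolding D_def by blast
    finally have "\<Union>K = D (\<Union>U\<in>K. S U)" .
    moreover have "(\<Union>U\<in>K. S U) \<subseteq> P"
      using S by (intro UN_least) (drule (1) bspec, erule conjunct1)
    ultimately show ?thesis
      unfolding opn_def by (intro exI conjI)
  qed
  have "istopology opn"
    unfolding istopology_def
  proof (intro conjI allI impI)
    fix U V' assume "opn U" "opn V'"
    then obtain S T where "S \<subseteq> P" "T \<subseteq> P" and eq: "U = D S" "V' = D T"
      unfolding opn_def by (elim exE conjE) simp
    from 1[OF this(1,2)] show "opn (U \<inter> V')"
      by (simp only: eq)
  next
    fix K assume "\<forall>U\<in>K. opn U"
    thus "opn (\<Union>K)"
      by (rule 2)
  qed
  from topology_inverse'[OF this] show ?thesis
    unfolding zariski_def opn_def D_def P_def by (rule fun_cong)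
qed

section \<open>The projective plane curve attached to three forms\<close>

text \<open>Points of the projective plane are the lines through the origin in \<open>\<complex>\<^sup>3\<close>.\<close>

definition proj_point :: "complex^3 \<Rightarrow> (complex^3) set" where
  "proj_point v = vec.span {v}"

definition holomorphic_to_P2 ::
    "(real^2^2) set \<Rightarrow> (riemann_sphere set \<Rightarrow> (complex^3) set) \<Rightarrow> bool" where
  "holomorphic_to_P2 \<Gamma> \<Phi> \<longleftrightarrow> \<Phi> \<in> extensional (RSurf \<Gamma>) \<and>
     (\<forall>P\<in>extended_half_plane \<Gamma>. \<exists>\<phi>::complex \<Rightarrow> complex^3.
        (\<forall>i. (\<lambda>t. \<phi> t $ i) analytic_on {0}) \<and> \<phi> 0 \<noteq> 0 \<and> \<Phi> (orb \<Gamma> P) = proj_point (\<phi> 0) \<and>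
        eventually (\<lambda>z. \<Phi> (proj_pt \<Gamma> z) = proj_point (\<phi> (local_param \<Gamma> P z))) (punctured_nhds P))"

definition form_map :: "(real^2^2) set \<Rightarrow> (complex \<Rightarrow> complex) \<Rightarrow> (complex \<Rightarrow> complex) \<Rightarrow>
    (complex \<Rightarrow> complex) \<Rightarrow> riemann_sphere set \<Rightarrow> (complex^3) set" where
  "form_map \<Gamma> f g h =
     (THE \<Phi>. holomorphic_to_P2 \<Gamma> \<Phi> \<and>
        (\<forall>z\<in>upper_half_plane. (f z, g z, h z) \<noteq> (0, 0, 0) \<longrightarrow>
           \<Phi> (proj_pt \<Gamma> z) = proj_point (vector [f z, g z, h z])))"

definition form_curve :: "(real^2^2) set \<Rightarrow> (complex \<Rightarrow> complex) \<Rightarrow> (complex \<Rightarrow> complex) \<Rightarrow>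
    (complex \<Rightarrow> complex) \<Rightarrow> (complex^3) set set" where
  "form_curve \<Gamma> f g h = form_map \<Gamma> f g h ` RSurf \<Gamma>"

definition proj_line :: "complex^3 \<Rightarrow> (complex^3) set set" where
  "proj_line a = proj_point ` {v. v \<noteq> 0 \<and> (\<Sum>i\<in>UNIV. a $ i * v $ i) = 0}"

text \<open>The number of points of intersection with a line in general position, that is, with every
  line whose coefficient vector lies in some non-empty Zariski open set.\<close>

definition plane_curve_degree :: "(complex^3) set set \<Rightarrow> nat" where
  "plane_curve_degree C =
     (THE n. \<exists>U. openin (zariski (*s) UNIV) U \<and> U \<noteq> {} \<and>
        (\<forall>a\<in>U. a \<noteq> 0 \<longrightarrow> finite (C \<inter> proj_line a) \<and> card (C \<inter> proj_line a) = n))"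

definition deg_curve :: "(real^2^2) set \<Rightarrow> (complex \<Rightarrow> complex) \<Rightarrow> (complex \<Rightarrow> complex) \<Rightarrow>
    (complex \<Rightarrow> complex) \<Rightarrow> nat" where
  "deg_curve \<Gamma> f g h = plane_curve_degree (form_curve \<Gamma> f g h)"

text \<open>The field of rational functions of the curve, as a subfield of the function field of the surface.\<close>

definition curve_field :: "(real^2^2) set \<Rightarrow> (complex \<Rightarrow> complex) \<Rightarrow> (complex \<Rightarrow> complex) \<Rightarrow>
    (complex \<Rightarrow> complex) \<Rightarrow> (riemann_sphere set \<Rightarrow> riemann_sphere) set" where
  "curve_field \<Gamma> f g h = generated_over_C \<Gamma> {form_quot \<Gamma> g f, form_quot \<Gamma> h f}"

definition deg_map :: "(real^2^2) set \<Rightarrow> (complex \<Rightarrow> complex) \<Rightarrow> (complex \<Rightarrow> complex) \<Rightarrow>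
    (complex \<Rightarrow> complex) \<Rightarrow> nat" where
  "deg_map \<Gamma> f g h =
     ring.dim (function_field \<Gamma>) (curve_field \<Gamma> f g h) (carrier (function_field \<Gamma>))"

definition degree_set :: "(real^2^2) set \<Rightarrow> (complex \<Rightarrow> complex) set \<Rightarrow> (complex \<Rightarrow> complex) \<Rightarrow>
    (complex \<Rightarrow> complex) \<Rightarrow> nat \<Rightarrow> (complex \<Rightarrow> complex) set" where
  "degree_set \<Gamma> \<Xi> f g l = {h \<in> \<Xi> - cfun.span {f, g}. deg_curve \<Gamma> f g h = l}"

definition birational_set :: "(real^2^2) set \<Rightarrow> (complex \<Rightarrow> complex) set \<Rightarrow> (complex \<Rightarrow> complex) \<Rightarrow>
    (complex \<Rightarrow> complex) \<Rightarrow> (complex \<Rightarrow> complex) set" where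
  "birational_set \<Gamma> \<Xi> f g = {h \<in> \<Xi> - cfun.span {f, g}. deg_map \<Gamma> f g h = 1}"

definition max_degree :: "(real^2^2) set \<Rightarrow> (complex \<Rightarrow> complex) set \<Rightarrow> (complex \<Rightarrow> complex) \<Rightarrow>
    (complex \<Rightarrow> complex) \<Rightarrow> nat" where
  "max_degree \<Gamma> \<Xi> f g = (GREATEST l. l \<ge> 1 \<and> degree_set \<Gamma> \<Xi> f g l \<noteq> {})"

end

theory Submission
  imports Defs
    "HOL-Computational_Algebra.Polynomial_Factorial"
    "HOL-Computational_Algebra.Fundamental_Theorem_Algebra"
    "HOL-Computational_Algebra.Field_as_Ring"
begin

no_notation fps_nth (infixl "$" 75)
hide_const (open) up_ring.coeff up_ring.monom Polynomials.degree Divisibility.irreducible Coset.order UnivPoly.deg module.smult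

text \<open>A group of finite coarea has a compact thick part (by packing of discs), and its thin part is covered by
  finitely many cusp neighbourhoods, because small elements commute. So a space of forms is described by finitely
  many charts, and by Siegel's lemma \<open>f, g, h\<close> satisfy a homogeneous relation of degree bounded independently
  of \<open>h\<close>: a form vanishing to high order at the centres of the charts vanishes.

  The degree of the image curve is the least degree \<open>r(h)\<close> of a relation. Indeed a general line meets the zero set of
  the minimal relation in \<open>r(h)\<close> points; if one of them were not attained, an auxiliary polynomial would give a
  bounded, hence constant, quotient of forms on the curve, contradicting minimality.

  Now \<open>r(h) \<ge> n\<close> means that the monomials of degree \<open>n - 1\<close> in \<open>f, g, h\<close> are independent, a Zariski open condition
  on \<open>h\<close>. If \<open>r(h)\<close> has the maximal value \<open>L\<close>, then for every \<open>u \<in> \<Xi>\<close> the forms \<open>f, g, h + e u\<close> satisfy relations of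
  degree \<open>L\<close> with coefficients polynomial in \<open>e\<close>. The derivative at \<open>e = 0\<close> expresses \<open>u / f\<close> rationally through
  \<open>g / f\<close> and \<open>h / f\<close>; so the map is birational for every \<open>h\<close> in \<open>X\<^sub>L\<close>.\<close>

text \<open>Both degrees are read off from the single number \<open>r(h)\<close>, so divisors, genus
  and Riemann-Roch do not enter. Compactness of the surface appears only as a finite atlas: the unit
  discs of its charts cover, and the discs of radius 2 leave room for the maximum principle and the
  Schwarz lemma.

  Birationality for a general h alone would leave two open conditions to be intersected. Maximality
  of L avoids this: on the line h + e u the degree cannot rise above L, so a relation F_e of degree
  L persists for every e, even if h + e u falls into the span of f and g. Differentiating F_e(f, g,
  h + e u) = 0 at e = 0 gives A(f, g, h) + u B(f, g, h) = 0, where B is the partial derivative of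
  the minimal relation in its third variable. Since B has degree L - 1, minimality keeps it from
  vanishing on the curve, and division by it is allowed. The set in question is therefore X_L
  itself, and its openness concerns \<open>r(h)\<close> alone.\<close>

type_synonym cfun = "complex => complex"

abbreviation UHP :: "complex set" where "UHP == upper_half_plane"
abbreviation EHP :: "(real^2^2) set => riemann_sphere set" where "EHP == extended_half_plane"
abbreviation near :: "riemann_sphere => (complex => bool) => bool" where
 "near P Q == eventually Q (punctured_nhds P)"

section \<open>Linear systems and polynomials in two variables\<close>

text \<open>Gaussian elimination, one equation at a time: the equation \<open>l\<close> is solved
  for a variable \<open>k\<close> with nonzero coefficient and substituted into the others
  (\<open>b\<close>), so that both counts drop by one.\<close>

lemma underdetermined_system:
 fixes a :: "'l => 'i => complex"
 assumes "finite L" "finite I" "card L < card I"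
 shows "\<exists>c. (\<exists>i\<in>I. c i ~= 0) \<and> (\<forall>i. i \<notin> I --> c i = 0) \<and> (\<forall>l\<in>L. (\<Sum>i\<in>I. a l i * c i) = 0)"
 using assms
proof (induction L arbitrary: a I rule: finite_induct)
  case empty
  then obtain i where "i \<in> I" by (auto simp: card_gt_0_iff)
  thus ?case by (intro exI[of _ "\<lambda>j. if j = i then 1 else 0"]) auto
 next
  case (insert l L)
  show ?case
  proof (cases "\<forall>i\<in>I. a l i = 0")
   case True
   have "card L < card I" using insert.prems insert.hyps by simp
   from insert.IH[OF insert.prems(1) this, of a] True show ?thesis by auto
  next
   case False
   then obtain k where k: "k \<in> I" "a l k ~= 0" by blast
   define b where "b = (\<lambda>l' i. a l' i - a l' k * a l i / a l k)"
   have "card L < card (I - {k})" using insert.prems insert.hyps k by simp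
   from insert.IH[OF _ this, of b] insert.prems(1)
   obtain c where c: "\<exists>i\<in>I - {k}. c i ~= 0" "\<And>i. i \<notin> I - {k} ==> c i = 0"
    "\<And>l'. l' \<in> L ==> (\<Sum>i\<in>I - {k}. b l' i * c i) = 0" by auto
   define s where "s = (\<Sum>i\<in>I - {k}. a l i * c i)"
   define c' where "c' = (\<lambda>i. if i = k then - s / a l k else c i)"
   have sum: "(\<Sum>i\<in>I. a l' i * c' i) = a l' k * (- s / a l k) + (\<Sum>i\<in>I - {k}. a l' i * c i)" for l'
    using insert.prems(1) k(1) by (subst sum.remove[of _ k]) (auto simp: c'_def intro!: sum.cong)
   have "(\<Sum>i\<in>I. a l' i * c' i) = 0" if "l' \<in> L" for l'
   proof -
    have "(\<Sum>i\<in>I - {k}. b l' i * c i) = (\<Sum>i\<in>I - {k}. a l' i * c i) - (a l' k / a l k) * s"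
 by (simp add: b_def s_def algebra_simps sum_subtractf sum_distrib_left)
    thus ?thesis using c(3)[OF that] sum[of l'] by simp
   qed
   moreover have "(\<Sum>i\<in>I. a l i * c' i) = 0" using sum[of l] k(2) by (simp add: s_def)
   moreover have "\<exists>i\<in>I. c' i ~= 0" using c(1) by (auto simp: c'_def)
   moreover have "\<forall>i. i \<notin> I --> c' i = 0" using c(2) k by (auto simp: c'_def)
   ultimately show ?thesis by auto
  qed
 qed

text \<open>The outer variable is y and the coefficients are polynomials in x:
  \<open>coeff (coeff p j) i\<close> belongs to x^i y^j.\<close>

abbreviation poly2 :: "complex poly poly => complex => complex => complex" where
 "poly2 p x y \<equiv> poly (poly p [:y:]) x"

lemma poly2_sum: "poly2 p x y = (\<Sum>j\<le>degree p. poly (coeff p j) x * y ^ j)"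
 by (simp add: poly_altdef[of p] poly_sum)

lemma holomorphic_on_compose_poly:
 assumes "f holomorphic_on S" shows "(\<lambda>t. poly q (f t)) holomorphic_on S"
 unfolding poly_altdef by (intro holomorphic_intros assms)

lemma holomorphic_poly2 [holomorphic_intros]:
 assumes "f holomorphic_on S" "g holomorphic_on S"
 shows "(\<lambda>t. poly2 p (f t) (g t)) holomorphic_on S"
 unfolding poly2_sum by (intro holomorphic_intros assms holomorphic_on_compose_poly)

definition slice :: "complex => complex poly poly => complex poly" where
 "slice x p = map_poly (\<lambda>q. poly q x) p"

lemma coeff_slice [simp]: "coeff (slice x p) j = poly (coeff p j) x"
 by (simp add: slice_def coeff_map_poly)

lemma poly_slice: "poly (slice x p) y = poly2 p x y"
proof -
 have "degree (slice x p) \<le> degree p" by (intro degree_le) (simp add: coeff_eq_0)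
 hence "(\<Sum>j\<le>degree (slice x p). coeff (slice x p) j * y ^ j) = (\<Sum>j\<le>degree p. coeff (slice x p) j * y ^ j)"
 by (intro sum.mono_neutral_left) (auto simp: coeff_eq_0 simp del: coeff_slice)
 thus ?thesis by (simp add: poly2_sum poly_altdef[of "slice x p"])
qed

lemma pderiv_slice: "pderiv (slice x p) = slice x (pderiv p)"
 by (rule poly_eqI) (simp add: coeff_pderiv)

lemma card_roots_squarefree:
 fixes q :: "complex poly"
 assumes "q ~= 0" "\<And>y. poly q y = 0 ==> poly (pderiv q) y ~= 0"
 shows "card {y. poly q y = 0} = degree q"
 using assms
proof (induction "degree q" arbitrary: q)
 case 0
 then obtain c where "q = [:c:]" by (metis degree_eq_zeroE)
 thus ?case using 0 by simp
next
 case (Suc n)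
 hence "degree q > 0" by simp
 from alg_closed_imp_poly_has_root[OF this] obtain y where y: "poly q y = 0" ..
 hence "[:- y, 1:] dvd q" by (simp only: poly_eq_0_iff_dvd)
 then obtain r where r: "q = [:- y, 1:] * r" by auto
 have r0: "r ~= 0" using Suc.prems(1) r by auto
 have "degree q = Suc (degree r)" using r0 by (subst r, subst degree_mult_eq) auto
 hence n: "n = degree r" using Suc.hyps(2) by simp
 have pd: "pderiv q = r + [:- y, 1:] * pderiv r"
 by (subst r, subst pderiv_mult) (simp add: pderiv_pCons)

 have "card {z. poly r z = 0} = degree r"
 proof (rule Suc.hyps(1)[OF n r0])
  fix z assume "poly r z = 0"
  moreover from this have "poly (pderiv q) z ~= 0" by (intro Suc.prems(2)) (subst r, simp)
  ultimately show "poly (pderiv r) z ~= 0" by (auto simp: pd)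
 qed
 moreover have "{z. poly q z = 0} = insert y {z. poly r z = 0}" unfolding r poly_mult by auto
 ultimately show ?case using Suc.prems(2)[OF y] poly_roots_finite[OF r0] n Suc.hyps(2) by (auto simp: pd)
qed

text \<open>The constant \<open>s\<close> in C[x] plays the role of a resultant. It comes from the
  Euclidean algorithm in y with pseudo-division, which keeps all coefficients in C[x];
  irreducibility of \<open>p\<close> prevents the algorithm from ending in a common factor of
  positive y-degree.\<close>

lemma bezout_poly2:
 fixes p q :: "complex poly poly"
 assumes irr: "irreducible p" and deg: "degree p > 0" and ndvd: "\<not> p dvd q"
 obtains A B s where "s ~= 0" "A * p + B * q = [:s:]"
proof -
 have prime: "prime_elem p" using irr by (rule irreducible_imp_prime_elem_gcd)
 have p0: "p ~= 0" using irr by auto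
 have no_const: "\<not> p dvd [:s:]" if "s ~= 0" for s
  using that deg by (auto dest: dvd_imp_degree_le)
 have small: "\<exists>A B s. s ~= 0 \<and> A * p + B * q = [:s:]" if "q ~= 0" "degree q < degree p" for q :: "complex poly poly"
  using that
 proof (induction "degree q" arbitrary: q rule: less_induct)
  case less
  obtain d r where dr: "pseudo_divmod p q = (d, r)" by fastforce
  define c where "c = coeff q (degree q) ^ (Suc (degree p) - degree q)"
  have eq: "smult c p = q * d + r" and r: "r = 0 \<or> degree r < degree q"
   using pseudo_divmod[OF less.prems(1) dr] by (auto simp: c_def)
  have c0: "c ~= 0" using less.prems(1) by (simp add: c_def)
  show ?case
  proof (cases "r = 0")
   case True
   \<comment> \<open>For degree reasons \<open>p\<close> does not divide \<open>q\<close>, so it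
     divides the quotient \<open>d\<close>; cancelling \<open>p\<close> leaves a nonzero constant
     that is a multiple of \<open>q\<close>.\<close>
   hence "p dvd q \<or> p dvd d" using eq prime prime_elem_dvd_mult_iff by (metis add.right_neutral dvd_smult dvd_refl)
   moreover have "\<not> p dvd q" using less.prems by (auto dest: dvd_imp_degree_le)
   ultimately obtain d' where d': "d = p * d'" by auto
   have "p * [:c:] = p * (q * d')" using eq True d' by simp
   hence "[:c:] = q * d'" using p0 mult_left_cancel by blast
   thus ?thesis using c0 by (intro exI[of _ 0] exI[of _ d'] exI[of _ c]) (simp add:)
  next
   case False
   with r have "degree r < degree q" by simp
   from less.hyps[OF this False] this less.prems(2)
   obtain A B s where s: "s ~= 0" "A * p + B * r = [:s:]" by auto
   have req: "r = [:c:] * p - q * d" using eq by simp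
   have "(A + B * [:c:]) * p + (- (B * d)) * q = A * p + B * r" unfolding req by (simp only: algebra_simps) (simp add:)
   hence "(A + B * [:c:]) * p + (- (B * d)) * q = [:s:]" by (simp only: s(2))
   thus ?thesis using s(1) by blast
  qed
 qed
 obtain d r where dr: "pseudo_divmod q p = (d, r)" by fastforce
 define c where "c = coeff p (degree p) ^ (Suc (degree q) - degree p)"
 have eq: "smult c q = p * d + r" and r: "r = 0 \<or> degree r < degree p"
  using pseudo_divmod[OF p0 dr] by (auto simp: c_def)
 have c0: "c ~= 0" using p0 by (simp add: c_def)
 have "r ~= 0"
 using eq prime_elem_dvd_mult_iff[OF prime] ndvd no_const[OF c0] by force
 with small[of r] r obtain A B s where s: "s ~= 0" "A * p + B * r = [:s:]" by auto
 have req: "r = [:c:] * q - p * d" using eq by simp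
 have "(A - B * d) * p + (B * [:c:]) * q = A * p + B * r" unfolding req by (simp only: algebra_simps)
 thus ?thesis using s(1) that by (simp only: s(2))
qed

text \<open>\<open>poly p [:0, b:]\<close> is the restriction of \<open>p\<close> to the line \<open>y = b x\<close>; on almost every such line its
 degree is the total degree of \<open>p\<close>.\<close>

definition total_degree_le :: "complex poly poly => nat => bool" where
 "total_degree_le p n \<longleftrightarrow> (\<forall>i j. coeff (coeff p j) i ~= 0 --> i + j \<le> n)"

lemma coeff_line:
 fixes p :: "complex poly poly"
 shows "coeff (poly p [:0, b:]) n = (\<Sum>j\<le>degree p. if j \<le> n then coeff (coeff p j) (n - j) * b ^ j else 0)"
proof -
 have "[:0, b:] = monom b 1" by (simp add: monom_Suc monom_0)
 hence "[:0, b:] ^ j = monom (b ^ j) j" for j :: nat by (simp add: monom_power)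
 hence "coeff (coeff p j * [:0, b:] ^ j) n = (if j \<le> n then coeff (coeff p j) (n - j) * b ^ j else 0)" for j
  using coeff_monom_mult[of "b ^ j" j "coeff p j" n] by (simp only: mult.commute[of "coeff p j"]) auto
 thus ?thesis by (simp only: poly_altdef[of p] coeff_sum)
qed

lemma total_degree_line: "total_degree_le p n ==> degree (poly p [:0, b:]) \<le> n"
 by (intro degree_le allI impI, subst coeff_line, intro sum.neutral ballI)
   (fastforce simp: total_degree_le_def)

text \<open>Here n is the total degree. The coefficient of x^n on the line y = b x is the top
  homogeneous part at (1, b), a nonzero polynomial in b, and so vanishes for finitely many b
  only.\<close>

lemma total_degree_exact:
 assumes "p ~= 0"
 obtains n where "total_degree_le p n" "finite {b. coeff (poly p [:0, b:]) n = 0}"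
proof -
 define M where "M = {(i, j). coeff (coeff p j) i ~= 0}"
 have "M \<subseteq> (\<Union>j\<le>degree p. (\<lambda>i. (i, j)) ` {..degree (coeff p j)})"
 proof
  fix x assume "x \<in> M"
  then obtain i j where x: "x = (i, j)" "coeff (coeff p j) i ~= 0" by (auto simp: M_def)
  hence "i \<le> degree (coeff p j)" "j \<le> degree p" by (auto intro: le_degree)
  thus "x \<in> (\<Union>j\<le>degree p. (\<lambda>i. (i, j)) ` {..degree (coeff p j)})" using x by auto
 qed
 hence fin: "finite M" using finite_subset by blast
 obtain j where "coeff p j ~= 0" using assms by (metis leading_coeff_0_iff)
 then obtain i where "coeff (coeff p j) i ~= 0" by (metis leading_coeff_0_iff)
 hence ne: "M ~= {}" by (auto simp: M_def)
 define n where "n = Max ((\<lambda>(i, j). i + j) ` M)"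
 have "n \<in> (\<lambda>(i, j). i + j) ` M" unfolding n_def using fin ne by simp
 then obtain i0 j0 where n: "n = i0 + j0" "coeff (coeff p j0) i0 ~= 0" by (auto simp: M_def)
 have le: "total_degree_le p n" unfolding total_degree_le_def n_def
  using fin by (auto simp: M_def intro!: Max_ge)
 define q where "q = (\<Sum>j\<le>degree p. monom (if j \<le> n then coeff (coeff p j) (n - j) else 0) j)"
 have "coeff q j0 ~= 0"
 proof -
  have "j0 \<le> degree p" using n(2) by (intro le_degree) auto
  thus ?thesis using n by (simp add: q_def coeff_sum)
 qed
 hence "q ~= 0" by auto
 hence "finite {b. poly q b = 0}" by (rule poly_roots_finite)
 moreover have "coeff (poly p [:0, b:]) n = poly q b" for b
  unfolding coeff_line q_def poly_sum poly_monom by (intro sum.cong) auto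
 ultimately show ?thesis using that le by simp
qed

text \<open>On a line y = b x that is good for both factors the total degrees are ordinary degrees,
  which add up.\<close>

lemma total_degree_mult:
 assumes "p ~= 0" "q ~= 0" "total_degree_le (p * q) n"
 obtains k l where "total_degree_le p k" "total_degree_le q l" "k + l \<le> n"
proof -
 obtain k where k: "total_degree_le p k" "finite {b. coeff (poly p [:0, b:]) k = 0}" using total_degree_exact[OF assms(1)] .
 obtain l where l: "total_degree_le q l" "finite {b. coeff (poly q [:0, b:]) l = 0}" using total_degree_exact[OF assms(2)] .
 have "infinite (UNIV :: complex set)" by (simp add: infinite_UNIV_char_0)
 then obtain b where b: "coeff (poly p [:0, b:]) k ~= 0" "coeff (poly q [:0, b:]) l ~= 0"
  using k(2) l(2) by (metis (mono_tags, lifting) UNIV_eq_I Un_iff finite_UnI mem_Collect_eq)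
 have "degree (poly p [:0, b:]) \<ge> k" "degree (poly q [:0, b:]) \<ge> l" using b by (auto intro: le_degree)
 moreover have "poly p [:0, b:] ~= 0" "poly q [:0, b:] ~= 0" using b by auto
 hence "degree (poly (p * q) [:0, b:]) = degree (poly p [:0, b:]) + degree (poly q [:0, b:])"
 by (simp add: degree_mult_eq)
 ultimately show ?thesis using total_degree_line[OF assms(3), of b] that k l by simp
qed

lemma total_degree_0:
 assumes "total_degree_le p 0"
 shows "p = [:[:coeff (coeff p 0) 0:]:]"
proof (rule poly_eqI, rule poly_eqI)
 fix i j
 show "coeff (coeff p i) j = coeff (coeff [:[:coeff (coeff p 0) 0:]:] i) j"
  using assms by (cases i; cases j) (auto simp: total_degree_le_def)
qed

section \<open>Homogeneous forms in three variables\<close>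

text \<open>The exponent \<open>n - i - j\<close> of the first coordinate is left implicit, so the
  same indices serve for homogeneous forms and for their dehomogenizations.\<close>

definition Mon :: "nat => (nat \<times> nat) set" where
 "Mon n = {(i, j). i + j \<le> n}"

definition hform :: "nat => (nat \<times> nat => complex) => complex^3 => complex" where
 "hform n c v = (\<Sum>(i, j)\<in>Mon n. c (i, j) * (v$1 ^ (n - i - j) * v$2 ^ i * v$3 ^ j))"

definition homog :: "nat => (complex^3 => complex) set" where
 "homog n = range (hform n)"

lemma finite_Mon [simp]: "finite (Mon n)"
 by (rule finite_subset[of _ "{..n} \<times> {..n}"]) (auto simp: Mon_def)

lemma homogI: "hform n c \<in> homog n"
 by (simp add: homog_def)

lemma homog_add: "p \<in> homog n ==> q \<in> homog n ==> (\<lambda>v. p v + q v) \<in> homog n"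
proof -
 assume "p \<in> homog n" "q \<in> homog n"
 then obtain c d where "p = hform n c" "q = hform n d" by (auto simp: homog_def)
 hence "(\<lambda>v. p v + q v) = hform n (\<lambda>x. c x + d x)"
 by (simp add: fun_eq_iff hform_def case_prod_beta' sum.distrib[symmetric] algebra_simps)
 thus ?thesis by (simp add: homogI)
qed

lemma homog_scale: "p \<in> homog n ==> (\<lambda>v. a * p v) \<in> homog n"
proof -
 assume "p \<in> homog n"
 then obtain c where "p = hform n c" by (auto simp: homog_def)
 hence "(\<lambda>v. a * p v) = hform n (\<lambda>x. a * c x)"
 by (simp add: fun_eq_iff hform_def case_prod_beta' sum_distrib_left algebra_simps)
 thus ?thesis by (simp add: homogI)
qed

lemma homog_0 [simp]: "(\<lambda>v. 0) \<in> homog n"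
 using homog_scale[of "hform n (\<lambda>_. 0)" n 0] homogI by simp

lemma homog_sum: "(\<And>i. i \<in> I ==> p i \<in> homog n) ==> (\<lambda>v. \<Sum>i\<in>I. p i v) \<in> homog n"
 by (induction I rule: infinite_finite_induct) (auto intro: homog_add)

lemma homog_monomial:
 assumes "i + j + k = n"
 shows "(\<lambda>v. v$1 ^ k * v$2 ^ i * v$3 ^ j) \<in> homog n"
proof -
 have "(\<lambda>v. v$1 ^ k * v$2 ^ i * v$3 ^ j) = hform n (\<lambda>x. if x = (i, j) then 1 else 0)"
 proof
  fix v :: "complex^3"
  have ij: "(i, j) \<in> Mon n" using assms by (simp add: Mon_def)
  have "hform n (\<lambda>x. if x = (i, j) then 1 else 0) v = (\<Sum>x\<in>Mon n. if x = (i, j) then v$1 ^ (n - i - j) * v$2 ^ i * v$3 ^ j else 0)"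
   unfolding hform_def by (intro sum.cong) (auto split: if_splits)
  also have "... = v$1 ^ k * v$2 ^ i * v$3 ^ j" using ij assms by auto
  finally show "v$1 ^ k * v$2 ^ i * v$3 ^ j = hform n (\<lambda>x. if x = (i, j) then 1 else 0) v" ..
 qed
 thus ?thesis by (simp add: homogI)
qed

lemma homog_mult:
 assumes "p \<in> homog m" "q \<in> homog n"
 shows "(\<lambda>v. p v * q v) \<in> homog (m + n)"
proof -
 obtain c d where cd: "p = hform m c" "q = hform n d" using assms by (auto simp: homog_def)
 have "(\<lambda>v. p v * q v) = (\<lambda>v. \<Sum>x\<in>Mon m. \<Sum>y\<in>Mon n. (c x * d y) * (v$1 ^ ((m - fst x - snd x) + (n - fst y - snd y)) * v$2 ^ (fst x + fst y) * v$3 ^ (snd x + snd y)))"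
  unfolding cd hform_def sum_product case_prod_beta' prod.collapse
 by (simp add: power_add mult_ac)
 also have "... \<in> homog (m + n)"
 by (intro homog_sum homog_scale homog_monomial) (auto simp: Mon_def)
 finally show ?thesis .
qed

lemma homog_const [simp]: "(\<lambda>v. a) \<in> homog 0"
 using homog_scale[OF homog_monomial[of 0 0 0 0], of a] by simp

lemma homog_power: "p \<in> homog m ==> (\<lambda>v. p v ^ k) \<in> homog (m * k)"
 by (induction k) (auto dest: homog_mult)

lemma homog_linear: "(\<lambda>v. a * v$1 + b * v$2 + c * v$3) \<in> homog 1"
 using homog_add[OF homog_add[OF homog_scale[OF homog_monomial[of 0 0 1 1], of a] homog_scale[OF homog_monomial[of 1 0 0 1], of b]] homog_scale[OF homog_monomial[of 0 1 0 1], of c]]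
 by simp

lemma homog_subst:
 assumes "p \<in> homog n"
 shows "(\<lambda>v. p (M *v v)) \<in> homog n"
proof -
 obtain c where c: "p = hform n c" using assms by (auto simp: homog_def)
 have lin: "(\<lambda>v. (M *v v)$i) \<in> homog 1" for i
  using homog_linear[of "M$i$1" "M$i$2" "M$i$3"] by (simp add: matrix_vector_mult_def sum_3)
 have "(\<lambda>v. c x * ((M *v v)$1 ^ (n - fst x - snd x) * (M *v v)$2 ^ fst x * (M *v v)$3 ^ snd x)) \<in> homog n"
  if "x \<in> Mon n" for x
 proof (rule homog_scale)
  have "(\<lambda>v. (M *v v)$1 ^ (n - fst x - snd x) * (M *v v)$2 ^ fst x * (M *v v)$3 ^ snd x) \<in> homog (1 * (n - fst x - snd x) + 1 * fst x + 1 * snd x)"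
 by (intro homog_mult homog_power lin)
  moreover have "1 * (n - fst x - snd x) + 1 * fst x + 1 * snd x = n" using that by (auto simp: Mon_def)
  ultimately show "(\<lambda>v. (M *v v)$1 ^ (n - fst x - snd x) * (M *v v)$2 ^ fst x * (M *v v)$3 ^ snd x) \<in> homog n" by simp
 qed
 thus ?thesis unfolding c hform_def case_prod_beta' by (auto intro!: homog_sum)
qed

lemma homog_scaling:
 assumes "p \<in> homog n"
 shows "p (a *s v) = a ^ n * p v"
proof -
 obtain c where c: "p = hform n c" using assms by (auto simp: homog_def)
 have "a ^ (n - i - j) * a ^ i * a ^ j = a ^ n" if "(i, j) \<in> Mon n" for i j
  using that by (simp add: Mon_def flip: power_add)
 thus ?thesis unfolding c hform_def
 by (subst sum_distrib_left, intro sum.cong) (auto simp: power_mult_distrib mult_ac)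
qed

definition dehom :: "nat => (nat \<times> nat => complex) => complex poly poly" where
 "dehom n c = (\<Sum>(i, j)\<in>Mon n. monom (monom (c (i, j)) i) j)"

lemma coeff_dehom: "coeff (coeff (dehom n c) j) i = (if i + j \<le> n then c (i, j) else 0)"
proof -
 have "coeff (coeff (dehom n c) j) i = (\<Sum>x\<in>Mon n. if x = (i, j) then c (i, j) else 0)"
  unfolding dehom_def coeff_sum by (intro sum.cong refl) (auto simp: split: if_splits)
 thus ?thesis by (simp add:) (simp add: Mon_def)
qed

lemma total_degree_dehom: "total_degree_le (dehom n c) n"
 by (simp add: total_degree_le_def coeff_dehom)

lemma hform_poly2:
 assumes "total_degree_le p n" "v$1 ~= 0"
 shows "hform n (\<lambda>(i, j). coeff (coeff p j) i) v = v$1 ^ n * poly2 p (v$2 / v$1) (v$3 / v$1)"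
proof -
 have sub: "(\<Sum>(i, j)\<in>Mon n. coeff (coeff p j) i * (v$1 ^ (n - i - j) * v$2 ^ i * v$3 ^ j)) =
  (\<Sum>(i, j)\<in>Mon n. v$1 ^ n * (coeff (coeff p j) i * (v$2 / v$1) ^ i * (v$3 / v$1) ^ j))"
 proof (intro sum.cong refl, safe)
  fix i j assume "(i, j) \<in> Mon n"
  hence "n = (n - i - j) + i + j" by (simp add: Mon_def)
  hence "v$1 ^ n = v$1 ^ (n - i - j) * v$1 ^ i * v$1 ^ j" by (metis power_add)
  thus "coeff (coeff p j) i * (v$1 ^ (n - i - j) * v$2 ^ i * v$3 ^ j) = v$1 ^ n * (coeff (coeff p j) i * (v$2 / v$1) ^ i * (v$3 / v$1) ^ j)"
   using assms(2) by (simp add: power_divide)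
 qed
 define x y where "x = v$2 / v$1" "y = v$3 / v$1"
 have "poly2 p x y = (\<Sum>(i, j)\<in>Mon n. coeff (coeff p j) i * x ^ i * y ^ j)"
 proof -
  have "poly2 p x y = (\<Sum>j\<le>degree p. \<Sum>i\<le>degree (coeff p j). coeff (coeff p j) i * x ^ i * y ^ j)"
 by (simp add: poly2_sum poly_altdef[of "coeff p _"] sum_distrib_right)
  also have "... = (\<Sum>(j, i)\<in>(SIGMA j:{..degree p}. {..degree (coeff p j)}). coeff (coeff p j) i * x ^ i * y ^ j)"
 by (simp add: sum.Sigma)
  also have "... = (\<Sum>(j, i)\<in>{(j, i). i + j \<le> n}. coeff (coeff p j) i * x ^ i * y ^ j)"
  proof (rule sum.mono_neutral_cong)
   show "finite {(j, i). i + j \<le> n}" by (rule finite_subset[of _ "{..n} \<times> {..n}"]) auto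
   show "finite (SIGMA j:{..degree p}. {..degree (coeff p j)})" by auto
  next
   fix x' assume "x' \<in> {(j, i). i + j \<le> n} - (SIGMA j:{..degree p}. {..degree (coeff p j)})"
   thus "(case x' of (j, i) => coeff (coeff p j) i * x ^ i * y ^ j) = 0"
   proof (clarsimp, intro conjI)
    fix i j assume "coeff (coeff p j) i ~= 0"
    thus "j \<le> degree p" "i \<le> degree (coeff p j)" by (auto intro: le_degree)
   qed
  next
   fix x' assume "x' \<in> (SIGMA j:{..degree p}. {..degree (coeff p j)}) - {(j, i). i + j \<le> n}"
   thus "(case x' of (j, i) => coeff (coeff p j) i * x ^ i * y ^ j) = 0"
    using assms(1) by (force simp: total_degree_le_def)
  qed auto
  also have "... = (\<Sum>(i, j)\<in>Mon n. coeff (coeff p j) i * x ^ i * y ^ j)"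
 by (rule sum.reindex_bij_witness[of _ prod.swap prod.swap]) (auto simp: Mon_def)
  finally show ?thesis .
 qed
 thus ?thesis using sub by (simp add: hform_def x_y_def sum_distrib_left case_prod_beta')
qed

lemma hform_dehom:
 assumes "v$1 ~= 0"
 shows "hform n c v = v$1 ^ n * poly2 (dehom n c) (v$2 / v$1) (v$3 / v$1)"
proof -
 have "hform n c v = hform n (\<lambda>(i, j). coeff (coeff (dehom n c) j) i) v"
  unfolding hform_def by (intro sum.cong refl) (auto simp: coeff_dehom Mon_def)
 thus ?thesis using hform_poly2[OF total_degree_dehom assms] by simp
qed

lemma poly2_zero_imp:
 assumes "\<And>x y. poly2 p x y = 0" shows "p = 0"
proof (rule poly_eqI)
 fix j
 have "slice x p = 0" for x using assms by (metis poly_slice poly_all_0_iff_0)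
 hence "poly (coeff p j) x = 0" for x using coeff_slice[of x p j] by simp
 thus "coeff p j = coeff 0 j" by (simp add: poly_all_0_iff_0[symmetric])
qed

lemma dehom_eq_0_iff: "dehom n c = 0 \<longleftrightarrow> hform n c = (\<lambda>_. 0)"
proof
 assume "dehom n c = 0"
 hence "c x = 0" if "x \<in> Mon n" for x using that coeff_dehom[of n c "snd x" "fst x"] by (auto simp: Mon_def)
 thus "hform n c = (\<lambda>_. 0)" unfolding hform_def by (auto simp: intro!: sum.neutral)
next
 assume h: "hform n c = (\<lambda>_. 0)"
 show "dehom n c = 0"
 proof (rule poly2_zero_imp)
  fix x y :: complex
  show "poly2 (dehom n c) x y = 0" using hform_dehom[of "vector [1, x, y]" n c] h by simp
 qed
qed

lemma hform_eq_0D: "hform n c = (\<lambda>_. 0) ==> (i, j) \<in> Mon n ==> c (i, j) = 0"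
 using dehom_eq_0_iff[of n c] coeff_dehom[of n c j i] by (auto simp: Mon_def)

lemma card_Mon: "2 * card (Mon n) = (n + 1) * (n + 2)"
proof (induction n)
 case (Suc n)
 have eq: "Mon (Suc n) = Mon n \<union> (\<lambda>i. (i, Suc n - i)) ` {..Suc n}"
 by (force simp: Mon_def)
 have "card (Mon (Suc n)) = card (Mon n) + card ((\<lambda>i. (i, Suc n - i)) ` {..Suc n})"
  unfolding eq by (rule card_Un_disjoint[OF finite_Mon]) (auto simp: Mon_def)
 also have "card ((\<lambda>i. (i, Suc n - i)) ` {..Suc n}) = n + 2" by (subst card_image) (auto simp: inj_on_def)
 finally show ?case using Suc by simp
qed (simp add: Mon_def)

section \<open>Plane curves covered by finitely many discs\<close>

lemma holomorphic_zero_mult: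
 assumes "f holomorphic_on S" "g holomorphic_on S" "open S" "connected S" "\<And>t. t \<in> S ==> f t * g t = 0"
 shows "(\<forall>t\<in>S. f t = 0) \<or> (\<forall>t\<in>S. g t = (0::complex))"
proof (rule ccontr)
 assume "\<not> ?thesis"
 then obtain s u where s: "s \<in> S" "f s ~= 0" and u: "u \<in> S" "g u ~= 0" by blast
 have "continuous_on S f" using assms holomorphic_on_imp_continuous_on by blast
 then obtain e where e: "e > 0" "\<And>t. t \<in> S ==> dist t s < e ==> f t ~= 0"
  using continuous_on_avoid[OF _ s(1), of f 0] s(2) by (metis dist_commute)
 obtain d where d: "d > 0" "ball s d \<subseteq> S" using assms(3) s(1) openE by blast
 have z: "g t = 0" if "t \<in> ball s (min d e)" for t
  using that d e assms(5)[of t] by (auto simp: dist_commute)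
 have "g u = 0"
 by (rule analytic_continuation_open[of "ball s (min d e)" S g "\<lambda>_. 0"])
    (use assms u d e z in auto)
 thus False using u by simp
qed

lemma holomorphic_nonzero_ball:
 assumes "f holomorphic_on S" "open S" "s \<in> S" "f s ~= 0"
 shows "\<exists>d>0. ball s d \<subseteq> S \<and> (\<forall>t\<in>ball s d. f t ~= 0)"
proof -
 have "open (S \<inter> f -` (- {0}))" using assms by (intro continuous_open_preimage holomorphic_on_imp_continuous_on) auto
 then obtain d where "d > 0" "ball s d \<subseteq> S \<inter> f -` (- {0})" by (rule openE) (use assms(3,4) in auto)
 thus ?thesis by auto
qed

text \<open>Two local quotients agree wherever \<open>g\<close> is nonzero, hence on the whole
  overlap by the identity theorem. The glued quotient is the diagonal \<open>u t t\<close>: at each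
  point the local quotient centred there.\<close>

lemma holomorphic_quotient_glue:
 assumes g: "g holomorphic_on S" and dense: "\<And>U. open U ==> U ~= {} ==> U \<subseteq> S ==> \<exists>t\<in>U. g t ~= 0"
  and loc: "\<And>s. s \<in> S ==> \<exists>d>0. \<exists>u. ball s d \<subseteq> S \<and> u holomorphic_on ball s d \<and> (\<forall>t\<in>ball s d. f t = u t * g t)"
 shows "\<exists>u. u holomorphic_on S \<and> (\<forall>t\<in>S. f t = u t * (g t :: complex))"
proof -
 obtain d u where d: "\<And>s. s \<in> S ==> d s > 0" "\<And>s. s \<in> S ==> ball s (d s) \<subseteq> S" "\<And>s. s \<in> S ==> u s holomorphic_on ball s (d s)"
  "\<And>s t. s \<in> S ==> t \<in> ball s (d s) ==> f t = u s t * g t"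
  using loc by metis
 have eq: "u s t = u t t" if s: "s \<in> S" "t \<in> ball s (d s)" for s t
 proof -
  have t: "t \<in> S" using s d(2) by blast
  define B where "B = ball s (d s) \<inter> ball t (d t)"
  have B: "open B" "t \<in> B" "B \<subseteq> S" "connected B"
   using s t d(1,2) by (auto simp: B_def intro: convex_connected convex_Int)
  have uB: "u s holomorphic_on B" "u t holomorphic_on B"
   using holomorphic_on_subset[OF d(3)] s(1) t by (auto simp: B_def)
  have "open (B \<inter> g -` (- {0}))"
   using holomorphic_on_imp_continuous_on[OF holomorphic_on_subset[OF g B(3)]] B(1) by (intro continuous_open_preimage) auto
  moreover have "B \<inter> g -` (- {0}) ~= {}" using dense[OF B(1) _ B(3)] B(2) by auto
  moreover have "u s x = u t x" if "x \<in> B \<inter> g -` (- {0})" for x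
   using d(4)[OF s(1), of x] d(4)[OF t, of x] that by (auto simp: B_def)
  ultimately show ?thesis using analytic_continuation_open[of "B \<inter> g -` (- {0})" B "u s" "u t"] B uB by blast
 qed
 have "(\<lambda>t. u t t) holomorphic_on (\<Union>s\<in>S. ball s (d s))"
  using eq by (intro holomorphic_on_UN_open) (auto intro: holomorphic_transform[OF d(3)])
 moreover have "(\<Union>s\<in>S. ball s (d s)) = S" using d(1,2) by force
 ultimately show ?thesis using d(1,4) by auto
qed

lemma holomorphic_homog:
 assumes "p \<in> homog n" "\<And>i. (\<lambda>t. \<phi> t $ i) holomorphic_on S"
 shows "(\<lambda>t. p (\<phi> t)) holomorphic_on S"
proof -
 obtain c where "p = hform n c" using assms(1) by (auto simp: homog_def)
 thus ?thesis unfolding hform_def case_prod_beta'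
 by (auto intro!: holomorphic_intros assms(2))
qed

text \<open>A compact irreducible curve given by finitely many nonvanishing lifts to C^3.
  Compactness is \<open>cover\<close>: up to scaling, each point of a disc of radius 2 occurs on
  some closed unit disc. Irreducibility is \<open>ident\<close>: a form vanishing on one chart
  vanishes on all. The curve lies on no line by \<open>nondeg\<close>.\<close>

locale plane_curve =
 fixes J :: "(complex => complex^3) set"
 assumes finite_J: "finite J" and J_ne: "J ~= {}"
  and hol: "\<And>\<phi> i. \<phi> \<in> J ==> (\<lambda>t. \<phi> t $ i) holomorphic_on ball 0 2"
  and nz: "\<And>\<phi> t. \<phi> \<in> J ==> t \<in> ball 0 2 ==> \<phi> t ~= 0"
  and cover: "\<And>\<phi> t. \<phi> \<in> J ==> t \<in> ball 0 2 ==> \<exists>\<psi>\<in>J. \<exists>u\<in>cball 0 1. \<exists>a. a ~= 0 \<and> \<phi> t = a *s \<psi> u"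
  and ident: "\<And>p n \<phi> \<psi> t. p \<in> homog n ==> \<phi> \<in> J ==> \<psi> \<in> J ==> (\<And>t. t \<in> ball 0 2 ==> p (\<phi> t) = 0) ==> t \<in> ball 0 2 ==> p (\<psi> t) = 0"
  and nondeg: "\<And>\<phi> a. \<phi> \<in> J ==> (\<And>t. t \<in> ball 0 2 ==> (\<Sum>i\<in>UNIV. a $ i * \<phi> t $ i) = 0) ==> a = 0"
begin

definition vanish :: "(complex^3 => complex) => bool" where
 "vanish p \<longleftrightarrow> (\<forall>\<phi>\<in>J. \<forall>t\<in>ball 0 2. p (\<phi> t) = 0)"

lemma vanish_open:
 assumes "p \<in> homog n" "\<phi> \<in> J" "open S" "S ~= {}" "S \<subseteq> ball 0 2" "\<And>t. t \<in> S ==> p (\<phi> t) = 0"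
 shows "vanish p"
proof -
 have "p (\<phi> t) = 0" if "t \<in> ball 0 2" for t
 by (rule analytic_continuation_open[of S "ball 0 2" "\<lambda>t. p (\<phi> t)" "\<lambda>_. 0"])
    (use assms that holomorphic_homog[OF assms(1) hol[OF assms(2)]] in auto)
 thus ?thesis using ident[OF assms(1,2)] by (auto simp: vanish_def)
qed

lemma linear_nonzero_open:
 assumes "\<phi> \<in> J" "a ~= 0" "open S" "S ~= {}" "S \<subseteq> ball 0 2"
 shows "\<exists>t\<in>S. (\<Sum>i\<in>UNIV. a $ i * \<phi> t $ i) ~= 0"
proof (rule ccontr)
 assume n: "\<not> ?thesis"
 have "(\<lambda>v. \<Sum>i\<in>UNIV. a $ i * v $ i) \<in> homog 1" using homog_linear[of "a$1" "a$2" "a$3"] by (simp add: sum_3)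
 from vanish_open[OF this assms(1,3-5)] n have "a = 0" using nondeg[OF assms(1)] assms(1) by (auto simp: vanish_def)
 thus False using assms by simp
qed

lemma coord_nonzero_open:
 assumes "\<phi> \<in> J" "open S" "S ~= {}" "S \<subseteq> ball 0 2"
 shows "\<exists>t\<in>S. \<phi> t $ k ~= 0"
proof -
 have "axis k 1 ~= (0 :: complex^3)" by simp
 from linear_nonzero_open[OF assms(1) this assms(2-4)] obtain t where t: "t \<in> S" "(\<Sum>i\<in>UNIV. axis k 1 $ i * \<phi> t $ i) ~= 0" by blast
 have "(\<Sum>i\<in>UNIV. axis k 1 $ i * \<phi> t $ i) = \<phi> t $ k"
 by (simp add: axis_def if_distrib[of "\<lambda>x. x * _"] cong: if_cong)
 thus ?thesis using t by auto
qed

lemma disc_nonzero: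
 assumes "\<phi> \<in> J"
 shows "\<exists>d s. d > 0 \<and> ball s d \<subseteq> ball 0 2 \<and> (\<forall>t\<in>ball s d. \<phi> t $ 1 ~= 0)"
proof -
 obtain s where s: "s \<in> ball 0 2" "\<phi> s $ 1 ~= 0" using coord_nonzero_open[OF assms, of "ball 0 2" 1] by auto
 thus ?thesis using holomorphic_nonzero_ball[OF hol[OF assms] open_ball s] by blast
qed

text \<open>Invariance under projective coordinate changes, which later moves an arbitrary line to x
  = 0.\<close>

lemma transform:
 assumes "M ** N = mat 1" "N ** M = mat 1"
 shows "plane_curve ((\<lambda>\<phi> t. M *v \<phi> t) ` J)"
proof
 show "finite ((\<lambda>\<phi> t. M *v \<phi> t) ` J)" "(\<lambda>\<phi> t. M *v \<phi> t) ` J ~= {}" using finite_J J_ne by auto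

 have inv': "M *v (N *v v) = v" for v using assms(1) by (simp add: matrix_vector_mul_assoc)
 fix \<phi>' assume "\<phi>' \<in> (\<lambda>\<phi> t. M *v \<phi> t) ` J"
 then obtain \<phi> where \<phi>: "\<phi> \<in> J" "\<phi>' = (\<lambda>t. M *v \<phi> t)" by auto
 show "(\<lambda>t. \<phi>' t $ i) holomorphic_on ball 0 2" for i
  unfolding \<phi>(2) matrix_vector_mult_def by (auto intro!: holomorphic_intros hol[OF \<phi>(1)])
 show "\<phi>' t ~= 0" if "t \<in> ball 0 2" for t
 proof
  assume "\<phi>' t = 0"
  hence "N *v (M *v \<phi> t) = 0" by (simp add: \<phi>)
  thus False using nz[OF \<phi>(1) that] assms(2) by (auto simp: matrix_vector_mul_assoc)
 qed
 show "\<exists>\<psi>\<in>(\<lambda>\<phi> t. M *v \<phi> t) ` J. \<exists>u\<in>cball 0 1. \<exists>a. a ~= 0 \<and> \<phi>' t = a *s \<psi> u" if t: "t \<in> ball 0 2" for t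
 using cover[OF \<phi>(1) t] by (force simp: \<phi> vector_scalar_commute)
 show "p (\<psi>' t) = 0" if h: "p \<in> homog n" "\<psi>' \<in> (\<lambda>\<phi> t. M *v \<phi> t) ` J" "\<And>t. t \<in> ball 0 2 ==> p (\<phi>' t) = 0" "t \<in> ball 0 2" for p n \<psi>' t
 proof -
  obtain \<psi> where \<psi>: "\<psi> \<in> J" "\<psi>' = (\<lambda>t. M *v \<psi> t)" using h(2) by auto
  show ?thesis using ident[OF homog_subst[OF h(1), of M] \<phi>(1) \<psi>(1) _ h(4)] h(3) by (simp add: \<phi>(2) \<psi>(2))
 qed
 show "a = 0" if "\<And>t. t \<in> ball 0 2 ==> (\<Sum>i\<in>UNIV. a $ i * \<phi>' t $ i) = 0" for a
 proof -
  have "(\<Sum>i\<in>UNIV. (a v* M) $ i * v $ i) = (\<Sum>i\<in>UNIV. a $ i * (M *v v) $ i)" for v :: "complex^3"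
 by (simp add: vector_matrix_mult_def matrix_vector_mult_def sum_3 algebra_simps)
  hence "a v* M = 0" using that by (intro nondeg[OF \<phi>(1)]) (simp add: \<phi>(2))
  hence "(a v* M) v* N = 0" by simp
  thus ?thesis using assms(1) by (simp add: vector_matrix_mul_assoc)
 qed
qed

end

section \<open>Hensel lifting and the minimal relation of a curve\<close>

lemma poly_taylor1:
 fixes p :: "'a::idom poly"
 shows "\<exists>g. poly p (a + b) = poly p a + b * poly (pderiv p) a + b ^ 2 * g"
proof (induction p)
 case (pCons c p)
 then obtain g where g: "poly p (a + b) = poly p a + b * poly (pderiv p) a + b ^ 2 * g" by blast
 show ?case
 by (intro exI[of _ "poly (pderiv p) a + (a + b) * g"])
    (simp add: g pderiv_pCons power2_eq_square algebra_simps)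
qed (intro exI[of _ 0], simp)

text \<open>Newton iteration modulo powers of x: at a simple root the derivative \<open>D\<close> is
  a unit at x = 0, so each step can kill one more coefficient.\<close>

lemma hensel:
 fixes p :: "complex poly poly"
 assumes "poly2 p 0 y = 0" "poly2 (pderiv p) 0 y ~= 0"
 shows "\<exists>\<eta>. poly \<eta> 0 = y \<and> monom 1 (Suc k) dvd poly p \<eta>"
proof (induction k)
 case 0
 show ?case using assms(1) by (force simp: monom_Suc monom_0 poly_eq_0_iff_dvd)
next
 case (Suc k)
 then obtain \<eta> E where \<eta>: "poly \<eta> 0 = y" "poly p \<eta> = monom 1 (Suc k) * E" by auto
 define D where "D = poly (pderiv p) \<eta>"
 have "poly D 0 = poly2 (pderiv p) 0 (poly \<eta> 0)"
 proof -
  have "poly (poly q \<eta>) 0 = poly2 q 0 (poly \<eta> 0)" for q :: "complex poly poly"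
 by (induction q) auto
  thus ?thesis by (simp add: D_def)
 qed
 hence D0: "poly D 0 ~= 0" using assms(2) \<eta>(1) by simp
 \<comment> \<open>Solves \<open>E + e D = 0\<close> at x = 0; the remaining term contains the
   factor \<open>b\<close>, which vanishes there.\<close>
 define e where "e = - poly E 0 / poly D 0"
 define b where "b = monom 1 (Suc k) * [:e:]"
 obtain g where g: "poly p (\<eta> + b) = poly p \<eta> + b * D + b ^ 2 * g" using poly_taylor1[of p \<eta> b] by (auto simp: D_def)
 also have "... = monom 1 (Suc k) * (E + [:e:] * D + [:e:] * b * g)"
 by (simp add: \<eta>(2) b_def power2_eq_square algebra_simps)
 finally have eq: "poly p (\<eta> + b) = monom 1 (Suc k) * (E + [:e:] * D + [:e:] * b * g)" .
 have "poly (E + [:e:] * D + [:e:] * b * g) 0 = 0" using D0 by (simp add: e_def b_def poly_monom)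
 hence "[:- 0, 1:] dvd (E + [:e:] * D + [:e:] * b * g)" by (simp only: poly_eq_0_iff_dvd)
 hence "monom 1 1 dvd (E + [:e:] * D + [:e:] * b * g)" by (simp add: monom_Suc monom_0)
 hence "monom 1 (Suc k) * monom 1 1 dvd poly p (\<eta> + b)" unfolding eq by simp
 hence "monom 1 (Suc (Suc k)) dvd poly p (\<eta> + b)" by (simp add: mult_monom)
 moreover have "poly (\<eta> + b) 0 = y" by (simp add: \<eta> b_def poly_monom)
 ultimately show ?case by blast
qed

locale plane_curve_min = plane_curve +
 fixes r :: nat and c :: "nat \<times> nat => complex"
 assumes rel: "vanish (hform r c)" and rel_nz: "hform r c ~= (\<lambda>_. 0)"
  and min: "\<And>n p. p \<in> homog n ==> vanish p ==> p ~= (\<lambda>_. 0) ==> r \<le> n"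
begin

abbreviation "P \<equiv> dehom r c"

lemma r_ge_2: "r \<ge> 2"
proof (rule ccontr)
 assume "\<not> r \<ge> 2"
 hence "r = 0 \<or> r = 1" by auto
 obtain \<phi> where \<phi>: "\<phi> \<in> J" using J_ne by blast
 from \<open>r = 0 \<or> r = 1\<close> show False
 proof
  assume r: "r = 0"
  have M: "Mon 0 = {(0, 0)}" by (auto simp: Mon_def)
  have "hform r c (\<phi> 0) = 0" using rel \<phi> by (auto simp: vanish_def)
  thus False using rel_nz by (simp add: r hform_def M fun_eq_iff)
 next
  assume r: "r = 1"
  have M: "Mon 1 = {(0, 0), (1, 0), (0, 1)}" by (auto simp: Mon_def)
  define a :: "complex^3" where "a = vector [c (0, 0), c (1, 0), c (0, 1)]"
  have h: "hform r c v = (\<Sum>i\<in>UNIV. a $ i * v $ i)" for v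
   unfolding r hform_def M by (simp add: a_def sum_3)
  have "a = 0" using rel \<phi> h by (intro nondeg[OF \<phi>]) (auto simp: vanish_def)
  thus False using rel_nz h by auto
 qed
qed

lemma P_nz: "P ~= 0"
 using rel_nz dehom_eq_0_iff by blast

lemma vanish_hform_poly2:
 assumes "total_degree_le q n" "\<phi> \<in> J" "d > 0" "ball s d \<subseteq> ball 0 2"
  "\<And>t. t \<in> ball s d ==> \<phi> t $ 1 ~= 0"
  "\<And>t. t \<in> ball s d ==> poly2 q (\<phi> t $ 2 / \<phi> t $ 1) (\<phi> t $ 3 / \<phi> t $ 1) = 0"
 shows "vanish (hform n (\<lambda>(i, j). coeff (coeff q j) i))"
 by (rule vanish_open[OF homogI assms(2) open_ball _ assms(4)])
   (use assms in \<open>auto simp: hform_poly2\<close>)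

lemma P_zero: "\<phi> \<in> J ==> t \<in> ball 0 2 ==> \<phi> t $ 1 ~= 0 ==> poly2 P (\<phi> t $ 2 / \<phi> t $ 1) (\<phi> t $ 3 / \<phi> t $ 1) = 0"
 using rel hform_dehom[of "\<phi> t" r c] by (auto simp: vanish_def)

lemma hform_coeff_nz:
 assumes "total_degree_le q n" "q ~= 0"
 shows "hform n (\<lambda>(i, j). coeff (coeff q j) i) ~= (\<lambda>_. 0)"
proof
 assume h: "hform n (\<lambda>(i, j). coeff (coeff q j) i) = (\<lambda>_. 0)"
 have "coeff (coeff q j) i = 0" for i j
  using hform_eq_0D[OF h, of i j] assms(1) by (cases "i + j \<le> n") (auto simp: Mon_def total_degree_le_def)
 hence "q = 0" by (intro poly_eqI) simp
 thus False using assms by simp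
qed

text \<open>If P = A B, one factor vanishes on a disc of the curve, because holomorphic functions
  form a domain, and then on the whole curve. Minimality gives it degree at least \<open>r\<close>,
  so the other factor has total degree 0 and is a unit.\<close>

lemma irreducible_P: "irreducible P"
proof (rule Factorial_Ring.irreducibleI[OF P_nz])
 obtain \<phi> where \<phi>: "\<phi> \<in> J" using J_ne by blast
 obtain s d where sd: "d > 0" "ball s d \<subseteq> ball 0 2" "\<And>t. t \<in> ball s d ==> \<phi> t $ 1 ~= 0" using disc_nonzero[OF \<phi>] by blast
 define x where "x = (\<lambda>t. \<phi> t $ 2 / \<phi> t $ 1)" define y where "y = (\<lambda>t. \<phi> t $ 3 / \<phi> t $ 1)"
 have P0: "poly2 P (x t) (y t) = 0" if "t \<in> ball s d" for t
  using P_zero[OF \<phi>, of t] sd that by (auto simp: x_def y_def)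
 show "\<not> P dvd 1"
 proof
  assume "P dvd 1"
  then obtain B where "1 = P * B" by auto
  hence "poly2 1 (x s) (y s) = poly2 P (x s) (y s) * poly2 B (x s) (y s)" by (metis poly_mult)
  thus False using P0[of s] sd by simp
 qed
 fix A B assume AB: "P = A * B"
 hence nz: "A ~= 0" "B ~= 0" using P_nz by auto
 obtain k l where kl: "total_degree_le A k" "total_degree_le B l" "k + l \<le> r"
 by (rule total_degree_mult[OF nz]) (use total_degree_dehom[of r c] AB in auto)
 have hx: "x holomorphic_on ball s d" "y holomorphic_on ball s d"
  using hol[OF \<phi>] sd unfolding x_def y_def by (auto intro!: holomorphic_intros intro: holomorphic_on_subset)
 have "(\<forall>t\<in>ball s d. poly2 A (x t) (y t) = 0) \<or> (\<forall>t\<in>ball s d. poly2 B (x t) (y t) = 0)"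
 by (rule holomorphic_zero_mult) (use P0 hx in \<open>auto simp: AB intro!: holomorphic_intros\<close>)
 thus "A dvd 1 \<or> B dvd 1"
 proof
  assume "\<forall>t\<in>ball s d. poly2 A (x t) (y t) = 0"
  hence "vanish (hform k (\<lambda>(i, j). coeff (coeff A j) i))"
 by (intro vanish_hform_poly2[OF kl(1) \<phi> sd]) (auto simp: x_def y_def)
  hence "l = 0" using min[OF homogI] hform_coeff_nz[OF kl(1) nz(1)] kl by force
  then obtain b where "B = [:[:b:]:]" using total_degree_0 kl(2) by blast
  thus ?thesis using nz(2) by (auto simp: is_unit_const_poly_iff is_unit_pCons_iff)
 next
  assume "\<forall>t\<in>ball s d. poly2 B (x t) (y t) = 0"
  hence "vanish (hform l (\<lambda>(i, j). coeff (coeff B j) i))"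
 by (intro vanish_hform_poly2[OF kl(2) \<phi> sd]) (auto simp: x_def y_def)
  hence "k = 0" using min[OF homogI] hform_coeff_nz[OF kl(2) nz(2)] kl by force
  then obtain b where "A = [:[:b:]:]" using total_degree_0 kl(1) by blast
  thus ?thesis using nz(1) by (auto simp: is_unit_const_poly_iff is_unit_pCons_iff)
 qed
qed

text \<open>Otherwise x takes values among finitely many roots on a connected disc, is constant
  there, and the curve lies on a line.\<close>

lemma x_nonconstant:
 assumes "s ~= 0" "\<phi> \<in> J" "d > 0" "ball a d \<subseteq> ball 0 2" "\<And>t. t \<in> ball a d ==> \<phi> t $ 1 ~= 0"
 shows "\<exists>t\<in>ball a d. poly s (\<phi> t $ 2 / \<phi> t $ 1) ~= 0"
proof (rule ccontr)
 assume n: "\<not> ?thesis"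
 define x where "x = (\<lambda>t. \<phi> t $ 2 / \<phi> t $ 1)"
 have "continuous_on (ball a d) x"
  unfolding x_def using assms hol[OF assms(2)]
 by (intro continuous_intros holomorphic_on_imp_continuous_on) (auto intro: holomorphic_on_subset)
 moreover have "x ` ball a d \<subseteq> {z. poly s z = 0}" using n by (auto simp: x_def)
 hence "finite (x ` ball a d)" using poly_roots_finite[OF assms(1)] finite_subset by blast
 ultimately have "x constant_on ball a d"
 by (intro continuous_finite_range_constant) auto
 then obtain b where b: "\<And>t. t \<in> ball a d ==> x t = b" by (auto simp: constant_on_def)
 have nz: "(vector [- b, 1, 0] :: complex^3) ~= 0" by (simp add: vec_eq_iff forall_3)
 have "ball a d ~= {}" using assms(3) by simp
 from linear_nonzero_open[OF assms(2) nz open_ball this assms(4)]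
 obtain t where t: "t \<in> ball a d" "- b * \<phi> t $ 1 + \<phi> t $ 2 ~= 0" unfolding sum_3 vector_3 by auto
 thus False using b[OF t(1)] assms(5)[OF t(1)] by (auto simp: x_def)
qed

lemma degree_P_pos: "degree P > 0"
proof (rule ccontr)
 assume "\<not> ?thesis"
 then obtain s where s: "P = [:s:]" by (metis degree_eq_zeroE neq0_conv)
 hence s0: "s ~= 0" using P_nz by auto
 obtain \<phi> where \<phi>: "\<phi> \<in> J" using J_ne by blast
 obtain a d where sd: "d > 0" "ball a d \<subseteq> ball 0 2" "\<And>t. t \<in> ball a d ==> \<phi> t $ 1 ~= 0" using disc_nonzero[OF \<phi>] by blast
 obtain t where "t \<in> ball a d" "poly s (\<phi> t $ 2 / \<phi> t $ 1) ~= 0" using x_nonconstant[OF s0 \<phi> sd] by blast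
 thus False using P_zero[OF \<phi>, of t] sd by (auto simp: s)
qed

text \<open>If both \<open>P\<close> and \<open>q\<close> vanished along the curve, the Bezout
  identity would make the nonzero polynomial \<open>s(x)\<close> vanish there, although x is not
  constant.\<close>

lemma not_vanish_if_not_dvd:
 assumes "\<not> P dvd q" "total_degree_le q n"
 shows "\<not> vanish (hform n (\<lambda>(i, j). coeff (coeff q j) i))"
proof
 assume v: "vanish (hform n (\<lambda>(i, j). coeff (coeff q j) i))"
 obtain A B s where s: "s ~= 0" "A * P + B * q = [:s:]"
 by (rule bezout_poly2[OF irreducible_P degree_P_pos assms(1)])
 obtain \<phi> where \<phi>: "\<phi> \<in> J" using J_ne by blast
 obtain a d where sd: "d > 0" "ball a d \<subseteq> ball 0 2" "\<And>t. t \<in> ball a d ==> \<phi> t $ 1 ~= 0" using disc_nonzero[OF \<phi>] by blast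
 obtain t where t: "t \<in> ball a d" "poly s (\<phi> t $ 2 / \<phi> t $ 1) ~= 0" using x_nonconstant[OF s(1) \<phi> sd] by blast
 define x y where "x = \<phi> t $ 2 / \<phi> t $ 1" "y = \<phi> t $ 3 / \<phi> t $ 1"
 have t2: "t \<in> ball 0 2" "\<phi> t $ 1 ~= 0" using t sd by auto
 have "poly2 P x y = 0" using P_zero[OF \<phi> t2] by (simp add: x_y_def)
 moreover have "poly2 q x y = 0" using v \<phi> t2 hform_poly2[OF assms(2) t2(2)] by (auto simp: vanish_def x_y_def)
 ultimately have "poly2 (A * P + B * q) x y = 0" by simp
 thus False using t(2) by (simp add: s x_y_def)
qed

text \<open>The relations of least degree form a line. This is what makes the monomials independent
  once a single monomial that occurs in the relation has been removed.\<close>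

lemma relation_unique:
 assumes "vanish (hform r c')"
 shows "\<exists>a. \<forall>x\<in>Mon r. c' x = a * c x"
proof -
 have "P dvd dehom r c'"
 proof (rule ccontr)
  assume "\<not> P dvd dehom r c'"
  from not_vanish_if_not_dvd[OF this total_degree_dehom]
  have "\<not> vanish (hform r (\<lambda>(i, j). coeff (coeff (dehom r c') j) i))" .
  moreover have "hform r (\<lambda>(i, j). coeff (coeff (dehom r c') j) i) = hform r c'"
   unfolding hform_def fun_eq_iff by (intro allI sum.cong) (auto simp: coeff_dehom Mon_def)
  ultimately show False using assms by simp
 qed
 then obtain A where A: "dehom r c' = P * A" by auto
 show ?thesis
 proof (cases "A = 0")
  case True
  hence "c' x = 0" if "x \<in> Mon r" for x
   using that coeff_dehom[of r c' "snd x" "fst x"] A by (auto simp: Mon_def)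
  thus ?thesis by simp
 next
  case False
  obtain k l where kl: "total_degree_le P k" "total_degree_le A l" "k + l \<le> r"
 by (rule total_degree_mult[OF P_nz False]) (use total_degree_dehom[of r c'] A in auto)
  have "r \<le> k"
  proof -
   obtain \<phi> where \<phi>: "\<phi> \<in> J" using J_ne by blast
   obtain s d where sd: "d > 0" "ball s d \<subseteq> ball 0 2" "\<And>t. t \<in> ball s d ==> \<phi> t $ 1 ~= 0" using disc_nonzero[OF \<phi>] by blast
   have "vanish (hform k (\<lambda>(i, j). coeff (coeff P j) i))"
    using P_zero[OF \<phi>] sd by (intro vanish_hform_poly2[OF kl(1) \<phi> sd]) auto
   thus ?thesis using min[OF homogI] hform_coeff_nz[OF kl(1) P_nz] by blast
  qed
  hence "l = 0" using kl by simp
  then obtain a where a: "A = [:[:a:]:]" using total_degree_0 kl(2) by blast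
  have "c' x = a * c x" if "x \<in> Mon r" for x
  proof -
   from that obtain i j where x: "x = (i, j)" "i + j \<le> r" by (auto simp: Mon_def)
   have "coeff (coeff (dehom r c') j) i = coeff (coeff (P * A) j) i" by (simp add: A)
   thus ?thesis using x by (simp add: a coeff_dehom)
  qed
  thus ?thesis by blast
 qed
qed

lemma coeff_P_top:
 shows "coeff P r = [:c (0, r):]" "j > r ==> coeff P j = 0"
proof -
 show "coeff P r = [:c (0, r):]"
 by (rule poly_eqI) (auto simp: coeff_dehom coeff_pCons split: nat.split)
 show "coeff P j = 0" if "j > r" using that by (intro poly_eqI) (simp add: coeff_dehom)
qed

lemma degree_P: "c (0, r) ~= 0 ==> degree P = r"
 by (rule antisym) (auto intro!: degree_le le_degree simp: coeff_P_top)

lemma degree_slice_P: "c (0, r) ~= 0 ==> degree (slice x P) = r"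
 by (rule antisym) (auto intro!: degree_le le_degree simp: coeff_P_top)

text \<open>The polynomial that vanishes to order \<open>k\<close> along the line \<open>x = 0\<close> at all points of the curve on this line
 except \<open>(1 : 0 : y0)\<close>; it exists because the number of conditions is smaller than the number of coefficients.\<close>

lemma auxiliary_poly:
 assumes lead: "c (0, r) ~= 0" and root: "poly2 P 0 y0 = 0" and simple: "poly2 (pderiv P) 0 y0 ~= 0"
 shows "\<exists>k q \<eta> A E S G. q ~= 0 \<and> total_degree_le q k \<and> degree q < r \<and> (\<forall>a. q ~= [:monom a k:]) \<and>
  poly \<eta> 0 = y0 \<and> P = [:- \<eta>, 1:] * G + [:monom 1 k * E:] \<and>
  smult [:c (0, r):] q = [:A:] * G + smult (monom 1 k) S"
proof -
 \<comment> \<open>The count needs (r - 1) k conditions to be fewer than (k - r + 1) r coefficients,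
   that is, k > r^2 - r.\<close>
 define k where "k = r * r + 1"
 have kr: "k \<ge> r" unfolding k_def using le_square[of r] by linarith
 obtain \<eta> E where \<eta>: "poly \<eta> 0 = y0" "poly P \<eta> = monom 1 k * E"
  using hensel[OF root simple, of "r * r"] by (auto simp: k_def elim!: dvdE)
 \<comment> \<open>To order \<open>k\<close> in x, \<open>G\<close> carries all branches over x = 0
   except the one through \<open>y0\<close>.\<close>
 define G where "G = synthetic_div P \<eta>"
 have PG: "P = [:- \<eta>, 1:] * G + [:monom 1 k * E:]"
  using synthetic_div_correct'[of \<eta> P] by (simp add: G_def \<eta>(2))
 have degG: "degree G = r - 1" by (simp add: G_def degree_synthetic_div degree_P[OF lead])
 have leadG: "coeff G (r - 1) = [:c (0, r):]"
 proof -
  obtain n where n: "r = Suc n" using r_ge_2 by (cases r) auto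
  have "coeff P r = coeff ([:- \<eta>, 1:] * G + [:monom 1 k * E:]) (Suc n)" using PG n by metis
  also have "... = coeff G (r - 1)" using degG by (simp add: coeff_eq_0 n)
  finally show ?thesis by (simp add: coeff_P_top)
 qed
 \<comment> \<open>The monomials allowed in \<open>q\<close>: x-degree at most k - r and y-degree
   below r, so total degree below \<open>k\<close>. This also keeps \<open>q\<close> from being a
   multiple of x^k.\<close>
 define I where "I = {..k - r} \<times> {..<r}"
 define mo where "mo = (\<lambda>x::nat \<times> nat. monom (monom (1::complex) (fst x)) (snd x))"
 \<comment> \<open>Reduction of \<open>q\<close> modulo \<open>G\<close>, whose leading coefficient
   is the constant \<open>c (0, r)\<close>. The remainder has y-degree below r - 1, so its
   divisibility by x^k amounts to the (r - 1) k conditions indexed by \<open>L\<close>.\<close>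
 define R where "R = (\<lambda>q. smult [:c (0, r):] q - smult (coeff q (r - 1)) G)"
 define L where "L = {..<r - 1} \<times> {..<k}"
 have "card L < card I"
 using r_ge_2 by (auto simp: I_def L_def k_def algebra_simps)
 moreover have "finite L" "finite I" by (auto simp: L_def I_def)
 ultimately obtain d where d: "\<exists>x\<in>I. d x ~= 0" "\<And>l. l \<in> L ==> (\<Sum>x\<in>I. coeff (coeff (R (mo x)) (fst l)) (snd l) * d x) = 0"
  using underdetermined_system[of L I "\<lambda>l x. coeff (coeff (R (mo x)) (fst l)) (snd l)"] by blast
 define q where "q = (\<Sum>x\<in>I. smult [:d x:] (mo x))"
 have cq: "coeff (coeff q j) i = (if (i, j) \<in> I then d (i, j) else 0)" for i j
 proof -
  have "coeff (coeff q j) i = (\<Sum>x\<in>I. if x = (i, j) then d (i, j) else 0)"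
   unfolding q_def coeff_sum by (intro sum.cong refl) (auto simp: mo_def split: if_splits)
  thus ?thesis using \<open>finite I\<close> by simp
 qed
 have q0: "q ~= 0"
 proof
  assume "q = 0"
  obtain x where "x \<in> I" "d x ~= 0" using d(1) by blast
  thus False using cq[of "snd x" "fst x"] by (simp add: \<open>q = 0\<close>)
 qed
 have tq: "total_degree_le q k" using kr by (auto simp: total_degree_le_def cq I_def split: if_splits)
 have degq: "degree q < r"
 proof -
  have "coeff q j = 0" if "j > r - 1" for j using that by (intro poly_eqI) (auto simp: cq I_def)
  hence "degree q \<le> r - 1" by (intro degree_le) auto
  thus ?thesis using r_ge_2 by simp
 qed
 have qm: "q ~= [:monom a k:]" for a
 proof
  assume a: "q = [:monom a k:]"
  have "coeff (coeff q 0) k = 0" unfolding cq using kr by (auto simp: I_def)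
  thus False using a q0 by simp
 qed
 have Rq: "coeff (coeff (R q) b) a = (\<Sum>x\<in>I. coeff (coeff (R (mo x)) b) a * d x)" for a b
 proof -
  have add: "R (p + p') = R p + R p'" and sm: "R (smult e p) = smult e (R p)" for p p' e
 by (simp_all add: R_def smult_add_right smult_add_left smult_diff_right)
  have "R (\<Sum>x\<in>I'. smult [:d x:] (mo x)) = (\<Sum>x\<in>I'. smult [:d x:] (R (mo x)))" if "finite I'" for I'
   using that by induction (simp_all add: add sm, simp add: R_def)
  from this[OF \<open>finite I\<close>] show ?thesis by (auto simp: q_def coeff_sum mult.commute)
 qed
 have Rz: "coeff (coeff (R q) b) a = 0" if "a < k" for a b
 proof (cases "b < r - 1")
  case True thus ?thesis unfolding Rq using d(2)[of "(b, a)"] that by (simp add: L_def)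
 next
  case False
  show ?thesis
  proof (cases "b = r - 1")
   case True thus ?thesis using leadG by (simp add: R_def)
  next
   case False
   with \<open>\<not> b < r - 1\<close> have "coeff q b = 0" "coeff G b = 0" using degq degG by (auto intro!: coeff_eq_0)
   thus ?thesis by (simp add: R_def)
  qed
 qed
 have "\<exists>s. coeff (R q) b = monom 1 k * s" for b
 proof -
  have "coeff (R q) b = monom 1 k * poly_shift k (coeff (R q) b)"
 by (rule poly_eqI) (auto simp: coeff_monom_mult coeff_poly_shift Rz)
  thus ?thesis by blast
 qed
 hence "[:monom 1 k:] dvd R q" unfolding const_poly_dvd_iff by (auto simp: dvd_def)
 then obtain S where S: "R q = smult (monom 1 k) S" by auto
 have "smult [:c (0, r):] q = [:coeff q (r - 1):] * G + smult (monom 1 k) S"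
  using S by (simp add: R_def algebra_simps)
 thus ?thesis using q0 tq degq qm \<eta>(1) PG by blast
qed

lemma hform_axis3: "hform n d (axis 3 1) = d (0, n)"
proof -
 have ax: "(axis 3 1 :: complex^3) $ 1 = 0" "(axis 3 1 :: complex^3) $ 2 = 0" "(axis 3 1 :: complex^3) $ 3 = 1"
 by (simp_all add: axis_def)
 have "hform n d (axis 3 1 :: complex^3) = (\<Sum>x\<in>Mon n. if x = (0, n) then d (0, n) else 0)"
  unfolding hform_def
 proof (intro sum.cong refl, clarify)
  fix i j assume "(i, j) \<in> Mon n"
  thus "d (i, j) * ((axis 3 1 :: complex^3) $ 1 ^ (n - i - j) * (axis 3 1 :: complex^3) $ 2 ^ i * (axis 3 1 :: complex^3) $ 3 ^ j) = (if (i, j) = (0, n) then d (0, n) else 0)"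
 by (cases "i = 0") (auto simp: Mon_def ax)
 qed
 thus ?thesis by (simp add:) (simp add: Mon_def)
qed

text \<open>Numerator and denominator have the same degree, so the quotient does not depend on the
  lift and is one function on the curve. Its maximum over all closed unit discs is attained at an
  interior point of a disc of radius 2; by the maximum principle it is constant on that chart, and
  the resulting relation spreads to all charts.\<close>

lemma bounded_quotient_constant:
 assumes Qh: "Q \<in> homog k" and loc: "\<And>\<phi> s. \<phi> \<in> J ==> s \<in> ball 0 2 ==>
  \<exists>d>0. \<exists>u. ball s d \<subseteq> ball 0 2 \<and> u holomorphic_on ball s d \<and> (\<forall>t\<in>ball s d. Q (\<phi> t) = u t * (\<phi> t $ 2) ^ k)"
 shows "\<exists>b. vanish (\<lambda>v. Q v - b * v $ 2 ^ k)"
proof -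
 have "\<exists>u. u holomorphic_on ball 0 2 \<and> (\<forall>t\<in>ball 0 2. Q (\<phi> t) = u t * (\<phi> t $ 2) ^ k)" if \<phi>: "\<phi> \<in> J" for \<phi>
  using coord_nonzero_open[OF \<phi>, of _ 2] by (intro holomorphic_quotient_glue loc holomorphic_intros hol \<phi>) auto
 then obtain u where u: "\<And>\<phi>. \<phi> \<in> J ==> u \<phi> holomorphic_on ball 0 2" "\<And>\<phi> t. \<phi> \<in> J ==> t \<in> ball 0 2 ==> Q (\<phi> t) = u \<phi> t * (\<phi> t $ 2) ^ k"
 by metis
 have cont: "continuous_on (ball 0 2) (\<lambda>t. cmod (u \<phi> t))" if "\<phi> \<in> J" for \<phi>
 by (intro continuous_intros holomorphic_on_imp_continuous_on u(1) that)
 have "\<exists>m\<in>cball 0 1. \<forall>t\<in>cball 0 1. cmod (u \<phi> t) \<le> cmod (u \<phi> m)" if "\<phi> \<in> J" for \<phi>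
 by (rule continuous_attains_sup) (auto intro!: continuous_on_subset[OF cont[OF that]])
 then obtain m where m: "\<And>\<phi>. \<phi> \<in> J ==> m \<phi> \<in> cball 0 1" "\<And>\<phi> t. \<phi> \<in> J ==> t \<in> cball 0 1 ==> cmod (u \<phi> t) \<le> cmod (u \<phi> (m \<phi>))" by metis
 define v where "v = (\<lambda>\<phi>. cmod (u \<phi> (m \<phi>)))"
 have "Max (v ` J) \<in> v ` J" using finite_J J_ne by simp
 then obtain \<phi> where "\<phi> \<in> J" "Max (v ` J) = v \<phi>" by auto
 hence \<phi>: "\<phi> \<in> J" "\<And>\<psi>. \<psi> \<in> J ==> v \<psi> \<le> v \<phi>" using finite_J by (auto intro: Max_ge simp flip: \<open>Max (v ` J) = v \<phi>\<close>)
 have le1: "cmod (u \<phi> t) \<le> v \<phi>" if t: "t \<in> ball 0 2" "\<phi> t $ 2 ~= 0" for t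
 proof -
  obtain \<psi> s a where va: "\<psi> \<in> J" "s \<in> cball 0 1" "a ~= 0" "\<phi> t = a *s \<psi> s" using cover[OF \<phi>(1) t(1)] by blast
  hence "u \<phi> t * (a * \<psi> s $ 2) ^ k = a ^ k * (u \<psi> s * (\<psi> s $ 2) ^ k)"
   using u(2)[OF \<phi>(1) t(1)] u(2)[OF va(1), of s] homog_scaling[OF Qh, of a "\<psi> s"] by simp
  moreover have "\<psi> s $ 2 ~= 0" using t(2) va(4) by auto
  ultimately show ?thesis using va(3) m(2)[OF va(1,2)] \<phi>(2)[OF va(1)] by (auto simp: power_mult_distrib v_def)
 qed
 \<comment> \<open>The points with vanishing second coordinate remain; a larger value there would
   persist on an open set, which contains points of the other kind.\<close>
 have "cmod (u \<phi> t) \<le> v \<phi>" if t: "t \<in> ball 0 2" for t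
 proof (rule ccontr)
  assume n: "\<not> ?thesis"
  have "open (ball 0 2 \<inter> (\<lambda>v. cmod (u \<phi> v)) -` {v \<phi><..})" by (intro continuous_open_preimage cont \<phi>) auto
  from coord_nonzero_open[OF \<phi>(1) this, of 2] t n le1 show False by force
 qed
 hence "u \<phi> constant_on ball 0 2"
  using m(1)[OF \<phi>(1)] by (intro maximum_modulus_principle[OF u(1)[OF \<phi>(1)], where U = "ball 0 2" and \<xi> = "m \<phi>"]) (auto simp: v_def)
 then obtain b where b: "\<And>t. t \<in> ball 0 2 ==> u \<phi> t = b" by (auto simp: constant_on_def)
 have "(\<lambda>v. Q v + - b * (v $ 1 ^ 0 * v $ 2 ^ k * v $ 3 ^ 0)) \<in> homog k" by (intro homog_add homog_scale homog_monomial Qh) simp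
 hence "vanish (\<lambda>v. Q v + - b * (v $ 1 ^ 0 * v $ 2 ^ k * v $ 3 ^ 0))"
 by (rule vanish_open[OF _ \<phi>(1) open_ball]) (use u(2)[OF \<phi>(1)] b in auto)
 thus ?thesis by auto
qed

text \<open>Suppose (1 : 0 : y0) is missed. Over x = 0 the function y - eta(x) is then invertible on
  the curve, so P = 0 makes \<open>G\<close>, and with it \<open>q\<close>, divisible by x^k along
  the curve. The quotient of the auxiliary form by x^k is thus holomorphic everywhere and equals a
  constant b. But q - b x^k is nonzero of y-degree below r, so it is no multiple of
  \<open>P\<close>.\<close>

lemma point_attained:
 assumes lead: "c (0, r) ~= 0" and root: "poly2 P 0 y0 = 0" and simple: "poly2 (pderiv P) 0 y0 ~= 0"
 shows "\<exists>\<phi>\<in>J. \<exists>t\<in>cball 0 1. \<exists>a. a ~= 0 \<and> \<phi> t = a *s vector [1, 0, y0]"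
proof (rule ccontr)
 assume neg: "\<not> ?thesis"
 obtain k q \<eta> A E S G where q: "q ~= 0" "total_degree_le q k" "degree q < r" "\<And>a. q ~= [:monom a k:]"
  "poly \<eta> 0 = y0" "P = [:- \<eta>, 1:] * G + [:monom 1 k * E:]"
  "smult [:c (0, r):] q = [:A:] * G + smult (monom 1 k) S"
  using auxiliary_poly[OF assms] by blast
 define Q where "Q = hform k (\<lambda>(i, j). coeff (coeff q j) i)"
 have Qh: "Q \<in> homog k" by (simp add: Q_def homogI)
 have neg': "\<phi> t ~= a *s vector [1, 0, y0]" if h: "\<phi> \<in> J" "t \<in> ball 0 2" "a ~= 0" for \<phi> t a
 proof
  assume a: "\<phi> t = a *s vector [1, 0, y0]"
  obtain \<psi> u b where b: "\<psi> \<in> J" "u \<in> cball 0 1" "b ~= 0" "\<phi> t = b *s \<psi> u" using cover[OF h(1,2)] by blast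
  have "\<psi> u = (1 / b) *s (b *s \<psi> u)" using b(3) by simp
  also have "... = (a / b) *s vector [1, 0, y0]" using a b by simp
  finally show False using neg b h(3) by (metis divide_eq_0_iff)
 qed
 \<comment> \<open>\<open>Q / x^k\<close> extends holomorphically over every point of every chart\<close>
 have loc: "\<exists>d>0. \<exists>u. ball s d \<subseteq> ball 0 2 \<and> u holomorphic_on ball s d \<and> (\<forall>t\<in>ball s d. Q (\<phi> t) = u t * (\<phi> t $ 2) ^ k)"
  if \<phi>: "\<phi> \<in> J" and s: "s \<in> ball 0 2" for \<phi> s
 proof (cases "\<phi> s $ 2 = 0")
  case False
  obtain d where d: "d > 0" "ball s d \<subseteq> ball 0 2" "\<And>t. t \<in> ball s d ==> \<phi> t $ 2 ~= 0"
   using holomorphic_nonzero_ball[OF hol[OF \<phi>] open_ball s False] by blast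
  have "(\<lambda>t. Q (\<phi> t) / (\<phi> t $ 2) ^ k) holomorphic_on ball s d"
   using d hol[OF \<phi>] holomorphic_homog[OF Qh hol[OF \<phi>]]
 by (intro holomorphic_intros) (auto intro: holomorphic_on_subset)
  thus ?thesis using d by (intro exI[of _ d] conjI exI[of _ "\<lambda>t. Q (\<phi> t) / (\<phi> t $ 2) ^ k"]) auto
 next
  case True
  \<comment> \<open>On the line x = 0 only (0 : 0 : 1) has first coordinate zero, and the curve
    avoids it because the coefficient \<open>c (0, r)\<close> of the pure power of the third
    coordinate is nonzero.\<close>
  have w: "\<phi> s $ 1 ~= 0"
  proof
   assume w: "\<phi> s $ 1 = 0"
   have "\<phi> s = \<phi> s $ 3 *s axis 3 1" using w True by (simp add: vec_eq_iff forall_3 axis_def)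
   hence "\<phi> s $ 3 = 0" using homog_scaling[OF homogI, of r c "\<phi> s $ 3" "axis 3 1"] hform_axis3 rel \<phi> s lead by (auto simp: vanish_def)
   thus False using w True nz[OF \<phi> s] by (simp add: vec_eq_iff forall_3)
  qed
  define x y where "x = (\<lambda>t. \<phi> t $ 2 / \<phi> t $ 1)" "y = (\<lambda>t. \<phi> t $ 3 / \<phi> t $ 1)"
  obtain d1 where d1: "d1 > 0" "ball s d1 \<subseteq> ball 0 2" "\<And>t. t \<in> ball s d1 ==> \<phi> t $ 1 ~= 0"
   using holomorphic_nonzero_ball[OF hol[OF \<phi>] open_ball s w] by blast
  have hx: "x holomorphic_on ball s d1" "y holomorphic_on ball s d1"
   using d1 hol[OF \<phi>] unfolding x_y_def by (auto intro!: holomorphic_intros intro: holomorphic_on_subset)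
  have "y s ~= y0"
  proof
   assume "y s = y0"
   thus False using w True neg'[OF \<phi> s w] by (auto simp: vec_eq_iff forall_3 x_y_def)
  qed
  hence ne: "y s - poly \<eta> (x s) ~= 0" using True q(5) by (simp add: x_y_def)
  have "(\<lambda>t. y t - poly \<eta> (x t)) holomorphic_on ball s d1"
 by (intro holomorphic_intros hx holomorphic_on_compose_poly)
  from holomorphic_nonzero_ball[OF this open_ball _ ne] d1(1)
  obtain d where d: "d > 0" "ball s d \<subseteq> ball s d1" "\<And>t. t \<in> ball s d ==> y t - poly \<eta> (x t) ~= 0" by auto
  define u where "u = (\<lambda>t. (poly2 S (x t) (y t) - poly A (x t) * poly E (x t) / (y t - poly \<eta> (x t))) / c (0, r))"
  have "u holomorphic_on ball s d"
   unfolding u_def using hx d(2,3)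
 by (intro holomorphic_intros holomorphic_on_compose_poly) (auto intro: holomorphic_on_subset)
  moreover have "Q (\<phi> t) = u t * (\<phi> t $ 2) ^ k" if t: "t \<in> ball s d" for t
  proof -
   have t1: "\<phi> t $ 1 ~= 0" "t \<in> ball 0 2" using t d(2) d1(2,3) by blast+
   have "0 = poly2 ([:- \<eta>, 1:] * G + [:monom 1 k * E:]) (x t) (y t)"
    using P_zero[OF \<phi> t1(2,1)] q(6) by (simp add: x_y_def)
   also have "... = (y t - poly \<eta> (x t)) * poly2 G (x t) (y t) + x t ^ k * poly E (x t)"
 by (simp add: poly_monom left_diff_distrib)
   finally have "poly2 G (x t) (y t) = - (x t ^ k * poly E (x t) / (y t - poly \<eta> (x t)))"
    using d(3)[OF t] by (simp add: field_simps)
   moreover have "poly2 (smult [:c (0, r):] q) (x t) (y t) = poly2 ([:A:] * G + smult (monom 1 k) S) (x t) (y t)" using q(7) by simp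
   ultimately have "poly2 q (x t) (y t) = x t ^ k * u t" using lead by (simp add: u_def poly_monom field_simps)
   thus ?thesis unfolding Q_def using hform_poly2[OF q(2) t1(1)] t1 by (simp add: x_y_def power_divide)
  qed
  ultimately show ?thesis using d d1 by (intro exI[of _ d] conjI exI[of _ u]) auto
 qed
 obtain b where b: "vanish (\<lambda>v. Q v - b * v $ 2 ^ k)" using bounded_quotient_constant[OF Qh loc] by blast
 define q' where "q' = q - [:monom b k:]"
 have tq': "total_degree_le q' k"
  unfolding total_degree_le_def
 proof (intro allI impI)
  fix i j assume "coeff (coeff q' j) i ~= 0"
  hence "coeff (coeff q j) i ~= 0 \<or> (j = 0 \<and> i = k)"
 by (cases j) (auto simp: q'_def split: if_splits)
  thus "i + j \<le> k" using q(2) by (auto simp: total_degree_le_def)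
 qed
 have "hform k (\<lambda>(i, j). coeff (coeff q' j) i) v = Q v - b * v $ 2 ^ k" for v
 proof -
  have "hform k (\<lambda>(i, j). coeff (coeff q' j) i) v = Q v - (\<Sum>x\<in>Mon k. if x = (k, 0) then b * v $ 2 ^ k else 0)"
   unfolding Q_def hform_def sum_subtractf[symmetric]
 by (intro sum.cong refl) (auto simp: q'_def coeff_pCons algebra_simps split: nat.splits if_splits)
  thus ?thesis by (simp add:) (simp add: Mon_def)
 qed
 hence "vanish (hform k (\<lambda>(i, j). coeff (coeff q' j) i))" using b by (simp add: vanish_def)
 moreover have "degree q' < r" unfolding q'_def using q(3) by (intro degree_diff_less) auto
 hence "\<not> P dvd q'" using q(4)[of b] degree_P[OF lead] dvd_imp_degree_le[of P q'] by (auto simp: q'_def)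
 ultimately show False using not_vanish_if_not_dvd tq' by blast
qed

text \<open>The Bezout constant of \<open>P\<close> and its y-derivative replaces the
  discriminant.\<close>

lemma finite_bad_slices:
 assumes "c (0, r) ~= 0"
 shows "finite {x. \<exists>y. poly2 P x y = 0 \<and> poly2 (pderiv P) x y = 0}"
proof -
 have "\<not> P dvd pderiv P" using degree_P[OF assms] r_ge_2 by simp
 then obtain A B s where s: "s ~= 0" "A * P + B * pderiv P = [:s:]"
 by (rule bezout_poly2[OF irreducible_P degree_P_pos])
 have "{x. \<exists>y. poly2 P x y = 0 \<and> poly2 (pderiv P) x y = 0} \<subseteq> {x. poly s x = 0}"
 proof safe
  fix x y assume "poly2 P x y = 0" "poly2 (pderiv P) x y = 0"
  hence "poly2 (A * P + B * pderiv P) x y = 0" by simp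
  thus "poly s x = 0" by (simp add: s)
 qed
 thus ?thesis using poly_roots_finite[OF s(1)] finite_subset by blast
qed

end

section \<open>Independence as a Zariski open condition\<close>

definition indep_fam :: "'i set => ('i => 'z => complex) => bool" where
 "indep_fam I f \<longleftrightarrow> (\<forall>c. (\<forall>z. (\<Sum>i\<in>I. c i * f i z) = 0) --> (\<forall>i\<in>I. c i = 0))"

lemma indep_famD: "indep_fam I f ==> (\<And>z. (\<Sum>i\<in>I. c i * f i z) = 0) ==> i \<in> I ==> c i = 0"
 by (auto simp: indep_fam_def)

lemma polynomial_funs_sum:
 "(\<And>i. i \<in> I ==> p i \<in> polynomial_funs scl) ==> (\<lambda>h. \<Sum>i\<in>I. p i h) \<in> polynomial_funs scl"
 by (induction I rule: infinite_finite_induct) (auto intro: polynomial_funs.intros)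

lemma polynomial_funs_prod:
 "(\<And>i. i \<in> I ==> p i \<in> polynomial_funs scl) ==> (\<lambda>h. \<Prod>i\<in>I. p i h) \<in> polynomial_funs scl"
 by (induction I rule: infinite_finite_induct) (auto intro: polynomial_funs.intros)

lemma polynomial_funs_power: "p \<in> polynomial_funs scl ==> (\<lambda>h. p h ^ n) \<in> polynomial_funs scl"
 by (induction n) (auto intro: polynomial_funs.intros)

lemma polynomial_funs_cmult: "p \<in> polynomial_funs scl ==> (\<lambda>h. a * p h) \<in> polynomial_funs scl"
 by (rule polynomial_funs.mult[OF polynomial_funs.const])

lemma polynomial_funs_diff: "p \<in> polynomial_funs scl ==> q \<in> polynomial_funs scl ==> (\<lambda>h. p h - q h) \<in> polynomial_funs scl"
 using polynomial_funs.add[OF _ polynomial_funs_cmult[of q scl "-1"], of p] by simp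

text \<open>One step of Gaussian elimination with pivot \<open>f p z0\<close>.\<close>

lemma elimination_step:
 assumes "finite I" "p \<notin> I" "\<And>z. c p * f p z + (\<Sum>i\<in>I. c i * f i z) = 0"
 shows "(\<Sum>i\<in>I. c i * (f i z * f p z0 - f i z0 * f p z)) = (0::complex)"
proof -
 have "(\<Sum>i\<in>I. c i * (f i z * f p z0 - f i z0 * f p z)) = (\<Sum>i\<in>I. c i * f i z) * f p z0 - (\<Sum>i\<in>I. c i * f i z0) * f p z"
 by (simp add: sum_distrib_right sum_subtractf right_diff_distrib mult.assoc)
 also have "(\<Sum>i\<in>I. c i * f i z) = - (c p * f p z)"
  using assms(3)[of z] by (simp add: eq_neg_iff_add_eq_0 add.commute)
 also have "(\<Sum>i\<in>I. c i * f i z0) = - (c p * f p z0)"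
  using assms(3)[of z0] by (simp add: eq_neg_iff_add_eq_0 add.commute)
 finally show ?thesis by simp
qed

text \<open>A relation of the reduced family extends to \<open>p\<close>: its coefficient is
  determined by evaluation at the pivot point \<open>z0\<close>, where \<open>f p z0\<close> is
  nonzero.\<close>

lemma indep_elimination:
 assumes "finite I" "p \<notin> I" "f p z0 ~= 0"
 shows "indep_fam (insert p I) f \<longleftrightarrow> indep_fam I (\<lambda>i z. f i z * f p z0 - f i z0 * f p z)"
proof
 assume ind: "indep_fam I (\<lambda>i z. f i z * f p z0 - f i z0 * f p z)"
 show "indep_fam (insert p I) f"
  unfolding indep_fam_def
 proof (intro allI impI)
  fix c assume "\<forall>z. (\<Sum>i\<in>insert p I. c i * f i z) = 0"
  hence rel: "c p * f p z + (\<Sum>i\<in>I. c i * f i z) = 0" for z using assms by simp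
  have ci: "c i = 0" if "i \<in> I" for i
   using indep_famD[OF ind elimination_step[OF assms(1,2) rel] that] .
  thus "\<forall>i\<in>insert p I. c i = 0" using rel[of z0] assms(3) by simp
 qed
next
 assume ind: "indep_fam (insert p I) f"
 show "indep_fam I (\<lambda>i z. f i z * f p z0 - f i z0 * f p z)"
  unfolding indep_fam_def
 proof (intro allI impI ballI)
  fix c i assume rel: "\<forall>z. (\<Sum>i\<in>I. c i * (f i z * f p z0 - f i z0 * f p z)) = 0" and i: "i \<in> I"
  define c' where "c' = (\<lambda>j. if j = p then - (\<Sum>i\<in>I. c i * f i z0) else c j * f p z0)"
  have "(\<Sum>j\<in>insert p I. c' j * f j z) = 0" for z
  proof -
   have "(\<Sum>j\<in>insert p I. c' j * f j z) = c' p * f p z + (\<Sum>j\<in>I. c' j * f j z)" using assms by simp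
   also have "(\<Sum>j\<in>I. c' j * f j z) = (\<Sum>j\<in>I. c j * f p z0 * f j z)"
    using assms(2) by (intro sum.cong) (auto simp: c'_def)
   also have "c' p * f p z + ... = (\<Sum>i\<in>I. c i * (f i z * f p z0 - f i z0 * f p z))"
 by (simp add: c'_def sum_subtractf algebra_simps sum_distrib_left)
   finally show ?thesis using rel by simp
  qed
  from indep_famD[OF ind this, of i] i assms show "c i = 0" by (auto simp: c'_def split: if_splits)
 qed
qed

lemma indep_nonzero:
 assumes "finite I" "p \<in> I" "indep_fam I f"
 shows "\<exists>z. f p z ~= 0"
proof (rule ccontr)
 assume n: "\<not> ?thesis"
 have "(\<Sum>i\<in>I. (if i = p then 1 else 0) * f i z) = 0" for z
  using n by (intro sum.neutral) auto
 from indep_famD[OF assms(3) this assms(2)] show False by simp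
qed

text \<open>\<open>D\<close> is the product of the pivots met when elimination is carried out at
  \<open>h0\<close>. Elimination without division keeps all entries polynomial in \<open>h\<close>,
  so wherever the same pivots are nonzero the same elimination proves independence.\<close>

lemma independence_open:
 fixes b :: "'i => 'h::ab_group_add => 'z => complex"
 assumes "finite I" "\<And>i z. i \<in> I ==> (\<lambda>h. b i h z) \<in> polynomial_funs scl" "indep_fam I (\<lambda>i. b i h0)"
 shows "\<exists>D\<in>polynomial_funs scl. D h0 ~= 0 \<and> (\<forall>h. D h ~= 0 --> indep_fam I (\<lambda>i. b i h))"
 using assms
proof (induction I arbitrary: b rule: finite_induct)
 case empty
 show ?case by (intro bexI[of _ "\<lambda>_. 1"]) (auto simp: indep_fam_def intro: polynomial_funs.const)
next
 case (insert p I)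
 obtain z0 where z0: "b p h0 z0 ~= 0" using indep_nonzero[OF _ _ insert.prems(2), of p] insert.hyps by auto
 define b' where "b' = (\<lambda>i h z. b i h z * b p h z0 - b i h z0 * b p h z)"
 have "(\<lambda>h. b' i h z) \<in> polynomial_funs scl" if "i \<in> I" for i z
  unfolding b'_def using that insert.prems(1) by (intro polynomial_funs_diff polynomial_funs.mult) auto
 moreover have "indep_fam I (\<lambda>i. b' i h0)"
  using insert.prems(2) indep_elimination[of I p "\<lambda>i. b i h0" z0] insert.hyps z0 by (simp add: b'_def)
 ultimately obtain D where D: "D \<in> polynomial_funs scl" "D h0 ~= 0" "\<And>h. D h ~= 0 ==> indep_fam I (\<lambda>i. b' i h)"
  using insert.IH[of b'] by blast
 show ?case
 proof (intro bexI[of _ "\<lambda>h. D h * b p h z0"] conjI allI impI)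
  show "(\<lambda>h. D h * b p h z0) \<in> polynomial_funs scl" using D insert.prems(1) by (intro polynomial_funs.mult) auto
  show "D h0 * b p h0 z0 ~= 0" using D z0 by simp
  fix h assume "D h * b p h z0 ~= 0"
  thus "indep_fam (insert p I) (\<lambda>i. b i h)"
   using D(3)[of h] indep_elimination[of I p "\<lambda>i. b i h" z0] insert.hyps by (simp add: b'_def)
 qed
qed

text \<open>Cramer's rule by elimination without division: if the members other than
  \<open>k\<close> are independent at \<open>h0\<close>, the dependence of the full family is solved
  with coefficients polynomial in \<open>h\<close>, and the coefficient of \<open>k\<close>, a
  product of pivots, is nonzero at \<open>h0\<close>.\<close>

lemma polynomial_relation:
 fixes b :: "'i => 'h::ab_group_add => 'z => complex"
 assumes "finite I" "k \<notin> I" "\<And>i z. i \<in> insert k I ==> (\<lambda>h. b i h z) \<in> polynomial_funs scl" "indep_fam I (\<lambda>i. b i h0)"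
 shows "\<exists>co. (\<forall>i\<in>insert k I. co i \<in> polynomial_funs scl) \<and> co k h0 ~= 0 \<and>
  (\<forall>h. co k h ~= 0 --> \<not> indep_fam (insert k I) (\<lambda>i. b i h) --> (\<forall>z. (\<Sum>i\<in>insert k I. co i h * b i h z) = 0))"
 using assms
proof (induction I arbitrary: b rule: finite_induct)
 case empty
 show ?case
 \<comment> \<open>A dependent family with the single member \<open>k\<close> consists of the zero
   function, so the coefficient 1 is a relation.\<close>
 by (intro exI[of _ "\<lambda>_ _. 1"]) (auto simp: indep_fam_def intro: polynomial_funs.const)
next
 case (insert p I)
 have pk: "p ~= k" "k \<notin> I" using insert.prems by auto
 obtain z0 where z0: "b p h0 z0 ~= 0" using indep_nonzero[OF _ _ insert.prems(3), of p] insert.hyps by auto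
 define b' where "b' = (\<lambda>i h z. b i h z * b p h z0 - b i h z0 * b p h z)"
 have "(\<lambda>h. b' i h z) \<in> polynomial_funs scl" if "i \<in> insert k I" for i z
  unfolding b'_def using that insert.prems(2) by (intro polynomial_funs_diff polynomial_funs.mult) auto
 moreover have "indep_fam I (\<lambda>i. b' i h0)"
  using insert.prems(3) indep_elimination[of I p "\<lambda>i. b i h0" z0] insert.hyps z0 by (simp add: b'_def)
 ultimately obtain co where co: "\<And>i. i \<in> insert k I ==> co i \<in> polynomial_funs scl" "co k h0 ~= 0"
  "\<And>h. co k h ~= 0 ==> \<not> indep_fam (insert k I) (\<lambda>i. b' i h) ==> (\<forall>z. (\<Sum>i\<in>insert k I. co i h * b' i h z) = 0)"
  using insert.IH[of b'] pk by blast
 \<comment> \<open>Undoes the elimination: the old coefficients are scaled by the pivot, and that of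
   \<open>p\<close> is forced by the relation at \<open>z0\<close>.\<close>
 define co' where "co' = (\<lambda>i h. if i = p then - (\<Sum>j\<in>insert k I. co j h * b j h z0) else co i h * b p h z0)"
 have fin: "finite (insert k I)" "p \<notin> insert k I" using insert.hyps pk by auto
 have eq: "insert k (insert p I) = insert p (insert k I)" by auto
 show ?case
 proof (intro exI[of _ co'] conjI ballI allI impI)
  fix i assume i: "i \<in> insert k (insert p I)"
  show "co' i \<in> polynomial_funs scl"
  proof (cases "i = p")
   case True
   have "(\<lambda>h. (-1) * (\<Sum>j\<in>insert k I. co j h * b j h z0)) \<in> polynomial_funs scl"
    using co(1) insert.prems(2) by (intro polynomial_funs_cmult polynomial_funs_sum polynomial_funs.mult) auto
   thus ?thesis using True by (simp add: co'_def)
  next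
   case False
   thus ?thesis using i co(1)[of i] insert.prems(2)[of p z0] by (auto simp: co'_def intro: polynomial_funs.mult)
  qed
 next
  show "co' k h0 ~= 0" using co(2) z0 pk by (simp add: co'_def)
 next
  fix h z assume h: "co' k h ~= 0" "\<not> indep_fam (insert k (insert p I)) (\<lambda>i. b i h)"
  have nz: "co k h ~= 0" "b p h z0 ~= 0" using h(1) pk by (auto simp: co'_def split: if_splits)
  hence rel: "(\<Sum>i\<in>insert k I. co i h * b' i h z) = 0" using h(2) indep_elimination[OF fin, of "\<lambda>i. b i h" z0] co(3)[OF nz(1)] by (simp add: eq b'_def)
  have "(\<Sum>i\<in>insert k (insert p I). co' i h * b i h z) = co' p h * b p h z + (\<Sum>i\<in>insert k I. co' i h * b i h z)"
   unfolding eq using fin by simp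
  also have "(\<Sum>i\<in>insert k I. co' i h * b i h z) = (\<Sum>i\<in>insert k I. co i h * b p h z0 * b i h z)"
   using fin(2) by (intro sum.cong) (auto simp: co'_def)
  also have "co' p h * b p h z = - (\<Sum>j\<in>insert k I. co j h * b j h z0 * b p h z)"
 by (simp only: co'_def if_True refl) (simp add: sum_distrib_right del: sum.insert)
  also have "- (\<Sum>j\<in>insert k I. co j h * b j h z0 * b p h z) + (\<Sum>i\<in>insert k I. co i h * b p h z0 * b i h z) = (\<Sum>i\<in>insert k I. co i h * b' i h z)"
   unfolding b'_def by (simp add: right_diff_distrib sum_subtractf mult_ac del: sum.insert)
  finally show "(\<Sum>i\<in>insert k (insert p I). co' i h * b i h z) = 0" using rel by simp
 qed
qed

section \<open>The general line\<close>

text \<open>Bilinear, without conjugation, so that \<open>dot a v = 0\<close> depends algebraically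
  on both the line \<open>a\<close> and the point \<open>v\<close>.\<close>

definition dot :: "complex^3 => complex^3 => complex" where
 "dot a v = (\<Sum>i\<in>UNIV. a $ i * v $ i)"

lemma dot_simps: "dot a (v + w) = dot a v + dot a w" "dot a (s *s v) = s * dot a v" "dot a 0 = 0"
 by (auto simp: dot_def sum_3 algebra_simps)

text \<open>Dividing out a multiple root leaves all roots in place but lowers the degree, so the
  roots would be fewer than the degree.\<close>

lemma poly_roots_simple:
 fixes q :: "complex poly"
 assumes "q ~= 0" "card {y. poly q y = 0} = degree q" "poly q y = 0"
 shows "poly (pderiv q) y ~= 0"
proof
 assume d: "poly (pderiv q) y = 0"
 have "[:- y, 1:] dvd q" using assms(3) by (simp only: poly_eq_0_iff_dvd)
 then obtain g where g: "q = [:- y, 1:] * g" by auto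
 have g0: "g ~= 0" using assms(1) g by auto
 have "pderiv q = g + [:- y, 1:] * pderiv g"
 by (subst g, subst pderiv_mult) (simp add: pderiv_pCons)
 hence "{z. poly q z = 0} = {z. poly g z = 0}" using d unfolding g poly_mult by auto
 hence "card {y. poly q y = 0} \<le> degree g" using card_poly_roots_bound[OF g0] by simp
 moreover have "degree q = Suc (degree g)" using g0 by (subst g, subst degree_mult_eq) auto
 ultimately show False using assms(2) by simp
qed

lemma slice_simple:
 assumes "slice x p ~= 0" "card {y. poly2 p x y = 0} = degree (slice x p)" "poly2 p x y = 0"
 shows "poly2 (pderiv p) x y ~= 0"
 using poly_roots_simple[of "slice x p" y] assms by (simp add: poly_slice pderiv_slice)

context plane_curve_min
begin

lemma transform_min:
 assumes "M ** N = mat 1" "N ** M = mat 1" "\<And>v. hform r c' v = hform r c (N *v v)"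
 shows "plane_curve_min ((\<lambda>\<phi> t. M *v \<phi> t) ` J) r c'"
proof -
 interpret T: plane_curve "(\<lambda>\<phi> t. M *v \<phi> t) ` J" by (rule transform[OF assms(1,2)])
 have inv: "N *v (M *v v) = v" "M *v (N *v v) = v" for v using assms(1,2) by (simp_all add: matrix_vector_mul_assoc)
 show ?thesis
 proof
  show "T.vanish (hform r c')" using rel by (auto simp: T.vanish_def vanish_def assms(3) inv)
  obtain v where "hform r c v ~= 0" using rel_nz by auto
  hence "hform r c' (M *v v) ~= 0" by (simp add: assms(3) inv)
  thus "hform r c' ~= (\<lambda>_. 0)" by auto
  fix n p assume p: "p \<in> homog n" "T.vanish p" "p ~= (\<lambda>_. 0)"
  have "vanish (\<lambda>v. p (M *v v))" using p(2) by (auto simp: T.vanish_def vanish_def)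
  moreover obtain v where "p v ~= 0" using p(3) by auto
  hence "(\<lambda>v. p (M *v v)) ~= (\<lambda>_. 0)" using inv(2)[of v] by (metis (no_types))
  ultimately show "r \<le> n" using min[OF homog_subst[OF p(1)]] by blast
 qed
qed

definition basis_mat :: "complex^3 => complex^3 => complex^3 => complex^3^3" where
 "basis_mat e x q = (\<chi> i j. if j = 1 then e $ i else if j = 2 then x $ i else q $ i)"

lemma basis_mat_mult: "basis_mat e x q *v v = v $ 1 *s e + v $ 2 *s x + v $ 3 *s q"
 by (simp add: basis_mat_def matrix_vector_mult_def vec_eq_iff sum_3)

lemma basis_mat_inverse:
 assumes "\<And>a b d. a *s e + b *s x + d *s q = 0 ==> a = 0 \<and> b = 0 \<and> d = 0"
 shows "\<exists>M. M ** basis_mat e x q = mat 1 \<and> basis_mat e x q ** M = mat 1"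
proof -
 have "inj ((*v) (basis_mat e x q))"
 proof (rule injI)
  fix v w assume "basis_mat e x q *v v = basis_mat e x q *v w"
  hence "basis_mat e x q *v (v - w) = 0" by (simp add: matrix_vector_mult_diff_distrib)
  hence "(v - w) $ 1 = 0 \<and> (v - w) $ 2 = 0 \<and> (v - w) $ 3 = 0" by (intro assms) (simp add: basis_mat_mult)
  thus "v = w" by (simp add: vec_eq_iff forall_3)
 qed
 then obtain M where "M ** basis_mat e x q = mat 1" using matrix_left_invertible_injective by blast
 thus ?thesis using matrix_left_right_inverse by blast
qed

lemma hform_zero: "hform r c 0 = 0"
 using homog_scaling[OF homogI, of r c 0 0] r_ge_2 by (simp add: power_0_left)

text \<open>If e were a multiple of q, the form restricted to e + s q would be a constant times an
  r-th power in s and have at most one root, while r is at least 2.\<close>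

lemma line_directions_independent:
 assumes q: "hform r c q ~= 0" and card: "card {s. hform r c (e + s *s q) = 0} = r" and "\<alpha> *s e + \<beta> *s q = 0"
 shows "\<alpha> = 0 \<and> \<beta> = 0"
proof -

 show ?thesis
 proof (cases "\<alpha> = 0")
  case True
  thus ?thesis using assms(3) q hform_zero by auto
 next
  case False
  have "e = (- \<beta> / \<alpha>) *s q"
  proof -
   have "\<alpha> * e $ i + \<beta> * q $ i = 0" for i using arg_cong[OF assms(3), of "\<lambda>v. v $ i"] by simp
   thus ?thesis using False by (simp add: vec_eq_iff field_simps eq_neg_iff_add_eq_0)
  qed
  hence "e + s *s q = (s - \<beta> / \<alpha>) *s q" for s by simp
  hence "hform r c (e + s *s q) = (s - \<beta> / \<alpha>) ^ r * hform r c q" for s using homog_scaling[OF homogI] by metis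
  hence "{s. hform r c (e + s *s q) = 0} \<subseteq> {\<beta> / \<alpha>}" using q by auto
  hence "card {s. hform r c (e + s *s q) = 0} \<le> 1" using card_mono[of "{\<beta> / \<alpha>}"] by force
  thus ?thesis using card r_ge_2 by simp
 qed
qed

text \<open>In coordinates with basis e, x, q, where x lies off the line, the line becomes x = 0 and
  q becomes (0 : 0 : 1), which is not a zero of the form. The r distinct roots exhaust the degree
  and are therefore simple, so each zero on the line is attained by the curve.\<close>

lemma line_points:
 assumes a: "a ~= 0" "dot a e = 0" "dot a q = 0" and q: "hform r c q ~= 0" and card: "card {s. hform r c (e + s *s q) = 0} = r"
  and v: "v ~= 0" "dot a v = 0" "hform r c v = 0"
 shows "\<exists>s b. b ~= 0 \<and> v = b *s (e + s *s q) \<and> hform r c (e + s *s q) = 0"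
  and "\<exists>\<phi>\<in>J. \<exists>t\<in>cball 0 1. \<exists>b. b ~= 0 \<and> \<phi> t = b *s v"
proof -
 have ind: "\<alpha> = 0 \<and> \<beta> = 0" if "\<alpha> *s e + \<beta> *s q = 0" for \<alpha> \<beta> by (rule line_directions_independent[OF q card that])
 obtain x where x: "dot a x = 1"
 proof -
  obtain i where "a $ i ~= 0" using a(1) by (auto simp: vec_eq_iff)
  hence "dot a (axis i (1 / a $ i)) = 1" by (simp add: dot_def axis_def if_distrib cong: if_cong)
  thus ?thesis using that by blast
 qed
 define N where "N = basis_mat e x q"
 have "\<exists>M. M ** N = mat 1 \<and> N ** M = mat 1"
  unfolding N_def
 proof (rule basis_mat_inverse)
  fix \<alpha> b d assume h: "\<alpha> *s e + b *s x + d *s q = 0"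
  have "dot a (\<alpha> *s e + b *s x + d *s q) = b" using a x by (simp add: dot_simps)
  thus "\<alpha> = 0 \<and> b = 0 \<and> d = 0" using h ind[of \<alpha> d] by (simp add: dot_simps)
 qed
 then obtain M where MN: "M ** N = mat 1" "N ** M = mat 1" by blast
 have inv: "N *v (M *v v) = v" "M *v (N *v v) = v" for v using MN by (simp_all add: matrix_vector_mul_assoc)
 obtain c' where c': "(\<lambda>v. hform r c (N *v v)) = hform r c'" using homog_subst[OF homogI, of r c N] by (auto simp: homog_def)
 interpret T: plane_curve_min "(\<lambda>\<phi> t. M *v \<phi> t) ` J" r c'
 by (rule transform_min[OF MN]) (metis c')
 have lead: "c' (0, r) ~= 0"
 proof -
  have "c' (0, r) = hform r c (N *v axis 3 1)" using fun_cong[OF c', of "axis 3 1"] by (simp add: hform_axis3)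
  also have "N *v axis 3 1 = q" by (simp add: N_def basis_mat_mult axis_def)
  finally show ?thesis using q by simp
 qed
 have P': "poly2 T.P 0 y = hform r c (e + y *s q)" for y
 proof -
  have "hform r c (N *v vector [1, 0, y]) = hform r c' (vector [1, 0, y])" using fun_cong[OF c'] by simp
  also have "... = poly2 T.P 0 y" using hform_dehom[of "vector [1, 0, y]" r c'] by simp
  finally show ?thesis by (simp add: N_def basis_mat_mult)
 qed
 define u where "u = M *v v"
 have vu: "v = u $ 1 *s e + u $ 2 *s x + u $ 3 *s q" using inv(1)[of v] by (simp add: u_def N_def basis_mat_mult)
 have vu: "v = u $ 1 *s e + u $ 3 *s q" using v(2) vu by (subst vu) (use a x in \<open>simp add: dot_simps\<close>)
 have u1: "u $ 1 ~= 0"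
 using vu v(3) homog_scaling[OF homogI, of r c "u $ 3" q] q v(1) by auto
 define s where "s = u $ 3 / u $ 1"
 have vs: "v = u $ 1 *s (e + s *s q)" using vu u1 by (simp add: s_def)
 have root: "hform r c (e + s *s q) = 0"
  using v(3) vs u1 homog_scaling[OF homogI, of r c "u $ 1" "e + s *s q"] by simp
 show "\<exists>s b. b ~= 0 \<and> v = b *s (e + s *s q) \<and> hform r c (e + s *s q) = 0" using vs root u1 by blast
 have "poly2 (pderiv T.P) 0 s ~= 0"
 proof (rule slice_simple)
  have "degree (slice 0 T.P) = r" by (rule T.degree_slice_P[OF lead])
  thus "slice 0 T.P ~= 0" "card {y. poly2 T.P 0 y = 0} = degree (slice 0 T.P)"
   using r_ge_2 card by (auto simp: P')
 qed (simp add: P' root)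
 from T.point_attained[OF lead _ this] root obtain \<phi> t b where \<phi>: "\<phi> \<in> J" "t \<in> cball 0 1" "b ~= 0" "M *v \<phi> t = b *s vector [1, 0, s]"
 by (auto simp: P')
 have "\<phi> t = N *v (b *s vector [1, 0, s])" using \<phi>(4) inv(1)[of "\<phi> t"] by simp
 also have "... = b *s (e + s *s q)" by (simp add: N_def basis_mat_mult)
 also have "... = (b / u $ 1) *s v" using u1 by (subst vs) (simp add:)
 finally show "\<exists>\<phi>\<in>J. \<exists>t\<in>cball 0 1. \<exists>b. b ~= 0 \<and> \<phi> t = b *s v" using \<phi> u1 by (metis divide_eq_0_iff)
qed

end

section \<open>Lines parametrized polynomially by their coefficient vectors\<close>

text \<open>The cross product. For fixed v it gives a point on the line \<open>a\<close> that
  depends linearly on \<open>a\<close>; two fixed vectors thus parametrize all nearby lines at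
  once.\<close>

definition ccross :: "complex^3 => complex^3 => complex^3" where
 "ccross a v = vector [a$2 * v$3 - a$3 * v$2, a$3 * v$1 - a$1 * v$3, a$1 * v$2 - a$2 * v$1]"

lemma ccross_sel: "ccross a v $ 1 = a$2 * v$3 - a$3 * v$2" "ccross a v $ 2 = a$3 * v$1 - a$1 * v$3"
 "ccross a v $ 3 = a$1 * v$2 - a$2 * v$1"
 by (simp_all add: ccross_def)

lemma dot_ccross: "dot a (ccross a v) = 0"
 by (simp add: dot_def sum_3 ccross_sel algebra_simps)

lemma ccross_surj:
 assumes "a ~= 0" "dot a e = 0"
 shows "\<exists>v. e = ccross a v"
proof -
 have d: "a$1 * e$1 + a$2 * e$2 + a$3 * e$3 = 0" using assms(2) by (simp add: dot_def sum_3)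
 consider "a$1 ~= 0" | "a$2 ~= 0" | "a$3 ~= 0" using assms(1) by (auto simp: vec_eq_iff forall_3)
 thus ?thesis
 proof cases
  case 1
  have "e$1 = - (a$2 * e$2 + a$3 * e$3) / a$1" using 1 d by (simp add: field_simps eq_neg_iff_add_eq_0)
  thus ?thesis using 1
 by (intro exI[of _ "vector [0, e$3 / a$1, - e$2 / a$1]"])
     (simp add: vec_eq_iff forall_3 ccross_sel field_simps)
 next
  case 2
  have "a$2 * e$2 = - (a$1 * e$1 + a$3 * e$3)" using d by (simp only: eq_neg_iff_add_eq_0 add_ac)
  hence e2: "e$2 = - (a$1 * e$1 + a$3 * e$3) / a$2" using 2 by (metis nonzero_mult_div_cancel_left)
  show ?thesis
  proof (rule exI[of _ "vector [- e$3 / a$2, 0, e$1 / a$2]"])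
   show "e = ccross a (vector [- e$3 / a$2, 0, e$1 / a$2])" using 2 by (auto simp: e2 diff_divide_distrib vec_eq_iff forall_3 ccross_sel)
  qed
 next
  case 3
  have "e$3 = - (a$1 * e$1 + a$2 * e$2) / a$3" using 3 d by (simp add: field_simps eq_neg_iff_add_eq_0)
  thus ?thesis using 3
 by (intro exI[of _ "vector [e$2 / a$3, - e$1 / a$3, 0]"])
     (simp add: vec_eq_iff forall_3 ccross_sel field_simps)
 qed
qed

lemma coord_linear: "(\<lambda>v :: complex^3. v $ i) \<in> polynomial_funs (*s)"
proof (rule polynomial_funs.lin)
 interpret a: vector_space "(*s) :: complex => complex^3 => complex^3"
 by (rule vec.vector_space_axioms)
 interpret b: vector_space "(*) :: complex => complex => complex"
 by unfold_locales (auto simp: algebra_simps)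
 show "Vector_Spaces.linear (*s) (*) (\<lambda>v :: complex^3. v $ i)"
 by unfold_locales (auto simp:)
qed

lemma ccross_polynomial: "(\<lambda>a. ccross a v $ i) \<in> polynomial_funs (*s)"
proof -
 have "\<forall>i. (\<lambda>a. ccross a v $ i) \<in> polynomial_funs (*s)"
  unfolding forall_3 ccross_sel
 by (intro conjI polynomial_funs_diff polynomial_funs.mult coord_linear polynomial_funs.const)
 thus ?thesis by blast
qed

definition coeff_polynomial :: "(complex^3 => complex poly) => bool" where
 "coeff_polynomial F \<longleftrightarrow> (\<forall>n. (\<lambda>a. coeff (F a) n) \<in> polynomial_funs (*s))"

lemma coeff_polynomial_mult: "coeff_polynomial F ==> coeff_polynomial G ==> coeff_polynomial (\<lambda>a. F a * G a)"
 unfolding coeff_polynomial_def coeff_mult by (auto intro!: polynomial_funs_sum polynomial_funs.mult)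

lemma coeff_polynomial_const: "coeff_polynomial (\<lambda>a. q)"
 unfolding coeff_polynomial_def by (auto intro: polynomial_funs.const)

lemma coeff_polynomial_power: "coeff_polynomial F ==> coeff_polynomial (\<lambda>a. F a ^ n)"
 by (induction n) (auto intro: coeff_polynomial_mult coeff_polynomial_const)

lemma coeff_polynomial_sum: "(\<And>i. i \<in> I ==> coeff_polynomial (F i)) ==> coeff_polynomial (\<lambda>a. \<Sum>i\<in>I. F i a)"
 unfolding coeff_polynomial_def coeff_sum by (auto intro: polynomial_funs_sum)

lemma coeff_polynomial_linear:
 "p \<in> polynomial_funs (*s) ==> q \<in> polynomial_funs (*s) ==> coeff_polynomial (\<lambda>a. [:p a, q a:])"
 unfolding coeff_polynomial_def
proof
 fix n assume "p \<in> polynomial_funs (*s)" "q \<in> polynomial_funs (*s)"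
 thus "(\<lambda>a. coeff [:p a, q a:] n) \<in> polynomial_funs (*s)"
 by (cases n; cases "n - 1") (auto intro: polynomial_funs.const)
qed

text \<open>Squarefreeness of a polynomial of known degree, as independence of the rows of the Sylvester matrix of the
 polynomial and its derivative.\<close>

definition sylv :: "complex poly => nat + nat => complex => complex" where
 "sylv q i s = (case i of Inl n => s ^ n * poly q s | Inr n => s ^ n * poly (pderiv q) s)"

definition sylv_ind :: "nat => (nat + nat) set" where
 "sylv_ind r = Inl ` {..<r - 1} \<union> Inr ` {..<r}"

lemma sylv_sum:
 "(\<Sum>i\<in>sylv_ind r. c i * sylv q i s) = poly ((\<Sum>n<r-1. monom (c (Inl n)) n) * q + (\<Sum>n<r. monom (c (Inr n)) n) * pderiv q) s"
proof -
 have "(\<Sum>i\<in>sylv_ind r. c i * sylv q i s) = (\<Sum>i\<in>Inl ` {..<r - 1}. c i * sylv q i s) + (\<Sum>i\<in>Inr ` {..<r}. c i * sylv q i s)"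
  unfolding sylv_ind_def by (rule sum.union_disjoint) auto
 also have "... = (\<Sum>n<r - 1. c (Inl n) * (s ^ n * poly q s)) + (\<Sum>n<r. c (Inr n) * (s ^ n * poly (pderiv q) s))"
 by (simp add: sum.reindex sylv_def)
 also have "... = poly ((\<Sum>n<r-1. monom (c (Inl n)) n) * q + (\<Sum>n<r. monom (c (Inr n)) n) * pderiv q) s"
 by (simp add: poly_sum poly_monom sum_distrib_right mult.assoc)
 finally show ?thesis .
qed

lemma poly_as_monoms: "degree p < n ==> (\<Sum>i<n. monom (coeff p i) i) = p"
 by (rule poly_eqI) (auto simp: coeff_sum coeff_eq_0 cong: if_cong)

text \<open>A common root s gives q = (t - s) g and q' = (t - s) h, hence the relation h q - g q' =
  0. Conversely A q + B q' = 0 makes B vanish at the r roots of a squarefree q, while its degree is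
  at most r - 1; so B = 0 and then A = 0.\<close>

lemma sylv_indep_iff:
 assumes "degree q = r" "r \<ge> 2"
 shows "indep_fam (sylv_ind r) (sylv q) \<longleftrightarrow> (\<forall>s. poly q s = 0 --> poly (pderiv q) s ~= 0)"
proof

 assume ind: "indep_fam (sylv_ind r) (sylv q)"
 show "\<forall>s. poly q s = 0 --> poly (pderiv q) s ~= 0"
 proof (intro allI impI notI)
  fix s assume s: "poly q s = 0" "poly (pderiv q) s = 0"
  then obtain g h where g: "q = [:- s, 1:] * g" and h: "pderiv q = [:- s, 1:] * h"
   unfolding poly_eq_0_iff_dvd by (auto elim!: dvdE)
  have pd0: "pderiv q ~= 0" using assms by (auto simp: pderiv_eq_0_iff)
  hence gh0: "g ~= 0" "h ~= 0" using g h by auto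
  have "degree q = Suc (degree g)" using gh0 by (subst g, subst degree_mult_eq) auto
  hence dg: "degree g < r" using assms by simp
  have "degree (pderiv q) = Suc (degree h)" using gh0 by (subst h, subst degree_mult_eq) auto
  hence dh: "degree h < r - 1" using assms by (simp add: degree_pderiv)
  define c where "c = (\<lambda>i. case i of Inl n => coeff h n | Inr n => - coeff g n)"
  have "(\<Sum>i\<in>sylv_ind r. c i * sylv q i t) = 0" for t
  proof -
   have "(\<Sum>n<r. monom (c (Inr n)) n) = - g"
    using poly_as_monoms[OF dg] by (simp add: c_def minus_monom[symmetric] sum_negf)
   moreover have "(\<Sum>n<r - 1. monom (c (Inl n)) n) = h" using poly_as_monoms[OF dh] by (simp add: c_def)
   ultimately have "(\<Sum>i\<in>sylv_ind r. c i * sylv q i t) = poly (h * q + (- g) * pderiv q) t"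
    unfolding sylv_sum by simp
   also have "h * q + (- g) * pderiv q = 0"
 by (subst g, subst h) (simp add: algebra_simps)
   finally show ?thesis by simp
  qed
  hence "c i = 0" if "i \<in> sylv_ind r" for i using indep_famD[OF ind _ that] by blast
  from this[of "Inl (degree h)"] show False using dh gh0 by (simp add: sylv_ind_def c_def)
 qed
next
 have q0: "q ~= 0" using assms by auto
 assume sq: "\<forall>s. poly q s = 0 --> poly (pderiv q) s ~= 0"
 show "indep_fam (sylv_ind r) (sylv q)"
  unfolding indep_fam_def
 proof (intro allI impI)
  fix c assume z: "\<forall>s. (\<Sum>i\<in>sylv_ind r. c i * sylv q i s) = 0"
  define A where "A = (\<Sum>n<r-1. monom (c (Inl n)) n)"
  define B where "B = (\<Sum>n<r. monom (c (Inr n)) n)"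
  have eq: "A * q + B * pderiv q = 0" using z poly_all_0_iff_0 unfolding sylv_sum A_def B_def by blast
  have cB: "coeff B n = (if n < r then c (Inr n) else 0)" for n
 by (simp add: B_def coeff_sum cong: if_cong)
  have cA: "coeff A n = (if n < r - 1 then c (Inl n) else 0)" for n
 by (simp add: A_def coeff_sum cong: if_cong)
  have B0: "B = 0"
  proof (rule ccontr)
   assume "B ~= 0"
   have "poly B s = 0" if "poly q s = 0" for s
   proof -
    have "poly (A * q + B * pderiv q) s = 0" by (simp add: eq)
    thus ?thesis using that sq by simp
   qed
   hence "{s. poly q s = 0} \<subseteq> {s. poly B s = 0}" by auto
   hence "card {s. poly q s = 0} \<le> card {s. poly B s = 0}" using poly_roots_finite[OF \<open>B ~= 0\<close>] by (rule card_mono[rotated])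
   also have "... \<le> degree B" using card_poly_roots_bound[OF \<open>B ~= 0\<close>] .
   also have "... \<le> r - 1" by (intro degree_le) (auto simp: cB)
   finally show False using card_roots_squarefree[OF q0] sq assms by auto
  qed
  hence "A = 0" using eq q0 by simp
  have "c (Inl n) = 0" if "n < r - 1" for n using cA[of n] that \<open>A = 0\<close> by simp
  moreover have "c (Inr n) = 0" if "n < r" for n using cB[of n] that B0 by simp
  ultimately show "\<forall>i\<in>sylv_ind r. c i = 0" by (auto simp: sylv_ind_def)
 qed
qed

context plane_curve_min
begin

text \<open>The minimal form restricted to the line \<open>a\<close>, with parameter s; its
  coefficients are polynomial functions of \<open>a\<close>.\<close>

definition line_poly :: "complex^3 => complex^3 => complex^3 => complex poly" where
 "line_poly u v a = (\<Sum>x\<in>Mon r. [:c x:] * ([:ccross a u $ 1, ccross a v $ 1:] ^ (r - fst x - snd x) *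
   [:ccross a u $ 2, ccross a v $ 2:] ^ fst x * [:ccross a u $ 3, ccross a v $ 3:] ^ snd x))"

lemma poly_line_poly: "poly (line_poly u v a) s = hform r c (ccross a u + s *s ccross a v)"
 by (simp add: line_poly_def poly_sum hform_def case_prod_beta')

lemma coeff_line_poly: "coeff_polynomial (line_poly u v)"
 unfolding line_poly_def
 by (intro coeff_polynomial_sum coeff_polynomial_mult coeff_polynomial_power coeff_polynomial_linear coeff_polynomial_const ccross_polynomial)

lemma degree_line_poly: "degree (line_poly u v a) \<le> r"
 unfolding line_poly_def
proof (rule degree_sum_le)
 fix x assume "x \<in> Mon r"
 have pw: "degree ([:s, t:] ^ n) \<le> n" for s t :: complex and n
  using degree_power_le[of "[:s, t:]" n] by (auto elim: order_trans)
 have "degree ([:c x:] * ([:ccross a u $ 1, ccross a v $ 1:] ^ (r - fst x - snd x) *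
   [:ccross a u $ 2, ccross a v $ 2:] ^ fst x * [:ccross a u $ 3, ccross a v $ 3:] ^ snd x)) \<le> 0 + (((r - fst x - snd x) + fst x) + snd x)"
 by (intro order_trans[OF degree_mult_le] add_mono pw) auto
 also have "... = r" using \<open>x \<in> Mon r\<close> by (auto simp: Mon_def)
 finally show "degree ([:c x:] * ([:ccross a u $ 1, ccross a v $ 1:] ^ (r - fst x - snd x) *
   [:ccross a u $ 2, ccross a v $ 2:] ^ fst x * [:ccross a u $ 3, ccross a v $ 3:] ^ snd x)) \<le> r" .
qed simp

text \<open>Projection from a point q off the zero set: after q is moved to (0 : 0 : 1), the lines
  through q are the slices x = x0 and the line at infinity, and all but finitely many slices are
  good.\<close>

lemma exists_good_line:
 assumes "finite Z" "\<And>z. z \<in> Z ==> z ~= 0 \<and> hform r c z = 0"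
 shows "\<exists>a e q. a ~= 0 \<and> dot a e = 0 \<and> dot a q = 0 \<and> hform r c q ~= 0 \<and> card {s. hform r c (e + s *s q) = 0} = r \<and>
  (\<forall>z\<in>Z. dot a z ~= 0)"
proof -
 obtain q where q: "hform r c q ~= 0" using rel_nz by auto
 hence q0: "q ~= 0" using hform_zero by auto
 have "\<exists>e x M. M ** basis_mat e x q = mat 1 \<and> basis_mat e x q ** M = mat 1"
 proof -
  consider "q$1 ~= 0" | "q$2 ~= 0" | "q$3 ~= 0" using q0 by (auto simp: vec_eq_iff forall_3)
  thus ?thesis
  proof cases
   case 1
   have "\<exists>M. M ** basis_mat (axis 2 1) (axis 3 1) q = mat 1 \<and> basis_mat (axis 2 1) (axis 3 1) q ** M = mat 1"
 by (rule basis_mat_inverse) (use 1 in \<open>auto simp: vec_eq_iff forall_3 axis_def\<close>)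
   thus ?thesis by blast
  next
   case 2
   have "\<exists>M. M ** basis_mat (axis 1 1) (axis 3 1) q = mat 1 \<and> basis_mat (axis 1 1) (axis 3 1) q ** M = mat 1"
 by (rule basis_mat_inverse) (use 2 in \<open>auto simp: vec_eq_iff forall_3 axis_def\<close>)
   thus ?thesis by blast
  next
   case 3
   have "\<exists>M. M ** basis_mat (axis 1 1) (axis 2 1) q = mat 1 \<and> basis_mat (axis 1 1) (axis 2 1) q ** M = mat 1"
 by (rule basis_mat_inverse) (use 3 in \<open>auto simp: vec_eq_iff forall_3 axis_def\<close>)
   thus ?thesis by blast
  qed
 qed
 then obtain e x M where M: "M ** basis_mat e x q = mat 1" "basis_mat e x q ** M = mat 1" by blast
 define N where "N = basis_mat e x q"
 have MN: "M ** N = mat 1" "N ** M = mat 1" using M by (simp_all add: N_def)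
 have inv: "N *v (M *v v) = v" "M *v (N *v v) = v" for v using MN by (simp_all add: matrix_vector_mul_assoc)
 obtain c' where c': "(\<lambda>v. hform r c (N *v v)) = hform r c'" using homog_subst[OF homogI, of r c N] by (auto simp: homog_def)
 interpret T: plane_curve_min "(\<lambda>\<phi> t. M *v \<phi> t) ` J" r c'
 by (rule transform_min[OF MN]) (metis c')
 have lead: "c' (0, r) ~= 0"
 proof -
  have "c' (0, r) = hform r c (N *v axis 3 1)" using fun_cong[OF c', of "axis 3 1"] by (simp add: hform_axis3)
  also have "N *v axis 3 1 = q" by (simp add: N_def basis_mat_mult axis_def)
  finally show ?thesis using q by simp
 qed
 \<comment> \<open>Slices with a multiple root, or through a point of \<open>Z\<close>. For a point
   of \<open>Z\<close> at infinity the quotient has the harmless default value 0; such a point could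
   lie on a slice only if it were proportional to q, which is not a zero of the form.\<close>
 define bad where "bad = {x. \<exists>y. poly2 T.P x y = 0 \<and> poly2 (pderiv T.P) x y = 0} \<union> (\<lambda>z. (M *v z) $ 2 / (M *v z) $ 1) ` Z"
 have "finite bad" unfolding bad_def using T.finite_bad_slices[OF lead] assms(1) by blast
 then obtain x0 where x0: "x0 \<notin> bad" using ex_new_if_finite[OF infinite_UNIV_char_0] by blast
 define b :: "complex^3" where "b = vector [- x0, 1, 0]"
 define a where "a = b v* M"
 have dota: "dot a v = dot b (M *v v)" for v
 by (simp add: a_def dot_def vector_matrix_mult_def matrix_vector_mult_def sum_3 algebra_simps)
 have dotb: "dot b w = w $ 2 - x0 * w $ 1" for w by (simp add: b_def dot_def sum_3)
 define e' where "e' = N *v vector [1, x0, 0]"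
 have q': "q = N *v vector [0, 0, 1]" by (simp add: N_def basis_mat_mult)
 have slice: "poly2 T.P x0 s = hform r c (e' + s *s q)" for s
 proof -
  have "hform r c (N *v vector [1, x0, s]) = hform r c' (vector [1, x0, s])" using fun_cong[OF c'] by simp
  also have "... = poly2 T.P x0 s" using hform_dehom[of "vector [1, x0, s]" r c'] by simp
  moreover have "N *v vector [1, x0, s] = e' + s *s q" by (simp add: e'_def N_def basis_mat_mult)
  ultimately show ?thesis by simp
 qed
 show ?thesis
 proof (rule exI[of _ a], rule exI[of _ e'], rule exI[of _ q], intro conjI ballI)
  show "a ~= 0"
  proof
   assume "a = 0"
   hence "dot a x = 0" by (simp add: dot_def)
   moreover have "x = N *v vector [0, 1, 0]" by (simp add: N_def basis_mat_mult)
   ultimately show False by (simp add: dota inv dotb)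
  qed
  show "dot a e' = 0" by (simp add: dota e'_def inv dotb)
  show "dot a q = 0" by (subst q') (simp add: dota inv dotb)
  show "hform r c q ~= 0" by (rule q)
  have deg: "degree (slice x0 T.P) = r" by (rule T.degree_slice_P[OF lead])
  have "card {y. poly (slice x0 T.P) y = 0} = degree (slice x0 T.P)"
  proof (rule card_roots_squarefree)
   show "slice x0 T.P ~= 0" using deg r_ge_2 by auto
  qed (use x0 in \<open>auto simp: bad_def poly_slice pderiv_slice\<close>)
  thus "card {s. hform r c (e' + s *s q) = 0} = r" by (simp add: poly_slice slice deg)
  fix z assume z: "z \<in> Z"
  define w where "w = M *v z"
  have zw: "z = N *v w" by (simp add: w_def inv)
  show "dot a z ~= 0"
  proof (cases "w $ 1 = 0")
   case False
   have "w $ 2 / w $ 1 ~= x0" using x0 z by (auto simp: bad_def w_def)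
   thus ?thesis using False by (auto simp: dota dotb w_def[symmetric])
  next
   case True
   have "w $ 2 ~= 0"
   using True zw assms(2)[OF z] homog_scaling[OF homogI, of r c "w $ 3" q] q by (auto simp: N_def basis_mat_mult)
   thus ?thesis using True by (simp add: dota dotb w_def[symmetric])
  qed
 qed
qed

text \<open>\<open>D\<close> multiplies polynomial conditions that hold at one good line
  \<open>a0\<close>: squarefreeness by the Sylvester rows, full degree on the line, a base point q
  off the curve, and avoidance of \<open>Z\<close>. The vectors \<open>u\<close> and
  \<open>v\<close> found for \<open>a0\<close> stay fixed while \<open>a\<close> varies.\<close>

theorem generic_line:
 assumes "finite Z" "\<And>z. z \<in> Z ==> z ~= 0 \<and> hform r c z = 0"
 shows "\<exists>D\<in>polynomial_funs (*s). (\<exists>a. D a ~= 0) \<and> (\<forall>a. a ~= 0 --> D a ~= 0 --> (\<forall>z\<in>Z. dot a z ~= 0) \<and>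
  (\<exists>e q. dot a e = 0 \<and> dot a q = 0 \<and> hform r c q ~= 0 \<and> card {s. hform r c (e + s *s q) = 0} = r))"
proof -
 obtain a0 e0 q0 where a0: "a0 ~= 0" "dot a0 e0 = 0" "dot a0 q0 = 0" "hform r c q0 ~= 0"
  "card {s. hform r c (e0 + s *s q0) = 0} = r" "\<And>z. z \<in> Z ==> dot a0 z ~= 0"
  using exists_good_line[OF assms] by blast
 obtain u v where uv: "e0 = ccross a0 u" "q0 = ccross a0 v" using ccross_surj a0 by metis
 define F where "F = line_poly u v"
 have F: "poly (F a) s = hform r c (ccross a u + s *s ccross a v)" for a s by (simp add: F_def poly_line_poly)
 have cF: "(\<lambda>a. coeff (F a) n) \<in> polynomial_funs (*s)" for n using coeff_line_poly by (simp add: F_def coeff_polynomial_def)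
 have dF: "degree (F a) \<le> r" for a by (simp add: F_def degree_line_poly)
 have roots0: "card {s. poly (F a0) s = 0} = r" using a0(5) by (simp add: F uv)
 have F0: "F a0 ~= 0"
 using infinite_UNIV_char_0[where 'a=complex] roots0 r_ge_2 by auto
 have "degree (F a0) = r" using card_poly_roots_bound[OF F0] roots0 dF[of a0] by simp
 have ind0: "indep_fam (sylv_ind r) (sylv (F a0))"
  unfolding sylv_indep_iff[OF \<open>degree (F a0) = r\<close> r_ge_2]
  using poly_roots_simple[OF F0] roots0 \<open>degree (F a0) = r\<close> by simp
 have polys: "(\<lambda>a. sylv (F a) i s) \<in> polynomial_funs (*s)" for i s
 proof (cases i)
  case (Inl n)
  have "poly (F a) s = (\<Sum>k\<le>r. coeff (F a) k * s ^ k)" for a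
   unfolding poly_altdef using dF[of a] by (intro sum.mono_neutral_left) (auto simp: coeff_eq_0)
  hence "(\<lambda>a. sylv (F a) i s) = (\<lambda>a. s ^ n * (\<Sum>k\<le>r. coeff (F a) k * s ^ k))" by (simp add: sylv_def Inl)
  thus ?thesis by (auto intro!: polynomial_funs_cmult polynomial_funs_sum polynomial_funs.mult cF polynomial_funs.const)
 next
  case (Inr n)
  have "poly (pderiv (F a)) s = (\<Sum>k\<le>r. (of_nat (Suc k) * coeff (F a) (Suc k)) * s ^ k)" for a
  proof -
   show ?thesis using dF[of a] degree_pderiv[of "F a"] unfolding poly_altdef[of "pderiv (F a)"] coeff_pderiv[symmetric] by (intro sum.mono_neutral_left) (auto intro: coeff_eq_0)
  qed
  hence "(\<lambda>a. sylv (F a) i s) = (\<lambda>a. s ^ n * (\<Sum>k\<le>r. (of_nat (Suc k) * coeff (F a) (Suc k)) * s ^ k))" by (simp add: sylv_def Inr)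
  thus ?thesis by (auto intro!: polynomial_funs_cmult polynomial_funs_sum polynomial_funs.mult cF polynomial_funs.const)
 qed
 have fin: "finite (sylv_ind r)" by (simp add: sylv_ind_def)
 obtain D0 where D0: "D0 \<in> polynomial_funs (*s)" "D0 a0 ~= 0" "\<And>a. D0 a ~= 0 ==> indep_fam (sylv_ind r) (sylv (F a))"
  using independence_open[OF fin, of "\<lambda>i a s. sylv (F a) i s" "(*s)" a0] polys ind0 by blast
 have top: "(\<lambda>a. hform r c (ccross a v)) \<in> polynomial_funs (*s)"
  unfolding hform_def case_prod_beta'
 by (intro polynomial_funs_sum polynomial_funs_cmult polynomial_funs.mult polynomial_funs_power ccross_polynomial)
 have dz: "(\<lambda>a. dot a z) \<in> polynomial_funs (*s)" for z
  unfolding dot_def by (intro polynomial_funs_sum polynomial_funs.mult coord_linear polynomial_funs.const)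
 define D where "D = (\<lambda>a. D0 a * (coeff (F a) r * (hform r c (ccross a v) * (\<Prod>z\<in>Z. dot a z))))"
 show ?thesis
 proof (rule bexI[of _ D], intro conjI allI impI ballI)
  show "D \<in> polynomial_funs (*s)" unfolding D_def
 by (intro polynomial_funs.mult D0 cF top polynomial_funs_prod dz)
  show "\<exists>a. D a ~= 0"
 by (rule exI[of _ a0]) (use D0(2) a0 F0 \<open>degree (F a0) = r\<close> assms(1) in \<open>auto simp: D_def uv\<close>)
  fix a assume a: "a ~= 0" "D a ~= 0"
  show "dot a z ~= 0" if "z \<in> Z" for z using a(2) that assms(1) by (auto simp: D_def)
  have nz: "D0 a ~= 0" "coeff (F a) r ~= 0" "hform r c (ccross a v) ~= 0" using a(2) by (auto simp: D_def)
  have deg: "degree (F a) = r" using dF[of a] le_degree[OF nz(2)] by simp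
  have "F a ~= 0" using nz(2) by auto
  moreover have "poly (pderiv (F a)) s ~= 0" if "poly (F a) s = 0" for s
   using D0(3)[OF nz(1)] that unfolding sylv_indep_iff[OF deg r_ge_2] by blast
  ultimately have "card {s. poly (F a) s = 0} = r" using card_roots_squarefree deg by blast
  thus "\<exists>e q. dot a e = 0 \<and> dot a q = 0 \<and> hform r c q ~= 0 \<and> card {s. hform r c (e + s *s q) = 0} = r"
   using nz(3) by (simp add: F) (metis dot_ccross)
 qed
qed

end

section \<open>Moebius transformations\<close>

lemma mat2_sel [simp]:
 "mat2 a b c d $ 1 $ 1 = a" "mat2 a b c d $ 1 $ 2 = b"
 "mat2 a b c d $ 2 $ 1 = c" "mat2 a b c d $ 2 $ 2 = d"
 by (simp_all add: mat2_def)

lemma mat2_eqI: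
 fixes A B :: "real^2^2"
 assumes "A$1$1 = B$1$1" "A$1$2 = B$1$2" "A$2$1 = B$2$1" "A$2$2 = B$2$2"
 shows "A = B"
 using assms by (simp add: vec_eq_iff forall_2)

lemma matrix_mult_sel:
 fixes A B :: "real^2^2"
 shows "(A ** B)$i$j = A$i$1 * B$1$j + A$i$2 * B$2$j"
 by (simp add: matrix_matrix_mult_def sum_2)

lemma mat1_sel [simp]:
 "(mat 1 :: real^2^2)$1$1 = 1" "(mat 1 :: real^2^2)$1$2 = 0"
 "(mat 1 :: real^2^2)$2$1 = 0" "(mat 1 :: real^2^2)$2$2 = 1"
 by (simp_all add: mat_def)

text \<open>The adjugate, which is the inverse on SL2 and has entries that simplify
  directly.\<close>

definition adj2 :: "real^2^2 => real^2^2" where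
 "adj2 A = mat2 (A$2$2) (- A$1$2) (- A$2$1) (A$1$1)"

lemma adj2_sel [simp]:
 "adj2 A $ 1 $ 1 = A$2$2" "adj2 A $ 1 $ 2 = - A$1$2"
 "adj2 A $ 2 $ 1 = - A$2$1" "adj2 A $ 2 $ 2 = A$1$1"
 by (simp_all add: adj2_def)

lemma adj2_1 [simp]: "adj2 (mat 1) = mat 1"
 by (rule mat2_eqI) simp_all

lemma det_adj2 [simp]: "det (adj2 A) = det A"
 by (simp add: det_2)

lemma adj2_mult:
 assumes "det A = 1" shows "A ** adj2 A = mat 1" "adj2 A ** A = mat 1"
 using assms by (auto intro!: mat2_eqI simp: matrix_mult_sel det_2 algebra_simps)

lemma adj2_adj2 [simp]: "adj2 (adj2 A) = A"
 by (rule mat2_eqI) simp_all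

lemma adj2_prod: "adj2 (A ** B) = adj2 B ** adj2 A"
 by (rule mat2_eqI) (simp_all add: matrix_mult_sel)

lemma matrix_inv_SL2:
 assumes "det (A :: real^2^2) = 1" shows "matrix_inv A = adj2 A"
 unfolding matrix_inv_def
proof (rule some_equality)
 show "A ** adj2 A = mat 1 \<and> adj2 A ** A = mat 1" using adj2_mult[OF assms] by simp
next
 fix B assume "A ** B = mat 1 \<and> B ** A = mat 1"
 thus "B = adj2 A" using adj2_mult[OF assms] by (metis matrix_mul_assoc matrix_mul_lid matrix_mul_rid)
qed

lemma adj2_cancel [simp]:
 assumes "det A = 1"
 shows "A ** (adj2 A ** B) = B" "adj2 A ** (A ** B) = B"
  "B ** A ** adj2 A = B" "B ** adj2 A ** A = B"
 using adj2_mult[OF assms] by (metis matrix_mul_assoc matrix_mul_lid matrix_mul_rid)+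

lemma det_mult1: "det (A::real^2^2) = 1 ==> det B = 1 ==> det (A ** B) = 1"
 by (simp add: det_mul)

lemma UHP_iff [simp]: "z \<in> UHP \<longleftrightarrow> Im z > 0"
 by (simp add: upper_half_plane_def)

lemma open_UHP: "open UHP"
 unfolding upper_half_plane_def by (rule open_halfspace_Im_gt)

lemma connected_UHP: "connected UHP"
 unfolding upper_half_plane_def by auto

lemma cocyc_nz:
 assumes "det A = 1" "Im z > 0" shows "cocyc A z ~= 0"
proof
 assume h: "cocyc A z = 0"
 hence "A$2$1 * Im z = 0" by (auto simp: cocyc_def complex_eq_iff)
 hence "A$2$1 = 0" using assms by simp
 with h show False using assms(1) by (auto simp: cocyc_def det_2)
qed

lemma mob_eq: "mob A z = (of_real (A$1$1) * z + of_real (A$1$2)) / cocyc A z"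
 by (simp add: mob_def moebius_def cocyc_def)

lemma Im_mob:
 assumes "det A = 1" "Im z > 0"
 shows "Im (mob A z) = Im z / (cmod (cocyc A z))\<^sup>2"
proof -
 have *: "Im (mob A z) = Im ((of_real (A$1$1) * z + of_real (A$1$2)) * cnj (cocyc A z)) / (cmod (cocyc A z))\<^sup>2"
 by (simp add: mob_eq complex_div_cnj[of _ "cocyc A z"] flip: of_real_power)
 have "Im ((of_real (A$1$1) * z + of_real (A$1$2)) * cnj (cocyc A z)) = det A * Im z"
 by (simp add: det_2 cocyc_def algebra_simps)
 thus ?thesis using * assms by simp
qed

lemma Im_mob_pos:
 assumes "det A = 1" "Im z > 0" shows "Im (mob A z) > 0"
 using assms cocyc_nz[OF assms] by (simp add: Im_mob)

lemma cocyc_mult: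
 assumes "det B = 1" "Im z > 0"
 shows "cocyc (A ** B) z = cocyc A (mob B z) * cocyc B z"
proof -
 have "mob B z * cocyc B z = of_real (B$1$1) * z + of_real (B$1$2)" using cocyc_nz[OF assms] by (simp add: mob_eq)
 moreover have "cocyc A (mob B z) * cocyc B z = of_real (A$2$1) * (mob B z * cocyc B z) + of_real (A$2$2) * cocyc B z"
 by (simp add: cocyc_def[of A] distrib_right)
 ultimately show ?thesis by (simp add: cocyc_def matrix_mult_sel algebra_simps)
qed

lemma mob_mult:
 assumes "det A = 1" "det B = 1" "Im z > 0"
 shows "mob (A ** B) z = mob A (mob B z)"
proof -
 have nz: "cocyc B z ~= 0" "cocyc A (mob B z) ~= 0"
  using assms cocyc_nz Im_mob_pos by auto
 have "mob A (mob B z) = ((of_real (A$1$1) * mob B z + of_real (A$1$2)) * cocyc B z) / (cocyc A (mob B z) * cocyc B z)"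
  using nz by (simp add: mob_eq[of A])
 also have "(of_real (A$1$1) * mob B z + of_real (A$1$2)) * cocyc B z = of_real ((A**B)$1$1) * z + of_real ((A**B)$1$2)"
 proof -
  have "mob B z * cocyc B z = of_real (B$1$1) * z + of_real (B$1$2)" using nz by (simp add: mob_eq)
  thus ?thesis by (simp add: distrib_right mult.assoc matrix_mult_sel) (simp add: cocyc_def algebra_simps)
 qed
 finally show ?thesis using cocyc_mult[OF assms(2,3), of A] by (simp add: mob_eq[of "A**B"])
qed

lemma mob_1 [simp]: "mob (mat 1) z = z"
 by (simp add: mob_eq cocyc_def)

lemma mob_adj2:
 assumes "det A = 1" "Im z > 0"
 shows "mob A (mob (adj2 A) z) = z" "mob (adj2 A) (mob A z) = z"
 using mob_mult[of A "adj2 A" z] mob_mult[of "adj2 A" A z] adj2_mult[OF assms(1)] assms by auto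

lemma mob_inj: "det A = 1 ==> Im z > 0 ==> Im w > 0 ==> mob A z = mob A w ==> z = w"
 by (metis mob_adj2(2))

lemma mob_diff:
 assumes "det A = 1" "Im z > 0" "Im w > 0"
 shows "mob A z - mob A w = (z - w) / (cocyc A z * cocyc A w)"
proof -
 have nz: "cocyc A z ~= 0" "cocyc A w ~= 0" using assms cocyc_nz by auto
 have "mob A z - mob A w = ((of_real (A$1$1) * z + of_real (A$1$2)) * cocyc A w - (of_real (A$1$1) * w + of_real (A$1$2)) * cocyc A z) / (cocyc A z * cocyc A w)"
  using nz by (simp add: mob_eq field_simps)
 also have "(of_real (A$1$1) * z + of_real (A$1$2)) * cocyc A w - (of_real (A$1$1) * w + of_real (A$1$2)) * cocyc A z = of_real (det A) * (z - w)"
 by (simp add: cocyc_def det_2 algebra_simps)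
 finally show ?thesis using assms by simp
qed

lemma mob_has_derivative:
 assumes "det A = 1" "Im z > 0"
 shows "(mob A has_field_derivative 1 / (cocyc A z)\<^sup>2) (at z)"
proof -
 define a b c d where "a = complex_of_real (A$1$1)" "b = complex_of_real (A$1$2)"
  "c = complex_of_real (A$2$1)" "d = complex_of_real (A$2$2)"
 note defs = a_b_c_d_def
 have nz: "c * z + d ~= 0" using cocyc_nz[OF assms] by (simp add: cocyc_def defs)
 have d: "a * d - b * c = 1"
  using assms(1) by (simp add: det_2 defs flip: of_real_mult of_real_diff)
 have "mob A = (\<lambda>z. (a * z + b) / (c * z + d))"
 by (simp add: fun_eq_iff mob_eq cocyc_def defs)
 moreover have "((\<lambda>z. (a * z + b) / (c * z + d)) has_field_derivative
   (a * (c * z + d) - (a * z + b) * c) / ((c * z + d) * (c * z + d))) (at z)"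
  using nz by (auto intro!: derivative_eq_intros)
 moreover have "a * (c * z + d) - (a * z + b) * c = 1"
  using d by (simp add: algebra_simps)
 ultimately show ?thesis by (simp add: cocyc_def power2_eq_square defs)
qed

lemma mob_holomorphic: "det A = 1 ==> mob A holomorphic_on UHP"
 using mob_has_derivative by (metis UHP_iff field_differentiable_def holomorphic_onI field_differentiable_at_within)

lemma cocyc_holomorphic: "cocyc A holomorphic_on S"
 unfolding cocyc_def by (intro holomorphic_intros)

section \<open>Hyperbolic displacement\<close>

text \<open>This is 2 cosh of the hyperbolic distance. It is also the squared Frobenius norm of the
  matrix comparing the two base points, so the triangle inequality becomes submultiplicativity of
  that norm.\<close>

definition hdisp :: "complex => complex => real" where
 "hdisp z w = (cmod (z - w))\<^sup>2 / (Im z * Im w) + 2"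

lemma hdisp_commute: "hdisp z w = hdisp w z"
 by (simp add: hdisp_def norm_minus_commute)

lemma hdisp_refl [simp]: "hdisp z z = 2"
 by (simp add: hdisp_def)

lemma hdisp_mob:
 assumes "det A = 1" "Im z > 0" "Im w > 0"
 shows "hdisp (mob A z) (mob A w) = hdisp z w"
 using cocyc_nz[of A z] cocyc_nz[of A w] assms
 by (simp add: hdisp_def mob_diff Im_mob norm_divide norm_mult power_mult_distrib power_divide)

lemma det_scaling [simp]: "det (scaling s) = 1"
 by (cases s) (simp_all add: det_2)

text \<open>The matrix taking \<open>\<i>\<close> to \<open>z\<close>.\<close>

definition base_mat :: "complex => real^2^2" where
 "base_mat z = mat2 (sqrt (Im z)) (Re z / sqrt (Im z)) 0 (1 / sqrt (Im z))"

lemma norm_mat2: "(norm (A :: real^2^2))\<^sup>2 = (A$1$1)\<^sup>2 + (A$1$2)\<^sup>2 + (A$2$1)\<^sup>2 + (A$2$2)\<^sup>2"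
 by (simp add: norm_vec_def L2_set_def sum_2)

lemma norm_matrix_mult:
 fixes A B :: "real^2^2"
 shows "norm (A ** B) \<le> norm A * norm B"
proof -
 have "(norm (A ** B))\<^sup>2 \<le> (norm A * norm B)\<^sup>2"
 proof -
  have cs: "(a*b + c*d)\<^sup>2 \<le> (a\<^sup>2 + c\<^sup>2) * (b\<^sup>2 + d\<^sup>2)" for a b c d :: real
   using zero_le_power2[of "a * d - b * c"] by (simp add: power2_eq_square algebra_simps)
  have "(norm (A ** B))\<^sup>2 \<le>
   ((A$1$1)\<^sup>2 + (A$1$2)\<^sup>2) * ((B$1$1)\<^sup>2 + (B$2$1)\<^sup>2) + ((A$1$1)\<^sup>2 + (A$1$2)\<^sup>2) * ((B$1$2)\<^sup>2 + (B$2$2)\<^sup>2) +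
   ((A$2$1)\<^sup>2 + (A$2$2)\<^sup>2) * ((B$1$1)\<^sup>2 + (B$2$1)\<^sup>2) + ((A$2$1)\<^sup>2 + (A$2$2)\<^sup>2) * ((B$1$2)\<^sup>2 + (B$2$2)\<^sup>2)"
   unfolding norm_mat2 matrix_mult_sel by (intro add_mono cs)
  also have "... = (norm A * norm B)\<^sup>2" by (simp add: norm_mat2 algebra_simps)
  finally show ?thesis .
 qed
 thus ?thesis by simp
qed

lemma norm_adj2 [simp]: "norm (adj2 A) = norm A"
proof -
 have "(norm (adj2 A))\<^sup>2 = (norm A)\<^sup>2" by (simp add: norm_mat2)
 thus ?thesis by simp
qed

lemma det_base_mat [simp]: "Im z > 0 ==> det (base_mat z) = 1"
 by (simp add: base_mat_def det_2)

lemma hdisp_norm: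
 assumes "Im z > 0" "Im w > 0"
 shows "hdisp z w = (norm (adj2 (base_mat z) ** base_mat w))\<^sup>2"
proof -
 define s t where "s = sqrt (Im z)" "t = sqrt (Im w)"
 have st: "s > 0" "t > 0" "Im z = s\<^sup>2" "Im w = t\<^sup>2" using assms by (auto simp: s_t_def)
 show ?thesis
  unfolding hdisp_def norm_mat2 matrix_mult_sel cmod_power2 base_mat_def adj2_sel mat2_sel s_t_def[symmetric] minus_complex.sel
  unfolding st(3,4) using st(1,2) by (simp add: field_simps) (simp add: power2_eq_square power4_eq_xxxx algebra_simps)?
qed

lemma hdisp_triangle:
 assumes "Im z > 0" "Im v > 0" "Im w > 0"
 shows "hdisp z w \<le> hdisp z v * hdisp v w"
proof -
 have "adj2 (base_mat z) ** base_mat w = (adj2 (base_mat z) ** base_mat v) ** (adj2 (base_mat v) ** base_mat w)"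
  using assms by (simp add: matrix_mul_assoc[symmetric])
 hence "norm (adj2 (base_mat z) ** base_mat w) \<le> norm (adj2 (base_mat z) ** base_mat v) * norm (adj2 (base_mat v) ** base_mat w)"
 by (metis norm_matrix_mult)
 thus ?thesis using assms by (simp add: hdisp_norm power_mult_distrib[symmetric])
qed

lemma hdisp_ge_2: "Im z > 0 ==> Im w > 0 ==> hdisp z w \<ge> 2"
 by (simp add: hdisp_def)

definition conj_at :: "complex => real^2^2 => real^2^2" where
 "conj_at z A = adj2 (base_mat z) ** A ** base_mat z"

text \<open>The squared distance from the identity of the conjugate of \<open>A\<close> that moves \<open>z\<close> to \<open>\<i>\<close>.\<close>

definition defect :: "real^2^2 => complex => real" where
 "defect A z = hdisp z (mob A z) + 2 - 2 * trace A"

lemma det_conj_at [simp]: "Im z > 0 ==> det (conj_at z A) = det A"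
 by (simp add: conj_at_def det_mul)

lemma trace_2: "trace (A::real^2^2) = A$1$1 + A$2$2"
 by (simp add: trace_def sum_2)

lemma conj_at_sel:
 assumes "Im z > 0"
 shows "conj_at z A $1$1 = A$1$1 - A$2$1 * Re z"
  "conj_at z A $1$2 = (A$1$2 + (A$1$1 - A$2$2) * Re z - A$2$1 * (Re z)\<^sup>2) / Im z"
  "conj_at z A $2$1 = A$2$1 * Im z"
  "conj_at z A $2$2 = A$2$2 + A$2$1 * Re z"
proof -
 define s where "s = sqrt (Im z)"
 have st: "s > 0" "Im z = s\<^sup>2" using assms by (auto simp: s_def)
 show "conj_at z A $1$1 = A$1$1 - A$2$1 * Re z"
  "conj_at z A $1$2 = (A$1$2 + (A$1$1 - A$2$2) * Re z - A$2$1 * (Re z)\<^sup>2) / Im z"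
  "conj_at z A $2$1 = A$2$1 * Im z"
  "conj_at z A $2$2 = A$2$2 + A$2$1 * Re z"
  unfolding conj_at_def matrix_mult_sel base_mat_def adj2_sel mat2_sel s_def[symmetric]
  unfolding st(2) using st(1) by (simp_all add: field_simps power2_eq_square)
qed

lemma trace_conj_at: "Im z > 0 ==> trace (conj_at z A) = trace A"
 by (simp add: trace_2 conj_at_sel)

lemma hdisp_mob_norm:
 assumes "det A = 1" "Im z > 0"
 shows "hdisp z (mob A z) = (norm (conj_at z A))\<^sup>2"
proof -
 have nz: "cocyc A z ~= 0" using assms cocyc_nz by auto
 define c where "c = cocyc A z"
 have "z - mob A z = (z * c - (of_real (A$1$1) * z + of_real (A$1$2))) / c"
  using nz by (simp add: c_def mob_eq field_simps)
 hence "hdisp z (mob A z) = (cmod (z * c - (of_real (A$1$1) * z + of_real (A$1$2))))\<^sup>2 / (Im z)\<^sup>2 + 2"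
  using nz assms by (simp add: hdisp_def Im_mob norm_divide flip: c_def) (simp add: power2_eq_square)
 also have "... = (norm (conj_at z A))\<^sup>2"
 proof -
  define x y where "x = Re z" "y = Im z"
  define a b e d where "a = A$1$1" "b = A$1$2" "e = A$2$1" "d = A$2$2"
  have y: "y > 0" using assms by (simp add: x_y_def)

  have "(cmod (z * c - (of_real a * z + of_real b)))\<^sup>2 =
    (e * (x\<^sup>2 - y\<^sup>2) + d * x - a * x - b)\<^sup>2 + (2 * e * x * y + d * y - a * y)\<^sup>2"
   unfolding cmod_power2 by (simp add: c_def cocyc_def a_b_e_d_def x_y_def power2_eq_square algebra_simps)
  also have "... = (b + (a - d) * x - e * x\<^sup>2)\<^sup>2 + y\<^sup>2 * ((a - e * x)\<^sup>2 + (d + e * x)\<^sup>2 + (e * y)\<^sup>2 - 2 * (a * d - b * e))"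
 by (simp add: power2_eq_square algebra_simps)
  also have "... = (b + (a - d) * x - e * x\<^sup>2)\<^sup>2 + y\<^sup>2 * ((a - e * x)\<^sup>2 + (d + e * x)\<^sup>2 + (e * y)\<^sup>2 - 2)"
   using assms(1) by (auto simp: det_2 a_b_e_d_def)
  finally show ?thesis using assms(2)
 by (simp add: norm_mat2 conj_at_sel flip: a_b_e_d_def x_y_def) (simp add: field_simps)
 qed
 finally show ?thesis .
qed

lemma defect_norm:
 assumes "det A = 1" "Im z > 0"
 shows "defect A z = (norm (conj_at z A - mat 1))\<^sup>2"
proof -
 have "(norm (conj_at z A - mat 1))\<^sup>2 = (norm (conj_at z A))\<^sup>2 - 2 * trace (conj_at z A) + 2"
  unfolding norm_mat2 trace_2 vector_minus_component mat1_sel by (simp add: power2_eq_square algebra_simps)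
 thus ?thesis using assms by (simp add: defect_def hdisp_mob_norm trace_conj_at)
qed

lemma trace_conj: "det B = 1 ==> trace (B ** A ** adj2 B) = trace (A::real^2^2)"
 by (metis adj2_mult(2) matrix_mul_assoc matrix_mul_lid trace_mul_sym)

lemma defect_conj:
 assumes "det A = 1" "det B = 1" "Im z > 0"
 shows "defect (B ** A ** adj2 B) (mob B z) = defect A z"
proof -
 have "mob (B ** A ** adj2 B) (mob B z) = mob B (mob A z)"
  using assms by (simp add: mob_mult mob_adj2 Im_mob_pos det_mult1)
 thus ?thesis using assms by (simp add: defect_def hdisp_mob trace_conj Im_mob_pos)
qed

section \<open>Invariance of the hyperbolic area\<close>

definition complex_of_vec :: "real^2 => complex" where
 "complex_of_vec v = Complex (v$1) (v$2)"

definition vec_of_complex :: "complex => real^2" where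
 "vec_of_complex z = vector [Re z, Im z]"

lemma complex_of_vec_inverse [simp]:
 "complex_of_vec (vec_of_complex z) = z" "vec_of_complex (complex_of_vec v) = v"
 by (auto simp: complex_of_vec_def vec_of_complex_def vec_eq_iff forall_2)

lemma linear_complex_of_vec: "linear complex_of_vec"
 by (rule linearI) (auto simp: complex_of_vec_def complex_eq_iff)

lemma linear_vec_of_complex: "linear vec_of_complex"
 by (rule linearI) (auto simp: vec_of_complex_def vec_eq_iff forall_2)

lemma complex_of_vec_measurable [measurable]: "complex_of_vec \<in> borel_measurable borel"
 by (intro borel_measurable_continuous_onI linear_continuous_on)
   (simp add: linear_complex_of_vec linear_conv_bounded_linear[symmetric])

lemma lborel_complex_of_vec: "lborel = distr lborel borel complex_of_vec"
proof (rule lborel_eqI)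
 fix l u :: complex assume le: "\<And>b. b \<in> Basis ==> l \<bullet> b \<le> u \<bullet> b"
 have "complex_of_vec -` box l u = box (vec_of_complex l) (vec_of_complex u)"
 by (auto simp: complex_of_vec_def vec_of_complex_def in_box_complex_iff mem_box_cart forall_2)
 moreover have "Re l \<le> Re u" "Im l \<le> Im u" using le[of 1] le[of \<i>] by auto
 moreover have B: "(Basis :: (real^2) set) = {axis 1 1, axis 2 1}"
 by (auto simp: Basis_vec_def UNIV_2)
 moreover have "axis 1 1 ~= (axis 2 1 :: real^2)" by (simp add: axis_eq_axis)
 ultimately show "emeasure (distr lborel borel complex_of_vec) (box l u) = ennreal (\<Prod>b\<in>Basis. (u - l) \<bullet> b)"
 by (subst emeasure_distr)
    (simp_all add: B emeasure_lborel_box_eq[of "vector [Re l, Im l] :: real^2"] inner_axis vec_of_complex_def Basis_complex_def)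
qed simp

text \<open>The change of variables for finite measure is an equivalence, so the two sides are also
  infinite together; this gives an identity in \<open>ennreal\<close> without an integrability
  assumption.\<close>

lemma emeasure_differentiable_image:
 fixes f :: "real^2 => real^2"
 assumes S: "S \<in> sets lebesgue"
  and der: "\<And>x. x \<in> S ==> (f has_derivative f' x) (at x within S)"
  and inj: "inj_on f S"
  and D: "D \<in> borel_measurable lebesgue" "\<And>x. D x \<ge> 0" "\<And>x. x \<in> S ==> D x = \<bar>det (matrix (f' x))\<bar>"
 shows "emeasure lebesgue (f ` S) = (\<integral>\<^sup>+x. ennreal (D x) * indicator S x \<partial>lebesgue)"
proof -
 have fS: "f ` S \<in> sets lebesgue"
  using der by (intro differentiable_image_in_sets_lebesgue[OF S]) (auto simp: differentiable_on_def differentiable_def)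
 have iff: "f ` S \<in> lmeasurable \<and> measure lebesgue (f ` S) = m \<longleftrightarrow> ((\<lambda>x. D x) has_integral m) S" for m
  using D(3) by (subst has_measure_differentiable_image[OF S der inj]) (auto intro!: has_integral_cong)
 have eq: "(\<integral>\<^sup>+x. ennreal (D x) * indicator S x \<partial>lebesgue) = (\<integral>\<^sup>+x. ennreal (D x * indicator S x) \<partial>lebesgue)"
 by (intro nn_integral_cong) (auto simp: indicator_def)
 have iff2: "((\<lambda>x. D x) has_integral m) S \<longleftrightarrow> (\<integral>\<^sup>+x. ennreal (D x * indicator S x) \<partial>lebesgue) = ennreal m \<and> m \<ge> 0" for m
 proof -
  have "((\<lambda>x. D x) has_integral m) S \<longleftrightarrow> ((\<lambda>x. D x * indicator S x) has_integral m) UNIV"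
 by (simp add: indicator_def if_distrib of_bool_def cong: if_cong)
  also have "... \<longleftrightarrow> (\<integral>\<^sup>+x. ennreal (D x * indicator S x) \<partial>lebesgue) = ennreal m \<and> m \<ge> 0"
   using D S by (subst has_integral_iff_nn_integral_lebesgue) (auto intro!: borel_measurable_times borel_measurable_indicator)
  finally show ?thesis .
 qed
 show ?thesis
 proof (cases "f ` S \<in> lmeasurable")
  case True
  thus ?thesis using iff[of "measure lebesgue (f ` S)"] iff2[of "measure lebesgue (f ` S)"] eq
 by (simp add: emeasure_eq_measure2)
 next
  case False
  hence "emeasure lebesgue (f ` S) = \<infinity>" using fS unfolding fmeasurable_def by (metis (no_types, lifting) infinity_ennreal_def mem_Collect_eq top.not_eq_extremum)
  moreover have "(\<integral>\<^sup>+x. ennreal (D x * indicator S x) \<partial>lebesgue) = \<infinity>"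
  proof (rule ccontr)
   assume "(\<integral>\<^sup>+x. ennreal (D x * indicator S x) \<partial>lebesgue) ~= \<infinity>"
   then obtain m where "m \<ge> 0" "(\<integral>\<^sup>+x. ennreal (D x * indicator S x) \<partial>lebesgue) = ennreal m"
 by (cases "(\<integral>\<^sup>+x. ennreal (D x * indicator S x) \<partial>lebesgue)") auto
   with iff2[of m] iff[of m] False show False by auto
  qed
  ultimately show ?thesis using eq by simp
 qed
qed

lemma det_matrix_complex_mult:
 "det (matrix (\<lambda>v. vec_of_complex (c * complex_of_vec v))) = (cmod c)\<^sup>2"
 by (simp add: det_2 matrix_def vec_of_complex_def complex_of_vec_def axis_def cmod_power2)
   (simp add: power2_eq_square)

text \<open>Transport to \<open>real^2\<close>, where the real Jacobian of multiplication by c is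
  the squared modulus of c. The indicator in front of \<open>g'\<close> is there because its values
  off \<open>A\<close> are arbitrary.\<close>

lemma emeasure_holomorphic_image:
 assumes A: "A \<in> sets borel" and der: "\<And>z. z \<in> A ==> (g has_field_derivative g' z) (at z)"
  and inj: "inj_on g A" and gA: "g ` A \<in> sets borel"
  and g': "(\<lambda>z. indicator A z *\<^sub>R g' z) \<in> borel_measurable borel"
 shows "emeasure lborel (g ` A) = (\<integral>\<^sup>+z\<in>A. ennreal ((cmod (g' z))\<^sup>2) \<partial>lborel)"
proof -
 define f where "f = vec_of_complex \<circ> g \<circ> complex_of_vec"
 define f' where "f' = (\<lambda>x v. vec_of_complex (g' (complex_of_vec x) * complex_of_vec v))"
 define D where "D = (\<lambda>x. (cmod (indicator A (complex_of_vec x) *\<^sub>R g' (complex_of_vec x)))\<^sup>2)"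
 define S where "S = complex_of_vec -` A"
 have S: "S \<in> sets borel" unfolding S_def
  using measurable_sets[OF complex_of_vec_measurable A] by simp
 have fS: "f ` S = complex_of_vec -` (g ` A)"
 proof (intro Set.set_eqI iffI)
  fix x assume "x \<in> complex_of_vec -` (g ` A)"
  then obtain a where "a \<in> A" "complex_of_vec x = g a" by auto
  hence "x = f (vec_of_complex a)" "vec_of_complex a \<in> S" by (simp_all add: f_def S_def flip: \<open>complex_of_vec x = g a\<close>)
  thus "x \<in> f ` S" by blast
 qed (auto simp: f_def S_def)
 have Dm: "D \<in> borel_measurable borel"
  unfolding D_def using measurable_compose[OF complex_of_vec_measurable g'] by measurable
 have "emeasure lebesgue (f ` S) = (\<integral>\<^sup>+x. ennreal (D x) * indicator S x \<partial>lebesgue)"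
 proof (rule emeasure_differentiable_image[where f'=f'])
  show "S \<in> sets lebesgue" using S by auto
  show "inj_on f S"
   using inj by (auto simp: inj_on_def f_def S_def) (metis complex_of_vec_inverse)
  show "D \<in> borel_measurable lebesgue" using Dm by (simp add: measurable_completion)
  fix x assume x: "x \<in> S"
  show "D x = \<bar>det (matrix (f' x))\<bar>" using x by (simp add: D_def S_def f'_def det_matrix_complex_mult)
  have "(g has_derivative (*) (g' (complex_of_vec x))) (at (complex_of_vec x))"
   using der[of "complex_of_vec x"] x by (simp add: has_field_derivative_def S_def)
  hence "(f has_derivative (vec_of_complex \<circ> (*) (g' (complex_of_vec x)) \<circ> complex_of_vec)) (at x)"
   unfolding f_def
 by (intro diff_chain_at linear_imp_has_derivative linear_complex_of_vec linear_vec_of_complex)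
  moreover have "vec_of_complex \<circ> (*) (g' (complex_of_vec x)) \<circ> complex_of_vec = f' x" by (auto simp: f'_def)
  ultimately show "(f has_derivative f' x) (at x within S)" by (simp add: has_derivative_at_withinI)
 qed (auto simp: D_def)
 moreover have "emeasure lborel (g ` A) = emeasure lebesgue (f ` S)"
 by (subst lborel_complex_of_vec) (use gA in \<open>simp add: emeasure_distr fS measurable_sets_borel[OF complex_of_vec_measurable]\<close>)
 moreover have "(\<integral>\<^sup>+x. ennreal (D x) * indicator S x \<partial>lebesgue) = (\<integral>\<^sup>+x. ennreal (D x) * indicator S x \<partial>lborel)"
 by (simp add: nn_integral_completion)
 moreover have "(\<integral>\<^sup>+z. ennreal ((cmod (indicator A z *\<^sub>R g' z))\<^sup>2) * indicator A z \<partial>distr lborel borel complex_of_vec) =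
   (\<integral>\<^sup>+x. ennreal (D x) * indicator S x \<partial>lborel)"
 proof -
  have "(\<lambda>z. ennreal ((cmod (indicator A z *\<^sub>R g' z))\<^sup>2)) \<in> borel_measurable borel"
   using g' by measurable
  moreover have "(\<lambda>z. indicator A z :: ennreal) \<in> borel_measurable borel" using A by simp
  ultimately have m: "(\<lambda>z. ennreal ((cmod (indicator A z *\<^sub>R g' z))\<^sup>2) * indicator A z) \<in> borel_measurable borel"
 by simp
  show ?thesis
 by (rule trans[OF nn_integral_distr]) (use m in \<open>auto simp: D_def S_def indicator_def intro!: nn_integral_cong\<close>)
 qed
 moreover have "(\<integral>\<^sup>+z\<in>A. ennreal ((cmod (g' z))\<^sup>2) \<partial>lborel) = (\<integral>\<^sup>+z. ennreal ((cmod (indicator A z *\<^sub>R g' z))\<^sup>2) * indicator A z \<partial>lborel)"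
 by (intro nn_integral_cong) (auto simp: indicator_def)
 ultimately show ?thesis using lborel_complex_of_vec by metis
qed

lemma UHP_borel [measurable]: "UHP \<in> sets borel"
 using open_UHP by simp

lemma mob_borel [measurable]: "mob A \<in> borel_measurable borel"
 unfolding mob_eq[abs_def] cocyc_def by simp

lemma cocyc_borel [measurable]: "cocyc A \<in> borel_measurable borel"
 unfolding cocyc_def by simp

lemma mob_image_eq:
 assumes "det A = 1" "E \<subseteq> UHP"
 shows "mob A ` E = {z \<in> UHP. mob (adj2 A) z \<in> E}"
proof (intro Set.set_eqI iffI)
 fix z assume "z \<in> {z \<in> UHP. mob (adj2 A) z \<in> E}"
 thus "z \<in> mob A ` E" using mob_adj2(1)[of A z] assms by (metis (no_types, lifting) UHP_iff image_eqI mem_Collect_eq)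
qed (use assms Im_mob_pos mob_adj2 in auto)

lemma mob_image_borel:
 assumes "det A = 1" "E \<subseteq> UHP" "E \<in> sets borel"
 shows "mob A ` E \<in> sets borel"
 unfolding mob_image_eq[OF assms(1,2)] using assms(3) by simp

definition hyp_measure :: "complex measure" where
 "hyp_measure = density lborel (\<lambda>z. ennreal (1 / (Im z)\<^sup>2) * indicator UHP z)"

lemma sets_hyp_measure [simp, measurable_cong]: "sets hyp_measure = sets borel"
 by (simp add: hyp_measure_def)

lemma space_hyp_measure [simp]: "space hyp_measure = UNIV"
 by (simp add: hyp_measure_def)

lemma emeasure_hyp_measure:
 "A \<in> sets borel ==> emeasure hyp_measure A = (\<integral>\<^sup>+z\<in>A \<inter> UHP. ennreal (1 / (Im z)\<^sup>2) \<partial>lborel)"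
 unfolding hyp_measure_def by (subst emeasure_density) (auto intro!: nn_integral_cong simp: indicator_def)

lemma distr_mob_lborel:
 assumes "det A = 1"
 shows "distr (density lborel (\<lambda>z. ennreal (1 / (cmod (cocyc A z))^4) * indicator UHP z)) borel (mob A)
  = density lborel (indicator UHP)" (is "?L = ?R")
proof (rule measure_eqI)
 fix W assume "W \<in> sets ?L"
 hence W: "W \<in> sets borel" by simp
 define E where "E = mob A -` W \<inter> UHP"
 have E: "E \<in> sets borel" "E \<subseteq> UHP" unfolding E_def using W by auto
 have "mob A ` E = {z \<in> UHP. mob (adj2 A) z \<in> E}"
 by (rule mob_image_eq[OF assms E(2)])
 also have "... = W \<inter> UHP"
  using mob_adj2(1)[OF assms] Im_mob_pos[of "adj2 A"] assms by (auto simp: E_def)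
 finally have img: "mob A ` E = W \<inter> UHP" .
 have "emeasure ?L W = (\<integral>\<^sup>+z\<in>E. ennreal (1 / (cmod (cocyc A z))^4) \<partial>lborel)"
  using W measurable_sets_borel[OF mob_borel W]
 by (subst emeasure_distr) (auto simp: emeasure_density E_def indicator_def simp del: UHP_iff intro!: nn_integral_cong)
 also have "... = (\<integral>\<^sup>+z\<in>E. ennreal ((cmod (1 / (cocyc A z)\<^sup>2))\<^sup>2) \<partial>lborel)"
 by (intro nn_integral_cong) (auto simp: norm_divide norm_power power_divide)
 also have "... = emeasure lborel (mob A ` E)"
 proof (rule emeasure_holomorphic_image[symmetric])
  show "inj_on (mob A) E" using E(2) mob_inj[OF assms] by (meson UHP_iff inj_onI subsetD)
  show "mob A ` E \<in> sets borel" using mob_image_borel[OF assms E(2,1)] .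
 qed (use E mob_has_derivative[OF assms] in auto)
 also have "... = emeasure ?R W"
  using W by (simp add: img emeasure_density Int_commute flip: indicator_inter_arith)
 finally show "emeasure ?L W = emeasure ?R W" .
qed simp

text \<open>The Jacobian is the inverse fourth power of the modulus of \<open>cocyc A z\<close>, and
  the density at the image is multiplied by its fourth power; the two cancel.\<close>

lemma nn_integral_hyp_mob:
 assumes "det A = 1" and F [measurable]: "F \<in> borel_measurable borel"
 shows "(\<integral>\<^sup>+z. F (mob A z) \<partial>hyp_measure) = (\<integral>\<^sup>+z. F z \<partial>hyp_measure)"
proof -
 have "(\<integral>\<^sup>+z. F z \<partial>hyp_measure) = (\<integral>\<^sup>+z. ennreal (1 / (Im z)\<^sup>2) * F z \<partial>density lborel (indicator UHP))"
  unfolding hyp_measure_def by (simp add: nn_integral_density mult_ac)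
 also have "... = (\<integral>\<^sup>+z. ennreal (1 / (Im (mob A z))\<^sup>2) * F (mob A z) \<partial>density lborel (\<lambda>z. ennreal (1 / (cmod (cocyc A z))^4) * indicator UHP z))"
  unfolding distr_mob_lborel[OF assms(1), symmetric] by (subst nn_integral_distr) auto
 also have "... = (\<integral>\<^sup>+z. (ennreal (1 / (cmod (cocyc A z))^4) * indicator UHP z) * (ennreal (1 / (Im (mob A z))\<^sup>2) * F (mob A z)) \<partial>lborel)"
 by (subst nn_integral_density) auto
 also have "... = (\<integral>\<^sup>+z. ennreal (1 / (Im z)\<^sup>2) * indicator UHP z * F (mob A z) \<partial>lborel)"
 proof (intro nn_integral_cong)
  fix z :: complex
  show "(ennreal (1 / (cmod (cocyc A z))^4) * indicator UHP z) * (ennreal (1 / (Im (mob A z))\<^sup>2) * F (mob A z)) = ennreal (1 / (Im z)\<^sup>2) * indicator UHP z * F (mob A z)"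
  proof (cases "Im z > 0")
   case True
   have nz: "cocyc A z ~= 0" using cocyc_nz[OF assms(1) True] .
   have "1 / (cmod (cocyc A z))^4 * (1 / (Im (mob A z))\<^sup>2) = 1 / (Im z)\<^sup>2"
    using nz by (simp add: Im_mob[OF assms(1) True] power_divide)
   hence "ennreal (1 / (cmod (cocyc A z))^4) * ennreal (1 / (Im (mob A z))\<^sup>2) = ennreal (1 / (Im z)\<^sup>2)"
 by (subst ennreal_mult'[symmetric]) auto
   thus ?thesis using True by (simp add: mult.assoc[symmetric])
  qed auto
 qed
 also have "... = (\<integral>\<^sup>+z. F (mob A z) \<partial>hyp_measure)"
  unfolding hyp_measure_def by (subst nn_integral_density) auto
 finally show ?thesis ..
qed

section \<open>Discrete groups\<close>

lemma matrix_distribs: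
 fixes A B C :: "real^2^2"
 shows "A ** (B + C) = A ** B + A ** C" "(B + C) ** A = B ** A + C ** A"
 by (auto intro!: mat2_eqI simp: matrix_mult_sel algebra_simps)

lemma matrix_diff_distribs:
 fixes A B C :: "real^2^2"
 shows "A ** (B - C) = A ** B - A ** C" "(B - C) ** A = B ** A - C ** A"
 by (auto intro!: mat2_eqI simp: matrix_mult_sel algebra_simps)

lemma SL2R_simps [simp]: "carrier SL2R = {A. det A = 1}" "monoid.mult SL2R = (**)" "one SL2R = mat 1"
 by (simp_all add: SL2R_def)

lemma group_SL2R: "group SL2R"
proof (rule groupI)
 fix A assume "A \<in> carrier SL2R"
 thus "\<exists>B\<in>carrier SL2R. B \<otimes>\<^bsub>SL2R\<^esub> A = \<one>\<^bsub>SL2R\<^esub>"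
 by (intro bexI[of _ "adj2 A"]) (auto simp: adj2_mult)
qed (auto simp: det_mul matrix_mul_assoc)

lemma inv_SL2R: "det A = 1 ==> inv\<^bsub>SL2R\<^esub> A = adj2 A"
 by (rule group.inv_equality[OF group_SL2R]) (auto simp: adj2_mult)

locale discrete_SL2 =
 fixes \<Gamma> :: "(real^2^2) set"
 assumes subgroup: "subgroup \<Gamma> SL2R" and discrete: "discrete \<Gamma>"
begin

lemma det_Gamma [simp]: "A \<in> \<Gamma> ==> det A = 1"
 using subgroup.subset[OF subgroup] by auto

lemma one_Gamma [simp, intro]: "mat 1 \<in> \<Gamma>"
 using subgroup.one_closed[OF subgroup] by simp

lemma mult_Gamma [intro]: "A \<in> \<Gamma> ==> B \<in> \<Gamma> ==> A ** B \<in> \<Gamma>"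
 using subgroup.m_closed[OF subgroup] by simp

lemma adj2_Gamma [intro]: "A \<in> \<Gamma> ==> adj2 A \<in> \<Gamma>"
 using subgroup.m_inv_closed[OF subgroup, of A] inv_SL2R[of A] by simp

lemma one_isolated:
 obtains e where "e > 0" "\<And>A. A \<in> \<Gamma> ==> norm (A - mat 1) < e ==> A = mat 1"
proof -
 obtain e where "e > 0" "\<And>A. A \<in> \<Gamma> ==> dist (mat 1) A < e ==> A = mat 1" using discrete by (force simp: isolated_in_dist_Ex_iff discrete_def)
 thus ?thesis using that[of e] by (simp add: dist_norm norm_minus_commute)
qed

lemma norm_diff_ge:
 assumes "det A = 1" "det B = 1" "norm (adj2 B ** A - mat 1) \<ge> e" "norm B \<le> R" "R > 0"
 shows "norm (A - B) \<ge> e / R"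
proof -
 have "adj2 B ** A - mat 1 = adj2 B ** (A - B)"
  using assms by (simp add: matrix_diff_distribs adj2_mult)
 hence "e \<le> norm B * norm (A - B)" using assms(3) norm_matrix_mult[of "adj2 B" "A - B"] by simp
 also have "... \<le> R * norm (A - B)" using assms by (simp add: mult_right_mono)
 finally show ?thesis using assms by (simp add: divide_le_eq mult.commute)
qed

text \<open>Isolation of the identity is carried by left translation to every element; on a set of
  bounded norm the separation is uniform, so the set is finite.\<close>

lemma finite_bounded: "finite {A \<in> \<Gamma>. norm A \<le> R}"
proof -
 obtain e where e: "e > 0" "\<And>A. A \<in> \<Gamma> ==> norm (A - mat 1) < e ==> A = mat 1"
  using one_isolated by blast
 define R' where "R' = max R 1"
 have "uniform_discrete {A \<in> \<Gamma>. norm A \<le> R}"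
  unfolding uniform_discrete_def
 proof (intro exI[of _ "e / R'"] conjI ballI impI)
  show "e / R' > 0" using e by (simp add: R'_def)
  fix A B assume A: "A \<in> {A \<in> \<Gamma>. norm A \<le> R}" and B: "B \<in> {A \<in> \<Gamma>. norm A \<le> R}" and d: "dist A B < e / R'"
  show "A = B"
  proof (rule ccontr)
   assume "A ~= B"
   hence "adj2 B ** A ~= mat 1" using B adj2_cancel(1)[of B A] by (metis (no_types, lifting) det_Gamma matrix_mul_rid mem_Collect_eq)
   hence "norm (adj2 B ** A - mat 1) \<ge> e" using e(2)[of "adj2 B ** A"] A B by force
   hence "norm (A - B) \<ge> e / R'" using A B by (intro norm_diff_ge) (auto simp: R'_def)
   thus False using d by (simp add: dist_norm)
  qed
 qed
 moreover have "bounded {A \<in> \<Gamma>. norm A \<le> R}" by (auto simp: bounded_iff)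
 ultimately show ?thesis using uniform_discrete_finite_iff by blast
qed

lemma countable_Gamma: "countable \<Gamma>"
proof -
 have "\<Gamma> = (\<Union>n::nat. {A \<in> \<Gamma>. norm A \<le> real n})" using real_arch_simple by auto
 moreover have "countable (\<Union>n::nat. {A \<in> \<Gamma>. norm A \<le> real n})"
  using finite_bounded by (intro countable_UN) (auto intro: countable_finite)
 ultimately show ?thesis by simp
qed

lemma hdisp_pos_norm:
 assumes "A \<in> \<Gamma>" "Im z > 0" "hdisp z (mob A z) \<le> R"
 shows "norm A \<le> (norm (base_mat z))\<^sup>2 * sqrt R"
proof -
 have "norm (conj_at z A) \<le> sqrt R" using assms by (simp add: hdisp_mob_norm real_le_rsqrt)
 moreover have "A = base_mat z ** (conj_at z A ** adj2 (base_mat z))"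
  using assms by (simp add: conj_at_def)
 moreover have "norm (base_mat z ** (conj_at z A ** adj2 (base_mat z))) \<le> norm (base_mat z) * (norm (conj_at z A) * norm (base_mat z))"

 by (intro order_trans[OF norm_matrix_mult] mult_left_mono) auto
 moreover have "norm (base_mat z) * (norm (conj_at z A) * norm (base_mat z)) \<le> norm (base_mat z) * (sqrt R * norm (base_mat z))"
  using \<open>norm (conj_at z A) \<le> sqrt R\<close> by (intro mult_left_mono mult_right_mono) auto
 ultimately show ?thesis by (simp add: power2_eq_square mult_ac)
qed

text \<open>Proper discontinuity: over a compact set the base-point matrices are bounded, so a
  bounded displacement bounds the norm of the group element.\<close>

lemma finite_hdisp_compact:
 assumes "compact K" "K \<subseteq> UHP"
 shows "finite {A \<in> \<Gamma>. \<exists>z\<in>K. hdisp z (mob A z) \<le> R}"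
proof -
 have "continuous_on K (\<lambda>z. (norm (base_mat z))\<^sup>2)"
  unfolding norm_mat2 base_mat_def mat2_sel using assms(2)
 by (intro continuous_intros) auto
 hence "bounded ((\<lambda>z. (norm (base_mat z))\<^sup>2) ` K)" using assms compact_continuous_image compact_imp_bounded by blast
 then obtain b where b: "\<And>z. z \<in> K ==> (norm (base_mat z))\<^sup>2 \<le> b" by (auto simp: bounded_iff)
 have "{A \<in> \<Gamma>. \<exists>z\<in>K. hdisp z (mob A z) \<le> R} \<subseteq> {A \<in> \<Gamma>. norm A \<le> b * sqrt \<bar>R\<bar>}"
 proof safe
  fix A z assume *: "A \<in> \<Gamma>" "z \<in> K" "hdisp z (mob A z) \<le> R"
  hence "norm A \<le> (norm (base_mat z))\<^sup>2 * sqrt \<bar>R\<bar>" using assms by (intro hdisp_pos_norm) auto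
  also have "... \<le> b * sqrt \<bar>R\<bar>" using b * by (intro mult_right_mono) auto
  finally show "norm A \<le> b * sqrt \<bar>R\<bar>" .
 qed
 thus ?thesis using finite_bounded finite_subset by blast
qed

lemma finite_hdisp: "Im z > 0 ==> finite {A \<in> \<Gamma>. hdisp z (mob A z) \<le> R}"
 using finite_hdisp_compact[of "{z}" R] by simp

end

lemma packing:
 fixes e R :: real
 assumes "e > 0"
 obtains N where "\<And>S :: (real^2^2) set. S \<subseteq> cball 0 R ==> (\<And>x y. x \<in> S ==> y \<in> S ==> x ~= y ==> norm (x - y) \<ge> e) ==> finite S \<and> card S \<le> N"
proof -
 have "compact (cball (0::real^2^2) R)" by simp
 hence "\<forall>d>0. \<exists>C. finite C \<and> cball (0::real^2^2) R \<subseteq> (\<Union>x\<in>C. ball x d)"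
  unfolding compact_eq_totally_bounded by simp
 then obtain C where C: "finite C" "cball (0::real^2^2) R \<subseteq> (\<Union>x\<in>C. ball x (e/2))"
  using assms by (meson half_gt_zero)
 show ?thesis
 proof (rule that[of "card C"])
  fix S :: "(real^2^2) set" assume S: "S \<subseteq> cball 0 R" and sep: "\<And>x y. x \<in> S ==> y \<in> S ==> x ~= y ==> norm (x - y) \<ge> e"
  have "\<forall>x\<in>S. \<exists>y\<in>C. dist y x < e/2"
  using S C(2) by force
  then obtain h where h: "\<And>x. x \<in> S ==> h x \<in> C" "\<And>x. x \<in> S ==> dist (h x) x < e/2" by metis
  have "inj_on h S"
  proof (rule inj_onI, rule ccontr)
   fix x y assume *: "x \<in> S" "y \<in> S" "h x = h y" "x ~= y"
   show False using h(2)[OF *(1)] h(2)[OF *(2)] dist_triangle_half_r[of "h x" x e y] sep[of x y] * by (simp add: dist_norm)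
  qed
  moreover have "h ` S \<subseteq> C" using h by auto
  ultimately show "finite S \<and> card S \<le> card C" using C(1) inj_on_finite[of h S C] card_inj_on_le[of h S C] by simp
 qed
qed

section \<open>Small elements commute\<close>

text \<open>With P = 1 + a and Q = 1 + b the commutator differs from 1 by (ab - ba) times a bounded
  matrix, hence quadratically. For norms below 1/10 the factor is 2 (1/10) (16/10)^2 < 1.\<close>

lemma commutator_small:
 fixes P Q :: "real^2^2"
 assumes "det P = 1" "det Q = 1" "norm (P - mat 1) < 1/10" "norm (Q - mat 1) < 1/10" "P ~= mat 1"
 shows "norm (P ** Q ** adj2 P ** adj2 Q - mat 1) < norm (P - mat 1)"
proof -
 define a where "a = P - mat 1" define b where "b = Q - mat 1"
 have n1: "norm (mat 1 :: real^2^2) < 15/10"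
 proof -
  have "(norm (mat 1 :: real^2^2))\<^sup>2 = 2" by (simp add: norm_mat2)
  hence "(norm (mat 1 :: real^2^2))\<^sup>2 < (15/10)\<^sup>2" by (simp add: power2_eq_square)
  thus ?thesis by (rule power_less_imp_less_base) simp
 qed
 have nP: "norm P \<le> 16/10" using norm_triangle_ineq[of a "mat 1"] assms n1 by (simp add: a_def)
 have nQ: "norm Q \<le> 16/10" using norm_triangle_ineq[of b "mat 1"] assms n1 by (simp add: b_def)
 have eq: "P ** Q ** adj2 P ** adj2 Q - mat 1 = (a ** b - b ** a) ** (adj2 P ** adj2 Q)"
 proof -
  have "a ** b - b ** a = P ** Q - Q ** P"
 by (simp add: a_def b_def matrix_diff_distribs)
  moreover have "Q ** P ** (adj2 P ** adj2 Q) = mat 1"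
   using assms by (simp add: matrix_mul_assoc adj2_mult)
  ultimately show ?thesis by (simp add: matrix_diff_distribs matrix_mul_assoc)
 qed
 have "norm ((a ** b - b ** a) ** (adj2 P ** adj2 Q)) \<le> norm (a ** b - b ** a) * (norm P * norm Q)"
 by (intro order_trans[OF norm_matrix_mult] mult_left_mono) auto
 also have "... \<le> (2 * norm a * norm b) * (16/10 * (16/10))"
 proof (intro mult_mono nP nQ)
  show "norm (a ** b - b ** a) \<le> 2 * norm a * norm b"
   using norm_triangle_ineq4[of "a ** b" "b ** a"] norm_matrix_mult[of a b] norm_matrix_mult[of b a] mult.commute[of "norm b" "norm a"] by simp
 qed auto
 also have "... \<le> (2 * norm a * (1/10)) * (16/10 * (16/10))"
  using assms by (intro mult_right_mono mult_left_mono) (auto simp: b_def)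
 also have "... < norm a" using assms by (simp add: a_def)
 finally show ?thesis by (simp add: eq a_def)
qed

text \<open>Commuting with B makes the traceless parts of A and B proportional, and the traceless
  part of B is nonzero because B is not scalar.\<close>

lemma centralizer_SL2:
 fixes A B :: "real^2^2"
 assumes "det B = 1" "B ~= mat 1" "B ~= - mat 1" "A ** B = B ** A"
 obtains s t where "A = s *\<^sub>R mat 1 + t *\<^sub>R B"
proof -
 have c: "(A ** B)$1$1 = (B ** A)$1$1" "(A ** B)$1$2 = (B ** A)$1$2" "(A ** B)$2$1 = (B ** A)$2$1"
  using assms by auto
 define p q r where "p = A$1$2" "q = A$2$1" "r = A$1$1 - A$2$2"
 define p' q' r' where "p' = B$1$2" "q' = B$2$1" "r' = B$1$1 - B$2$2"
 have e: "p * q' = p' * q" "r * p' = r' * p" "r * q' = r' * q"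
  using c by (simp_all add: matrix_mult_sel p_q_r_def p'_q'_r'_def algebra_simps)
 have "\<exists>t. p = t * p' \<and> q = t * q' \<and> r = t * r'"
 proof (cases "p' = 0")
  case False thus ?thesis using e by (intro exI[of _ "p / p'"]) (auto simp: field_simps)
 next
  case p: True
  show ?thesis
  proof (cases "q' = 0")
   case False thus ?thesis using e by (intro exI[of _ "q / q'"]) (auto simp: field_simps)
  next
   case q: True
   have "r' ~= 0"
   proof
    assume "r' = 0"
    with p q have eq: "B$1$2 = 0" "B$2$1 = 0" "B$1$1 = B$2$2" by (auto simp: p'_q'_r'_def)
    with assms(1) have "B$2$2 = 1 \<or> B$2$2 = -1" by (auto simp: det_2 square_eq_1_iff)
    with eq have "B = mat 1 \<or> B = - mat 1" by (auto intro!: mat2_eqI)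
    with assms show False by blast
   qed
   thus ?thesis using e by (intro exI[of _ "r / r'"]) (auto simp:)
  qed
 qed
 then obtain t where t: "p = t * p'" "q = t * q'" "r = t * r'" by blast
 have "A = (A$1$1 - t * B$1$1) *\<^sub>R mat 1 + t *\<^sub>R B"
  using t by (intro mat2_eqI) (auto simp: p_q_r_def p'_q'_r'_def algebra_simps)
 thus ?thesis using that by blast
qed

lemma scaleR_matrix_mult: "(r *\<^sub>R A) ** B = r *\<^sub>R (A ** B)" "A ** (r *\<^sub>R B) = r *\<^sub>R (A ** B)" for A B :: "real^2^2"
 by (auto intro!: mat2_eqI simp: matrix_mult_sel algebra_simps)

lemma commute_trans:
 fixes A B C :: "real^2^2"
 assumes "det B = 1" "B ~= mat 1" "B ~= - mat 1" "A ** B = B ** A" "C ** B = B ** C"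
 shows "A ** C = C ** A"
proof -
 obtain s t where "A = s *\<^sub>R mat 1 + t *\<^sub>R B" using centralizer_SL2[OF assms(1-4)] .
 moreover obtain s' t' where "C = s' *\<^sub>R mat 1 + t' *\<^sub>R B" using centralizer_SL2[OF assms(1-3,5)] .
 ultimately show ?thesis
 by (simp add: matrix_distribs scaleR_matrix_mult algebra_simps)
qed

text \<open>Although -1 moves no point, it is far from 1 as a matrix; hence a small element other
  than 1 is never scalar and its centralizer is commutative.\<close>

lemma defect_neg_one: "Im z > 0 ==> defect (- mat 1) z = 8"
by (auto simp: mob_eq cocyc_def defect_def trace_2)

context discrete_SL2
begin

lemma finite_defect: "Im z > 0 ==> finite {A \<in> \<Gamma>. defect A z \<le> R}"
proof -
 assume z: "Im z > 0"
 have "{A \<in> \<Gamma>. defect A z \<le> R} \<subseteq> {A \<in> \<Gamma>. hdisp z (mob A z) \<le> (sqrt R + 2)\<^sup>2}"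
 proof safe
  fix A assume A: "A \<in> \<Gamma>" "defect A z \<le> R"
  have d: "det A = 1" using A by simp
  have "norm (conj_at z A - mat 1) \<le> sqrt R" using A z by (simp add: defect_norm real_le_rsqrt)
  moreover have "norm (mat 1 :: real^2^2) \<le> 2"
 by (rule power2_le_imp_le) (simp_all add: norm_mat2)
  ultimately show "hdisp z (mob A z) \<le> (sqrt R + 2)\<^sup>2" using norm_triangle_ineq[of "conj_at z A - mat 1" "mat 1"] by (simp add: hdisp_mob_norm[OF d z] power_mono)
 qed
 thus ?thesis using finite_hdisp[OF z] finite_subset by blast
qed

text \<open>The Zassenhaus argument. Among the small elements other than 1 choose \<open>M\<close>
  of least defect at z; its commutator with any small element is smaller still, hence equal to 1. So
  all small elements lie in the commutative centralizer of \<open>M\<close>. The bound 1/100 is the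
  square of 1/10, since the defect is a squared norm.\<close>

lemma small_commute:
 assumes z: "Im z > 0" and A: "A \<in> \<Gamma>" "defect A z < 1/100" and B: "B \<in> \<Gamma>" "defect B z < 1/100"
 shows "A ** B = B ** A"
proof -
 define T where "T = {C \<in> \<Gamma>. defect C z < 1/100 \<and> C ~= mat 1}"
 have small: "norm (conj_at z C - mat 1) < 1/10" if "C \<in> \<Gamma>" "defect C z < 1/100" for C
 proof -
  have "(norm (conj_at z C - mat 1))\<^sup>2 < (1/10)\<^sup>2" using that z by (simp add: defect_norm power2_eq_square)
  thus ?thesis by (rule power_less_imp_less_base) simp
 qed
 show ?thesis
 proof (cases "T = {}")
  case True
  thus ?thesis using B by (auto simp: T_def)
 next
  case False
  have "T \<subseteq> {C \<in> \<Gamma>. defect C z \<le> 1/100}" by (auto simp: T_def)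
  hence "finite T" using finite_defect[OF z] finite_subset by blast
  then obtain M where M: "M \<in> T" "\<And>C. C \<in> T ==> defect M z \<le> defect C z"
   using False ex_min_if_finite[of "(\<lambda>C. defect C z) ` T"] by (metis (no_types, lifting) arg_min_if_finite(1) arg_min_least)
  have M': "M \<in> \<Gamma>" "defect M z < 1/100" "M ~= mat 1" using M by (auto simp: T_def)
  have comm: "C ** M = M ** C" if C: "C \<in> \<Gamma>" "defect C z < 1/100" for C
  proof -
   define K where "K = M ** C ** adj2 M ** adj2 C"
   have K: "K \<in> \<Gamma>" using C M' by (auto simp: K_def)
   have cK: "conj_at z K = conj_at z M ** conj_at z C ** adj2 (conj_at z M) ** adj2 (conj_at z C)"
 by (auto simp: conj_at_def adj2_prod matrix_mul_assoc K_def z)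
   have M1: "conj_at z M ~= mat 1"
   proof
    assume "conj_at z M = mat 1"
    hence "base_mat z ** conj_at z M ** adj2 (base_mat z) = mat 1" using z by (simp add: adj2_mult)
    thus False using M' z by (simp add: conj_at_def matrix_mul_assoc adj2_mult)
   qed
   have "norm (conj_at z K - mat 1) < norm (conj_at z M - mat 1)"
    unfolding cK using C M' z M1 by (intro commutator_small small) auto
   hence lt: "defect K z < defect M z" using K M' z by (simp add: defect_norm power_strict_mono)
   have "K ** (C ** M) = C ** M" using K lt M' M(2) by (force simp: T_def)
   moreover have "K ** (C ** M) = M ** C" using C M' by (simp add: K_def matrix_mul_assoc)
   ultimately show ?thesis by simp
  qed
  show ?thesis using M' defect_neg_one[OF z] commute_trans[of M A B] comm A B by force
 qed
qed

end

lemma borel_measurable_nn_integral_count_space: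
 assumes "countable I" and f: "\<And>i. i \<in> I ==> f i \<in> borel_measurable M"
 shows "(\<lambda>x. \<integral>\<^sup>+i. f i x \<partial>count_space I) \<in> borel_measurable M"
proof -
 have "(\<lambda>p. f (snd p) (fst p)) \<in> borel_measurable (M \<Otimes>\<^sub>M count_space I)"
  using f by (intro measurable_compose_countable'[where f="\<lambda>i b. f i (fst b)" and g=snd and I=I] assms(1)) simp_all
 thus ?thesis
 by (intro sigma_finite_measure.borel_measurable_nn_integral sigma_finite_measure_count_space_countable assms(1))
    (simp add:)
qed

lemma hdisp_borel [measurable]: "(\<lambda>w. hdisp z w) \<in> borel_measurable borel"
 unfolding hdisp_def by simp

text \<open>Any bound above \<open>hdisp z z = 2\<close> would serve. With 3, two balls that meet
  have centres with displacement below 3 times 3, which is the origin of the 9 in the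
  packing.\<close>

lemma hdisp_ball_area:
 assumes "Im z > 0"
 shows "emeasure hyp_measure {w \<in> UHP. hdisp z w < 3} = emeasure hyp_measure {w \<in> UHP. hdisp \<i> w < 3}"
proof -
 define B where "B = (\<lambda>z. {w \<in> UHP. hdisp z w < 3})"
 have B: "B z \<in> sets borel" for z unfolding B_def by simp
 have bi: "mob (base_mat z) \<i> = z" using assms
 by (simp add: mob_eq cocyc_def base_mat_def complex_eq_iff)
 have "emeasure hyp_measure (B z) = (\<integral>\<^sup>+w. indicator (B z) (mob (base_mat z) w) \<partial>hyp_measure)"
  using assms B by (subst nn_integral_hyp_mob) auto
 also have "... = (\<integral>\<^sup>+w. indicator (B \<i>) w \<partial>hyp_measure)"
  unfolding hyp_measure_def
 proof (subst (1 2) nn_integral_density; (intro nn_integral_cong)?)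
  fix w :: complex
  have "mob (base_mat z) w \<in> B z \<longleftrightarrow> w \<in> B \<i>" if w: "Im w > 0"
   using hdisp_mob[of "base_mat z" \<i> w] assms w Im_mob_pos[of "base_mat z" w] by (simp add: B_def bi)
  thus "ennreal (1 / (Im w)\<^sup>2) * indicator UHP w * indicator (B z) (mob (base_mat z) w) =
   ennreal (1 / (Im w)\<^sup>2) * indicator UHP w * indicator (B \<i>) w"
 by (auto simp: indicator_def)
 qed (use B in auto)
 also have "... = emeasure hyp_measure (B \<i>)" using B by simp
 finally show ?thesis by (simp add: B_def)
qed

lemma hdisp_ball_area_pos: "emeasure hyp_measure {w \<in> UHP. hdisp \<i> w < 3} > 0"
proof (rule ccontr)
 define B where "B = {w \<in> UHP. hdisp \<i> w < 3}"
 assume "\<not> ?thesis"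
 hence "emeasure hyp_measure B = 0" by (simp add: B_def)
 moreover have B: "B \<in> sets borel" unfolding B_def by simp
 ultimately have "(\<integral>\<^sup>+z. (ennreal (1 / (Im z)\<^sup>2) * indicator UHP z) * indicator B z \<partial>lborel) = 0"
  unfolding hyp_measure_def by (subst (asm) emeasure_density) auto
 hence "AE z in lborel. (ennreal (1 / (Im z)\<^sup>2) * indicator UHP z) * indicator B z = 0"
  using B by (subst (asm) nn_integral_0_iff_AE) auto
 hence "AE z in lborel. z \<notin> B"
 by eventually_elim (auto simp: B_def split: if_splits)
 hence "emeasure lborel B = 0" using B by (subst (asm) AE_iff_measurable[of B]) auto
 moreover have "open B"
 proof -
  have "continuous_on UHP (hdisp \<i>)" unfolding hdisp_def by (intro continuous_intros) auto
  hence "open (UHP \<inter> hdisp \<i> -` {..<3})"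
   using open_UHP by (intro continuous_open_preimage) auto
  thus ?thesis by (simp add: B_def Int_def)
 qed
 moreover have "\<i> \<in> B" by (simp add: B_def)
 ultimately show False using open_not_negligible by (force simp: negligible_iff_null_sets)
qed

section \<open>Groups of finite coarea\<close>

locale finite_area_SL2 = discrete_SL2 +
 fixes D
 assumes fund: "fundamental_set \<Gamma> D" and area: "hyperbolic_area D < \<infinity>"
begin

lemma D_borel [measurable]: "D \<in> sets borel" and D_UHP: "D \<subseteq> UHP"
 using fund by (auto simp: fundamental_set_def)

lemma D_cover: "Im z > 0 ==> \<exists>A\<in>\<Gamma>. mob A z \<in> D"
 using fund unfolding fundamental_set_def by auto

lemma D_area: "emeasure hyp_measure D < \<infinity>"
proof -
 show ?thesis using D_UHP area unfolding hyperbolic_area_def by (subst emeasure_hyp_measure) (auto simp: Int_absorb2)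
qed

definition thick :: "real => complex set" where
 "thick e = {z \<in> UHP. \<forall>A\<in>\<Gamma>. defect A z < e --> A = mat 1}"

text \<open>Unfolding the area of a ball over the translates of the fundamental set.\<close>

lemma ball_area_le:
 assumes "B \<in> sets borel"
 shows "emeasure hyp_measure B \<le> (\<integral>\<^sup>+w. (\<integral>\<^sup>+A. indicator B (mob A w) * indicator D w \<partial>count_space \<Gamma>) \<partial>hyp_measure)"
proof -
 note [measurable] = assms
 have "emeasure hyp_measure B = (\<integral>\<^sup>+w. indicator B w \<partial>hyp_measure)" by simp
 also have "... \<le> (\<integral>\<^sup>+w. (\<integral>\<^sup>+A. indicator B w * indicator D (mob A w) \<partial>count_space \<Gamma>) \<partial>hyp_measure)"
 proof (rule nn_integral_mono_AE)
  have "AE w in hyp_measure. w \<in> UHP"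
   unfolding hyp_measure_def by (subst AE_density) (auto simp: indicator_def)
  thus "AE w in hyp_measure. indicator B w \<le> (\<integral>\<^sup>+A. indicator B w * indicator D (mob A w) \<partial>count_space \<Gamma>)"
  proof eventually_elim
   fix w assume "w \<in> UHP"
   then obtain A where A: "A \<in> \<Gamma>" "mob A w \<in> D" using D_cover by auto
   have "indicator B w = (\<integral>\<^sup>+A'. indicator B w * indicator {A} A' \<partial>count_space \<Gamma>)"
    using A by simp
   also have "... \<le> (\<integral>\<^sup>+A. indicator B w * indicator D (mob A w) \<partial>count_space \<Gamma>)"
    using A by (intro nn_integral_mono) (auto simp: indicator_def)
   finally show "indicator B w \<le> (\<integral>\<^sup>+A. indicator B w * indicator D (mob A w) \<partial>count_space \<Gamma>)" .
  qed
 qed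
 also have "... = (\<integral>\<^sup>+A. (\<integral>\<^sup>+w. indicator B w * indicator D (mob A w) \<partial>hyp_measure) \<partial>count_space \<Gamma>)"
 by (rule nn_integral_count_space_nn_integral[OF countable_Gamma]) simp
 also have "... = (\<integral>\<^sup>+A. (\<integral>\<^sup>+w. indicator B (mob (adj2 A) w) * indicator D w \<partial>hyp_measure) \<partial>count_space \<Gamma>)"
 proof (rule nn_integral_cong)
  fix A assume "A \<in> space (count_space \<Gamma>)"
  hence A: "A \<in> \<Gamma>" by simp
  have "(\<integral>\<^sup>+w. indicator B (mob (adj2 A) w) * indicator D w \<partial>hyp_measure) = (\<integral>\<^sup>+w. indicator B (mob (adj2 A) (mob A w)) * indicator D (mob A w) \<partial>hyp_measure)"
   using A nn_integral_hyp_mob[of A "\<lambda>w. indicator B (mob (adj2 A) w) * indicator D w :: ennreal"] by simp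
  also have "... = (\<integral>\<^sup>+w. indicator B w * indicator D (mob A w) \<partial>hyp_measure)"
   unfolding hyp_measure_def using A
 by (subst (1 2) nn_integral_density) (auto intro!: nn_integral_cong simp: indicator_def mob_adj2)
  finally show "(\<integral>\<^sup>+w. indicator B w * indicator D (mob A w) \<partial>hyp_measure) = (\<integral>\<^sup>+w. indicator B (mob (adj2 A) w) * indicator D w \<partial>hyp_measure)" ..
 qed
 also have "... = (\<integral>\<^sup>+A. (\<integral>\<^sup>+w. indicator B (mob A w) * indicator D w \<partial>hyp_measure) \<partial>count_space \<Gamma>)"
 by (rule nn_integral_bij_count_space[of adj2])
    (auto intro!: bij_betw_byWitness[where f'=adj2])
 also have "... = (\<integral>\<^sup>+w. (\<integral>\<^sup>+A. indicator B (mob A w) * indicator D w \<partial>count_space \<Gamma>) \<partial>hyp_measure)"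
 by (rule nn_integral_count_space_nn_integral[OF countable_Gamma, symmetric]) simp
 finally show ?thesis .
qed

text \<open>Balls about separated points of the thick part are disjoint modulo the group, and each
  of them folds onto the quotient at most N times. So the number of points times the area of a ball
  is at most N times the coarea.\<close>

lemma thick_packing:
 assumes "e > 0"
 obtains N :: nat where
  "\<And>S. finite S ==> S \<subseteq> thick e ==> (\<And>s t A. s \<in> S ==> t \<in> S ==> s ~= t ==> A \<in> \<Gamma> ==> hdisp s (mob A t) \<ge> 9) ==> card S \<le> N"
proof -
 have pos: "sqrt e / 3 > 0" using assms by simp
 obtain N where N: "\<And>S :: (real^2^2) set. S \<subseteq> cball 0 3 ==> (\<And>x y. x \<in> S ==> y \<in> S ==> x ~= y ==> norm (x - y) \<ge> sqrt e / 3) ==> finite S \<and> card S \<le> N"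
  using packing[of "sqrt e / 3" 3, OF pos] by blast
 \<comment> \<open>The multiplicity N is uniform in z: conjugated to the base point these elements
   have norm at most 3 = sqrt 9, and thickness separates them by sqrt e / 3.\<close>
 have few: "finite {A \<in> \<Gamma>. hdisp z (mob A z) < 9} \<and> card {A \<in> \<Gamma>. hdisp z (mob A z) < 9} \<le> N" if z: "z \<in> thick e" for z
 proof -
  define S where "S = {A \<in> \<Gamma>. hdisp z (mob A z) < 9}"
  have z0: "Im z > 0" using z by (simp add: thick_def)
  have inj: "inj_on (conj_at z) S"
  proof (rule inj_onI)
   fix A B assume "conj_at z A = conj_at z B"
   hence "base_mat z ** conj_at z A ** adj2 (base_mat z) = base_mat z ** conj_at z B ** adj2 (base_mat z)" by simp
   thus "A = B" using z0 by (simp add: conj_at_def matrix_mul_assoc adj2_mult)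
  qed
  have le: "norm (conj_at z A) \<le> 3" if "A \<in> S" for A
  proof -
   have "(norm (conj_at z A))\<^sup>2 \<le> 3\<^sup>2" using that z0 by (simp add: S_def flip: hdisp_mob_norm)
   thus ?thesis by (rule power2_le_imp_le) simp
  qed
  have "finite (conj_at z ` S) \<and> card (conj_at z ` S) \<le> N"
  proof (rule N)
   show "conj_at z ` S \<subseteq> cball 0 3" using le by auto
   fix P Q assume "P \<in> conj_at z ` S" "Q \<in> conj_at z ` S" "P ~= Q"
   then obtain A B where AB: "A \<in> S" "B \<in> S" "P = conj_at z A" "Q = conj_at z B" "A ~= B" by auto
   have G: "A \<in> \<Gamma>" "B \<in> \<Gamma>" using AB by (auto simp: S_def)
   have "adj2 B ** A ~= mat 1" using G AB(5) adj2_cancel(1)[of B A] by (metis det_Gamma matrix_mul_rid)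
   hence "defect (adj2 B ** A) z \<ge> e" using z G by (force simp: thick_def)
   hence "sqrt e \<le> norm (conj_at z (adj2 B ** A) - mat 1)"
    using G z0 by (subst (asm) defect_norm) (auto simp: det_mul intro: real_le_lsqrt)
   moreover have "conj_at z (adj2 B ** A) = adj2 Q ** P" using z0 AB
 by (simp add:) (simp add: conj_at_def adj2_prod matrix_mul_assoc)
   ultimately show "norm (P - Q) \<ge> sqrt e / 3" using AB G z0 le[of B] by (intro norm_diff_ge) auto
  qed
  thus ?thesis using inj by (simp add: card_image finite_image_iff flip: S_def)
 qed
 define b where "b = emeasure hyp_measure {w \<in> UHP. hdisp \<i> w < 3}"
 have b: "b > 0" using hdisp_ball_area_pos by (simp add: b_def)
 define a where "a = emeasure hyp_measure D"
 have main: "of_nat (card S) * b \<le> of_nat N * a"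
  if S: "finite S" "S \<subseteq> thick e" and sep: "\<And>s t A. s \<in> S ==> t \<in> S ==> s ~= t ==> A \<in> \<Gamma> ==> hdisp s (mob A t) \<ge> 9" for S
 proof -
  define B where "B = (\<lambda>z. {w \<in> UHP. hdisp z w < 3})"
  have B [measurable]: "B z \<in> sets borel" for z unfolding B_def by simp
  have im: "Im s > 0" if "s \<in> S" for s using that S by (auto simp: thick_def)
  have close: "hdisp s (mob (A ** adj2 A') s') < 9" if w: "mob A w \<in> B s" "mob A' w \<in> B s'" "Im w > 0" "A \<in> \<Gamma>" "A' \<in> \<Gamma>" "s \<in> S" "s' \<in> S" for s s' w A A'
  proof -
   have "hdisp (mob A w) (mob (A ** adj2 A') s') = hdisp (mob A' w) s'" using w hdisp_mob[of "A ** adj2 A'" "mob A' w" s'] im by (auto simp: mob_mult mob_adj2 Im_mob_pos det_mul)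
   moreover have "hdisp s (mob (A ** adj2 A') s') \<le> hdisp s (mob A w) * hdisp (mob A w) (mob (A ** adj2 A') s')"
    using w im by (intro hdisp_triangle Im_mob_pos) (auto simp: det_mul)
   moreover have "hdisp s (mob A w) * hdisp (mob A' w) s' < 3 * 3"
    using w im hdisp_ge_2[of "mob A' w" s']
 by (intro mult_strict_mono) (auto simp: B_def hdisp_commute)
   ultimately show ?thesis by simp
  qed
  have "of_nat (card S) * b = (\<Sum>s\<in>S. emeasure hyp_measure (B s))"
   using im hdisp_ball_area by (simp add: B_def b_def flip: UHP_iff)
  also have "... \<le> (\<Sum>s\<in>S. (\<integral>\<^sup>+w. (\<integral>\<^sup>+A. indicator (B s) (mob A w) * indicator D w \<partial>count_space \<Gamma>) \<partial>hyp_measure))"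
 by (intro sum_mono ball_area_le B)
  also have "... = (\<integral>\<^sup>+w. (\<Sum>s\<in>S. (\<integral>\<^sup>+A. indicator (B s) (mob A w) * indicator D w \<partial>count_space \<Gamma>)) \<partial>hyp_measure)"
 by (rule nn_integral_sum[symmetric]) (auto intro!: borel_measurable_nn_integral_count_space[OF countable_Gamma])
  also have "... \<le> (\<integral>\<^sup>+w. of_nat N * indicator D w \<partial>hyp_measure)"
  proof (rule nn_integral_mono)
   fix w :: complex
   show "(\<Sum>s\<in>S. (\<integral>\<^sup>+A. indicator (B s) (mob A w) * indicator D w \<partial>count_space \<Gamma>)) \<le> of_nat N * indicator D w"
   proof (cases "w \<in> D \<and> (\<exists>s\<in>S. \<exists>A\<in>\<Gamma>. mob A w \<in> B s)")
    case True
    then obtain s A where sA: "s \<in> S" "A \<in> \<Gamma>" "mob A w \<in> B s" "w \<in> D" by blast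
    have w: "Im w > 0" using sA D_UHP by auto
    \<comment> \<open>The orbit of w meets the ball of a single s, so only one summand
      survives.\<close>
    have other: "mob A' w \<notin> B s'" if "s' \<in> S" "s' ~= s" "A' \<in> \<Gamma>" for s' A'
    using close[of A w s A' s'] sA w that sep[of s s' "A ** adj2 A'"] by (auto simp: not_less[symmetric])
    have "(\<Sum>s'\<in>S. (\<integral>\<^sup>+A'. indicator (B s') (mob A' w) * indicator D w \<partial>count_space \<Gamma>)) =
      (\<Sum>s'\<in>{s}. (\<integral>\<^sup>+A'. indicator (B s') (mob A' w) * indicator D w \<partial>count_space \<Gamma>))"
     using sA other S(1)
 by (intro sum.mono_neutral_right) (auto simp: nn_integral_0_iff_AE)
    also have "... = (\<integral>\<^sup>+A'. indicator {A' \<in> \<Gamma>. mob A' w \<in> B s} A' \<partial>count_space \<Gamma>)"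
     using sA by (auto intro!: nn_integral_cong simp: indicator_def)
    also have "... = emeasure (count_space \<Gamma>) {A' \<in> \<Gamma>. mob A' w \<in> B s}"
 by simp
    also have "... \<le> of_nat N"
    proof -
     let ?F = "{A \<in> \<Gamma>. hdisp s (mob A s) < 9}"
     have F: "finite ?F" "card ?F \<le> N" using few[of s] sA S by auto
     have inj: "inj_on (\<lambda>A'. A' ** adj2 A) {A' \<in> \<Gamma>. mob A' w \<in> B s}"
      using sA by (auto intro!: inj_onI) (metis adj2_cancel(4) det_Gamma)
     have sub: "(\<lambda>A'. A' ** adj2 A) ` {A' \<in> \<Gamma>. mob A' w \<in> B s} \<subseteq> ?F"
      using close[of _ w s A s] sA w by auto
     show ?thesis using inj_on_finite[OF inj sub F(1)] card_inj_on_le[OF inj sub F(1)] F by simp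
    qed
    finally show ?thesis using sA by simp
   next
    case False
    hence "(\<integral>\<^sup>+A. indicator (B s) (mob A w) * indicator D w \<partial>count_space \<Gamma>) = (\<integral>\<^sup>+A. 0 \<partial>count_space \<Gamma>)" if "s \<in> S" for s
     using that by (intro nn_integral_cong) (auto simp:)
    thus ?thesis by simp
   qed
  qed
  also have "... = of_nat N * a" unfolding a_def by (subst nn_integral_cmult_indicator) auto
  finally show ?thesis .
 qed
 obtain M :: nat where M: "of_nat N * a < of_nat M * b"
 proof -
  have fin: "of_nat N * a < \<infinity>" using D_area by (simp add: a_def ennreal_mult_less_top of_nat_less_top)
  show ?thesis
  proof (cases "b = \<infinity>")
   case True
   have "of_nat N * a < of_nat 1 * b" using fin True by simp
   thus ?thesis by (rule that)
  next
   case False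
   obtain r where r: "of_nat N * a = ennreal r" "r \<ge> 0" using fin by (cases "of_nat N * a") auto
   obtain c where c: "b = ennreal c" "c > 0" using False b by (cases b) auto
   obtain M :: nat where "r / c < real M" using reals_Archimedean2 by blast
   hence "r < real M * c" using c by (simp add: divide_less_eq)
   hence "ennreal r < ennreal (real M * c)" using r by (intro ennreal_lessI) auto
   thus ?thesis using r c that[of M] by (simp add: ennreal_mult' ennreal_of_nat_eq_real_of_nat)
  qed
 qed
 show ?thesis
 proof (rule that[of M])
  fix S assume S: "finite S" "S \<subseteq> thick e" and "\<And>s t A. s \<in> S ==> t \<in> S ==> s ~= t ==> A \<in> \<Gamma> ==> hdisp s (mob A t) \<ge> 9"
  from main[OF this] have "of_nat (card S) * b < of_nat M * b" using M by simp
  moreover have "of_nat M * b \<le> of_nat (card S) * b" if "M < card S"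
   using that by (intro mult_right_mono of_nat_mono) auto
  ultimately show "card S \<le> M" by (meson leD leI)
 qed
qed

end

lemma compact_hdisp_ball:
 assumes "Im s > 0"
 shows "compact {w \<in> UHP. hdisp s w \<le> 9}"
proof -
 \<comment> \<open>The same ball written by inequalities without denominators, which are closed
   conditions on the whole plane; the lower bound on \<open>Im w\<close> follows from the other
   inequality when \<open>Im w\<close> is positive.\<close>
 define T where "T = {w. Im w \<ge> Im s / 9 \<and> (cmod (s - w))\<^sup>2 + 2 * (Im s * Im w) \<le> 9 * (Im s * Im w)}"
 have eq: "{w \<in> UHP. hdisp s w \<le> 9} = T"
 proof (intro Set.set_eqI iffI)
  fix w assume "w \<in> {w \<in> UHP. hdisp s w \<le> 9}"
  hence w: "Im w > 0" and h: "hdisp s w \<le> 9" by auto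
  have p: "Im s * Im w > 0" using w assms by simp
  have h': "(cmod (s - w))\<^sup>2 + 2 * (Im s * Im w) \<le> 9 * (Im s * Im w)"
   using h p by (simp add: hdisp_def field_simps)
  have "(Im s)\<^sup>2 + (Im w)\<^sup>2 \<le> (cmod (s - w))\<^sup>2 + 2 * (Im s * Im w)"
   using zero_le_power2[of "Re s - Re w"] unfolding cmod_power2 by (simp add: power2_eq_square algebra_simps)
  hence "(Im s)\<^sup>2 \<le> 9 * (Im s * Im w)" using h' zero_le_power2[of "Im w"] by linarith
  hence "Im s * Im s \<le> Im s * (9 * Im w)" by (simp add: power2_eq_square)
  hence "Im s / 9 \<le> Im w" using assms by simp
  thus "w \<in> T" using h' unfolding T_def by (intro CollectI conjI)
 next
  fix w assume w: "w \<in> T"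
  hence "Im w \<ge> Im s / 9" by (simp add: T_def)
  hence w0: "Im w > 0" using assms by simp
  hence "Im s * Im w > 0" using assms by simp
  thus "w \<in> {w \<in> UHP. hdisp s w \<le> 9}" using w w0
 by (auto simp: T_def hdisp_def field_simps)
 qed
 have "closed T" unfolding T_def
 by (intro closed_Collect_conj closed_Collect_le continuous_intros)
 moreover have "bounded T"
 proof (rule boundedI)
  fix w assume w: "w \<in> T"
  hence w1: "Im w \<ge> Im s / 9" and "(cmod (s - w))\<^sup>2 + 2 * (Im s * Im w) \<le> 9 * (Im s * Im w)" unfolding T_def by blast+
  hence w2: "(cmod (s - w))\<^sup>2 \<le> 7 * (Im s * Im w)" by simp
  have w0: "Im w > 0" using assms w1 by simp
  have "(Im s - Im w)\<^sup>2 \<le> (cmod (s - w))\<^sup>2" by (simp add: cmod_power2)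
  hence "(Im s)\<^sup>2 + (Im w)\<^sup>2 - 2 * (Im s * Im w) \<le> 7 * (Im s * Im w)" using w2 by (simp add: power2_diff)
  hence "(Im w)\<^sup>2 \<le> 9 * (Im s * Im w)" using zero_le_power2[of "Im s"] by linarith
  hence "7 * (Im s * Im w) \<le> 7 * (Im s * (9 * Im s))" using w0 by (simp add: power2_eq_square)
  also have "... \<le> (8 * Im s)\<^sup>2" by (simp add: power2_eq_square)
  finally have "(cmod (s - w))\<^sup>2 \<le> (8 * Im s)\<^sup>2" using w2 by simp
  hence "cmod (s - w) \<le> 8 * Im s" by (rule power2_le_imp_le) (use assms in simp)
  thus "norm w \<le> cmod s + 8 * Im s" using norm_triangle_ineq2[of w s] by (simp add: norm_minus_commute)
 qed
 ultimately show ?thesis unfolding eq by (simp add: compact_eq_bounded_closed)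
qed

context finite_area_SL2
begin

text \<open>By the packing bound there is a separated set with the most elements; a thick point
  whose orbit avoided all its closed balls could be added to it.\<close>

lemma thick_compact:
 assumes "e > 0"
 obtains K where "compact K" "K \<subseteq> UHP" "\<And>z. z \<in> thick e ==> \<exists>A\<in>\<Gamma>. mob A z \<in> K"
proof -
 define P where "P = (\<lambda>S. finite S \<and> S \<subseteq> thick e \<and> (\<forall>s\<in>S. \<forall>t\<in>S. \<forall>A\<in>\<Gamma>. s ~= t --> hdisp s (mob A t) \<ge> 9))"
 obtain N where N: "\<And>S. P S ==> card S \<le> N"
  using thick_packing[OF assms] unfolding P_def by metis
 obtain S where S: "P S" "\<And>S'. P S' ==> card S' \<le> card S" using ex_has_greatest_nat[of P "{}" card "Suc N"] N by (auto simp: P_def less_Suc_eq_le)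
 define K where "K = (\<Union>s\<in>S. {w \<in> UHP. hdisp s w \<le> 9})"
 have im: "Im s > 0" if "s \<in> S" for s using that S by (auto simp: P_def thick_def)
 show ?thesis
 proof (rule that[of K])
  show "compact K" unfolding K_def using S im by (intro compact_UN compact_hdisp_ball) (auto simp: P_def)
  show "K \<subseteq> UHP" by (auto simp: K_def)
  fix z assume z: "z \<in> thick e"
  hence z0: "Im z > 0" by (simp add: thick_def)
  show "\<exists>A\<in>\<Gamma>. mob A z \<in> K"
  proof (rule ccontr)
   assume neg: "\<not> ?thesis"
   hence far: "hdisp s (mob A z) \<ge> 9" if "s \<in> S" "A \<in> \<Gamma>" for s A
    using that z0 Im_mob_pos[of A z] unfolding K_def by (fastforce simp:)
   have far': "hdisp z (mob A s) \<ge> 9" if "s \<in> S" "A \<in> \<Gamma>" for s A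
    using far[OF that(1) adj2_Gamma[OF that(2)]] hdisp_mob[of "adj2 A" z "mob A s"] that z0 im
 by (simp add: mob_adj2 Im_mob_pos hdisp_commute)
   have "z \<notin> S" using far[of z "mat 1"] by auto
   have "P (insert z S)" using S(1) z far far' by (auto simp: P_def)
   hence "card (insert z S) \<le> card S" by (rule S(2))
   moreover have "finite S" using S(1) by (simp add: P_def)
   ultimately show False using \<open>z \<notin> S\<close> by simp
  qed
 qed
qed

lemma continuous_defect: "A \<in> \<Gamma> ==> continuous_on UHP (defect A)"
proof -
 assume A: "A \<in> \<Gamma>"
 have "continuous_on UHP (\<lambda>z. (conj_at z A $1$1 - 1)\<^sup>2 + (conj_at z A $1$2)\<^sup>2 + (conj_at z A $2$1)\<^sup>2 + (conj_at z A $2$2 - 1)\<^sup>2)"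
 proof (rule continuous_on_eq)
  show "continuous_on UHP (\<lambda>z. (A$1$1 - A$2$1 * Re z - 1)\<^sup>2 + ((A$1$2 + (A$1$1 - A$2$2) * Re z - A$2$1 * (Re z)\<^sup>2) / Im z)\<^sup>2 + (A$2$1 * Im z)\<^sup>2 + (A$2$2 + A$2$1 * Re z - 1)\<^sup>2)"
 by (intro continuous_intros) auto
 qed (simp add: conj_at_sel)
 thus ?thesis
 by (rule continuous_on_eq) (use A in \<open>simp add: defect_norm norm_mat2\<close>)
qed

lemma open_small: "A \<in> \<Gamma> ==> open {z \<in> UHP. defect A z < e}"
proof -
 assume "A \<in> \<Gamma>"
 hence "open (UHP \<inter> defect A -` {..<e})"
  using continuous_defect open_UHP by (intro continuous_open_preimage) auto
 thus ?thesis by (simp add: Int_def)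
qed

text \<open>The thin region belonging to the centralizer of \<open>A\<close>. Since small elements
  at a point commute, a boundary point of this open set inside the half-plane has no small element
  and is thick.\<close>

definition thin_comp :: "real^2^2 => complex set" where
 "thin_comp A = (\<Union>B\<in>{B\<in>\<Gamma>. A ** B = B ** A \<and> B ~= mat 1}. {z \<in> UHP. defect B z < 1/100})"

lemma not_minus_one: "Im z > 0 ==> defect A z < 1/100 ==> A ~= - mat 1"
 using defect_neg_one[of z] by auto

text \<open>Up to conjugation the thin regions have finitely many commuting types. Unless a region
  is the whole half-plane, connectedness gives it a boundary point, which is thick and can be moved
  into the compact set. A small element at a nearby point moves that point by a bounded amount, so
  its conjugate belongs to a finite set.\<close>

lemma thin_classes:
 obtains C where "finite C" "C \<subseteq> \<Gamma> - {mat 1, - mat 1}"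
  "\<And>z A. Im z > 0 ==> A \<in> \<Gamma> ==> A ~= mat 1 ==> defect A z < 1/100 ==>
   \<exists>M\<in>\<Gamma>. \<exists>B\<in>C. (M ** A ** adj2 M) ** B = B ** (M ** A ** adj2 M)"
proof -
 define small where "small = (\<lambda>A z. Im z > 0 \<and> A \<in> \<Gamma> \<and> A ~= mat 1 \<and> defect A z < 1/100)"
 show ?thesis
 proof (cases "\<exists>A z. small A z \<and> thin_comp A = UHP")
  case True
  then obtain A z where A: "small A z" "thin_comp A = UHP" by blast
  show ?thesis
  proof (rule that[of "{A}"])
   show "{A} \<subseteq> \<Gamma> - {mat 1, - mat 1}" using A not_minus_one by (auto simp: small_def)
   fix w E assume E: "Im w > 0" "E \<in> \<Gamma>" "E ~= mat 1" "defect E w < 1/100"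
   have "w \<in> thin_comp A" using E A by simp
   then obtain B where B: "B \<in> \<Gamma>" "A ** B = B ** A" "B ~= mat 1" "defect B w < 1/100" by (auto simp: thin_comp_def)
   show "\<exists>M\<in>\<Gamma>. \<exists>B\<in>{A}. (M ** E ** adj2 M) ** B = B ** (M ** E ** adj2 M)" using small_commute[of w E B] E B commute_trans[of B E A] not_minus_one[of w B] by (auto intro!: bexI[of _ "mat 1 :: real^2^2" \<Gamma>])
  qed simp
 next
  case False
  obtain K where K: "compact K" "K \<subseteq> UHP" "\<And>z. z \<in> thick (1/100) ==> \<exists>A\<in>\<Gamma>. mob A z \<in> K"
   using thick_compact[of "1/100"] by auto
  \<comment> \<open>27 = 3 * 3 * 3 comes from the path w, v, Bv, Bw, in which each leg has
    displacement below 3.\<close>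
  define C where "C = {B \<in> \<Gamma>. \<exists>z\<in>K. hdisp z (mob B z) \<le> 27} - {mat 1, - mat 1}"
  show ?thesis
  proof (rule that[of C])
   show "finite C" unfolding C_def using finite_hdisp_compact[OF K(1,2)] by blast
   show "C \<subseteq> \<Gamma> - {mat 1, - mat 1}" by (auto simp: C_def)
   fix z A assume z: "Im z > 0" and A: "A \<in> \<Gamma>" "A ~= mat 1" "defect A z < 1/100"
   have "thin_comp A ~= UHP" using False z A by (auto simp: small_def)
   moreover have "z \<in> thin_comp A" using z A by (auto simp: thin_comp_def)
   moreover have op: "open (thin_comp A)" unfolding thin_comp_def by (intro open_UN ballI open_small) auto
   moreover have sub: "thin_comp A \<subseteq> UHP" by (auto simp: thin_comp_def)
   ultimately have "\<not> closedin (top_of_set UHP) (thin_comp A)"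
    using connected_UHP unfolding connected_clopen by (metis empty_iff openin_open_eq[OF open_UHP])
   then obtain w where w: "w \<in> UHP" "w \<in> closure (thin_comp A)" "w \<notin> thin_comp A" using sub closure_subset[of "thin_comp A"] unfolding closedin_closed by blast
   have w0: "Im w > 0" using w by simp
   have meet: "\<exists>v\<in>thin_comp A. v \<in> U" if "open U" "w \<in> U" for U
    using w(2) that by (metis (no_types, opaque_lifting) Int_iff closure_iff_nhds_not_empty equals0I open_Int_closure_eq_empty)
   \<comment> \<open>An element E that is small at w stays small at a nearby v in the thin region,
     so it commutes with a small B there and hence with A; then w itself would lie in the
     region.\<close>
   have "w \<in> thick (1/100)"
    unfolding thick_def
   proof (safe, simp add: w0)
    fix E assume E: "E \<in> \<Gamma>" "defect E w < 1/100"
    show "E = mat 1"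
    proof (rule ccontr)
     assume E1: "E ~= mat 1"
     have "w \<in> {z \<in> UHP. defect E z < 1/100}" using E w by blast
     from meet[OF open_small[OF E(1)] this]
     obtain v where v: "v \<in> thin_comp A" "v \<in> {z \<in> UHP. defect E z < 1/100}" by blast
     then obtain B where B: "B \<in> \<Gamma>" "A ** B = B ** A" "B ~= mat 1" "defect B v < 1/100" "Im v > 0" by (auto simp: thin_comp_def)
     show False using small_commute[of v E B] E B v commute_trans[of B A E] not_minus_one[of v B] E1 w by (auto simp: thin_comp_def)
    qed
   qed
   then obtain M where M: "M \<in> \<Gamma>" "mob M w \<in> K" using K(3) by blast
   have "open (UHP \<inter> hdisp w -` {..<3})"
    using open_UHP w0 unfolding hdisp_def by (intro continuous_open_preimage continuous_intros) auto
   then obtain v where v: "v \<in> thin_comp A" "v \<in> UHP \<inter> hdisp w -` {..<3}"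
    using meet[of "UHP \<inter> hdisp w -` {..<3}"] w0 by auto
   then obtain B where B: "B \<in> \<Gamma>" "A ** B = B ** A" "B ~= mat 1" "defect B v < 1/100" and v0: "Im v > 0" and wv: "hdisp w v < 3"
 by (auto simp: thin_comp_def)
   have dB: "det B = 1" using B by simp
   \<comment> \<open>The norm of the conjugate is below 1/10 plus sqrt 2, so at most 16/10, and
     (16/10)^2 < 3.\<close>
   have "hdisp v (mob B v) < 3"
   proof -
    have "(norm (conj_at v B - mat 1))\<^sup>2 < (1/10)\<^sup>2" using B v0 by (simp add: defect_norm power2_eq_square)
    hence "norm (conj_at v B - mat 1) < 1/10" by (rule power_less_imp_less_base) simp
    moreover have "norm (mat 1 :: real^2^2) \<le> 15/10"
 by (rule power2_le_imp_le) (simp_all add: norm_mat2 power_divide)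
    ultimately have "(norm (conj_at v B))\<^sup>2 \<le> (16/10)\<^sup>2" using norm_triangle_ineq[of "conj_at v B - mat 1" "mat 1"] by simp
    also have "... < 3" by (simp add: power2_eq_square)
    finally show ?thesis using v0 dB by (simp add: hdisp_mob_norm)
   qed
   moreover have "hdisp (mob B v) (mob B w) < 3" using wv dB v0 w0 by (simp add: hdisp_mob hdisp_commute)
   moreover have "hdisp w (mob B w) \<le> hdisp w v * (hdisp v (mob B v) * hdisp (mob B v) (mob B w))"
    using hdisp_triangle[of w v "mob B w"] hdisp_triangle[of v "mob B v" "mob B w"] w0 v0 dB Im_mob_pos
     hdisp_ge_2[of w v] by (meson mult_left_mono order_trans zero_le_numeral)
   ultimately have "hdisp w (mob B w) \<le> 3 * (3 * 3)"
    using wv hdisp_ge_2[of v "mob B v"] hdisp_ge_2[of "mob B v" "mob B w"] w0 v0 dB Im_mob_pos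
 by (elim order_trans) (intro mult_mono mult_nonneg_nonneg; force intro: order_trans[of 0 2])
   moreover define B' where "B' = M ** B ** adj2 M"
   have "hdisp (mob M w) (mob B' (mob M w)) = hdisp w (mob B w)" using M dB w0 by (auto simp: B'_def mob_mult mob_adj2 Im_mob_pos det_mult1 hdisp_mob)
   moreover have "B' ~= mat 1" "B' ~= - mat 1"
   proof -
    have rev: "adj2 M ** B' ** M = B" using M by (simp add: B'_def matrix_mul_assoc adj2_mult)
    show "B' ~= mat 1" using rev B M by (auto simp: adj2_mult)
    have "adj2 M ** (- mat 1) ** M = - (mat 1 :: real^2^2)"
     using det_Gamma[OF M(1)] by (intro mat2_eqI) (simp_all add: matrix_mult_sel det_2 algebra_simps)
    thus "B' ~= - mat 1" using rev not_minus_one[OF v0 B(4)] by auto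
   qed
   ultimately have "B' \<in> C" using M B by (auto simp: C_def B'_def intro!: bexI[of _ "mob M w"])
   moreover have "(M ** A ** adj2 M) ** B' = B' ** (M ** A ** adj2 M)"
   proof -
    have "(M ** A ** adj2 M) ** B' = M ** (A ** B) ** adj2 M" using M by (simp add: B'_def matrix_mul_assoc)
    also have "... = B' ** (M ** A ** adj2 M)" using M B by (simp add: B'_def matrix_mul_assoc)
    finally show ?thesis .
   qed
   ultimately show "\<exists>M\<in>\<Gamma>. \<exists>B\<in>C. (M ** A ** adj2 M) ** B = B ** (M ** A ** adj2 M)" using M by blast
  qed
 qed
qed

section \<open>Displacement of elements commuting with a fixed one\<close>

lemma commuting_trace:
 fixes A B :: "real^2^2"
 assumes "A = u *\<^sub>R mat 1 + t *\<^sub>R B" "det A = 1" "det B = 1"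
 shows "(trace A)\<^sup>2 - 4 = t\<^sup>2 * ((trace B)\<^sup>2 - 4)"
proof -
 have "(trace A)\<^sup>2 - 4 * det A = t\<^sup>2 * ((trace B)\<^sup>2 - 4 * det B)"
  unfolding assms(1) trace_2 det_2 by (simp add: power2_eq_square algebra_simps)
 thus ?thesis using assms by simp
qed

lemma defect_ge_trace:
 assumes "det A = 1" "Im z > 0"
 shows "defect A z \<ge> 4 - 2 * trace A" "defect A z \<ge> trace A * (trace A - 2)"
proof -
 have "hdisp z (mob A z) \<ge> 2" using assms by (intro hdisp_ge_2 Im_mob_pos)
 thus "defect A z \<ge> 4 - 2 * trace A" by (simp add: defect_def)
 have "(norm M)\<^sup>2 \<ge> (trace M)\<^sup>2 - 2 * det M" for M :: "real^2^2"
  unfolding norm_mat2 trace_2 det_2 using zero_le_power2[of "M$1$2 - M$2$1"]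
 by (simp add: power2_eq_square algebra_simps)
 from this[of "conj_at z A"] have "hdisp z (mob A z) \<ge> (trace A)\<^sup>2 - 2"
  using assms by (simp add: hdisp_mob_norm trace_conj_at)
 thus "defect A z \<ge> trace A * (trace A - 2)" by (simp add: defect_def power2_eq_square algebra_simps)
qed

text \<open>An element A = u + t B satisfies (tr A)^2 - 4 = t^2 Delta with Delta nonzero, so a bound
  on the trace bounds t and u and leaves finitely many A. Trace 2 forces t = 0 and A = 1; for all
  other A the trace alone gives a positive lower bound on the defect.\<close>

lemma nonparabolic_gap:
 assumes B: "B \<in> \<Gamma>" "B ~= mat 1" "B ~= - mat 1" "\<bar>trace B\<bar> ~= 2"
 obtains e where "e > 0" "\<And>A z. A \<in> \<Gamma> ==> A ~= mat 1 ==> A ** B = B ** A ==> Im z > 0 ==> defect A z \<ge> e"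
proof -
 define m where "m = (\<lambda>A :: real^2^2. max (4 - 2 * trace A) (trace A * (trace A - 2)))"
 define T where "T = {A \<in> \<Gamma>. A ** B = B ** A \<and> A ~= mat 1 \<and> \<bar>trace A\<bar> \<le> 3}"
 define \<Delta> where "\<Delta> = (trace B)\<^sup>2 - 4"
 have \<Delta>: "\<Delta> ~= 0"
 proof
  assume "\<Delta> = 0"
  hence "(trace B)\<^sup>2 = 2\<^sup>2" by (simp add: \<Delta>_def)
  hence "trace B = 2 \<or> trace B = - 2" by (simp only: power2_eq_iff)
  thus False using B(4) by auto
 qed
 have rep: "\<exists>u t. A = u *\<^sub>R mat 1 + t *\<^sub>R B \<and> (trace A)\<^sup>2 - 4 = t\<^sup>2 * \<Delta>" if A: "A \<in> \<Gamma>" "A ** B = B ** A" for A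
 proof -
  obtain u t where "A = u *\<^sub>R mat 1 + t *\<^sub>R B"
   using centralizer_SL2[OF det_Gamma[OF B(1)] B(2,3) A(2)] by blast
  thus ?thesis using commuting_trace[of A u t B] B A by (auto simp: \<Delta>_def)
 qed
 have tr2: "trace A ~= 2" if A: "A \<in> \<Gamma>" "A ~= mat 1" "A ** B = B ** A" for A
 using rep[of A] A \<Delta> by (auto simp: trace_2)
 have mpos: "m A > 0" if "A \<in> \<Gamma>" "A ~= mat 1" "A ** B = B ** A" for A
  using tr2[OF that] by (auto simp: m_def less_max_iff_disj) (meson less_linear mult_pos_pos order.strict_trans zero_less_numeral diff_gt_0_iff_gt)
 have "T \<subseteq> {A \<in> \<Gamma>. norm A \<le> (3 + sqrt (13 / \<bar>\<Delta>\<bar>) * \<bar>trace B\<bar>) * norm (mat 1 :: real^2^2) + sqrt (13 / \<bar>\<Delta>\<bar>) * norm B}"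
 proof safe
  fix A assume "A \<in> T"
  hence A: "A \<in> \<Gamma>" "A ** B = B ** A" "\<bar>trace A\<bar> \<le> 3" by (auto simp: T_def)
  then obtain u t where ut: "A = u *\<^sub>R mat 1 + t *\<^sub>R B" "(trace A)\<^sup>2 - 4 = t\<^sup>2 * \<Delta>" using rep by blast
  \<comment> \<open>13 = 9 + 4 is the crude bound on (tr A)^2 - 4 for traces of absolute value at
    most 3.\<close>
  have "\<bar>t\<^sup>2 * \<Delta>\<bar> \<le> 13" using A(3) abs_le_square_iff[of "trace A" 3] unfolding ut(2)[symmetric] abs_le_iff by (auto intro: order_trans[of _ 0])
  hence t: "\<bar>t\<bar> \<le> sqrt (13 / \<bar>\<Delta>\<bar>)" using \<Delta> by (auto simp: pos_le_divide_eq real_le_rsqrt)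
  have "2 * u = trace A - t * trace B" using ut(1) by (simp add: trace_2 algebra_simps)
  hence "\<bar>2 * u\<bar> \<le> \<bar>trace A\<bar> + \<bar>t\<bar> * \<bar>trace B\<bar>" by (metis abs_mult abs_triangle_ineq4)
  also have "... \<le> 3 + sqrt (13 / \<bar>\<Delta>\<bar>) * \<bar>trace B\<bar>" using A(3) t by (intro add_mono mult_right_mono) auto
  finally have u: "\<bar>u\<bar> \<le> 3 + sqrt (13 / \<bar>\<Delta>\<bar>) * \<bar>trace B\<bar>" by simp
  have "norm A \<le> \<bar>u\<bar> * norm (mat 1 :: real^2^2) + \<bar>t\<bar> * norm B"
   unfolding ut(1) using norm_triangle_ineq[of "u *\<^sub>R mat 1" "t *\<^sub>R B"] by simp
  also have "... \<le> (3 + sqrt (13 / \<bar>\<Delta>\<bar>) * \<bar>trace B\<bar>) * norm (mat 1 :: real^2^2) + sqrt (13 / \<bar>\<Delta>\<bar>) * norm B"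
   using u t by (intro add_mono mult_right_mono) auto
  finally show "norm A \<le> (3 + sqrt (13 / \<bar>\<Delta>\<bar>) * \<bar>trace B\<bar>) * norm (mat 1 :: real^2^2) + sqrt (13 / \<bar>\<Delta>\<bar>) * norm B" .
 qed (auto simp: T_def)
 hence fT: "finite T" using finite_bounded finite_subset by blast
 define e where "e = Min (insert 1 (m ` T))"
 have e: "e > 0" using mpos fT by (auto simp: e_def T_def)
 show ?thesis
 proof (rule that[OF e])
  fix A z assume A: "A \<in> \<Gamma>" "A ~= mat 1" "A ** B = B ** A" and z: "Im z > 0"
  have "e \<le> m A"
  proof (cases "\<bar>trace A\<bar> \<le> 3")
   case True
   thus ?thesis using A fT by (auto simp: e_def T_def)
  next
   case big: False
   have "e \<le> 1" using fT by (simp add: e_def)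
   also have "1 \<le> m A"
   proof (cases "trace A < 0")
    case False
    with big have "3 * 1 \<le> trace A * (trace A - 2)" by (intro mult_mono) auto
    thus ?thesis by (simp add: m_def)
   qed (simp add: m_def)
   finally show ?thesis .
  qed
  also have "m A \<le> defect A z" using defect_ge_trace[of A z] A z by (simp add: m_def)
  finally show "e \<le> defect A z" .
 qed
qed

text \<open>Once the fixed point of B is moved to infinity, the elements commuting with B become
  plus or minus translations. Translation by q has defect (q / y)^2 at height y, and by discreteness
  the nonzero lengths q are bounded below, so a small defect forces a large height.\<close>

lemma parabolic_gap:
 assumes B: "B \<in> \<Gamma>" "B ~= mat 1" "B ~= - mat 1" "\<bar>trace B\<bar> = 2"
 obtains s where "s \<in> cusps \<Gamma>"
  "\<And>Y. \<exists>e>0. \<forall>A\<in>\<Gamma>. \<forall>z. A ~= mat 1 --> A ** B = B ** A --> Im z > 0 --> defect A z < e --> Im (mob (adj2 (scaling s)) z) > Y"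
proof -
 \<comment> \<open>The double root of the fixed point equation, whose discriminant (tr B)^2 - 4
   vanishes.\<close>
 define x where "x = (B$1$1 - B$2$2) / (2 * B$2$1)"
 define s where "s = (if B$2$1 = 0 then Infty else Fin (of_real x))"
 define \<sigma> where "\<sigma> = scaling s"
 have d\<sigma>: "det \<sigma> = 1" by (simp add: \<sigma>_def)
 have dB: "B$1$1 * B$2$2 - B$1$2 * B$2$1 = 1" using det_Gamma[OF B(1)] by (simp add: det_2)
 have tB: "(B$1$1 + B$2$2)\<^sup>2 = 4" using B(4) power2_abs[of "trace B"] by (simp add: trace_2)
 have quad: "x * B$1$1 + B$1$2 = x * (x * B$2$1 + B$2$2)" if "B$2$1 ~= 0"
 proof -
  have "4 * B$2$1 * (x * B$1$1 + B$1$2 - x * (x * B$2$1 + B$2$2)) = (B$1$1 + B$2$2)\<^sup>2 - 4 * (B$1$1 * B$2$2 - B$1$2 * B$2$1)"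
   using that by (simp add: x_def field_simps power2_eq_square)
  thus ?thesis using tB dB that by simp
 qed
 have cusp: "s \<in> cusps \<Gamma>"
 proof -
  have "parabolic B" using B by (simp add: parabolic_def)
  moreover have "act B s = s"
  proof (cases "B$2$1 = 0")
   case True thus ?thesis by (simp add: s_def)
  next
   case False

   have "x * B$2$1 + B$2$2 = (B$1$1 + B$2$2) / 2" using False by (simp add: x_def)
   hence nz: "x * B$2$1 + B$2$2 ~= 0" using tB by force
   have c: "cocyc B (of_real x) = of_real (x * B$2$1 + B$2$2)" by (simp add: cocyc_def)
   have "of_real (B$1$1) * complex_of_real x + of_real (B$1$2) = of_real (x * (x * B$2$1 + B$2$2))"
    using quad[OF False] by (simp add: mult.commute flip: of_real_mult of_real_add)
   hence "mob B (of_real x) = of_real (x * (x * B$2$1 + B$2$2)) / of_real (x * B$2$1 + B$2$2)"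
 by (simp only: mob_eq c)
   also have "... = of_real x" using nz by (simp only: nonzero_mult_div_cancel_right of_real_eq_0_iff flip: of_real_divide) simp
   finally have m: "mob B (of_real x) = of_real x" .
   have "cocyc B (of_real x) ~= 0" unfolding c of_real_eq_0_iff using nz .
   thus ?thesis using m by (simp add: s_def)
  qed
  moreover have "s \<in> insert Infty (Fin ` \<real>)" by (auto simp: s_def)
  ultimately show ?thesis using B(1) unfolding cusps_def by blast
 qed
 define N where "N = (\<lambda>A. adj2 \<sigma> ** A ** \<sigma>)"
 have NB: "N B $2$1 = 0" "N B $1$1 = N B $2$2"
 proof -
  show N21: "N B $2$1 = 0"
  proof (cases "B$2$1 = 0")
   case True thus ?thesis by (simp add: N_def \<sigma>_def s_def)
  next
   case False thus ?thesis using quad[OF False]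
 by (simp add: N_def \<sigma>_def s_def matrix_mult_sel algebra_simps)
  qed
  have "det (N B) = 1" using d\<sigma> B by (simp add: N_def det_mul)
  hence 1: "N B $1$1 * N B $2$2 = 1" using N21 by (simp add: det_2)
  have 2: "(N B $1$1 + N B $2$2)\<^sup>2 = 4" using trace_conj[of "adj2 \<sigma>" B] d\<sigma> tB unfolding N_def by (simp add: trace_2)
  have "(N B $1$1 - N B $2$2)\<^sup>2 = 0" using 1 2 by (simp add: power2_eq_square algebra_simps)
  thus "N B $1$1 = N B $2$2" by simp
 qed
 have NA: "N A $2$1 = 0 \<and> N A $1$1 = N A $2$2" if A: "A \<in> \<Gamma>" "A ** B = B ** A" for A
 proof -
  obtain u t where ut: "A = u *\<^sub>R mat 1 + t *\<^sub>R B" by (rule centralizer_SL2[of B A]) (use B A in auto)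
  show ?thesis using d\<sigma> NB by (simp add: ut N_def matrix_distribs scaleR_matrix_mult adj2_mult)
 qed
 define T where "T = {A \<in> \<Gamma>. A ** B = B ** A \<and> A ~= mat 1 \<and> N A $1$1 = 1}"
 have inv: "A = \<sigma> ** N A ** adj2 \<sigma>" for A using d\<sigma> by (simp add: N_def matrix_mul_assoc adj2_mult)
 have q0: "N A $1$2 ~= 0" if "A \<in> T" for A
 proof
  assume "N A $1$2 = 0"
  hence "N A = mat 1" using that NA[of A] by (intro mat2_eqI) (auto simp: T_def)
  thus False using inv[of A] d\<sigma> that by (auto simp: adj2_mult T_def)
 qed
 have "finite {A \<in> T. \<bar>N A $1$2\<bar> \<le> 1}"
 proof (rule finite_subset)
  show "{A \<in> T. \<bar>N A $1$2\<bar> \<le> 1} \<subseteq> {A \<in> \<Gamma>. norm A \<le> norm \<sigma> * (2 * norm \<sigma>)}"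
  proof safe
   fix A assume A: "A \<in> T" "\<bar>N A $1$2\<bar> \<le> 1"
   have "(norm (N A))\<^sup>2 = 2 + (N A $1$2)\<^sup>2" using A NA[of A] by (simp add: norm_mat2 T_def)
   also have "... \<le> 2\<^sup>2" using A(2) abs_square_le_1[of "N A $1$2"] by simp
   finally have "norm (N A) \<le> 2" by (rule power2_le_imp_le) simp
   have "norm A \<le> norm \<sigma> * (norm (N A) * norm (adj2 \<sigma>))"
 by (subst inv[of A], subst matrix_mul_assoc[symmetric], rule order_trans[OF norm_matrix_mult])
      (intro mult_left_mono norm_matrix_mult norm_ge_zero)
   also have "... \<le> norm \<sigma> * (2 * norm \<sigma>)" using \<open>norm (N A) \<le> 2\<close> by (intro mult_left_mono) (auto intro: mult_right_mono)
   finally show "norm A \<le> norm \<sigma> * (2 * norm \<sigma>)" .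
  qed (auto simp: T_def)
 qed (rule finite_bounded)
 define q where "q = Min (insert 1 ((\<lambda>A. \<bar>N A $1$2\<bar>) ` {A \<in> T. \<bar>N A $1$2\<bar> \<le> 1}))"
 have q: "q > 0" using q0 \<open>finite {A \<in> T. _ A}\<close> by (auto simp: q_def)
 have qle: "q \<le> \<bar>N A $1$2\<bar>" if "A \<in> T" for A
 proof (cases "\<bar>N A $1$2\<bar> \<le> 1")
  case True thus ?thesis using that \<open>finite {A \<in> T. _ A}\<close> by (auto simp: q_def)
 next
  case False
  have "q \<le> 1" using \<open>finite {A \<in> T. _ A}\<close> by (simp add: q_def)
  thus ?thesis using False by simp
 qed
 show ?thesis
 proof (rule that[OF cusp])
  fix Y :: real
  define Y' where "Y' = \<bar>Y\<bar> + 1"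
  show "\<exists>e>0. \<forall>A\<in>\<Gamma>. \<forall>z. A ~= mat 1 --> A ** B = B ** A --> Im z > 0 --> defect A z < e --> Im (mob (adj2 (scaling s)) z) > Y"
  proof (intro exI[of _ "min 1 ((q / Y')\<^sup>2)"] conjI ballI allI impI)
   show "min 1 ((q / Y')\<^sup>2) > 0" using q by (simp add: Y'_def)
   fix A z assume A: "A \<in> \<Gamma>" "A ~= mat 1" "A ** B = B ** A" and z: "Im z > 0" and d: "defect A z < min 1 ((q / Y')\<^sup>2)"
   define w where "w = mob (adj2 \<sigma>) z"
   have w: "Im w > 0" using d\<sigma> z by (simp add: w_def Im_mob_pos)
   have dN: "det (N A) = 1" using A d\<sigma> by (simp add: N_def det_mul)
   have n: "N A $2$1 = 0" "N A $1$1 = N A $2$2" using NA A by auto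
   have "N A $1$1 = 1 \<or> N A $1$1 = -1" using dN n by (auto simp: det_2 square_eq_1_iff)
   \<comment> \<open>The value -1 would mean trace -2 and defect at least 8, but the defect is below
     1.\<close>
   moreover have "N A $1$1 ~= -1"
   using trace_conj[of "adj2 \<sigma>" A] d\<sigma> n defect_ge_trace(1)[of A z] A z d by (auto simp: N_def trace_2)
   ultimately have p1: "N A $1$1 = 1" by blast
   hence AT: "A \<in> T" using A by (simp add: T_def)
   have "defect A z = defect (N A) w"
    using defect_conj[of A "adj2 \<sigma>" z] A d\<sigma> z by (simp add: N_def w_def)
   also have "... = (N A $1$2 / Im w)\<^sup>2"
    unfolding defect_norm[OF dN w] norm_mat2 using n p1 w by (simp add: conj_at_sel)
   finally have "(N A $1$2 / Im w)\<^sup>2 < (q / Y')\<^sup>2" using d by simp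
   hence "\<bar>N A $1$2 / Im w\<bar>\<^sup>2 < (q / Y')\<^sup>2" unfolding power2_abs .
   hence "\<bar>N A $1$2 / Im w\<bar> < q / Y'" by (rule power_less_imp_less_base) (use q in \<open>simp add: Y'_def\<close>)
   moreover have "q / Im w \<le> \<bar>N A $1$2 / Im w\<bar>" using qle[OF AT] w by (simp add: divide_right_mono)
   ultimately have "q / Im w < q / Y'" by simp
   moreover have "Y' > 0" by (simp add: Y'_def)
   ultimately show "Im (mob (adj2 (scaling s)) z) > Y" using w q by (auto simp: divide_less_eq less_divide_eq w_def \<sigma>_def Y'_def)
  qed
 qed
qed

text \<open>The cusps are the fixed points of the parabolic members of the finite list
  \<open>C\<close>, so they do not depend on Y. With e below the gaps of all members of
  \<open>C\<close>, a point that is not e-thick has a translate near one of these cusps, and the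
  e-thick points are covered by a compact set modulo the group.\<close>

theorem finite_area_cover:
 obtains S where "finite S" "S \<subseteq> cusps \<Gamma>"
  "\<And>Y. \<exists>K. compact K \<and> K \<subseteq> UHP \<and>
    (\<forall>z\<in>UHP. \<exists>A\<in>\<Gamma>. mob A z \<in> K \<or> (\<exists>s\<in>S. Im (mob (adj2 (scaling s)) (mob A z)) > Y))"
proof -
 define cl where "cl = (\<lambda>C. finite C \<and> C \<subseteq> \<Gamma> - {mat 1, - mat 1} \<and>
  (\<forall>z A. Im z > 0 --> A \<in> \<Gamma> --> A ~= mat 1 --> defect A z < 1/100 -->
   (\<exists>M\<in>\<Gamma>. \<exists>B\<in>C. (M ** A ** adj2 M) ** B = B ** (M ** A ** adj2 M))))"
 have "\<exists>C. cl C"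
 proof (rule thin_classes)
  fix C assume "finite C" "C \<subseteq> \<Gamma> - {mat 1, - mat 1}" "\<And>z A. Im z > 0 ==> A \<in> \<Gamma> ==> A ~= mat 1 ==> defect A z < 1/100 ==>
   \<exists>M\<in>\<Gamma>. \<exists>B\<in>C. (M ** A ** adj2 M) ** B = B ** (M ** A ** adj2 M)"
  thus "\<exists>C. cl C" unfolding cl_def by (intro exI[of _ C] conjI allI impI)
 qed
 then obtain C where C: "finite C" "C \<subseteq> \<Gamma> - {mat 1, - mat 1}"
  "\<And>z A. Im z > 0 ==> A \<in> \<Gamma> ==> A ~= mat 1 ==> defect A z < 1/100 ==>
   \<exists>M\<in>\<Gamma>. \<exists>B\<in>C. (M ** A ** adj2 M) ** B = B ** (M ** A ** adj2 M)"
  unfolding cl_def by blast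
 define good where "good = (\<lambda>B s. s \<in> cusps \<Gamma> \<and> (\<forall>Y. \<exists>e>0. \<forall>A\<in>\<Gamma>. \<forall>z. A ~= mat 1 --> A ** B = B ** A --> Im z > 0 --> defect A z < e --> Im (mob (adj2 (scaling s)) z) > Y))"
 define C1 where "C1 = {B \<in> C. \<bar>trace B\<bar> = 2}"
 have "\<forall>B\<in>C1. \<exists>s. good B s"
 proof
  fix B assume "B \<in> C1"
  hence B: "B \<in> \<Gamma>" "B ~= mat 1" "B ~= - mat 1" "\<bar>trace B\<bar> = 2" using C(2) by (auto simp: C1_def)
  show "\<exists>s. good B s" by (rule parabolic_gap[OF B]) (auto simp: good_def)
 qed
 then obtain sc where sc: "\<And>B. B \<in> C1 ==> good B (sc B)" by metis
 show ?thesis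
 proof (rule that[of "sc ` C1"])
  show "finite (sc ` C1)" using C(1) by (simp add: C1_def)
  show "sc ` C1 \<subseteq> cusps \<Gamma>" using sc by (auto simp: good_def)
  fix Y
  have "\<forall>B\<in>C. \<exists>e>0. \<forall>A\<in>\<Gamma>. \<forall>z. A ~= mat 1 --> A ** B = B ** A --> Im z > 0 --> defect A z < e -->
    (\<exists>s\<in>sc ` C1. Im (mob (adj2 (scaling s)) z) > Y)"
  proof
   fix B assume B: "B \<in> C"
   show "\<exists>e>0. \<forall>A\<in>\<Gamma>. \<forall>z. A ~= mat 1 --> A ** B = B ** A --> Im z > 0 --> defect A z < e -->
    (\<exists>s\<in>sc ` C1. Im (mob (adj2 (scaling s)) z) > Y)"
   proof (cases "\<bar>trace B\<bar> = 2")
    case True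
    hence "B \<in> C1" using B by (simp add: C1_def)
    thus ?thesis using sc[of B] unfolding good_def by blast
   next
    case False
    obtain e where "e > 0" "\<And>A z. A \<in> \<Gamma> ==> A ~= mat 1 ==> A ** B = B ** A ==> Im z > 0 ==> defect A z \<ge> e"
 by (rule nonparabolic_gap[of B]) (use False B C(2) in auto)
    thus ?thesis by (meson not_le)
   qed
  qed
  then obtain ee where ee: "\<And>B. B \<in> C ==> ee B > 0"
   "\<And>B A z. B \<in> C ==> A \<in> \<Gamma> ==> A ~= mat 1 ==> A ** B = B ** A ==> Im z > 0 ==> defect A z < ee B ==>
    (\<exists>s\<in>sc ` C1. Im (mob (adj2 (scaling s)) z) > Y)" by metis
  define e where "e = Min (insert (1/100) (ee ` C))"
  have e: "e > 0" using C(1) ee(1) by (simp add: e_def)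
  have e': "e \<le> 1/100" "\<And>B. B \<in> C ==> e \<le> ee B" unfolding e_def using C(1) by (intro Min_le; simp)+
  obtain K where K: "compact K" "K \<subseteq> UHP" "\<And>z. z \<in> thick e ==> \<exists>A\<in>\<Gamma>. mob A z \<in> K"
   using thick_compact[OF e] by blast
  show "\<exists>K. compact K \<and> K \<subseteq> UHP \<and>
    (\<forall>z\<in>UHP. \<exists>A\<in>\<Gamma>. mob A z \<in> K \<or> (\<exists>s\<in>sc ` C1. Im (mob (adj2 (scaling s)) (mob A z)) > Y))"
  proof (intro exI[of _ K] conjI K ballI)
   fix z assume "z \<in> UHP"
   hence z: "Im z > 0" by simp
   show "\<exists>A\<in>\<Gamma>. mob A z \<in> K \<or> (\<exists>s\<in>sc ` C1. Im (mob (adj2 (scaling s)) (mob A z)) > Y)"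
   proof (cases "z \<in> thick e")
    case True thus ?thesis using K(3) by blast
   next
    case False
    then obtain A where A: "A \<in> \<Gamma>" "A ~= mat 1" "defect A z < e" using z by (auto simp: thick_def)
    obtain M B where M: "M \<in> \<Gamma>" "B \<in> C" "(M ** A ** adj2 M) ** B = B ** (M ** A ** adj2 M)"
     using C(3)[of z A] A z e'(1) by auto
    have 1: "defect (M ** A ** adj2 M) (mob M z) < ee B"
     using defect_conj[of A M z] A M z e'(2)[OF M(2)] by simp
    have "M ** A ** adj2 M ~= mat 1"
    proof
     assume "M ** A ** adj2 M = mat 1"
     hence "adj2 M ** (M ** A ** adj2 M) ** M = mat 1" using M(1) by (simp add: adj2_mult)
     thus False using A M(1) by (simp add: matrix_mul_assoc adj2_mult)
    qed
    thus ?thesis using ee(2)[of B "M ** A ** adj2 M" "mob M z"] 1 M A z by (auto simp: Im_mob_pos)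
   qed
  qed
 qed
qed

end

section \<open>Holomorphic functions of a periodic variable\<close>

lemma periodic_int:
 assumes "\<And>z. Im z > Y ==> E (z + of_real w) = (E z :: complex)" "Im z > Y"
 shows "E (z + of_int n * of_real w) = E z"
proof -
 have nat: "E (z + of_nat n * of_real w) = E z" if "Im z > Y" for n z
  using that
 proof (induction n)
  case (Suc n)
  have "E (z + of_nat (Suc n) * of_real w) = E ((z + of_nat n * of_real w) + of_real w)" by (simp add: algebra_simps)
  also have "... = E (z + of_nat n * of_real w)" using Suc.prems by (intro assms(1)) simp
  finally show ?case using Suc by simp
 qed simp
 show ?thesis
 proof (cases n rule: int_cases2)
  case (nonneg k)
  thus ?thesis using nat[OF assms(2), of k] by simp
 next
  case (nonpos k)
  show ?thesis using nat[of "z + of_int n * of_real w" k] assms(2) nonpos by simp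
 qed
qed

definition qexp :: "real => complex => complex" where
 "qexp w z = exp (2 * of_real pi * \<i> * z / of_real w)"

lemma qexp_nz [simp]: "qexp w z ~= 0"
 by (simp add: qexp_def)

lemma norm_qexp: "norm (qexp w z) = exp (- 2 * pi * Im z / w)"
 by (simp add: qexp_def)

lemma qexp_surj:
 assumes "w > 0" "q ~= 0"
 shows "qexp w (of_real w * Ln q / (2 * of_real pi * \<i>)) = q" "Im (of_real w * Ln q / (2 * of_real pi * \<i>)) = - w * ln (norm q) / (2 * pi)"
proof -
 show "qexp w (of_real w * Ln q / (2 * of_real pi * \<i>)) = q" using assms by (simp add: qexp_def)
 have "of_real w * Ln q / (2 * of_real pi * \<i>) = of_real (w / (2 * pi)) * (- \<i> * Ln q)" by (simp add: field_simps)
 thus "Im (of_real w * Ln q / (2 * of_real pi * \<i>)) = - w * ln (norm q) / (2 * pi)"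
  using assms(2) by simp
qed

lemma qexp_eqD:
 assumes "w > 0" "qexp w z = qexp w z'"
 shows "\<exists>n. z = z' + of_int n * of_real w"
proof -
 obtain n where n: "2 * of_real pi * \<i> * z / of_real w = 2 * of_real pi * \<i> * z' / of_real w + of_real (of_int (2 * n) * pi) * \<i>"
  using assms(2) unfolding qexp_def exp_eq by blast
 have "2 * of_real pi * \<i> * z = 2 * of_real pi * \<i> * (z' + of_int n * of_real w)"
  using n assms(1) by (simp add: field_simps)
 thus ?thesis by simp
qed

text \<open>\<open>g\<close> is E composed with a logarithm. The principal branch has a cut, but
  periodicity makes the choice of branch irrelevant, so near each \<open>q0\<close> the branch
  \<open>M\<close> centred there shows that \<open>g\<close> is differentiable.\<close>

lemma periodic_factor:
 assumes w: "w > 0" and hol: "E holomorphic_on {z. Im z > Y}" and per: "\<And>z. Im z > Y ==> E (z + of_real w) = E z"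
 shows "\<exists>g. g holomorphic_on (ball 0 (exp (- 2 * pi * Y / w)) - {0}) \<and> (\<forall>z. Im z > Y --> E z = g (qexp w z))"
proof -
 define L where "L = (\<lambda>q. of_real w * Ln q / (2 * of_real pi * \<i>))"
 define g where "g = (\<lambda>q. E (L q))"
 have L: "qexp w (L q) = q" "Im (L q) = - w * ln (norm q) / (2 * pi)" if "q ~= 0" for q
  using qexp_surj[OF w that] by (simp_all add: L_def)
 have ImL: "Im (L q) > Y" if "q \<in> ball 0 (exp (- 2 * pi * Y / w)) - {0}" for q
 proof -
  have "Y < - w * ln (norm q) / (2 * pi)" using that ln_less_cancel_iff[of "norm q" "exp (- 2 * pi * Y / w)"] w by (simp add: field_simps)
  thus ?thesis using that L(2)[of q] by simp
 qed
 have eq: "E z = g (qexp w z)" if z: "Im z > Y" for z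
 proof -
  have "qexp w (L (qexp w z)) = qexp w z" by (rule L) simp
  then obtain n where n: "L (qexp w z) = z + of_int n * of_real w" using qexp_eqD[OF w] by blast
  show ?thesis using periodic_int[of Y E w z n] per z by (simp add: g_def n)
 qed
 have "g holomorphic_on (ball 0 (exp (- 2 * pi * Y / w)) - {0})"
 proof (rule holomorphic_onI, rule field_differentiable_at_within)
  fix q0 :: complex assume q0: "q0 \<in> ball 0 (exp (- 2 * pi * Y / w)) - {0}"
  define M where "M = (\<lambda>q. L q0 + of_real w * Ln (q / q0) / (2 * of_real pi * \<i>))"
  have q0n: "q0 ~= 0" using q0 by simp
  have M0: "M q0 = L q0" using q0n by (simp add: M_def)
  have Md: "M field_differentiable at q0"
  proof -
   have "((\<lambda>q. q / q0) has_field_derivative 1 / q0) (at q0)" by (intro DERIV_cdivide DERIV_ident)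
   moreover have "(Ln has_field_derivative inverse (q0 / q0)) (at (q0 / q0))"
    using q0n by (intro has_field_derivative_Ln) simp
   ultimately have "((\<lambda>q. Ln (q / q0)) has_field_derivative inverse (q0 / q0) * (1 / q0)) (at q0)"
 by (rule DERIV_chain2[rotated])
   hence "((\<lambda>q. L q0 + of_real w * Ln (q / q0) / (2 * of_real pi * \<i>)) has_field_derivative
     0 + of_real w * (inverse (q0 / q0) * (1 / q0)) / (2 * of_real pi * \<i>)) (at q0)"
 by (intro DERIV_add DERIV_const DERIV_cdivide DERIV_cmult)
   thus ?thesis unfolding M_def field_differentiable_def by blast
  qed
  have mexp: "qexp w (M q) = q" if "q ~= 0" for q
  using w that q0n L by (auto simp: qexp_def M_def ring_distribs exp_add)
  have "continuous (at q0) (\<lambda>q. Im (M q))"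
   using field_differentiable_imp_continuous_at[OF Md] by simp
  hence "((\<lambda>q. Im (M q)) \<longlongrightarrow> Im (M q0)) (nhds q0)" using tendsto_at_iff_tendsto_nhds[of "\<lambda>q. Im (M q)" q0] by (simp only: isCont_def)
  hence "eventually (\<lambda>q. Im (M q) > Y) (nhds q0)" using ImL[OF q0] M0 by (intro order_tendstoD(1)) auto
  moreover have "eventually (\<lambda>q. q ~= 0) (nhds q0)" using q0n by (intro eventually_nhds_in_open[of "- {0}", simplified]) auto
  ultimately have ev: "eventually (\<lambda>q. E (M q) = g q) (nhds q0)"
  proof eventually_elim
   case (elim q)
   thus ?case using eq[of "M q"] mexp[of q] by simp
  qed
  have "E field_differentiable at (M q0)"
   using hol ImL[OF q0] M0 by (metis (mono_tags, lifting) holomorphic_on_open mem_Collect_eq open_halfspace_Im_gt field_differentiable_def)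
  then obtain D where "((\<lambda>q. E (M q)) has_field_derivative D) (at q0)" using field_differentiable_compose[OF Md] by (auto simp: o_def field_differentiable_def)
  thus "g field_differentiable at q0" using DERIV_cong_ev[OF refl ev refl] by (auto simp: field_differentiable_def)
 qed
 thus ?thesis using eq by blast
qed

lemma periodic_factor_bounded:
 assumes w: "w > 0" and hol: "E holomorphic_on UHP" and per: "\<And>z. Im z > 0 ==> E (z + of_real w) = E z"
  and bd: "\<And>z. Im z \<ge> 1 ==> norm (E z) \<le> B"
 shows "\<exists>g. g holomorphic_on ball 0 1 \<and> (\<forall>z\<in>UHP. E z = g (qexp w z))"
proof -
 obtain g where g: "g holomorphic_on (ball 0 1 - {0})" "\<And>z. Im z > 0 ==> E z = g (qexp w z)"
  using periodic_factor[OF w, of E 0] hol per by (auto simp: upper_half_plane_def)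
 have bdd: "norm (g q) \<le> B" if q: "q \<in> ball 0 (exp (- 2 * pi / w))" "q ~= 0" for q
 proof -
  define z where "z = of_real w * Ln q / (2 * of_real pi * \<i>)"
  have "1 \<le> - w * ln (norm q) / (2 * pi)" using q ln_less_cancel_iff[of "norm q" "exp (- 2 * pi / w)"] w by (simp add: field_simps)
  hence z: "Im z \<ge> 1" "qexp w z = q" using qexp_surj[OF w q(2)] by (simp_all add: z_def)
  thus ?thesis using bd[of z] g(2)[of z] by simp
 qed
 have "eventually (\<lambda>q. q \<in> ball 0 (exp (- 2 * pi / w))) (nhds 0)" by (intro eventually_nhds_in_open) auto
 hence "eventually (\<lambda>q. norm (g q) \<le> B) (at 0)"
  unfolding eventually_at_filter by eventually_elim (use bdd in auto)
 then obtain h where h: "h holomorphic_on ball 0 1" "\<And>q. q \<in> ball 0 1 - {0} ==> h q = g q" using holomorphic_on_extend_bounded[OF g(1)] by auto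
 have "E z = h (qexp w z)" if z: "Im z > 0" for z
 using w z h(2)[of "qexp w z"] g(2)[OF z] by (auto simp: norm_qexp)
 thus ?thesis using h(1) by auto
qed

section \<open>Charts for a space of modular forms\<close>

lemma divide_by_t:
 assumes "F holomorphic_on S" "open S" "0 \<in> S" "F 0 = 0"
 shows "\<exists>g. g holomorphic_on S \<and> (\<forall>t\<in>S. F t = t * g t)"
proof -
 have "(\<lambda>z. if z = 0 then deriv F 0 else (F z - F 0) / (z - 0)) holomorphic_on S"
  using assms by (intro pole_lemma) (auto simp: interior_open)
 thus ?thesis using assms(4) by auto
qed

text \<open>Here k is the largest power of t dividing the whole family; it exists because a member
  that is not identically zero has finite order at 0. After the division some member is nonzero at
  0.\<close>

lemma min_order:
 fixes u :: "'f => complex => complex"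
 assumes S: "open S" "connected S" "0 \<in> S" and hol: "\<And>F. F \<in> W ==> u F holomorphic_on S"
  and nz: "\<exists>F\<in>W. \<exists>t\<in>S. u F t ~= 0"
 shows "\<exists>k g. (\<forall>F\<in>W. g F holomorphic_on S \<and> (\<forall>t\<in>S. u F t = t ^ k * g F t)) \<and> (\<exists>F\<in>W. g F 0 ~= 0)"
proof -
 define dvs where "dvs = (\<lambda>k. \<forall>F\<in>W. \<exists>g. g holomorphic_on S \<and> (\<forall>t\<in>S. u F t = t ^ k * g t))"
 obtain F0 t0 where F0: "F0 \<in> W" "t0 \<in> S" "u F0 t0 ~= 0" using nz by blast
 have dvs0: "dvs 0" using hol by (auto simp: dvs_def)
 have step: "dvs (Suc k)" if dk: "dvs k" and dz: "\<And>F g. F \<in> W ==> g holomorphic_on S ==> (\<forall>t\<in>S. u F t = t ^ k * g t) ==> g 0 = 0" for k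
  unfolding dvs_def
 proof
  fix F assume F: "F \<in> W"
  then obtain g where g: "g holomorphic_on S" "\<forall>t\<in>S. u F t = t ^ k * g t" using dk by (auto simp: dvs_def)
  then obtain h where "h holomorphic_on S" "\<forall>t\<in>S. g t = t * h t" using divide_by_t[OF g(1) S(1,3)] dz[OF F g] by blast
  thus "\<exists>g. g holomorphic_on S \<and> (\<forall>t\<in>S. u F t = t ^ Suc k * g t)" using g(2) by auto
 qed
 have "\<not> (\<forall>k. dvs k)"
 proof
  assume all: "\<forall>k. dvs k"
  obtain G where G: "\<And>k. G k holomorphic_on S" "\<And>k t. t \<in> S ==> u F0 t = t ^ k * G k t"
  proof -
   have "\<forall>k. \<exists>g. g holomorphic_on S \<and> (\<forall>t\<in>S. u F0 t = t ^ k * g t)" using all F0(1) unfolding dvs_def by blast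
   then obtain G where "\<forall>k. G k holomorphic_on S \<and> (\<forall>t\<in>S. u F0 t = t ^ k * G k t)" by metis
   thus ?thesis using that by blast
  qed
  have "u F0 0 = 0" using G(2)[OF S(3), of 1] by simp
  obtain g r n where n: "0 < n" "0 < r" "ball 0 r \<subseteq> S" "g holomorphic_on ball 0 r"
   "\<And>w. w \<in> ball 0 r ==> u F0 w = (w - 0) ^ n * g w" "\<And>w. w \<in> ball 0 r ==> g w ~= 0" using F0 \<open>u F0 0 = 0\<close> S(3) holomorphic_factor_zero_nonconstant[OF hol[OF F0(1)] S \<open>u F0 0 = 0\<close>] unfolding constant_on_def by metis
  have "g w = w * G (Suc n) w" if "w \<in> ball 0 r" "w ~= 0" for w
   using n(5)[OF that(1)] G(2)[of w "Suc n"] n(3) that by auto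
  hence "eventually (\<lambda>w. w * G (Suc n) w = g w) (at 0)"
   unfolding eventually_at using n(2) by auto
  moreover have "((\<lambda>w. w * G (Suc n) w) \<longlongrightarrow> 0 * G (Suc n) 0) (at 0)"
   using holomorphic_on_imp_continuous_on[OF G(1)[of "Suc n"]] S continuous_on_eq_continuous_at[OF S(1)]
 by (intro tendsto_mult tendsto_ident_at) (auto simp: isCont_def)
  ultimately have "(g \<longlongrightarrow> 0) (at 0)" using tendsto_cong by fastforce
  moreover have "(g \<longlongrightarrow> g 0) (at 0)"
   using holomorphic_on_imp_continuous_on[OF n(4)] n(2) continuous_on_eq_continuous_at[of "ball 0 r" g] by (auto simp: isCont_def)
  ultimately show False using LIM_unique n(6)[of 0] n(2) by auto
 qed
 then obtain k where k: "dvs k" "\<not> dvs (Suc k)" using dvs0 by (metis nat_induct)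
 obtain G where G: "\<And>F. F \<in> W ==> G F holomorphic_on S \<and> (\<forall>t\<in>S. u F t = t ^ k * G F t)"
  using k(1) unfolding dvs_def by metis
 obtain F g where F: "F \<in> W" "g holomorphic_on S" "\<forall>t\<in>S. u F t = t ^ k * g t" "g 0 ~= 0" using step[OF k(1)] k(2) by blast
 show ?thesis
 by (intro exI[of _ k] exI[of _ "G(F := g)"]) (use G F in auto)
qed

text \<open>A chart evaluates all forms of \<open>W\<close> simultaneously, up to a factor common to
  them. The nowhere zero member makes it a map to projective space. Only for t different from 0 is
  it tied to a point of the half-plane, since the centre may be a cusp or a common zero.\<close>

definition is_chart :: "cfun set => (cfun => complex => complex) => bool" where
 "is_chart W \<Psi> \<longleftrightarrow> (\<forall>F\<in>W. \<Psi> F holomorphic_on ball 0 2) \<and> (\<exists>F\<in>W. \<forall>t\<in>ball 0 2. \<Psi> F t ~= 0) \<and>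
   (\<forall>t\<in>ball 0 2 - {0}. \<exists>z\<in>UHP. \<exists>a. a ~= 0 \<and> (\<forall>F\<in>W. \<Psi> F t = a * F z))"

lemma cusp_parabolic:
 assumes G: "subgroup \<Gamma> SL2R" and s: "s \<in> cusps \<Gamma>"
 shows "\<exists>B\<in>\<Gamma>. \<exists>p q. adj2 (scaling s) ** B ** scaling s = mat2 p q 0 p \<and> p\<^sup>2 = 1 \<and> q ~= 0"
proof -
 obtain B where B: "B \<in> \<Gamma>" "parabolic B" "act B s = s" and s': "s \<in> insert Infty (Fin ` \<real>)"
  using s by (auto simp: cusps_def)

 define C where "C = adj2 (scaling s) ** B ** scaling s"
 have C21: "C $ 2 $ 1 = 0"
 proof (cases s)
  case Infty
  thus ?thesis using B(3) by (auto simp: C_def split: if_splits)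
 next
  case (Fin z)
  then obtain x where x: "z = of_real x" using s' by (auto elim: Reals_cases)
  have nz: "cocyc B z ~= 0" "mob B z = z" using B(3) Fin by (auto split: if_splits)
  have "complex_of_real (B$1$1 * x + B$1$2) = of_real (x * (B$2$1 * x + B$2$2))" using nz by (auto simp: mob_eq field_simps x cocyc_def)
  hence "B$1$1 * x + B$1$2 = x * (B$2$1 * x + B$2$2)" using of_real_eq_iff by blast
  thus ?thesis by (simp add: C_def matrix_mult_sel Fin x algebra_simps)
 qed
 have dC: "det C = 1" using subgroup.mem_carrier[OF G B(1)] by (simp add: C_def det_mul)
 have B_C: "B = scaling s ** C ** adj2 (scaling s)" by (simp add: C_def matrix_mul_assoc adj2_mult)

 define p d where "p = C$1$1" and "d = C$2$2"
 have pd: "p * d = 1" using dC C21 by (simp add: det_2 p_def d_def)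
 have "\<bar>p + d\<bar> = 2" using trace_conj[of "scaling s" C] B(2) by (auto simp: B_C parabolic_def trace_2 p_def d_def)
 hence "(p + d)\<^sup>2 = 4" by (metis power2_abs power2_eq_square mult_2 numeral_Bit0)
 hence "(p - d)\<^sup>2 = 0" using pd by (simp add: power2_eq_square algebra_simps)
 hence pd2: "p = d" by simp
 hence p2: "p\<^sup>2 = 1" using pd by (simp add: power2_eq_square)
 have q: "C$1$2 ~= 0"
 proof
  assume "C$1$2 = 0"
  moreover have "p = 1 \<or> p = -1" using p2 by (simp add: power2_eq_1_iff)
  ultimately have "C = mat 1 \<or> C = - mat 1" using C21 pd2 by (auto intro!: mat2_eqI simp: p_def d_def)
  hence "B = mat 1 \<or> B = - mat 1"
  proof
   assume "C = mat 1" thus ?thesis using B_C by (simp add: adj2_mult)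
  next
   assume "C = - mat 1"
   hence "B = - (scaling s ** adj2 (scaling s))" unfolding B_C
 by (intro mat2_eqI) (simp_all add: matrix_mult_sel)
   thus ?thesis by (simp add: adj2_mult)
  qed
  thus False using B(2) by (auto simp: parabolic_def)
 qed
 have "C = mat2 p (C$1$2) 0 p" using C21 pd2 by (intro mat2_eqI) (simp_all add: p_def d_def)
 thus ?thesis using B(1) p2 q unfolding C_def by blast
qed

lemma holomorphic_at_cusp_bounded:
 assumes "holomorphic_at_cusp m s F"
 shows "\<exists>B. \<forall>z. Im z \<ge> 1 --> norm (F (mob (scaling s) z) / cocyc (scaling s) z ^ m) \<le> B"
proof -
 obtain w a where w: "w > 0" and sm': "\<forall>z\<in>{z. Im z > 0}. (\<lambda>n. a n * exp (2 * of_real pi * \<i> * of_nat n * z / of_real w)) sums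
       (F (mob (scaling s) z) / cocyc (scaling s) z ^ m)"
  using assms unfolding holomorphic_at_cusp_def upper_half_plane_def by blast
 have sm: "(\<lambda>n. a n * exp (2 * of_real pi * \<i> * of_nat n * z / of_real w)) sums
       (F (mob (scaling s) z) / cocyc (scaling s) z ^ m)" if "Im z > 0" for z
  using sm' that by blast
 define G where "G = (\<lambda>q. suminf (\<lambda>n. a n * q ^ n))"
 have pw: "exp (2 * of_real pi * \<i> * of_nat n * z / of_real w) = qexp w z ^ n" for n z
  unfolding qexp_def by (subst exp_of_nat_mult[symmetric]) (simp add: mult_ac)
 have s1: "(\<lambda>n. a n * q ^ n) sums G q" if "q \<in> ball 0 1" for q
 proof (cases "q = 0")
  case True thus ?thesis by (simp add: G_def)
 next
  case False
  define z where "z = of_real w * Ln q / (2 * of_real pi * \<i>)"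
  have z: "qexp w z = q" "Im z = - w * ln (norm q) / (2 * pi)" using qexp_surj[OF w False] by (auto simp: z_def)
  show ?thesis using that False w z(2) sm[of z] by (auto simp: pw z(1) G_def divide_neg_pos mult_pos_neg sums_iff)
 qed
 have hG: "G holomorphic_on ball 0 1"
 by (rule power_series_holomorphic[of 0 1 a]) (use s1 in auto)
 define R where "R = exp (- 2 * pi / w)"
 have R: "R < 1" using w by (simp add: R_def)
 have "compact (G ` cball 0 R)"
 by (intro compact_continuous_image holomorphic_on_imp_continuous_on holomorphic_on_subset[OF hG]) (use R in auto)
 then obtain B where B: "\<And>q. q \<in> cball 0 R ==> norm (G q) \<le> B"
  using compact_imp_bounded bounded_iff by (metis (no_types, lifting) image_eqI)
 have "norm (F (mob (scaling s) z) / cocyc (scaling s) z ^ m) \<le> B" if z: "Im z \<ge> 1" for z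
 proof -
  have n: "norm (qexp w z) \<le> R" using w z by (simp add: norm_qexp R_def divide_right_mono)
  hence "qexp w z \<in> ball 0 1" using R by simp
  from s1[OF this] show ?thesis using sm[of z] z sums_unique2 B n by (force simp: pw)
 qed
 thus ?thesis by blast
qed

text \<open>A single width serves all forms. Under the parabolic generator every form is multiplied
  by the same c = chi(B) p^m with p = 1 or p = -1; since chi has finite order, c^(2 N) = 1 and 2 N
  shifts give a genuine period.\<close>

lemma modular_form_cusp_expansion:
 assumes G: "subgroup \<Gamma> SL2R" and chi: "finite_order_character \<Gamma> chi" and s: "s \<in> cusps \<Gamma>"
 shows "\<exists>w>0. \<forall>F\<in>modular_forms \<Gamma> chi m. \<exists>g. g holomorphic_on ball 0 1 \<and>
   (\<forall>z\<in>UHP. F (mob (scaling s) z) / cocyc (scaling s) z ^ m = g (qexp w z))"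
proof -
 obtain B p q where B: "B \<in> \<Gamma>" "adj2 (scaling s) ** B ** scaling s = mat2 p q 0 p" "p\<^sup>2 = 1" "q ~= 0"
  using cusp_parabolic[OF G s] by blast
 obtain N where N: "N \<ge> 1" "\<And>A. A \<in> \<Gamma> ==> chi A ^ N = 1" using chi by (auto simp: finite_order_character_def)
 define \<sigma> where "\<sigma> = scaling s"
 have d\<sigma>: "det \<sigma> = 1" by (simp add: \<sigma>_def)
 have dB: "det B = 1" using subgroup.mem_carrier[OF G B(1)] by simp
 have pnz: "p ~= 0" using B(3) by auto
 define c where "c = chi B * of_real p ^ m"
 have cpow: "c ^ (2 * N) = 1"
 proof -
  have "c ^ (2 * N) = (chi B ^ N) ^ 2 * complex_of_real (p\<^sup>2) ^ (m * N)"
  proof -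
   have "(p ^ m) ^ (2 * N) = (p\<^sup>2) ^ (m * N)" by (simp only: power_mult[symmetric] mult_ac)
   hence "(complex_of_real p ^ m) ^ (2 * N) = complex_of_real (p\<^sup>2) ^ (m * N)"
 by (simp only: of_real_power[symmetric])
   moreover have "chi B ^ (2 * N) = (chi B ^ N)\<^sup>2" by (simp only: power_mult[symmetric] mult.commute)
   ultimately show ?thesis unfolding c_def power_mult_distrib by simp
  qed
  thus ?thesis using N(2)[OF B(1)] B(3) by simp
 qed
 have shift: "F (mob \<sigma> (z + of_real (q / p))) / cocyc \<sigma> (z + of_real (q / p)) ^ m = c * (F (mob \<sigma> z) / cocyc \<sigma> z ^ m)"
  if F: "F \<in> modular_forms \<Gamma> chi m" and z: "Im z > 0" for F z
 proof -
  have m2: "det (mat2 p q 0 p) = 1" using B(3) by (simp add: det_2 power2_eq_square)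
  have mobT: "mob (mat2 p q 0 p) z = z + of_real (q / p)" "cocyc (mat2 p q 0 p) z = of_real p"
   using pnz by (auto simp: mob_eq cocyc_def)
  have BS: "B ** \<sigma> = \<sigma> ** mat2 p q 0 p" unfolding \<sigma>_def B(2)[symmetric] by (simp add: matrix_mul_assoc adj2_mult)
  have e1: "mob \<sigma> (z + of_real (q / p)) = mob B (mob \<sigma> z)"
   using mob_mult[OF d\<sigma> m2 z] mob_mult[OF dB d\<sigma> z] by (simp add: mobT BS)
  have e2: "cocyc \<sigma> (z + of_real (q / p)) * of_real p = cocyc B (mob \<sigma> z) * cocyc \<sigma> z"
   using cocyc_mult[OF m2 z, of \<sigma>] cocyc_mult[OF d\<sigma> z, of B] by (simp add: mobT BS)
  have pos: "Im (mob \<sigma> z) > 0" using Im_mob_pos[OF d\<sigma> z] .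
  have F1: "F (mob B (mob \<sigma> z)) = chi B * cocyc B (mob \<sigma> z) ^ m * F (mob \<sigma> z)"
   using F B(1) pos by (simp add: modular_forms_def)

  have e3: "cocyc B (mob \<sigma> z) ^ m * cocyc \<sigma> z ^ m = cocyc \<sigma> (z + of_real (q / p)) ^ m * of_real p ^ m"
 by (metis e2 power_mult_distrib)
  show ?thesis unfolding e1 F1 c_def using cocyc_nz[OF d\<sigma>, of z] cocyc_nz[OF d\<sigma>, of "z + of_real (q / p)"] z e3 by (simp add: field_simps)
 qed
 define w0 where "w0 = of_nat (2 * N) * (q / p)"
 have w0: "w0 ~= 0" using N(1) B(4) pnz by (simp add: w0_def)
 have per: "F (mob \<sigma> (z + of_real w0)) / cocyc \<sigma> (z + of_real w0) ^ m = F (mob \<sigma> z) / cocyc \<sigma> z ^ m"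
  if F: "F \<in> modular_forms \<Gamma> chi m" and z: "Im z > 0" for F z
 proof -
  have "F (mob \<sigma> (z + of_real (of_nat n * (q / p)))) / cocyc \<sigma> (z + of_real (of_nat n * (q / p))) ^ m = c ^ n * (F (mob \<sigma> z) / cocyc \<sigma> z ^ m)" for n
  proof (induction n)
   case (Suc n)
   have eq: "z + complex_of_real (of_nat (Suc n) * (q / p)) = (z + of_real (of_nat n * (q / p))) + of_real (q / p)"
 by (simp add: algebra_simps)
   show ?case unfolding eq by (subst shift[OF F]) (use z Suc in simp_all)
  qed simp
  from this[of "2 * N"] show ?thesis by (simp add: cpow w0_def)
 qed
 define w where "w = \<bar>w0\<bar>"
 have w: "w > 0" using w0 by (simp add: w_def)
 have perw: "F (mob \<sigma> (z + of_real w)) / cocyc \<sigma> (z + of_real w) ^ m = F (mob \<sigma> z) / cocyc \<sigma> z ^ m"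
  if F: "F \<in> modular_forms \<Gamma> chi m" and z: "Im z > 0" for F z
  using per[OF F z] per[OF F, of "z + of_real w"] z by (cases "w0 > 0") (simp_all add: w_def)
 have "\<exists>g. g holomorphic_on ball 0 1 \<and> (\<forall>z\<in>UHP. F (mob \<sigma> z) / cocyc \<sigma> z ^ m = g (qexp w z))"
  if F: "F \<in> modular_forms \<Gamma> chi m" for F
 proof -
  have Fh: "F holomorphic_on UHP" using F by (simp add: modular_forms_def)
  have "(F \<circ> mob \<sigma>) holomorphic_on UHP"
 by (rule holomorphic_on_compose_gen[OF mob_holomorphic[OF d\<sigma>] Fh]) (use Im_mob_pos[OF d\<sigma>] in auto)
  hence "(\<lambda>z. F (mob \<sigma> z) / cocyc \<sigma> z ^ m) holomorphic_on UHP"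
   unfolding o_def using cocyc_nz[OF d\<sigma>] by (auto intro!: holomorphic_intros cocyc_holomorphic)
  moreover obtain B' where "\<And>z. Im z \<ge> 1 ==> norm (F (mob \<sigma> z) / cocyc \<sigma> z ^ m) \<le> B'"
   using holomorphic_at_cusp_bounded[of m s F] F s unfolding modular_forms_def \<sigma>_def by blast
  ultimately show ?thesis by (intro periodic_factor_bounded[OF w, where B = B']) (use perw[OF F] in auto)
 qed
 thus ?thesis using w unfolding \<sigma>_def by blast
qed

section \<open>Punctured neighbourhoods and local parameters\<close>

lemma filter_at_UHP: "Im a > 0 ==> punctured_nhds (Fin a) = at a"
 by (simp add: punctured_nhds_def)

lemma eventually_filtercomap_Im: "eventually Q (filtercomap Im at_top) \<longleftrightarrow> (\<exists>Y>0. \<forall>z. Im z > Y --> Q z)"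
proof
 assume "eventually Q (filtercomap Im at_top)"
 then obtain R where R: "eventually R at_top" "\<And>z. R (Im z) ==> Q z" by (auto simp: eventually_filtercomap)
 then obtain Y where "\<And>y. y > Y ==> R y" unfolding eventually_at_top_dense by blast
 thus "\<exists>Y>0. \<forall>z. Im z > Y --> Q z" using R(2) by (intro exI[of _ "max Y 1"]) auto
next
 assume "\<exists>Y>0. \<forall>z. Im z > Y --> Q z"
 then obtain Y where Y: "\<And>z. Im z > Y ==> Q z" by blast
 have "eventually (\<lambda>y. y > Y) (at_top :: real filter)" by simp
 thus "eventually Q (filtercomap Im at_top)" using Y unfolding eventually_filtercomap by blast
qed

lemma eventually_horoball:
 "eventually Q (horoball_filter s) \<longleftrightarrow> (\<exists>Y>0. \<forall>z. Im z > Y --> Q (mob (scaling s) z))"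
 by (simp add: horoball_filter_def eventually_filtermap eventually_filtercomap_Im)

definition boundary :: "riemann_sphere set" where
 "boundary = insert Infty (Fin ` \<real>)"

text \<open>A zero in the lower left corner says that infinity is fixed. Together with
  \<open>scaling\<close> this turns statements about boundary points into matrix identities, which
  avoids case distinctions between finite points and infinity.\<close>

lemma act_boundary:
 assumes "s \<in> boundary" "det A = 1"
 shows "act A s \<in> boundary" "(adj2 (scaling (act A s)) ** A ** scaling s) $ 2 $ 1 = 0"
proof -
 have "act A s \<in> boundary \<and> (adj2 (scaling (act A s)) ** A ** scaling s) $ 2 $ 1 = 0"
 proof (cases s)
  case Infty
  thus ?thesis by (simp add: boundary_def matrix_mult_sel)
 next
  case (Fin z)
  then obtain x where x: "z = of_real x" using assms(1) by (auto simp: boundary_def elim: Reals_cases)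
  have c: "cocyc A z = of_real (A$2$1 * x + A$2$2)" by (simp add: cocyc_def x)
  have m: "mob A z = of_real ((A$1$1 * x + A$1$2) / (A$2$1 * x + A$2$2))" by (simp add: mob_eq c) (simp add: x)
  show ?thesis
  proof (cases "A$2$1 * x + A$2$2 = 0")
   case True
   thus ?thesis by (simp add: Fin c boundary_def matrix_mult_sel) (simp add: x)
  next
   case False
   thus ?thesis by (simp add: Fin c m boundary_def matrix_mult_sel del: of_real_add of_real_divide of_real_mult) (simp add: x field_simps)
  qed
 qed
 thus "act A s \<in> boundary" "(adj2 (scaling (act A s)) ** A ** scaling s) $ 2 $ 1 = 0" by auto
qed

lemma boundary_unique:
 assumes "s \<in> boundary" "s' \<in> boundary" "det M = 1" "(adj2 (scaling s) ** M) $ 2 $ 1 = 0" "(adj2 (scaling s') ** M) $ 2 $ 1 = 0"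
 shows "s = s'"
proof -
 have nz: "M$1$1 ~= 0 \<or> M$2$1 ~= 0" using assms(3) by (auto simp: det_2)
 have eq: "r = r'" if r: "r * M$2$1 = M$1$1" "r' * M$2$1 = M$1$1" for r r'
 proof -
  have "M$2$1 ~= 0" using r nz by auto
  thus ?thesis using r by (metis mult_right_cancel)
 qed
 have b: "\<exists>r. z = of_real r" if "Fin z \<in> boundary" for z using that by (auto simp: boundary_def elim: Reals_cases)
 show ?thesis
 proof (cases s)
  case Infty
  thus ?thesis using assms nz b by (cases s') (auto simp: matrix_mult_sel)
 next
  case (Fin z)
  then obtain r where r: "z = of_real r" using b assms(1) by blast
  hence 1: "r * M$2$1 = M$1$1" using assms(4) by (simp add: Fin matrix_mult_sel)
  show ?thesis
  proof (cases s')
   case Infty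
   thus ?thesis using 1 assms(5) nz by simp
  next
   case (Fin z')
   then obtain r' where r': "z' = of_real r'" using b assms(2) by blast
   thus ?thesis using assms(5) eq[OF 1] r \<open>s = Fin z\<close> by (simp add: Fin matrix_mult_sel)
  qed
 qed
qed

lemma upper_triangular_mult:
 fixes A B :: "real^2^2"
 shows "A $ 2 $ 1 = 0 ==> B $ 2 $ 1 = 0 ==> (A ** B) $ 2 $ 1 = 0"
 by (simp add: matrix_mult_sel)

lemma cusps_boundary: "s \<in> cusps \<Gamma> ==> s \<in> boundary"
 by (auto simp: cusps_def boundary_def)

lemma boundary_not_UHP: "Fin z \<in> boundary ==> Im z = 0"
 by (auto simp: boundary_def complex_is_Real_iff)

lemma punctured_nhds_boundary: "s \<in> boundary ==> punctured_nhds s = horoball_filter s"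
 by (cases s) (auto simp: punctured_nhds_def dest: boundary_not_UHP)

lemma local_param_boundary: "s \<in> boundary ==> local_param \<Gamma> s = cusp_param \<Gamma> s"
 by (cases s) (auto simp: local_param_def fun_eq_iff dest: boundary_not_UHP)

lemma local_param_UHP: "Im a > 0 ==> local_param \<Gamma> (Fin a) z = ((z - a) / (z - cnj a)) ^ ramification \<Gamma> a"
 by (simp add: local_param_def)

lemma extended_cases:
 assumes "P \<in> EHP \<Gamma>"
 obtains a where "P = Fin a" "Im a > 0" | "P \<in> cusps \<Gamma>" "P \<in> boundary"
 using assms cusps_boundary by (auto simp: extended_half_plane_def)

lemma act_UHP: "det A = 1 ==> Im z > 0 ==> act A (Fin z) = Fin (mob A z)"
 using cocyc_nz by auto

lemma act_1: "P \<in> EHP \<Gamma> ==> act (mat 1) P = P"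
 by (cases P) (auto simp: cocyc_def)

text \<open>Between the two scalings A becomes an upper triangular matrix, which acts as a^2 z + b;
  heights are multiplied by a^2, so horoballs go to horoballs.\<close>

lemma filtermap_mob_horoball:
 assumes "det A = 1" "s \<in> boundary"
 shows "filtermap (mob A) (horoball_filter s) = horoball_filter (act A s)"
proof (rule filter_eqI)
 fix Q
 define T where "T = adj2 (scaling (act A s)) ** A ** scaling s"
 have T21: "T$2$1 = 0" using act_boundary(2)[OF assms(2,1)] by (simp add: T_def)
 have dT: "det T = 1" using assms(1) by (simp add: T_def det_mul)
 define a where "a = T$1$1"
 have ad: "a * T$2$2 = 1" using dT T21 by (simp add: det_2 a_def)
 hence a0: "a ~= 0" by auto
 have mT: "mob T z = of_real (a\<^sup>2) * z + of_real (a * T$1$2)" for z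
 proof -
  have d: "T$2$2 = 1 / a" using ad a0 by (simp add: field_simps)
  show ?thesis by (auto simp: mob_eq cocyc_def T21 d a_def power2_eq_square field_simps)
 qed

 have eq: "mob A (mob (scaling s) z) = mob (scaling (act A s)) (mob T z)" if "Im z > 0" for z
  using mob_mult[OF assms(1) det_scaling that, of s] mob_mult[OF det_scaling dT that, of "act A s"] by (auto simp: T_def matrix_mul_assoc adj2_mult)
 show "eventually Q (filtermap (mob A) (horoball_filter s)) = eventually Q (horoball_filter (act A s))"
  unfolding eventually_filtermap eventually_horoball
 proof
  assume "\<exists>Y>0. \<forall>z. Y < Im z --> Q (mob A (mob (scaling s) z))"
  then obtain Y where Y: "Y > 0" "\<And>z. Y < Im z ==> Q (mob A (mob (scaling s) z))" by blast
  have "Q (mob (scaling (act A s)) w)" if w: "Im w > a\<^sup>2 * Y" for w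
  proof -
   define z where "z = (w - of_real (a * T$1$2)) / of_real (a\<^sup>2)"
   have "mob T z = w" using a0 by (simp add: mT z_def)
   moreover have "Im z > Y" using w a0 unfolding z_def Im_divide_of_real by (simp add: pos_less_divide_eq mult.commute)
   ultimately show ?thesis using Y(1) Y(2)[of z] eq[of z] by auto
  qed
  moreover have "a\<^sup>2 * Y > 0" using Y a0 by simp
  ultimately show "\<exists>Y>0. \<forall>z. Y < Im z --> Q (mob (scaling (act A s)) z)" by blast
 next
  assume "\<exists>Y>0. \<forall>z. Y < Im z --> Q (mob (scaling (act A s)) z)"
  then obtain Y where Y: "Y > 0" "\<And>z. Y < Im z ==> Q (mob (scaling (act A s)) z)" by blast
  have "Q (mob A (mob (scaling s) z))" if z: "Im z > Y / a\<^sup>2" for z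
  proof -
   have "Y < a\<^sup>2 * Im z" using z a0 by (simp add: pos_divide_less_eq mult.commute)
   moreover have "Im (mob T z) = a\<^sup>2 * Im z" unfolding mT by simp
   moreover have "Im z > 0" using z Y(1) a0 by (meson divide_pos_pos dual_order.strict_trans zero_less_power2)
   ultimately show ?thesis using Y eq[of z] by auto
  qed
  moreover have "Y / a\<^sup>2 > 0" using Y a0 by simp
  ultimately show "\<exists>Y>0. \<forall>z. Y < Im z --> Q (mob A (mob (scaling s) z))" by blast
 qed
qed

lemma filtermap_mob_at:
 assumes "det A = 1" "Im a > 0"
 shows "filtermap (mob A) (at a) = at (mob A a)"
proof (rule filtermap_fun_inverse)
 have lim: "filterlim (mob B) (at (mob B b)) (at b)" if B: "det B = 1" and b: "Im b > 0" for B b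
 proof -
  have "(mob B \<longlongrightarrow> mob B b) (at b)" using mob_has_derivative[OF B b] DERIV_isCont by (simp add: isCont_def)
  moreover have "eventually (\<lambda>z. z \<in> UHP - {b}) (at b)"
   using b open_UHP by (intro eventually_at_in_open) auto
  hence "eventually (\<lambda>z. mob B z ~= mob B b) (at b)"
 by eventually_elim (use mob_inj[OF B] b in auto)
  ultimately show ?thesis by (simp add: filterlim_at)
 qed
 show "filterlim (mob A) (at (mob A a)) (at a)" using lim assms by blast
 show "filterlim (mob (adj2 A)) (at a) (at (mob A a))"
  using lim[of "adj2 A" "mob A a"] assms Im_mob_pos[OF assms] mob_adj2(2)[OF assms] by simp
 have "eventually (\<lambda>z. z \<in> UHP) (at (mob A a))"
  using Im_mob_pos[OF assms] open_UHP by (intro eventually_at_in_open') auto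
 thus "eventually (\<lambda>z. mob A (mob (adj2 A) z) = z) (at (mob A a))"
 by eventually_elim (use mob_adj2(1)[OF assms(1)] in auto)
qed

lemma eventually_UHP_punctured: "P \<in> EHP \<Gamma> ==> near P (\<lambda>z. Im z > 0)"
proof (erule extended_cases)
 fix a assume "P = Fin a" "Im a > 0"
 thus ?thesis using eventually_at_in_open'[OF open_UHP, of a] by (simp add: filter_at_UHP)
next
 assume "P \<in> boundary"
 thus ?thesis by (auto simp: punctured_nhds_boundary eventually_horoball intro!: exI[of _ 1] Im_mob_pos)
qed

lemma punctured_nhds_neq_bot: "P \<in> EHP \<Gamma> ==> punctured_nhds P ~= bot"
proof (erule extended_cases)
 assume "P \<in> boundary"
 moreover have "\<not> eventually (\<lambda>_. False) (horoball_filter P)"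
 proof
  assume "eventually (\<lambda>_. False) (horoball_filter P)"
  then obtain Y where Y: "\<And>z. \<not> Y < Im z" by (auto simp: eventually_horoball)
  from Y[of "Complex 0 (Y + 1)"] show False by simp
 qed
 ultimately show ?thesis by (auto simp: punctured_nhds_boundary)
qed (auto simp: filter_at_UHP)

lemma eventually_eventually_punctured:
 assumes P: "P \<in> EHP \<Gamma>" and Q: "near P Q"
 shows "near P (\<lambda>z. Im z > 0 \<and> Q z \<and> eventually Q (nhds z))"
proof -
 have "near P (\<lambda>z. eventually Q (nhds z))"
  using P
 proof (cases rule: extended_cases)
  case (1 a)
  then obtain S where S: "open S" "a \<in> S" "\<And>z. z \<in> S ==> z ~= a ==> Q z"
   using Q by (auto simp: filter_at_UHP eventually_at_topological)
  have "eventually (\<lambda>z. z \<in> S - {a}) (at a)" using S by (intro eventually_at_in_open) auto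
  thus ?thesis unfolding 1(1) filter_at_UHP[OF 1(2)]
  proof eventually_elim
   case (elim z)
   hence "eventually (\<lambda>w. w \<in> S - {a}) (nhds z)" using S by (intro eventually_nhds_in_open) auto
   thus ?case by eventually_elim (use S in auto)
  qed
 next
  case 2
  then obtain Y where Y: "Y > 0" "\<And>z. Im z > Y ==> Q (mob (scaling P) z)"
   using Q by (auto simp: punctured_nhds_boundary eventually_horoball)
  have "eventually Q (nhds (mob (scaling P) z))" if z: "Im z > Y" for z
  proof -
   have zp: "Im z > 0" using z Y(1) by simp
   have m: "Im (mob (scaling P) z) > 0" by (intro Im_mob_pos det_scaling zp)
   have "((\<lambda>w. Im (mob (adj2 (scaling P)) w)) \<longlongrightarrow> Im (mob (adj2 (scaling P)) (mob (scaling P) z))) (nhds (mob (scaling P) z))" using mob_has_derivative[of "adj2 (scaling P)", OF _ m] DERIV_isCont by (intro tendsto_Im) (simp add: isCont_def tendsto_at_iff_tendsto_nhds)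
   hence "eventually (\<lambda>w. Im (mob (adj2 (scaling P)) w) > Y) (nhds (mob (scaling P) z))"
    using mob_adj2(2)[OF det_scaling zp] z by (auto intro: order_tendstoD)
   moreover have "eventually (\<lambda>w. w \<in> UHP) (nhds (mob (scaling P) z))"
    using m open_UHP by (intro eventually_nhds_in_open) auto
   ultimately show ?thesis
   proof eventually_elim
    case (elim w)
    thus ?case using Y(2)[of "mob (adj2 (scaling P)) w"] mob_adj2(1)[OF det_scaling, of w] by simp
   qed
  qed
  thus ?thesis using Y(1) 2 by (auto simp: punctured_nhds_boundary eventually_horoball)
 qed
 thus ?thesis using eventually_UHP_punctured[OF P] Q by eventually_elim auto
qed

context discrete_SL2
begin

lemma act_cusp:
 assumes A: "A \<in> \<Gamma>" and s: "s \<in> cusps \<Gamma>"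
 shows "act A s \<in> cusps \<Gamma>"
proof -
 obtain B where B: "B \<in> \<Gamma>" "parabolic B" "act B s = s" using s by (auto simp: cusps_def)
 have sb: "s \<in> boundary" using s by (rule cusps_boundary)
 have dA: "det A = 1" and dB: "det B = 1" using A B by auto
 define s' where "s' = act A s"
 have s'b: "s' \<in> boundary" unfolding s'_def by (rule act_boundary(1)[OF sb dA])
 define T where "T = adj2 (scaling s') ** A ** scaling s"
 have T: "T$2$1 = 0" unfolding T_def s'_def by (rule act_boundary(2)[OF sb dA])
 have U: "(adj2 (scaling s) ** B ** scaling s)$2$1 = 0" using act_boundary(2)[OF sb dB] B(3) by simp
 define C where "C = A ** B ** adj2 A"
 have C: "C \<in> \<Gamma>" "det C = 1" unfolding C_def using A B by (auto simp: det_mul)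
 have "adj2 (scaling s') ** C ** scaling s' = T ** (adj2 (scaling s) ** B ** scaling s) ** adj2 T"
 by (simp add: T_def C_def adj2_prod matrix_mul_assoc)
 moreover have "adj2 T $2$1 = 0" using T by simp
 ultimately have "act C s' = s'" using upper_triangular_mult[OF upper_triangular_mult[OF T U]] boundary_unique[of "act C s'" s' "C ** scaling s'"] act_boundary[OF s'b C(2)] s'b C(2) by (simp add: matrix_mul_assoc det_mul)
 moreover have "parabolic C"
 proof -
  have "C = mat 1 ==> B = mat 1" "C = - mat 1 ==> B = - mat 1"
  proof -
   have "B = adj2 A ** C ** A" using dA by (simp add: C_def matrix_mul_assoc adj2_mult)
   thus "C = mat 1 ==> B = mat 1" "C = - mat 1 ==> B = - mat 1" using adj2_mult(2)[OF dA]
 by (auto intro!: mat2_eqI simp: matrix_mult_sel vec_eq_iff forall_2)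
  qed
  thus ?thesis using B(2) trace_conj[OF dA, of B] unfolding parabolic_def C_def by auto
 qed
 ultimately show ?thesis using C(1) s'b unfolding cusps_def s'_def[symmetric] boundary_def by blast
qed

lemma act_extended:
 assumes A: "A \<in> \<Gamma>" and P: "P \<in> EHP \<Gamma>"
 shows "act A P \<in> EHP \<Gamma>" "punctured_nhds (act A P) = filtermap (mob A) (punctured_nhds P)"
proof -
 have dA: "det A = 1" using A by simp
 have "act A P \<in> EHP \<Gamma> \<and> punctured_nhds (act A P) = filtermap (mob A) (punctured_nhds P)"
  using P
 proof (cases rule: extended_cases)
  case (1 a)
  show ?thesis unfolding 1(1) act_UHP[OF dA 1(2)] using Im_mob_pos[OF dA 1(2)] filtermap_mob_at[OF dA 1(2)] 1(2)
 by (simp add: filter_at_UHP extended_half_plane_def)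
 next
  case 2
  thus ?thesis using act_cusp[OF A 2(1)] filtermap_mob_horoball[OF dA 2(2)] cusps_boundary[OF act_cusp[OF A 2(1)]]
 by (simp add: punctured_nhds_boundary extended_half_plane_def)
 qed
 thus "act A P \<in> EHP \<Gamma>" "punctured_nhds (act A P) = filtermap (mob A) (punctured_nhds P)" by auto
qed

lemma orb_eqD:
 assumes "P' \<in> EHP \<Gamma>" "orb \<Gamma> P = orb \<Gamma> P'"
 shows "\<exists>A\<in>\<Gamma>. P' = act A P"
using act_1[OF assms(1)] assms(2) by (force simp: orb_def)

lemma proj_pt_mob:
 assumes "A \<in> \<Gamma>" "Im z > 0"
 shows "proj_pt \<Gamma> (mob A z) = proj_pt \<Gamma> z"
proof -
 have dA: "det A = 1" using assms by simp
 have "act B (Fin (mob A z)) = act (B ** A) (Fin z)" if "B \<in> \<Gamma>" for B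
  using that assms act_UHP[of B "mob A z"] act_UHP[of "B ** A" z] mob_mult[of B A z] Im_mob_pos[OF dA assms(2)]
 by (simp add: det_mul)
 moreover have "act B (Fin z) = act (B ** adj2 A) (Fin (mob A z))" if "B \<in> \<Gamma>" for B
  using that assms act_UHP[of "B ** adj2 A" "mob A z"] act_UHP[of B z] mob_mult[of B "adj2 A" "mob A z"] Im_mob_pos[OF dA assms(2)] mob_adj2(2)[OF dA assms(2)]
 by (simp add: det_mul)
 ultimately show ?thesis unfolding orb_def using mult_Gamma[OF _ assms(1)] mult_Gamma[OF _ adj2_Gamma[OF assms(1)]]
 by (intro subset_antisym image_subsetI) (metis imageI)+
qed

text \<open>The least element exists because bounded translation lengths correspond to group
  elements, up to sign, of bounded norm, of which there are finitely many. The sign does not change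
  the action.\<close>

lemma cusp_width:
 assumes s: "s \<in> cusps \<Gamma>"
 shows "cusp_width \<Gamma> s > 0" "\<exists>A\<in>\<Gamma>. \<forall>z. Im z > 0 --> mob A (mob (scaling s) z) = mob (scaling s) (z + of_real (cusp_width \<Gamma> s))"
proof -
 define \<sigma> where "\<sigma> = scaling s"
 have d\<sigma>: "det \<sigma> = 1" by (simp add: \<sigma>_def)
 define T where "T = (\<lambda>h. \<sigma> ** mat2 1 h 0 1 ** adj2 \<sigma>)"
 define S where "S = {h. h > 0 \<and> (T h \<in> \<Gamma> \<or> - T h \<in> \<Gamma>)}"
 have Tadd: "adj2 (T h) = T (- h)" for h
 proof -
  have "adj2 (mat2 1 h 0 1) = mat2 1 (-h) 0 1" by (rule mat2_eqI) simp_all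
  thus ?thesis by (simp add: T_def adj2_prod matrix_mul_assoc)
 qed
 have adjm: "adj2 (- M) = - adj2 M" for M by (rule mat2_eqI) simp_all
 have wS: "cusp_width \<Gamma> s = (LEAST h. h \<in> S)"
  unfolding cusp_width_def S_def T_def \<sigma>_def by (simp add: matrix_inv_SL2 Let_def)
 obtain B p q where B: "B \<in> \<Gamma>" "adj2 \<sigma> ** B ** \<sigma> = mat2 p q 0 p" "p\<^sup>2 = 1" "q ~= 0"
  using cusp_parabolic[OF subgroup s] unfolding \<sigma>_def by blast
 have pp: "p = 1 \<or> p = -1" using B(3) by (simp add: power2_eq_1_iff)
 have "B = \<sigma> ** (adj2 \<sigma> ** B ** \<sigma>) ** adj2 \<sigma>" using d\<sigma> by (simp add: matrix_mul_assoc adj2_mult)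
 hence B': "B = \<sigma> ** mat2 p q 0 p ** adj2 \<sigma>" using B(2) by simp
 have "T (q / p) = B \<or> - T (q / p) = B"
  using pp unfolding B' T_def by (auto intro!: mat2_eqI simp: matrix_mult_sel algebra_simps)
 hence TB: "T (q / p) \<in> \<Gamma> \<or> - T (q / p) \<in> \<Gamma>" using B(1) by auto
 define k where "k = q / p"
 have k: "k ~= 0" "T k \<in> \<Gamma> \<or> - T k \<in> \<Gamma>" using B(4) pp TB by (auto simp: k_def)
 have "\<bar>k\<bar> \<in> S"
 proof (cases "k > 0")
  case True thus ?thesis using k by (auto simp: S_def)
 next
  case False
  show ?thesis using k(2) adj2_Gamma Tadd adjm False k(1) by (force simp: S_def)
 qed
 then obtain h0 where h0: "h0 \<in> S" by blast
 define R where "R = norm \<sigma> * norm (adj2 \<sigma>) * sqrt (2 + h0\<^sup>2)"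
 have nT: "norm (T h) \<le> R" if "0 < h" "h \<le> h0" for h
 proof -
  have "(norm (mat2 1 h 0 1))\<^sup>2 \<le> 2 + h0\<^sup>2" using that by (simp add: norm_mat2)
  hence n: "norm (mat2 1 h 0 1) \<le> sqrt (2 + h0\<^sup>2)" by (rule real_le_rsqrt)
  have "norm (T h) \<le> norm (\<sigma> ** mat2 1 h 0 1) * norm (adj2 \<sigma>)" unfolding T_def by (rule norm_matrix_mult)
  also have "... \<le> (norm \<sigma> * norm (mat2 1 h 0 1)) * norm (adj2 \<sigma>)" by (intro mult_right_mono norm_matrix_mult) auto
  also have "... \<le> (norm \<sigma> * sqrt (2 + h0\<^sup>2)) * norm (adj2 \<sigma>)" by (intro mult_right_mono mult_left_mono n) auto
  finally show ?thesis by (simp add: R_def mult_ac)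
 qed
 have injT: "h = h'" if "T h = T h'" for h h'
 proof -
  have "adj2 \<sigma> ** T h ** \<sigma> = mat2 1 h 0 1" for h using d\<sigma> by (simp add: T_def matrix_mul_assoc adj2_mult)
  hence "mat2 1 h 0 1 $ 1 $ 2 = mat2 1 h' 0 1 $ 1 $ 2" using that by metis
  thus ?thesis by simp
 qed
 have fin: "finite {h \<in> S. h \<le> h0}"
 proof (rule finite_imageD)
  show "inj_on T {h \<in> S. h \<le> h0}" using injT by (auto intro: inj_onI)
  have "T ` {h \<in> S. h \<le> h0} \<subseteq> {A \<in> \<Gamma>. norm A \<le> R} \<union> uminus ` {A \<in> \<Gamma>. norm A \<le> R}"
  proof
   fix M assume "M \<in> T ` {h \<in> S. h \<le> h0}"
   then obtain h where h: "M = T h" "h > 0" "h \<le> h0" "T h \<in> \<Gamma> \<or> - T h \<in> \<Gamma>" by (auto simp: S_def)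
   thus "M \<in> {A \<in> \<Gamma>. norm A \<le> R} \<union> uminus ` {A \<in> \<Gamma>. norm A \<le> R}"
    using nT[OF h(2,3)] image_eqI[of M uminus "- T h"] by auto
  qed
  thus "finite (T ` {h \<in> S. h \<le> h0})" by (rule finite_subset) (intro finite_UnI finite_imageI finite_bounded)
 qed
 have mem: "cusp_width \<Gamma> s \<in> S"
 proof -
  have ne: "{h \<in> S. h \<le> h0} ~= {}" using h0 by blast
  define h1 where "h1 = Min {h \<in> S. h \<le> h0}"
  have h1: "h1 \<in> S" "h1 \<le> h0" using Min_in[OF fin ne] by (auto simp: h1_def)
  have "h1 \<le> h" if "h \<in> S" for h
   using Min_le[OF fin, of h] that h1 unfolding h1_def[symmetric] by (cases "h \<le> h0") auto
  hence "(LEAST h. h \<in> S) = h1" using h1 by (intro Least_equality) auto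
  thus ?thesis using h1 by (simp add: wS)
 qed
 thus "cusp_width \<Gamma> s > 0" by (simp add: S_def)
 define h where "h = cusp_width \<Gamma> s"
 have Th: "T h \<in> \<Gamma> \<or> - T h \<in> \<Gamma>" using mem by (simp add: S_def h_def)
 have dm: "det (mat2 1 h 0 1) = 1" by (simp add: det_2)
 have dT: "det (T h) = 1" using d\<sigma> dm by (simp add: T_def det_mul)
 have act: "mob (T h) (mob \<sigma> z) = mob \<sigma> (z + of_real h)" if z: "Im z > 0" for z
 using d\<sigma> mob_mult[OF dT d\<sigma> z] mob_mult[OF d\<sigma> dm z] by (auto simp: T_def mob_eq cocyc_def)
 have neg: "mob (- M) z = mob M z" for M z
 proof -
  have "cocyc (- M) z = - cocyc M z" by (simp add: cocyc_def)
  moreover have "of_real ((- M)$1$1) * z + of_real ((- M)$1$2) = - (of_real (M$1$1) * z + of_real (M$1$2))" by simp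
  ultimately show ?thesis unfolding mob_eq by (simp only: minus_divide_divide)
 qed
 show "\<exists>A\<in>\<Gamma>. \<forall>z. Im z > 0 --> mob A (mob (scaling s) z) = mob (scaling s) (z + of_real (cusp_width \<Gamma> s))"
  using Th act neg unfolding \<sigma>_def h_def by metis
qed

end

section \<open>Elliptic points and uniformizing half-planes\<close>

text \<open>The multiplier of a stabilizing element A in the Cayley coordinate (z - a) / (z - cnj
  a), where it acts as a rotation.\<close>

definition rot :: "complex => real^2^2 => complex" where
 "rot a A = cnj (cocyc A a) / cocyc A a"

lemma cocyc_cnj: "cocyc A (cnj a) = cnj (cocyc A a)"
 by (simp add: cocyc_def)

lemma rot_mob:
 assumes "det A = 1" "Im a > 0" "Im z > 0" "mob A a = a"
 shows "(mob A z - a) / (mob A z - cnj a) = rot a A * ((z - a) / (z - cnj a))"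
proof -
 have nz: "cocyc A a ~= 0" "cocyc A z ~= 0" using cocyc_nz assms by auto
 have 1: "mob A z - a = (z - a) / (cocyc A z * cocyc A a)" using mob_diff[OF assms(1,3,2)] assms(4) by simp
 have "mob A (cnj a) = cnj (mob A a)" by (simp add: mob_eq cocyc_cnj)
 hence a': "mob A (cnj a) = cnj a" using assms(4) by simp
 have "(of_real (A$1$1) * cnj a + of_real (A$1$2)) = cnj a * cnj (cocyc A a)"
  using a' nz unfolding mob_eq cocyc_cnj by (simp add: field_simps)
 moreover have "mob A z = (of_real (A$1$1) * z + of_real (A$1$2)) / cocyc A z" by (rule mob_eq)
 moreover have "(of_real (A$1$1) * z + of_real (A$1$2)) * cocyc A (cnj a) - (of_real (A$1$1) * cnj a + of_real (A$1$2)) * cocyc A z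
   = of_real (det A) * (z - cnj a)" by (simp add: cocyc_def det_2 algebra_simps)
 ultimately have m: "mob A z * cocyc A z * cnj (cocyc A a) - cnj a * cnj (cocyc A a) * cocyc A z = z - cnj a"
  using nz assms(1) by (simp add: cocyc_cnj)
 have 2: "mob A z - cnj a = (z - cnj a) / (cocyc A z * cnj (cocyc A a))"
  unfolding m[symmetric] using nz by simp
 have "x / (c * j) / (y / (c * k)) = k / j * (x / y)" if "c ~= 0" for x y c j k :: complex
  using that by simp
 thus ?thesis unfolding 1 2 rot_def using nz(2) by blast
qed

text \<open>\<open>p\<close> parametrizes a punctured neighbourhood of \<open>P\<close> by a half-plane, on which the local parameter
 becomes the exponential of period \<open>h\<close>.\<close>

definition uniformizes :: "(real^2^2) set => riemann_sphere => cfun => real => bool" where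
 "uniformizes \<Gamma> P p h \<longleftrightarrow> h > 0 \<and> p holomorphic_on UHP \<and>
  (\<forall>\<xi>. Im \<xi> > 0 --> Im (p \<xi>) > 0 \<and> local_param \<Gamma> P (p \<xi>) = qexp h \<xi> \<and> (\<exists>A\<in>\<Gamma>. p (\<xi> + of_real h) = mob A (p \<xi>))) \<and>
  (\<forall>Q. near P Q \<longleftrightarrow> (\<exists>Y>0. \<forall>\<xi>. Im \<xi> > Y --> Q (p \<xi>)))"

context discrete_SL2
begin

lemma finite_stabilizer: "Im a > 0 ==> finite {A \<in> \<Gamma>. mob A a = a}"
 by (rule finite_subset[OF _ finite_hdisp[of a 2]]) auto

lemma rot_kernel:
 assumes "det A = 1" "Im a > 0" "mob A a = a" "rot a A = 1"
 shows "A = mat 1 \<or> A = - mat 1"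
proof -
 have nz: "cocyc A a ~= 0" using cocyc_nz assms by auto
 have "cnj (cocyc A a) = cocyc A a" using assms(4) by (simp add: rot_def)
 hence 21: "A$2$1 = 0" using assms(2) by (auto simp: complex_eq_iff cocyc_def)

 have e: "of_real (A$1$1) * a + of_real (A$1$2) = a * of_real (A$2$2)"
  using assms(3) nz by (simp add: mob_eq cocyc_def 21 field_simps)
 from arg_cong[OF e, of Im] have 11: "A$1$1 = A$2$2" using assms(2) by simp
 with e have 12: "A$1$2 = 0" by simp
 have "A$1$1 = 1 \<or> A$1$1 = - 1" using assms(1) 21 11 by (auto simp: det_2 power2_eq_1_iff[symmetric] power2_eq_square)
 thus ?thesis using 21 11 12 by (auto intro!: mat2_eqI)
qed

text \<open>The rotations induced by the stabilizer form a group of order \<open>e\<close> of roots of unity.\<close>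

lemma elliptic_rotations:
 assumes a: "Im a > 0"
 shows "ramification \<Gamma> a \<ge> 1" "z ^ ramification \<Gamma> a = 1 ==> \<exists>A\<in>\<Gamma>. mob A a = a \<and> rot a A = z"
proof -
 define St where "St = {A \<in> \<Gamma>. mob A a = a}"
 define K where "K = \<Gamma> \<inter> {mat 1, - mat 1}"
 define H where "H = rot a ` St"
 have fin: "finite St" unfolding St_def by (rule finite_stabilizer[OF a])
 have finH: "finite H" using fin by (simp add: H_def)
 have mult: "A ** B \<in> St" "rot a (A ** B) = rot a A * rot a B" if "A \<in> St" "B \<in> St" for A B
 proof -
  have AB: "A \<in> \<Gamma>" "B \<in> \<Gamma>" "mob A a = a" "mob B a = a" "det A = 1" "det B = 1" using that by (auto simp: St_def)
  show "A ** B \<in> St" using AB mob_mult[OF AB(5,6) a] by (auto simp: St_def)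
  show "rot a (A ** B) = rot a A * rot a B" using cocyc_mult[OF AB(6) a, of A] AB(4) by (simp add: rot_def)
 qed
 have inv: "adj2 A \<in> St" if "A \<in> St" for A
  using that mob_adj2(2)[of A a] a by (auto simp: St_def)
 have rnz: "rot a A ~= 0" if "A \<in> St" for A using that cocyc_nz[of A a] a by (auto simp: rot_def St_def)
 have one: "mat 1 \<in> St" "mat 1 \<in> K" by (auto simp: St_def K_def)
 have finK: "finite K" by (simp add: K_def)
 have Kc: "B \<in> K \<longleftrightarrow> B \<in> St \<and> rot a B = 1" for B
 using rot_kernel[of B a] a by (auto simp: mob_eq cocyc_def rot_def K_def St_def)
 \<comment> \<open>All fibres of the rotation map are cosets of its kernel, so the quotient of
   cardinalities in \<open>ramification\<close> is the number of rotations.\<close>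
 have fib: "card {A \<in> St. rot a A = x} = card K" if xH: "x \<in> H" for x
 proof -
  obtain A where A: "A \<in> St" "rot a A = x" using xH unfolding H_def by blast
  have dA: "det A = 1" using A by (auto simp: St_def)
  have "{B \<in> St. rot a B = x} = (\<lambda>k. A ** k) ` K"
  proof (intro subset_antisym subsetI)
   fix B assume B: "B \<in> {B \<in> St. rot a B = x}"
   have "adj2 A ** B \<in> K" using mult(2)[OF inv[OF A(1)] A(1)] adj2_mult[OF dA] mult(2)[OF inv[OF A(1)], of B] B A one Kc mult(1)[OF inv[OF A(1)], of B] by simp
   moreover have "B = A ** (adj2 A ** B)" using dA by simp
   ultimately show "B \<in> (\<lambda>k. A ** k) ` K" by blast
  next
   fix B assume "B \<in> (\<lambda>k. A ** k) ` K"
   thus "B \<in> {B \<in> St. rot a B = x}" using A Kc mult by auto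
  qed
  moreover have "inj_on (\<lambda>k. A ** k) K" using dA by (intro inj_onI) (metis adj2_cancel(2))
  ultimately show ?thesis by (simp add: card_image)
 qed

 have cK: "card K > 0" using one finK card_gt_0_iff by blast
 have e: "ramification \<Gamma> a = card H" unfolding ramification_def using sum.image_gen[OF fin, of "\<lambda>_. 1::nat" "rot a"] fib by (auto simp: H_def St_def K_def)
 have Hne: "H ~= {}" using one by (auto simp: H_def)
 show ge1: "ramification \<Gamma> a \<ge> 1" using e finH Hne card_gt_0_iff[of H] by simp
 have Hmult: "x * y \<in> H" if xy: "x \<in> H" "y \<in> H" for x y proof -
  obtain A B where "A \<in> St" "x = rot a A" "B \<in> St" "y = rot a B" using xy unfolding H_def by blast
  thus ?thesis using mult[of A B] unfolding H_def by (intro image_eqI[of _ _ "A ** B"]) auto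
 qed
 have H0: "0 \<notin> H" using rnz by (force simp: H_def)
 have root: "x ^ card H = 1" if x: "x \<in> H" for x
 proof -

  have inj: "inj_on (\<lambda>y. x * y) H" using x H0 by (auto intro: inj_onI)
  have "(\<lambda>y. x * y) ` H = H" using finH inj Hmult[OF x] by (intro card_subset_eq) (auto simp: card_image)
  hence "prod id H = (\<Prod>y\<in>H. x * y)" using prod.reindex[OF inj, of id] by simp
  also have "... = x ^ card H * prod id H" by (simp add: prod.distrib)
  finally show ?thesis using H0 finH by simp
 qed
 \<comment> \<open>Every element of a group of order n is an n-th root of unity, and there are only
   n of these.\<close>
 have "H = {z. z ^ card H = 1}"
 proof (rule card_subset_eq)
  show "finite {z::complex. z ^ card H = 1}" using finite_roots_unity[of "card H"] ge1 e by simp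
  show "card H = card {z::complex. z ^ card H = 1}" using card_roots_unity_eq[of "card H"] ge1 e by simp
 qed (use root in auto)
 hence mem: "z \<in> H" if "z ^ card H = 1" using that by blast
 show "\<exists>A\<in>\<Gamma>. mob A a = a \<and> rot a A = z" if zz: "z ^ ramification \<Gamma> a = 1"
 using mem[unfolded e[symmetric]] zz by (auto simp: H_def St_def)
qed

text \<open>Treats cusps, elliptic points and ordinary points alike. At a cusp \<open>p\<close> is
  the scaling matrix, and forms may have a period \<open>w\<close> different from that of the local
  parameter. At an interior point with ramification e the exponential of period e is the Cayley
  coordinate, its e-th power the local parameter, and translation by 1 is realized by the rotation
  of angle 2 pi / e in the stabilizer.\<close>

lemma uniformizer:
 assumes chi: "finite_order_character \<Gamma> chi" and P: "P \<in> EHP \<Gamma>"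
 shows "\<exists>p h w \<nu>. uniformizes \<Gamma> P p h \<and> w > 0 \<and> (\<forall>\<xi>. Im \<xi> > 0 --> \<nu> \<xi> ~= 0) \<and>
  (\<forall>f\<in>modular_forms \<Gamma> chi m. \<exists>F. F holomorphic_on ball 0 1 \<and> (\<forall>\<xi>. Im \<xi> > 0 --> f (p \<xi>) = \<nu> \<xi> * F (qexp w \<xi>)))"
 using P
proof (cases rule: extended_cases)
 case 2
 obtain w where w: "w > 0" "\<And>F. F \<in> modular_forms \<Gamma> chi m ==> \<exists>g. g holomorphic_on ball 0 1 \<and>
   (\<forall>z\<in>UHP. F (mob (scaling P) z) / cocyc (scaling P) z ^ m = g (qexp w z))"
  using modular_form_cusp_expansion[OF subgroup chi 2(1), of m] by blast
 have nz: "cocyc (scaling P) \<xi> ~= 0" if "Im \<xi> > 0" for \<xi> using cocyc_nz[OF det_scaling that] .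
 show ?thesis
 proof (rule exI[of _ "mob (scaling P)"], rule exI[of _ "cusp_width \<Gamma> P"], rule exI[of _ w], rule exI[of _ "\<lambda>\<xi>. cocyc (scaling P) \<xi> ^ m"], unfold uniformizes_def, intro conjI allI impI ballI)
  show "cusp_width \<Gamma> P > 0" using cusp_width[OF 2(1)] by simp
  show "mob (scaling P) holomorphic_on UHP" by (intro mob_holomorphic det_scaling)
  fix \<xi> assume \<xi>: "Im \<xi> > 0"
  show "Im (mob (scaling P) \<xi>) > 0" by (intro Im_mob_pos det_scaling \<xi>)
  show "local_param \<Gamma> P (mob (scaling P) \<xi>) = qexp (cusp_width \<Gamma> P) \<xi>"
   using mob_adj2(2)[OF det_scaling \<xi>] by (simp add: local_param_boundary[OF 2(2)] cusp_param_def qexp_def matrix_inv_SL2)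
  show "\<exists>A\<in>\<Gamma>. mob (scaling P) (\<xi> + of_real (cusp_width \<Gamma> P)) = mob A (mob (scaling P) \<xi>)"
   using cusp_width(2)[OF 2(1)] \<xi> by metis
  show "cocyc (scaling P) \<xi> ^ m ~= 0" using nz[OF \<xi>] by simp
 next
  fix Q show "near P Q = (\<exists>Y>0. \<forall>\<xi>. Y < Im \<xi> --> Q (mob (scaling P) \<xi>))"
 by (simp add: punctured_nhds_boundary[OF 2(2)] eventually_horoball)
 next
  fix f assume "f \<in> modular_forms \<Gamma> chi m"
  then obtain g where g: "g holomorphic_on ball 0 1" "\<And>z. Im z > 0 ==> f (mob (scaling P) z) / cocyc (scaling P) z ^ m = g (qexp w z)"
   using w(2) by (metis UHP_iff)
  have "f (mob (scaling P) z) = cocyc (scaling P) z ^ m * g (qexp w z)" if "Im z > 0" for z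
   using g(2)[OF that] nz[OF that] by (simp add: field_simps)
  thus "\<exists>F. F holomorphic_on ball 0 1 \<and> (\<forall>\<xi>. Im \<xi> > 0 --> f (mob (scaling P) \<xi>) = cocyc (scaling P) \<xi> ^ m * F (qexp w \<xi>))"
   using g(1) by blast
 qed (use w in simp)
next
 case (1 a)
 define e where "e = ramification \<Gamma> a"
 have e: "e \<ge> 1" unfolding e_def by (rule elliptic_rotations[OF 1(2)])
 have e0: "real e > 0" using e by simp
 define Z where "Z = (\<lambda>w. (a - cnj a * w) / (1 - w))"
 define C where "C = (\<lambda>z. (z - a) / (z - cnj a))"
 have aca: "a ~= cnj a" using 1(2) by (metis complex_In_mult_cnj_zero complex_cnj_zero_iff less_irrefl Reals_cnj_iff complex_is_Real_iff)
 have ImZ: "Im (Z w) > 0" if w: "norm w < 1" for w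
 proof -
  have w1: "1 - w ~= 0" using w by auto
  have "Im (Z w) = Im ((a - cnj a * w) * cnj (1 - w)) / (norm (1 - w))\<^sup>2"
   unfolding Z_def by (simp add: complex_div_cnj[of _ "1 - w"])
  also have "Im ((a - cnj a * w) * cnj (1 - w)) = Im a * (1 - (norm w)\<^sup>2)"
 by (simp only: cmod_power2) (simp add: power2_eq_square algebra_simps)
  also have "... / (norm (1 - w))\<^sup>2 > 0" using w w1 1(2) by (simp add: power_less_one_iff)
  finally show ?thesis .
 qed
 have CZ: "C (Z w) = w" if w: "norm w < 1" for w
 proof -
  have w1: "1 - w ~= 0" using w by auto
  have "Z w - a = (a - cnj a) * w / (1 - w)" "Z w - cnj a = (a - cnj a) / (1 - w)"
   unfolding Z_def using w1 by (simp_all add: field_simps)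
  thus ?thesis unfolding C_def using aca w1 by simp
 qed
 have zc: "z - cnj a ~= 0" if "Im z > 0" for z using that 1(2) by auto
 have ZC: "Z (C z) = z" if z: "Im z > 0" for z
 proof -
  have "1 - C z = (a - cnj a) / (z - cnj a)" "a - cnj a * C z = z * (a - cnj a) / (z - cnj a)"
   unfolding C_def using zc[OF z] by (simp_all add: field_simps)
  thus ?thesis unfolding Z_def using aca zc[OF z] by simp
 qed
 have Z0: "Z 0 = a" by (simp add: Z_def)
 have Zhol: "Z holomorphic_on ball 0 1" unfolding Z_def by (intro holomorphic_intros) auto
 have qn: "norm (qexp e \<xi>) < 1" if "Im \<xi> > 0" for \<xi> using that e0 by (simp add: norm_qexp)
 have qhol: "qexp e holomorphic_on S" for S unfolding qexp_def by (intro holomorphic_intros) (use e0 in auto)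
 have Cp: "C (mob A z) = rot a A * C z" if "A \<in> \<Gamma>" "mob A a = a" "Im z > 0" for A z
  unfolding C_def using rot_mob[of A a z] that 1(2) by auto
 define p where "p = (\<lambda>\<xi>. Z (qexp e \<xi>))"
 show ?thesis
 proof (rule exI[of _ p], rule exI[of _ 1], rule exI[of _ "real e"], rule exI[of _ "\<lambda>_. 1"], unfold uniformizes_def, intro conjI allI impI ballI)
  have "(Z \<circ> qexp e) holomorphic_on UHP"
 by (rule holomorphic_on_compose_gen[OF qhol Zhol]) (use qn in auto)
  thus "p holomorphic_on UHP" by (simp add: p_def o_def)
  fix \<xi> assume \<xi>: "Im \<xi> > 0"
  show "Im (p \<xi>) > 0" unfolding p_def by (intro ImZ qn \<xi>)
  have "local_param \<Gamma> P (p \<xi>) = C (p \<xi>) ^ e" by (simp add: 1 local_param_UHP C_def e_def)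
  also have "... = qexp e \<xi> ^ e" unfolding p_def by (simp only: CZ[OF qn[OF \<xi>]])
  also have "... = qexp 1 \<xi>" unfolding qexp_def using e0 by (subst exp_of_nat_mult[symmetric]) simp
  finally show "local_param \<Gamma> P (p \<xi>) = qexp 1 \<xi>" .
  define \<zeta> where "\<zeta> = exp (2 * of_real pi * \<i> / of_nat e)"
  have "\<zeta> ^ e = 1" unfolding \<zeta>_def using e0 by (subst exp_of_nat_mult[symmetric]) simp
  then obtain A where A: "A \<in> \<Gamma>" "mob A a = a" "rot a A = \<zeta>" using elliptic_rotations(2)[OF 1(2), of \<zeta>] unfolding e_def by blast
  have \<xi>1: "Im (\<xi> + of_real 1) > 0" using \<xi> by simp
  have "Z (C (p (\<xi> + of_real 1))) = Z (C (mob A (p \<xi>)))" using Cp[OF A(1,2), of "p \<xi>"] CZ[OF qn[OF \<xi>1]] CZ[OF qn[OF \<xi>]] \<open>Im (p \<xi>) > 0\<close> A(3) by (auto simp: qexp_def \<zeta>_def exp_add[symmetric] ring_distribs add_divide_distrib add.commute p_def)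
  moreover have "Im (p (\<xi> + of_real 1)) > 0" "Im (mob A (p \<xi>)) > 0"
   using ImZ[OF qn[OF \<xi>1]] Im_mob_pos[of A "p \<xi>"] A(1) \<open>Im (p \<xi>) > 0\<close> by (auto simp: p_def)
  ultimately show "\<exists>A\<in>\<Gamma>. p (\<xi> + of_real 1) = mob A (p \<xi>)" using ZC A(1) by auto
 next
  fix Q
  show "near P Q = (\<exists>Y>0. \<forall>\<xi>. Y < Im \<xi> --> Q (p \<xi>))"
   unfolding 1(1) filter_at_UHP[OF 1(2)]
  proof
   assume "eventually Q (at a)"
   then obtain S where S: "open S" "a \<in> S" "\<And>z. z \<in> S ==> z ~= a ==> Q z" by (auto simp: eventually_at_topological)
   have "continuous_on (ball 0 1) Z" by (rule holomorphic_on_imp_continuous_on[OF Zhol])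
   hence "isCont Z 0" by (simp add: continuous_on_eq_continuous_at)
   then obtain d where d: "d > 0" "\<And>w. norm w < d ==> Z w \<in> S"
    using S Z0 unfolding isCont_def tendsto_at_iff_tendsto_nhds
 by (metis (no_types, lifting) dist_0_norm dist_commute eventually_nhds_metric topological_tendstoD)
   define Y where "Y = max 1 (- real e * ln d / (2 * pi))"
   have "Q (p \<xi>)" if \<xi>: "Im \<xi> > Y" for \<xi>
   proof -
    have \<xi>0: "Im \<xi> > 0" "Im \<xi> > - real e * ln d / (2 * pi)" using \<xi> by (auto simp: Y_def)
    have "- 2 * pi * Im \<xi> / e < ln d" using \<xi>0(2) e0 by (simp add: field_simps)
    hence "norm (qexp e \<xi>) < d" unfolding norm_qexp using d(1) by (metis exp_less_mono exp_ln)
    hence "p \<xi> \<in> S" unfolding p_def by (rule d(2))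
    moreover have "p \<xi> ~= a" using CZ[OF qn[OF \<xi>0(1)]] by (auto simp: p_def C_def)
    ultimately show ?thesis using S(3) by blast
   qed
   thus "\<exists>Y>0. \<forall>\<xi>. Y < Im \<xi> --> Q (p \<xi>)" by (intro exI[of _ Y]) (auto simp: Y_def)
  next
   assume "\<exists>Y>0. \<forall>\<xi>. Y < Im \<xi> --> Q (p \<xi>)"
   then obtain Y where Y: "\<And>\<xi>. Im \<xi> > Y ==> Q (p \<xi>)" by blast
   have "(C \<longlongrightarrow> C a) (at a)" unfolding C_def using zc[OF 1(2)] by (intro tendsto_intros) auto
   hence "eventually (\<lambda>z. norm (C z) < exp (- 2 * pi * Y / e)) (at a)" using order_tendstoD(2)[OF tendsto_norm_zero, of C "at a"] by (simp add: C_def)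
   moreover have "eventually (\<lambda>z. z \<in> UHP - {a}) (at a)" using 1(2) open_UHP by (intro eventually_at_in_open) auto
   ultimately show "eventually Q (at a)"
   proof eventually_elim
    case (elim z)
    have C0: "C z ~= 0" using elim zc[of z] by (auto simp: C_def)
    define \<xi> where "\<xi> = of_real e * Ln (C z) / (2 * of_real pi * \<i>)"
    have \<xi>: "qexp e \<xi> = C z" "Im \<xi> = - e * ln (norm (C z)) / (2 * pi)"
     using qexp_surj[OF e0 C0] by (simp_all add: \<xi>_def)
    have "ln (norm (C z)) < - 2 * pi * Y / e" using elim(1) C0 by (metis ln_exp ln_less_cancel_iff exp_gt_zero zero_less_norm_iff)
    hence "Im \<xi> > Y" unfolding \<xi>(2) using e0 by (simp add: field_simps)
    moreover have "p \<xi> = z" unfolding p_def \<xi>(1) using ZC elim by auto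
    ultimately show ?case using Y by metis
   qed
  qed
 next
  fix f assume "f \<in> modular_forms \<Gamma> chi m"
  hence "f holomorphic_on UHP" by (simp add: modular_forms_def)
  moreover have "Z ` ball 0 1 \<subseteq> UHP" using ImZ by auto
  ultimately show "\<exists>F. F holomorphic_on ball 0 1 \<and> (\<forall>\<xi>. Im \<xi> > 0 --> f (p \<xi>) = 1 * F (qexp e \<xi>))" using holomorphic_on_compose_gen[OF Zhol] by (intro exI[of _ "f \<circ> Z"]) (auto simp: p_def)
 qed (use e0 in auto)
qed

end

section \<open>A finite atlas and the degrees of relations\<close>

text \<open>Common zeros of \<open>W\<close> are exempt, because a point of projective space is not
  determined by the values there.\<close>

definition covers :: "cfun set => (cfun => complex => complex) => complex => bool" where
 "covers W \<Psi> z \<longleftrightarrow> (\<exists>F\<in>W. F z ~= 0) --> (\<exists>t\<in>cball 0 1. \<exists>a. a ~= 0 \<and> (\<forall>F\<in>W. \<Psi> F t = a * F z))"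

lemma coversD: "covers W \<Psi> z ==> F \<in> W ==> F z ~= 0 ==> \<exists>t\<in>cball 0 1. \<exists>a. a ~= 0 \<and> (\<forall>F\<in>W. \<Psi> F t = a * F z)"
 unfolding covers_def by blast

lemma holomorphic_on_comp: "h holomorphic_on T ==> h ` T \<subseteq> S ==> f holomorphic_on S ==> (\<lambda>t. f (h t)) holomorphic_on T"
 using holomorphic_on_compose_gen[of h T f S] by (simp add: o_def)

text \<open>Division by the common power of t makes some member nonzero at 0; the disc is shrunk
  until that member has no zero and then rescaled.\<close>

lemma chart_from_param:
 assumes S: "open S" "connected S" "0 \<in> S" and hol: "\<And>F. F \<in> W ==> u F holomorphic_on S"
  and nz: "\<exists>F\<in>W. \<exists>t\<in>S. u F t ~= 0"
  and pts: "\<And>t. t \<in> S - {0} ==> \<exists>z\<in>UHP. \<exists>a. a ~= 0 \<and> (\<forall>F\<in>W. u F t = a * F z)"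
 shows "\<exists>\<rho>>0. \<exists>\<Psi>. is_chart W \<Psi> \<and> (\<forall>t b z. norm t < \<rho> --> b ~= 0 --> (\<forall>F\<in>W. u F t = b * F z) --> covers W \<Psi> z)"
proof -
 obtain k g where g: "\<And>F. F \<in> W ==> g F holomorphic_on S" "\<And>F t. F \<in> W ==> t \<in> S ==> u F t = t ^ k * g F t"
  and F0: "\<exists>F\<in>W. g F 0 ~= 0" using min_order[OF S hol nz] by blast
 obtain F where F: "F \<in> W" "g F 0 ~= 0" using F0 by blast
 obtain d where d: "d > 0" "ball 0 d \<subseteq> S" "\<And>t. t \<in> ball 0 d ==> g F t ~= 0"
  using holomorphic_nonzero_ball[OF g(1)[OF F(1)] S(1,3) F(2)] by blast
 \<comment> \<open>Takes the disc of radius 2 onto the disc of radius d, and the unit disc onto the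
   half whose points count as covered.\<close>
 define \<rho> where "\<rho> = complex_of_real (d / 2)"
 define \<Psi> where "\<Psi> = (\<lambda>F t. g F (\<rho> * t))"
 have in_ball: "\<rho> * t \<in> ball 0 d" if "t \<in> ball 0 2" for t :: complex
  using that d(1) by (simp add: norm_mult \<rho>_def)
 have in_S: "\<rho> * t \<in> S" if "t \<in> ball 0 2" for t :: complex using in_ball[OF that] d(2) by blast
 have \<rho>0: "\<rho> ~= 0" using d(1) by (simp add: \<rho>_def)
 have "is_chart W \<Psi>"
  unfolding is_chart_def
 proof (intro conjI ballI)
  fix F assume "F \<in> W"
  show "\<Psi> F holomorphic_on ball 0 2" unfolding \<Psi>_def
 by (rule holomorphic_on_comp[OF _ _ g(1)[OF \<open>F \<in> W\<close>]]) (use in_S in \<open>auto intro!: holomorphic_intros\<close>)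
 next
  show "\<exists>F\<in>W. \<forall>t\<in>ball 0 2. \<Psi> F t ~= 0" unfolding \<Psi>_def using F(1) d(3) in_ball by blast
 next
  fix t :: complex assume t: "t \<in> ball 0 2 - {0}"
  then obtain z a where z: "z \<in> UHP" "a ~= 0" "\<And>F. F \<in> W ==> u F (\<rho> * t) = a * F z"
   using pts[of "\<rho> * t"] in_S[of t] \<rho>0 by auto
  have "\<Psi> F t = a / (\<rho> * t) ^ k * F z" if "F \<in> W" for F
   using z(3)[OF that] g(2)[OF that, of "\<rho> * t"] in_S[of t] t \<rho>0 by (simp add: \<Psi>_def)
  thus "\<exists>z\<in>UHP. \<exists>a. a ~= 0 \<and> (\<forall>F\<in>W. \<Psi> F t = a * F z)"
   using z(1,2) t \<rho>0 by (intro bexI[of _ z] exI[of _ "a / (\<rho> * t) ^ k"]) auto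
 qed
 moreover have "covers W \<Psi> z" if t: "norm t < d / 2" and b: "b ~= 0" "\<forall>F\<in>W. u F t = b * F z" for t b z
  unfolding covers_def
 proof
  assume "\<exists>F\<in>W. F z ~= 0"
  then obtain H where H: "H \<in> W" "H z ~= 0" by blast
  have t1: "t / \<rho> \<in> cball 0 1" using t d(1) by (simp add: \<rho>_def norm_divide)
  have tS: "t \<in> S" using t d by auto
  have tk: "t ^ k ~= 0" using g(2)[OF H(1) tS] b H by (metis mult_eq_0_iff)
  have "\<Psi> F (t / \<rho>) = b / t ^ k * F z" if "F \<in> W" for F
   using g(2)[OF that tS] b(2) that tk \<rho>0 by (simp add: \<Psi>_def)
  thus "\<exists>t\<in>cball 0 1. \<exists>a. a ~= 0 \<and> (\<forall>F\<in>W. \<Psi> F t = a * F z)"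
   using t1 b(1) tk by (intro bexI[of _ "t / \<rho>"] exI[of _ "b / t ^ k"]) auto
 qed
 ultimately show ?thesis using d(1) by (intro exI[of _ "d / 2"] conjI exI[of _ \<Psi>]) auto
qed

text \<open>The open set of half-plane points attached to each chart lets the identity theorem pass
  from a single chart to the half-plane and back.\<close>

definition chart_atlas :: "cfun set => (cfun => complex => complex) set => bool" where
 "chart_atlas W J \<longleftrightarrow> finite J \<and> (\<forall>\<Psi>\<in>J. is_chart W \<Psi>) \<and>
  (\<forall>\<Psi>\<in>J. \<exists>z. Im z > 0 \<and> eventually (covers W \<Psi>) (nhds z)) \<and> (\<forall>z. Im z > 0 --> (\<exists>\<Psi>\<in>J. covers W \<Psi> z))"

lemma chart_atlas_cover:
 assumes "chart_atlas W J" "z \<in> UHP" "F \<in> W" "F z ~= 0"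
 shows "\<exists>\<Psi>\<in>J. \<exists>t\<in>cball 0 1. \<exists>a. a ~= 0 \<and> (\<forall>F\<in>W. \<Psi> F t = a * F z)"
 using assms coversD unfolding chart_atlas_def UHP_iff by metis

lemma covers_open_UHP:
 assumes "P \<in> EHP \<Gamma>" "near P (covers W \<Psi>)"
 shows "\<exists>z. Im z > 0 \<and> eventually (covers W \<Psi>) (nhds z)"
 using eventually_happens'[OF punctured_nhds_neq_bot[OF assms(1)] eventually_eventually_punctured[OF assms]] by blast

context finite_area_SL2
begin

lemma modular_forms_charts:
 assumes chi: "finite_order_character \<Gamma> chi" and W: "W \<subseteq> modular_forms \<Gamma> chi m"
  and nz: "\<exists>F\<in>W. \<exists>z. F z ~= 0"
 shows "\<exists>J. chart_atlas W J"
proof -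
 obtain F0 z0 where F0: "F0 \<in> W" "F0 z0 ~= 0" using nz by blast
 have z0: "Im z0 > 0" using F0 W by (auto simp: modular_forms_def intro: ccontr)
 have hol: "F holomorphic_on UHP" if "F \<in> W" for F using that W by (auto simp: modular_forms_def)
 define chart where "chart = (\<lambda>\<Psi>. is_chart W \<Psi> \<and> (\<exists>z. Im z > 0 \<and> eventually (covers W \<Psi>) (nhds z)))"
 have pt: "\<exists>\<rho>>0. \<exists>\<Psi>. chart \<Psi> \<and> (\<forall>z\<in>ball a \<rho>. covers W \<Psi> z)" if a: "a \<in> UHP" for a
 proof -
  define S where "S = {t. Im t > - Im a}"
  have S: "open S" "connected S" "0 \<in> S" unfolding S_def using a
 by (auto intro: open_halfspace_Im_gt convex_connected convex_halfspace_Im_gt)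
  have "(\<lambda>t. F (a + t)) holomorphic_on S" if "F \<in> W" for F
 by (rule holomorphic_on_comp[OF _ _ hol[OF that]]) (auto simp: S_def intro!: holomorphic_intros)
  moreover have "\<exists>F\<in>W. \<exists>t\<in>S. F (a + t) ~= 0"
   using F0 z0 by (intro bexI[of _ F0] bexI[of _ "z0 - a"]) (auto simp: S_def)
  moreover have "\<exists>z\<in>UHP. \<exists>b. b ~= 0 \<and> (\<forall>F\<in>W. F (a + t) = b * F z)" if "t \<in> S - {0}" for t
   using that by (intro bexI[of _ "a + t"] exI[of _ 1]) (auto simp: S_def)
  ultimately have "\<exists>\<rho>>0. \<exists>\<Psi>. is_chart W \<Psi> \<and> (\<forall>t b z. norm t < \<rho> --> b ~= 0 --> (\<forall>F\<in>W. F (a + t) = b * F z) --> covers W \<Psi> z)"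
 by (rule chart_from_param[OF S])
  then obtain \<rho> \<Psi> where \<rho>: "\<rho> > 0" "is_chart W \<Psi>"
   "\<And>t b z. norm t < \<rho> ==> b ~= 0 ==> \<forall>F\<in>W. F (a + t) = b * F z ==> covers W \<Psi> z" by blast
  have c: "covers W \<Psi> z" if "z \<in> ball a \<rho>" for z
 by (rule \<rho>(3)[of "z - a" 1]) (use that in \<open>auto simp: dist_norm norm_minus_commute\<close>)
  hence "eventually (covers W \<Psi>) (nhds a)" by (intro eventually_mono[OF eventually_nhds_ball[OF \<rho>(1)]])
  thus ?thesis using \<rho>(1,2) a c unfolding chart_def UHP_iff by blast
 qed
 have cusp: "\<exists>Y \<Psi>. chart \<Psi> \<and> (\<forall>z. Im z > 0 --> Im (mob (adj2 (scaling s)) z) > Y --> covers W \<Psi> z)" if s: "s \<in> cusps \<Gamma>" for s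
 proof -
  define \<sigma> where "\<sigma> = scaling s"
  have d\<sigma>: "det \<sigma> = 1" by (simp add: \<sigma>_def)
  obtain w where w: "w > 0" "\<And>F. F \<in> W ==> \<exists>g. g holomorphic_on ball 0 1 \<and>
   (\<forall>z\<in>UHP. F (mob \<sigma> z) / cocyc \<sigma> z ^ m = g (qexp w z))"
   using modular_form_cusp_expansion[OF subgroup chi s, of m] W unfolding \<sigma>_def by blast
  then obtain u where u: "\<And>F. F \<in> W ==> u F holomorphic_on ball 0 1"
    "\<And>F z. F \<in> W ==> z \<in> UHP ==> F (mob \<sigma> z) / cocyc \<sigma> z ^ m = u F (qexp w z)" by metis
  have rel: "1 / cocyc \<sigma> z ^ m ~= 0" "\<forall>F\<in>W. u F (qexp w z) = 1 / cocyc \<sigma> z ^ m * F (mob \<sigma> z)" if "Im z > 0" for z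
   using u(2)[of _ z] that cocyc_nz[OF d\<sigma> that] by auto
  have "\<exists>F\<in>W. \<exists>t\<in>ball 0 1. u F t ~= 0"
  proof (intro bexI[OF _ F0(1)] bexI)
   have z1: "Im (mob (adj2 \<sigma>) z0) > 0" using Im_mob_pos[of "adj2 \<sigma>" z0] z0 d\<sigma> by simp
   show "qexp w (mob (adj2 \<sigma>) z0) \<in> ball 0 1" using z1 w(1) by (simp add: norm_qexp)
   show "u F0 (qexp w (mob (adj2 \<sigma>) z0)) ~= 0" using rel[OF z1] F0 mob_adj2(1)[OF d\<sigma> z0] by auto
  qed
  moreover have "\<exists>z\<in>UHP. \<exists>a. a ~= 0 \<and> (\<forall>F\<in>W. u F t = a * F z)" if t: "t \<in> ball 0 1 - {0}" for t
  proof -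
   obtain z where z: "qexp w z = t" "Im z = - w * ln (norm t) / (2 * pi)" using qexp_surj[OF w(1), of t] t by auto
   hence zp: "Im z > 0" using w t by (simp add: divide_neg_pos mult_pos_neg)
   show ?thesis using rel[OF zp] z(1) Im_mob_pos[OF d\<sigma> zp]
 by (intro bexI[of _ "mob \<sigma> z"] exI[of _ "1 / cocyc \<sigma> z ^ m"]) auto
  qed
  ultimately have "\<exists>\<rho>>0. \<exists>\<Psi>. is_chart W \<Psi> \<and> (\<forall>t b z. norm t < \<rho> --> b ~= 0 --> (\<forall>F\<in>W. u F t = b * F z) --> covers W \<Psi> z)"
   using u(1) by (intro chart_from_param[of "ball 0 1"]) auto
  then obtain \<rho> \<Psi> where \<rho>: "\<rho> > 0" "is_chart W \<Psi>"
   "\<And>t b z. norm t < \<rho> ==> b ~= 0 ==> \<forall>F\<in>W. u F t = b * F z ==> covers W \<Psi> z" by blast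
  define Y where "Y = max 1 (- w * ln \<rho> / (2 * pi))"
  have c: "covers W \<Psi> (mob \<sigma> z)" if z: "Im z > Y" for z
  proof (rule \<rho>(3)[OF _ rel])
   have "- 2 * pi * Im z / w < ln \<rho>" using z w(1) by (simp add: Y_def field_simps)
   thus "norm (qexp w z) < \<rho>" using \<rho>(1) unfolding norm_qexp by (metis exp_less_mono exp_ln)
  qed (use z in \<open>auto simp: Y_def\<close>)
  have "near s (covers W \<Psi>)"
   using c unfolding punctured_nhds_boundary[OF cusps_boundary[OF s]] eventually_horoball \<sigma>_def[symmetric]
 by (intro exI[of _ Y]) (auto simp: Y_def)
  from covers_open_UHP[OF _ this, of \<Gamma>] s show ?thesis using \<rho>(2) c mob_adj2(1)[OF d\<sigma>] by (force simp: \<sigma>_def chart_def extended_half_plane_def)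
 qed
 have trans: "covers W \<Psi> z" if AG: "A \<in> \<Gamma>" and z: "Im z > 0" and cv: "covers W \<Psi> (mob A z)" for A z \<Psi>
  unfolding covers_def
 proof
  assume ex: "\<exists>F\<in>W. F z ~= 0"
  define c where "c = chi A * cocyc A z ^ m"
  have c: "c ~= 0" using chi AG cocyc_nz[OF det_Gamma[OF AG] z] by (simp add: c_def finite_order_character_def)
  have Fc: "F (mob A z) = c * F z" if "F \<in> W" for F
   using that W AG z by (auto simp: modular_forms_def c_def)
  then obtain t b where "t \<in> cball 0 1" "b ~= 0" "\<And>F. F \<in> W ==> \<Psi> F t = b * F (mob A z)"
   using cv ex c unfolding covers_def by (metis mult_eq_0_iff)
  thus "\<exists>t\<in>cball 0 1. \<exists>a. a ~= 0 \<and> (\<forall>F\<in>W. \<Psi> F t = a * F z)"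
   using Fc c by (intro bexI[of _ t] exI[of _ "b * c"]) auto
 qed
 obtain S where S: "finite S" "S \<subseteq> cusps \<Gamma>" and Scov: "\<And>Y. \<exists>K. compact K \<and> K \<subseteq> UHP \<and>
    (\<forall>z\<in>UHP. \<exists>A\<in>\<Gamma>. mob A z \<in> K \<or> (\<exists>s\<in>S. Im (mob (adj2 (scaling s)) (mob A z)) > Y))"
  using finite_area_cover by metis
 obtain Y Ps where Ps: "\<And>s. s \<in> S ==> chart (Ps s)"
  "\<And>s z. s \<in> S ==> Im z > 0 ==> Im (mob (adj2 (scaling s)) z) > Y s ==> covers W (Ps s) z" using cusp S(2) by (metis subsetD)
 define Y0 where "Y0 = Max (insert 0 (Y ` S))"
 have Y0: "Y s \<le> Y0" if "s \<in> S" for s unfolding Y0_def using S(1) that by simp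
 obtain K where K: "compact K" "K \<subseteq> UHP"
  "\<And>z. Im z > 0 ==> \<exists>A\<in>\<Gamma>. mob A z \<in> K \<or> (\<exists>s\<in>S. Im (mob (adj2 (scaling s)) (mob A z)) > Y0)"
  using Scov[of Y0] by auto
 obtain \<rho> Pt where \<rho>: "\<And>a. a \<in> K ==> \<rho> a > 0" and Pt: "\<And>a. a \<in> K ==> chart (Pt a)" "\<And>a z. a \<in> K ==> z \<in> ball a (\<rho> a) ==> covers W (Pt a) z"
  using pt K(2) by (metis subsetD)
 obtain K' where K': "K' \<subseteq> K" "finite K'" "K \<subseteq> (\<Union>a\<in>K'. ball a (\<rho> a))" using \<rho> compactE_image[OF K(1), of K "\<lambda>a. ball a (\<rho> a)"] by force
 have "\<exists>\<Psi>\<in>Pt ` K' \<union> Ps ` S. covers W \<Psi> z" if z: "Im z > 0" for z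
 proof -
  obtain A where A: "A \<in> \<Gamma>" "mob A z \<in> K \<or> (\<exists>s\<in>S. Im (mob (adj2 (scaling s)) (mob A z)) > Y0)" using K(3)[OF z] by blast
  from A(2) have "\<exists>\<Psi>\<in>Pt ` K' \<union> Ps ` S. covers W \<Psi> (mob A z)"
  proof
   assume "mob A z \<in> K"
   thus ?thesis using Pt(2)[of _ "mob A z"] K' by blast
  next
   assume "\<exists>s\<in>S. Im (mob (adj2 (scaling s)) (mob A z)) > Y0"
   thus ?thesis using Ps(2)[of _ "mob A z"] Im_mob_pos[OF det_Gamma[OF A(1)] z] Y0 by (metis UnCI image_eqI order_le_less_trans)
  qed
  thus ?thesis using trans[OF A(1) z] by blast
 qed
 thus ?thesis using K' S(1) Pt(1) Ps(1) unfolding chart_atlas_def chart_def by (intro exI[of _ "Pt ` K' \<union> Ps ` S"]) auto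
qed

end

section \<open>A uniform bound for the degree of a relation\<close>

lemma taylor_expansion:
 assumes "F holomorphic_on S" "open S" "0 \<in> S"
 shows "\<exists>a R. R holomorphic_on S \<and> (\<forall>t\<in>S. F t = (\<Sum>l<M. a l * t ^ l) + t ^ M * R t)"
proof (induction M)
 case 0
 show ?case using assms(1) by auto
next
 case (Suc M)
 then obtain a R where R: "R holomorphic_on S" "\<And>t. t \<in> S ==> F t = (\<Sum>l<M. a l * t ^ l) + t ^ M * R t" by blast
 have "(\<lambda>t. R t - R 0) holomorphic_on S" using R(1) by (intro holomorphic_intros)
 then obtain Q where Q: "Q holomorphic_on S" "\<And>t. t \<in> S ==> R t - R 0 = t * Q t"
  using divide_by_t[of "\<lambda>t. R t - R 0" S] assms by auto
 have "F t = (\<Sum>l<Suc M. (a(M := R 0)) l * t ^ l) + t ^ Suc M * Q t" if "t \<in> S" for t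
 using arg_cong[OF Q(2)[OF that], of "\<lambda>x. t ^ M * x"] R(2)[OF that] by (auto simp: algebra_simps)
 thus ?case using Q(1) by blast
qed

text \<open>The Schwarz lemma: the maximum principle for \<open>q\<close> on the circle of radius
  3/2 gains a factor 2/3 on the unit disc for each order of vanishing.\<close>

lemma norm_le_of_high_order_zero:
 assumes "q holomorphic_on ball 0 2" "\<And>t. t \<in> cball 0 (3/2) ==> norm (t ^ M * q t) \<le> B" "t \<in> cball 0 1"
 shows "norm (t ^ M * q t) \<le> (2/3) ^ M * B"
proof -
 have "norm (q t) \<le> (2/3) ^ M * B"
 proof (rule maximum_modulus_frontier[where S = "cball 0 (3/2)" and f = q])
  show "q holomorphic_on interior (cball 0 (3/2))" by (intro holomorphic_on_subset[OF assms(1)]) auto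
  have "closure (cball 0 (3/2)) \<subseteq> ball (0::complex) 2" by auto
  thus "continuous_on (closure (cball 0 (3/2))) q"
 by (intro holomorphic_on_imp_continuous_on holomorphic_on_subset[OF assms(1)])
  fix z :: complex assume "z \<in> frontier (cball 0 (3/2))"
  hence z: "norm z = 3/2" by simp
  have "(2/3) ^ M * ((3/2) ^ M * norm (q z)) \<le> (2/3) ^ M * B" using assms(2)[of z] z by (simp add: norm_mult norm_power)
  thus "norm (q z) \<le> (2/3) ^ M * B" by (simp add: mult.assoc[symmetric] power_mult_distrib[symmetric])
 qed (use assms in auto)
 moreover have "norm (t ^ M) \<le> 1" using assms(3) by (simp add: norm_power power_le_one)
 ultimately show ?thesis unfolding norm_mult using mult_mono[of "norm (t ^ M)" 1 "norm (q t)" "(2/3)^M * B"]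
 by simp
qed

text \<open>Compares each disc of radius 3/2 with the unit discs. The factor b is a quotient of
  values of a form that has no zero in the target chart, so numerator and inverse denominator are
  bounded by compactness. It does not depend on F.\<close>

lemma chart_transition_bound:
 assumes J: "chart_atlas W J"
 shows "\<exists>C\<ge>1. \<forall>\<Psi>\<in>J. \<forall>t\<in>cball 0 (3/2) - {0}. \<exists>\<Psi>'\<in>J. \<exists>u\<in>cball 0 1. \<exists>b. norm b \<le> C \<and> (\<forall>F\<in>W. \<Psi> F t = b * \<Psi>' F u)"
proof -
 have fin: "finite J" and ch: "\<And>\<Psi>. \<Psi> \<in> J ==> is_chart W \<Psi>" using J by (auto simp: chart_atlas_def)
 have "\<forall>\<Psi>\<in>J. \<exists>F. F \<in> W \<and> (\<forall>t\<in>ball 0 2. \<Psi> F t ~= 0)" using ch unfolding is_chart_def by blast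
 from bchoice[OF this] obtain F0 where F0: "\<And>\<Psi>. \<Psi> \<in> J ==> F0 \<Psi> \<in> W" "\<And>\<Psi> t. \<Psi> \<in> J ==> t \<in> ball 0 2 ==> \<Psi> (F0 \<Psi>) t ~= 0" by blast
 have cont: "continuous_on (cball 0 (3/2)) (\<lambda>t. \<Psi> F t)" if "\<Psi> \<in> J" "F \<in> W" for \<Psi> F
 by (rule holomorphic_on_imp_continuous_on, rule holomorphic_on_subset[of _ "ball 0 2"])
    (use ch[OF that(1)] that(2) in \<open>auto simp: is_chart_def\<close>)
 have "\<exists>B. \<forall>t\<in>cball 0 (3/2). norm (\<Psi> (F0 \<Psi>') t) \<le> B" if "\<Psi> \<in> J" "\<Psi>' \<in> J" for \<Psi> \<Psi>' :: "cfun => complex => complex"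
  using compact_imp_bounded[OF compact_continuous_image[OF cont[OF that(1) F0(1)[OF that(2)]] compact_cball]]
  unfolding bounded_iff by auto
 hence "\<forall>\<Psi> \<Psi>'. \<exists>B. \<Psi> \<in> J --> \<Psi>' \<in> J --> (\<forall>t\<in>cball 0 (3/2). norm (\<Psi> (F0 \<Psi>') t) \<le> B)" by blast
 from this[unfolded choice_iff] obtain B where
  B: "\<And>\<Psi> \<Psi>' t. \<Psi> \<in> J ==> \<Psi>' \<in> J ==> t \<in> cball 0 (3/2) ==> norm (\<Psi> (F0 \<Psi>') t) \<le> B \<Psi> \<Psi>'" by blast
 have "\<exists>B. \<forall>t\<in>cball 0 (3/2). norm (1 / \<Psi> (F0 \<Psi>) t) \<le> B" if "\<Psi> \<in> J" for \<Psi>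
 proof -
  have "continuous_on (cball 0 (3/2)) (\<lambda>t. 1 / \<Psi> (F0 \<Psi>) t)"
 by (rule continuous_on_divide[OF continuous_on_const cont[OF that F0(1)[OF that]]]) (use F0(2)[OF that] in auto)
  from compact_imp_bounded[OF compact_continuous_image[OF this compact_cball]] show ?thesis
 by (simp only: bounded_iff ball_simps)
 qed
 hence "\<forall>\<Psi>. \<exists>B. \<Psi> \<in> J --> (\<forall>t\<in>cball 0 (3/2). norm (1 / \<Psi> (F0 \<Psi>) t) \<le> B)" by blast
 from this[unfolded choice_iff] obtain D where D: "\<And>\<Psi> t. \<Psi> \<in> J ==> t \<in> cball 0 (3/2) ==> norm (1 / \<Psi> (F0 \<Psi>) t) \<le> D \<Psi>" by blast
 define C where "C = Max (insert 1 ((\<lambda>(\<Psi>, \<Psi>'). B \<Psi> \<Psi>' * D \<Psi>') ` (J \<times> J)))"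
 have C1: "C \<ge> 1" unfolding C_def using fin by simp
 have C: "B \<Psi> \<Psi>' * D \<Psi>' \<le> C" if "\<Psi> \<in> J" "\<Psi>' \<in> J" for \<Psi> \<Psi>'
  unfolding C_def using fin that by (intro Max_ge) auto
 show ?thesis
 proof (intro exI[of _ C] conjI C1 ballI)
  fix \<Psi> and t :: complex assume \<Psi>: "\<Psi> \<in> J" and t: "t \<in> cball 0 (3/2) - {0}"
  hence t2: "t \<in> ball 0 2 - {0}" by auto
  then obtain z a where za: "z \<in> UHP" "a ~= 0" "\<And>F. F \<in> W ==> \<Psi> F t = a * F z"
   using ch[OF \<Psi>] unfolding is_chart_def by blast
  obtain \<Psi>' u l where u: "\<Psi>' \<in> J" "u \<in> cball 0 1" "l ~= 0" "\<And>F. F \<in> W ==> \<Psi>' F u = l * F z" using za(3)[OF F0(1)[OF \<Psi>]] F0(2)[OF \<Psi>, of t] t2 chart_atlas_cover[OF J za(1) F0(1)[OF \<Psi>]] by auto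
  have eq: "\<Psi> F t = (a / l) * \<Psi>' F u" if "F \<in> W" for F using za(3)[OF that] u(3) u(4)[OF that] by simp
  have u2: "u \<in> cball 0 (3/2)" "u \<in> ball 0 2" using u(2) by auto
  have "a / l = \<Psi> (F0 \<Psi>') t * (1 / \<Psi>' (F0 \<Psi>') u)"
   using eq[OF F0(1)[OF u(1)]] F0(2)[OF u(1) u2(2)] by simp
  hence "norm (a / l) = norm (\<Psi> (F0 \<Psi>') t) * norm (1 / \<Psi>' (F0 \<Psi>') u)" by (simp only: norm_mult)
  also have "... \<le> B \<Psi> \<Psi>' * D \<Psi>'"
   using B[OF \<Psi> u(1), of t] D[OF u(1) u2(1)] t by (intro mult_mono) (auto intro: order_trans[OF norm_ge_zero])
  also have "... \<le> C" by (rule C[OF \<Psi> u(1)])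
  finally show "\<exists>\<Psi>'\<in>J. \<exists>u\<in>cball 0 1. \<exists>b. norm b \<le> C \<and> (\<forall>F\<in>W. \<Psi> F t = b * \<Psi>' F u)"
   using eq u by blast
 qed
qed

text \<open>There are more monomials of large degree \<open>k\<close> than conditions for a form of degree \<open>k\<close> to vanish to order
 \<open>A * k\<close> at all chart centres, and such a form is too small on each chart not to vanish identically.\<close>

theorem uniform_relation_degree:
 assumes J: "chart_atlas W J"
 shows "\<exists>k. \<forall>f\<in>W. \<forall>g\<in>W. \<forall>h\<in>W. \<exists>c. (\<exists>x\<in>Mon k. c x ~= 0) \<and> (\<forall>z\<in>UHP. hform k c (vector [f z, g z, h z]) = 0)"
proof -
 have fin: "finite J" and ch: "\<And>\<Psi>. \<Psi> \<in> J ==> is_chart W \<Psi>" using J by (auto simp: chart_atlas_def)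
 obtain C where C: "C \<ge> 1" and tr: "\<And>\<Psi> t. \<Psi> \<in> J ==> t \<in> cball 0 (3/2) - {0} ==>
   \<exists>\<Psi>'\<in>J. \<exists>u\<in>cball 0 1. \<exists>b. norm b \<le> C \<and> (\<forall>F\<in>W. \<Psi> F t = b * \<Psi>' F u)"
  using chart_transition_bound[OF J] by blast
 \<comment> \<open>A change of chart costs C^k in degree k, while vanishing to order A k gains
   (2/3)^(A k); this choice of A makes the gain win.\<close>
 obtain A where A: "C < (3/2) ^ A" using real_arch_pow[of "3/2" C] by auto
 \<comment> \<open>The (k + 1)(k + 2) / 2 monomials then outnumber the card J * A * k
   conditions.\<close>
 define k where "k = 2 * card J * A + 1"
 define M where "M = A * k"
 have small: "(2/3) ^ M * C ^ k < 1"
 proof -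
  have "(2/3) ^ M * C ^ k = ((2/3) ^ A * C) ^ k" by (simp add: M_def power_mult power_mult_distrib)
  moreover have "(2/3::real) ^ A * C < (2/3) ^ A * (3/2) ^ A" using A by simp
  hence "(2/3) ^ A * C < 1" by (simp add: power_mult_distrib[symmetric])
  moreover have "k ~= 0" "0 \<le> (2/3) ^ A * C" using C by (simp_all add: k_def)
  ultimately show ?thesis using power_strict_mono[of "(2/3) ^ A * C" 1 k] by simp
 qed
 have count: "card (J \<times> {..<M}) < card (Mon k)"
 using card_Mon[of k] by (auto simp: M_def k_def algebra_simps card_cartesian_product)
 show ?thesis
 proof (intro exI[of _ k] ballI)
  fix f g h assume fgh: "f \<in> W" "g \<in> W" "h \<in> W"
  define V where "V = (\<lambda>(\<Psi> :: cfun => complex => complex) t. vector [\<Psi> f t, \<Psi> g t, \<Psi> h t] :: complex^3)"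
  define mon where "mon = (\<lambda>(i, j) v. (v::complex^3)$1 ^ (k - i - j) * v$2 ^ i * v$3 ^ j)"
  have Vhol: "(\<lambda>t. V \<Psi> t $ i) holomorphic_on ball 0 2" if "\<Psi> \<in> J" for \<Psi> i
   using ch[OF that] fgh exhaust_3[of i] by (auto simp: V_def is_chart_def)
  have "\<exists>a R. R holomorphic_on ball 0 2 \<and> (\<forall>t\<in>ball 0 2. mon x (V \<Psi> t) = (\<Sum>l<M. a l * t ^ l) + t ^ M * R t)" if "\<Psi> \<in> J" for \<Psi> :: "cfun => complex => complex" and x
   unfolding mon_def case_prod_beta
 by (rule taylor_expansion) (auto intro!: holomorphic_intros Vhol that)
  then obtain a R where R: "\<And>\<Psi> x. \<Psi> \<in> J ==> R \<Psi> x holomorphic_on ball 0 2"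
   and aR: "\<And>\<Psi> x t. \<Psi> \<in> J ==> t \<in> ball 0 2 ==> mon x (V \<Psi> t) = (\<Sum>l<M. a \<Psi> x l * t ^ l) + t ^ M * R \<Psi> x t" by metis
  obtain c where c: "\<exists>x\<in>Mon k. c x ~= 0" and c0: "\<forall>y\<in>J \<times> {..<M}. (\<Sum>x\<in>Mon k. a (fst y) x (snd y) * c x) = 0"
   using underdetermined_system[OF _ finite_Mon count, of "\<lambda>y x. a (fst y) x (snd y)"] fin by blast
  define p where "p = hform k c"
  define q where "q = (\<lambda>(\<Psi> :: cfun => complex => complex) t. \<Sum>x\<in>Mon k. c x * R \<Psi> x t)"
  have pq: "p (V \<Psi> t) = t ^ M * q \<Psi> t" if "\<Psi> \<in> J" "t \<in> ball 0 2" for \<Psi> t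
  proof -
   have "p (V \<Psi> t) = (\<Sum>x\<in>Mon k. c x * mon x (V \<Psi> t))" by (simp add: p_def hform_def mon_def case_prod_beta)
   also have "... = (\<Sum>x\<in>Mon k. \<Sum>l<M. t ^ l * (a \<Psi> x l * c x)) + t ^ M * q \<Psi> t"
 by (simp add: aR[OF that] q_def sum_distrib_left sum.distrib algebra_simps)
   also have "(\<Sum>x\<in>Mon k. \<Sum>l<M. t ^ l * (a \<Psi> x l * c x)) = (\<Sum>l<M. t ^ l * (\<Sum>x\<in>Mon k. a \<Psi> x l * c x))"
 by (subst sum.swap) (simp add: sum_distrib_left)
   also have "... = 0" using c0 that by simp
   finally show ?thesis by simp
  qed
  have qhol: "q \<Psi> holomorphic_on ball 0 2" if "\<Psi> \<in> J" for \<Psi>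
   unfolding q_def by (intro holomorphic_intros R that)
  have phom: "p \<in> homog k" unfolding p_def by (rule homogI)
  define N where "N = (\<lambda>(\<Psi> :: cfun => complex => complex). Sup ((\<lambda>t. norm (p (V \<Psi> t))) ` cball 0 1))"
  have bdd: "bdd_above ((\<lambda>t. norm (p (V \<Psi> t))) ` cball 0 1)" if "\<Psi> \<in> J" for \<Psi>
  proof -
   have "(\<lambda>t. p (V \<Psi> t)) holomorphic_on cball 0 1"
 by (rule holomorphic_on_subset[OF holomorphic_homog[OF phom Vhol[OF that]]]) auto
   hence "continuous_on (cball 0 1) (\<lambda>t. norm (p (V \<Psi> t)))" by (intro continuous_on_norm holomorphic_on_imp_continuous_on)
   thus ?thesis by (intro bounded_imp_bdd_above compact_imp_bounded compact_continuous_image) auto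
  qed
  have N: "norm (p (V \<Psi> t)) \<le> N \<Psi>" if "\<Psi> \<in> J" "t \<in> cball 0 1" for \<Psi> t
   unfolding N_def using bdd[OF that(1)] that(2) by (intro cSUP_upper) auto
  define S where "S = Max (insert 0 (N ` J))"
  have S: "N \<Psi> \<le> S" if "\<Psi> \<in> J" for \<Psi> unfolding S_def using fin that by simp
  have S0: "S \<ge> 0" unfolding S_def using fin by simp
  have bound: "norm (p (V \<Psi> t)) \<le> (2/3) ^ M * C ^ k * S" if \<Psi>: "\<Psi> \<in> J" and t: "t \<in> cball 0 1" for \<Psi> t
  proof -
   have big: "norm (s ^ M * q \<Psi> s) \<le> C ^ k * S" if s: "s \<in> cball 0 (3/2) - {0}" for s
   proof -
    have s2: "s \<in> ball 0 2" using s by auto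
    obtain \<Psi>' u b where u: "\<Psi>' \<in> J" "u \<in> cball 0 1" "norm b \<le> C" "\<And>F. F \<in> W ==> \<Psi> F s = b * \<Psi>' F u"
     using tr[OF \<Psi> s] by blast
    have "V \<Psi> s = b *s V \<Psi>' u" unfolding V_def using u(4) fgh by (simp add: vec_eq_iff forall_3)
    hence "norm (p (V \<Psi> s)) = norm b ^ k * norm (p (V \<Psi>' u))"
 by (simp add: homog_scaling[OF phom] norm_mult norm_power)
    also have "... \<le> C ^ k * S"
     using u(3) N[OF u(1,2)] S[OF u(1)] C by (intro mult_mono power_mono) auto
    finally show ?thesis using pq[OF \<Psi> s2] by simp
   qed
   have "norm (s ^ M * q \<Psi> s) \<le> C ^ k * S" if s: "s \<in> cball 0 (3/2)" for s
   proof (cases "s = 0")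
    case True
    have "continuous_on (ball 0 2) (\<lambda>s. norm (s ^ M * q \<Psi> s))"
 by (intro continuous_intros holomorphic_on_imp_continuous_on qhol \<Psi>)
    hence "((\<lambda>s. norm (s ^ M * q \<Psi> s)) \<longlongrightarrow> norm (0 ^ M * q \<Psi> 0)) (at 0)"
     using continuous_on_eq_continuous_at[of "ball 0 2" "\<lambda>s. norm (s ^ M * q \<Psi> s)"] by (auto simp: isCont_def)
    moreover have "eventually (\<lambda>s. norm (s ^ M * q \<Psi> s) \<le> C ^ k * S) (at 0)"
     unfolding eventually_at using big by (intro exI[of _ "3/2"]) auto
    ultimately show ?thesis using True by (auto intro: tendsto_upperbound)
   next
    case False
    thus ?thesis using big s by auto
   qed
   from norm_le_of_high_order_zero[OF qhol[OF \<Psi>] this t] show ?thesis using pq[OF \<Psi>, of t] t by simp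
  qed
  have "N \<Psi> \<le> (2/3) ^ M * C ^ k * S" if "\<Psi> \<in> J" for \<Psi>
   unfolding N_def using bound[OF that] by (intro cSUP_least) auto
  \<comment> \<open>The maximum over all charts is bounded by itself times a factor below 1, so it
    is 0.\<close>
  hence "S \<le> (2/3) ^ M * C ^ k * S"
   unfolding S_def using fin S0 C by simp
  hence van: "p (V \<Psi> t) = 0" if "\<Psi> \<in> J" "t \<in> cball 0 1" for \<Psi> t using small S0 mult_less_cancel_right2[of "(2/3) ^ M * C ^ k" S] bound[OF that] by simp
  have "p (vector [f z, g z, h z]) = 0" if z: "z \<in> UHP" for z
  proof (cases "\<exists>F\<in>W. F z ~= 0")
   case True
   then obtain F where "F \<in> W" "F z ~= 0" by blast
   from chart_atlas_cover[OF J z this] obtain \<Psi> t l where t: "\<Psi> \<in> J" "t \<in> cball 0 1" "l ~= 0" "\<And>F. F \<in> W ==> \<Psi> F t = l * F z" by blast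
   have "V \<Psi> t = l *s vector [f z, g z, h z]" unfolding V_def using t(4) fgh by (simp add: vec_eq_iff forall_3)
   thus ?thesis using van[OF t(1,2)] t(3) by (simp add: homog_scaling[OF phom])
  next
   case False
   hence "(vector [f z, g z, h z] :: complex^3) = 0 *s 0" using fgh by (simp add: vec_eq_iff forall_3)
   thus ?thesis by (simp only: homog_scaling[OF phom]) (simp add: k_def)
  qed
  thus "\<exists>c. (\<exists>x\<in>Mon k. c x ~= 0) \<and> (\<forall>z\<in>UHP. hform k c (vector [f z, g z, h z]) = 0)"
   using c unfolding p_def by blast
 qed
qed

section \<open>Invariant meromorphic functions on the half-plane\<close>

text \<open>The values at poles are irrelevant.\<close>

definition aut_mero :: "(real^2^2) set => cfun => bool" where
 "aut_mero \<Gamma> u \<longleftrightarrow> (\<forall>A\<in>\<Gamma>. \<forall>z. Im z > 0 --> u (mob A z) = u z) \<and>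
   (\<forall>P\<in>EHP \<Gamma>. \<exists>\<phi>. \<phi> meromorphic_on {0} \<and> near P (\<lambda>z. u z = \<phi> (local_param \<Gamma> P z)))"

text \<open>Equality off isolated points, at the cusps as well. Elements of the function field are
  handled as functions on the half-plane modulo this relation, where the field operations are
  pointwise.\<close>

definition aut_eq :: "(real^2^2) set => cfun => cfun => bool" where
 "aut_eq \<Gamma> u v \<longleftrightarrow> (\<forall>P\<in>EHP \<Gamma>. near P (\<lambda>z. u z = v z))"

lemma aut_mero_binop:
 assumes u: "aut_mero \<Gamma> u" and v: "aut_mero \<Gamma> v"
  and opn: "\<And>\<phi> \<psi>. \<phi> meromorphic_on {0} ==> \<psi> meromorphic_on {0} ==> (\<lambda>t. opn (\<phi> t) (\<psi> t)) meromorphic_on {0}"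
 shows "aut_mero \<Gamma> (\<lambda>z. opn (u z) (v z))"
 unfolding aut_mero_def
proof (intro conjI ballI)
 show "\<forall>z. 0 < Im z --> opn (u (mob A z)) (v (mob A z)) = opn (u z) (v z)" if "A \<in> \<Gamma>" for A
  using that u v by (auto simp: aut_mero_def)
 fix P assume "P \<in> EHP \<Gamma>"
 then obtain \<phi> \<psi> where "\<phi> meromorphic_on {0}" "\<psi> meromorphic_on {0}"
  and ev: "near P (\<lambda>z. u z = \<phi> (local_param \<Gamma> P z))" "near P (\<lambda>z. v z = \<psi> (local_param \<Gamma> P z))"
  using u v unfolding aut_mero_def by blast
 moreover have "near P (\<lambda>z. opn (u z) (v z) = opn (\<phi> (local_param \<Gamma> P z)) (\<psi> (local_param \<Gamma> P z)))"
  using ev by eventually_elim simp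
 ultimately show "\<exists>\<phi>. \<phi> meromorphic_on {0} \<and> near P (\<lambda>z. opn (u z) (v z) = \<phi> (local_param \<Gamma> P z))"
  using opn by auto
qed

lemma aut_mero_const [intro]: "aut_mero \<Gamma> (\<lambda>_. c)"
 unfolding aut_mero_def by (auto intro!: exI[of _ "\<lambda>_. c"])

lemma aut_mero_add [intro]: "aut_mero \<Gamma> u ==> aut_mero \<Gamma> v ==> aut_mero \<Gamma> (\<lambda>z. u z + v z)"
 by (rule aut_mero_binop) (auto intro: meromorphic_intros)

lemma aut_mero_mult [intro]: "aut_mero \<Gamma> u ==> aut_mero \<Gamma> v ==> aut_mero \<Gamma> (\<lambda>z. u z * v z)"
 by (rule aut_mero_binop) (auto intro: meromorphic_intros)

lemma aut_mero_inverse [intro]: "aut_mero \<Gamma> u ==> aut_mero \<Gamma> (\<lambda>z. inverse (u z))"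
 by (rule aut_mero_binop[of \<Gamma> u u "\<lambda>x y. inverse x"]) (auto intro: meromorphic_intros)

lemma aut_mero_uminus [intro]: "aut_mero \<Gamma> u ==> aut_mero \<Gamma> (\<lambda>z. - u z)"
 by (rule aut_mero_binop[of \<Gamma> u u "\<lambda>x y. - x"]) (auto intro: meromorphic_intros)

lemma meromorphic_zero_dichotomy:
 assumes "\<phi> meromorphic_on {z}"
 shows "eventually (\<lambda>t. \<phi> t = 0) (at z) \<or> eventually (\<lambda>t. \<phi> t ~= 0) (at z)"
proof (cases "frequently (\<lambda>t. \<phi> t = 0) (at z)")
 case True
 thus ?thesis using not_essential_frequently_0_imp_eventually_0 assms by (auto simp: meromorphic_at_iff)
next
 case False
 thus ?thesis by (auto simp: frequently_def)
qed

definition cusp_val :: "cfun => riemann_sphere => riemann_sphere" where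
 "cusp_val u P = (if \<exists>c. (u \<longlongrightarrow> c) (punctured_nhds P) then Fin (Lim (punctured_nhds P) u) else Infty)"

text \<open>Values are taken as limits along punctured neighbourhoods, so wrong values of u at
  isolated points are repaired. The choice of a representative of the orbit is immaterial for
  invariant u.\<close>

definition mk_mero :: "(real^2^2) set => cfun => riemann_sphere set => riemann_sphere" where
 "mk_mero \<Gamma> u = restrict (\<lambda>p. cusp_val u (SOME P. P \<in> EHP \<Gamma> \<and> orb \<Gamma> P = p)) (RSurf \<Gamma>)"

definition rep_mero :: "(real^2^2) set => (riemann_sphere set => riemann_sphere) => complex => complex" where
 "rep_mero \<Gamma> K z = (case K (proj_pt \<Gamma> z) of Fin c => c | Infty => 0)"

lemma cusp_val_Fin:
 assumes "punctured_nhds P ~= bot" "(u \<longlongrightarrow> c) (punctured_nhds P)" shows "cusp_val u P = Fin c"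
 unfolding cusp_val_def using assms tendsto_Lim by metis

lemma cusp_val_Infty:
 assumes "punctured_nhds P ~= bot" "filterlim u at_infinity (punctured_nhds P)" shows "cusp_val u P = Infty"
 unfolding cusp_val_def using assms not_tendsto_and_filterlim_at_infinity[of "punctured_nhds P" u] by auto

context discrete_SL2
begin

lemma uniformizer_exists:
 assumes P: "P \<in> EHP \<Gamma>"
 shows "\<exists>p h. uniformizes \<Gamma> P p h"
proof -
 have "finite_order_character \<Gamma> (\<lambda>_. 1)" by (auto simp: finite_order_character_def)
 from uniformizer[OF this P, of 0] show ?thesis by blast
qed

text \<open>Reduces germs at any point of the surface, whatever its type, to germs at 0 of the local
  parameter.\<close>

lemma filtermap_local_param:
 assumes P: "P \<in> EHP \<Gamma>"
 shows "filtermap (local_param \<Gamma> P) (punctured_nhds P) = at 0"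
proof (rule filter_eqI)
 fix Q
 obtain p h where h: "h > 0" and p: "\<And>\<xi>. Im \<xi> > 0 ==> local_param \<Gamma> P (p \<xi>) = qexp h \<xi>"
  and ev: "\<And>Q. near P Q \<longleftrightarrow> (\<exists>Y>0. \<forall>\<xi>. Im \<xi> > Y --> Q (p \<xi>))"
  using uniformizer_exists[OF P] unfolding uniformizes_def by blast
 show "eventually Q (filtermap (local_param \<Gamma> P) (punctured_nhds P)) = eventually Q (at 0)"
 proof
  assume "eventually Q (filtermap (local_param \<Gamma> P) (punctured_nhds P))"
  then obtain Y where Y: "Y > 0" "\<And>\<xi>. Im \<xi> > Y ==> Q (local_param \<Gamma> P (p \<xi>))"
 by (auto simp: eventually_filtermap ev)
  have "Q t" if t: "t ~= 0" "norm t < exp (- 2 * pi * Y / h)" for t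
  proof -
   define \<xi> where "\<xi> = of_real h * Ln t / (2 * of_real pi * \<i>)"
   have \<xi>: "qexp h \<xi> = t" "Im \<xi> = - h * ln (norm t) / (2 * pi)" using qexp_surj[OF h t(1)] by (simp_all add: \<xi>_def)
   have "ln (norm t) < - 2 * pi * Y / h" using t by (metis ln_exp ln_less_cancel_iff exp_gt_zero zero_less_norm_iff)
   hence "Im \<xi> > Y" unfolding \<xi>(2) using h by (simp add: field_simps)
   thus ?thesis using Y p[of \<xi>] \<xi>(1) by auto
  qed
  thus "eventually Q (at 0)" unfolding eventually_at by (intro exI[of _ "exp (- 2 * pi * Y / h)"]) auto
 next
  assume "eventually Q (at 0)"
  then obtain d where d: "d > 0" "\<And>t. t ~= 0 ==> norm t < d ==> Q t" unfolding eventually_at by auto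
  define Y where "Y = max 1 (- h * ln d / (2 * pi))"
  have "Q (local_param \<Gamma> P (p \<xi>))" if \<xi>: "Im \<xi> > Y" for \<xi>
  proof -
   have \<xi>0: "Im \<xi> > 0" "Im \<xi> > - h * ln d / (2 * pi)" using \<xi> by (auto simp: Y_def)
   have "- 2 * pi * Im \<xi> / h < ln d" using \<xi>0(2) h by (simp add: field_simps)
   hence "norm (qexp h \<xi>) < d" unfolding norm_qexp using d(1) by (metis exp_less_mono exp_ln)
   thus ?thesis using d(2)[of "qexp h \<xi>"] p[OF \<xi>0(1)] by simp
  qed
  thus "eventually Q (filtermap (local_param \<Gamma> P) (punctured_nhds P))"
   unfolding eventually_filtermap ev by (intro exI[of _ Y]) (auto simp: Y_def)
 qed
qed

lemma eventually_local_param: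
 "P \<in> EHP \<Gamma> ==> near P (\<lambda>z. Q (local_param \<Gamma> P z)) \<longleftrightarrow> eventually Q (at 0)"
 using filtermap_local_param[of P] by (simp add: eventually_filtermap[symmetric])

lemma filterlim_local_param:
 assumes P: "P \<in> EHP \<Gamma>" and ev: "near P (\<lambda>z. u z = \<phi> (local_param \<Gamma> P z))"
 shows "filterlim u F (punctured_nhds P) \<longleftrightarrow> filterlim \<phi> F (at 0)"
proof -
 have "filterlim u F (punctured_nhds P) \<longleftrightarrow> filterlim (\<lambda>z. \<phi> (local_param \<Gamma> P z)) F (punctured_nhds P)"
 by (rule filterlim_cong[OF refl refl ev])
 also have "... \<longleftrightarrow> filterlim \<phi> F (filtermap (local_param \<Gamma> P) (punctured_nhds P))"
 by (simp add: filterlim_def filtermap_filtermap)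
 finally show ?thesis using filtermap_local_param[OF P] by simp
qed

lemma local_param_isCont:
 assumes P: "P \<in> EHP \<Gamma>" and z: "Im z > 0"
 shows "isCont (local_param \<Gamma> P) z"
 using P
proof (cases rule: extended_cases)
 case (1 a)
 have "isCont (\<lambda>z. ((z - a) / (z - cnj a)) ^ ramification \<Gamma> a) z" using z 1(2) by (intro continuous_intros) auto
 moreover have "local_param \<Gamma> P = (\<lambda>z. ((z - a) / (z - cnj a)) ^ ramification \<Gamma> a)" using 1 by (simp add: fun_eq_iff local_param_UHP)
 ultimately show ?thesis by simp
next
 case 2
 have "isCont (mob (adj2 (scaling P))) z" using mob_has_derivative[of "adj2 (scaling P)", OF _ z] DERIV_isCont by auto
 moreover have "cusp_width \<Gamma> P > 0" using cusp_width[OF 2(1)] by simp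
 ultimately show ?thesis using local_param_boundary[OF 2(2)] unfolding cusp_param_def by (auto simp: matrix_inv_SL2)
qed

lemma aut_mero_limit:
 assumes "aut_mero \<Gamma> u" "P \<in> EHP \<Gamma>"
 shows "(\<exists>c. (u \<longlongrightarrow> c) (punctured_nhds P)) \<or> filterlim u at_infinity (punctured_nhds P)"
proof -
 obtain \<phi> where "\<phi> meromorphic_on {0}" and ev: "near P (\<lambda>z. u z = \<phi> (local_param \<Gamma> P z))"
  using assms unfolding aut_mero_def by blast
 thus ?thesis using filterlim_local_param[OF assms(2) ev] by (auto simp: meromorphic_at_iff not_essential_def is_pole_def)
qed

lemma cusp_val_act:
 assumes u: "\<And>z. Im z > 0 ==> u (mob A z) = u z" and A: "A \<in> \<Gamma>" and P: "P \<in> EHP \<Gamma>"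
 shows "cusp_val u (act A P) = cusp_val u P"
proof -
 have "filterlim u F (punctured_nhds (act A P)) \<longleftrightarrow> filterlim u F (punctured_nhds P)" for F
 proof -
  have "filterlim u F (punctured_nhds (act A P)) \<longleftrightarrow> filterlim (\<lambda>z. u (mob A z)) F (punctured_nhds P)"
   unfolding act_extended(2)[OF A P] by (simp add: filterlim_def filtermap_filtermap)
  also have "... \<longleftrightarrow> filterlim u F (punctured_nhds P)"
   using eventually_UHP_punctured[OF P] by (intro filterlim_cong refl) (auto elim!: eventually_mono intro: u)
  finally show ?thesis .
 qed
 thus ?thesis unfolding cusp_val_def Topological_Spaces.Lim_def by simp
qed

lemma mk_mero_orb:
 assumes u: "aut_mero \<Gamma> u" and P: "P \<in> EHP \<Gamma>"
 shows "mk_mero \<Gamma> u (orb \<Gamma> P) = cusp_val u P"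
proof -
 define P' where "P' = (SOME P'. P' \<in> EHP \<Gamma> \<and> orb \<Gamma> P' = orb \<Gamma> P)"
 have P': "P' \<in> EHP \<Gamma>" "orb \<Gamma> P' = orb \<Gamma> P" using someI[of "\<lambda>P'. P' \<in> EHP \<Gamma> \<and> orb \<Gamma> P' = orb \<Gamma> P" P] P by (auto simp: P'_def)
 obtain A where A: "A \<in> \<Gamma>" "P = act A P'" using orb_eqD[OF P P'(2)] by blast
 have "cusp_val u P = cusp_val u P'" unfolding A(2) by (rule cusp_val_act[OF _ A(1) P'(1)]) (use u A in \<open>auto simp: aut_mero_def\<close>)
 moreover have "orb \<Gamma> P \<in> RSurf \<Gamma>" using P by (simp add: RSurf_def)
 ultimately show ?thesis by (simp add: mk_mero_def P'_def[symmetric])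
qed

lemma UHP_extended [simp]: "Im z > 0 ==> Fin z \<in> EHP \<Gamma>"
 by (auto simp: extended_half_plane_def)

text \<open>The function u may differ from its limits, but only at isolated points: near P it agrees
  with a germ that is continuous off the centre.\<close>

lemma mk_mero_near:
 assumes u: "aut_mero \<Gamma> u" and P: "P \<in> EHP \<Gamma>"
 shows "near P (\<lambda>z. mk_mero \<Gamma> u (proj_pt \<Gamma> z) = Fin (u z))"
proof -
 obtain \<phi> where \<phi>: "\<phi> meromorphic_on {0}" and ev: "near P (\<lambda>z. u z = \<phi> (local_param \<Gamma> P z))"
  using u P unfolding aut_mero_def by blast
 obtain r where r: "r > 0" "\<phi> analytic_on ball 0 r - {0}" using \<phi> by (auto simp: meromorphic_at_iff isolated_singularity_at_def)
 have "eventually (\<lambda>t. t \<in> ball 0 r - {0}) (at 0)" using r by (intro eventually_at_in_open) auto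
 hence "eventually (\<lambda>t. isCont \<phi> t) (at 0)"
 proof eventually_elim
  case (elim t)
  hence "\<phi> analytic_on {t}" using r(2) analytic_on_subset by blast
  thus ?case by (rule analytic_at_imp_isCont)
 qed
 hence "near P (\<lambda>z. isCont \<phi> (local_param \<Gamma> P z))" using eventually_local_param[OF P, of "isCont \<phi>"] by simp
 with eventually_eventually_punctured[OF P ev] show ?thesis
 proof eventually_elim
  case (elim z)
  hence z: "Im z > 0" "u z = \<phi> (local_param \<Gamma> P z)" "eventually (\<lambda>z. u z = \<phi> (local_param \<Gamma> P z)) (nhds z)" by auto
  have "isCont (\<lambda>z. \<phi> (local_param \<Gamma> P z)) z" by (rule isCont_o2[OF local_param_isCont[OF P z(1)] elim(2)])
  hence "((\<lambda>z. \<phi> (local_param \<Gamma> P z)) \<longlongrightarrow> u z) (at z)" using z(2) by (simp add: isCont_def)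
  moreover have "eventually (\<lambda>z. u z = \<phi> (local_param \<Gamma> P z)) (at z)" using z(3) by (simp add: eventually_at_filter eventually_mono)
  ultimately have "(u \<longlongrightarrow> u z) (at z)" using tendsto_cong by fast
  hence "cusp_val u (Fin z) = Fin (u z)" using z(1) by (intro cusp_val_Fin) (auto simp: filter_at_UHP)
  thus ?case using mk_mero_orb[OF u, of "Fin z"] z(1) by simp
 qed
qed

lemma mk_mero_in:
 assumes u: "aut_mero \<Gamma> u" shows "mk_mero \<Gamma> u \<in> mero_funs \<Gamma>"
 unfolding mero_funs_def
proof (intro CollectI conjI ballI IntI)
 show "mk_mero \<Gamma> u \<in> extensional (RSurf \<Gamma>)" by (simp add: mk_mero_def)
 fix P assume P: "P \<in> EHP \<Gamma>"
 obtain \<phi> where \<phi>: "\<phi> meromorphic_on {0}" and ev: "near P (\<lambda>z. u z = \<phi> (local_param \<Gamma> P z))"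
  using u P unfolding aut_mero_def by blast
 have 1: "near P (\<lambda>z. mk_mero \<Gamma> u (proj_pt \<Gamma> z) = Fin (\<phi> (local_param \<Gamma> P z)))"
  using ev mk_mero_near[OF u P] by eventually_elim simp
 have "not_essential \<phi> 0" using \<phi> by (simp add: meromorphic_at_iff)
 then consider "is_pole \<phi> 0" | c where "\<phi> \<midarrow>0\<rightarrow> c" by (auto simp: not_essential_def)
 hence "is_pole \<phi> 0 \<and> mk_mero \<Gamma> u (orb \<Gamma> P) = Infty \<or> (\<exists>c. \<phi> \<midarrow>0\<rightarrow> c \<and> mk_mero \<Gamma> u (orb \<Gamma> P) = Fin c)"
 by (metis 1 cusp_val_Infty[OF punctured_nhds_neq_bot[OF P]] mk_mero_orb[OF u P] cusp_val_Fin[OF punctured_nhds_neq_bot[OF P]] filterlim_local_param[OF P ev] is_pole_def)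
 thus "meromorphic_at_point \<Gamma> (mk_mero \<Gamma> u) P" unfolding meromorphic_at_point_def using \<phi> 1 by blast
qed

lemma mero_fun_orb:
 assumes K: "K \<in> mero_funs \<Gamma>" and ev: "near P (\<lambda>z. K (proj_pt \<Gamma> z) = Fin (u z))"
  and P: "P \<in> EHP \<Gamma>"
 shows "K (orb \<Gamma> P) = cusp_val u P" "\<exists>\<phi>. \<phi> meromorphic_on {0} \<and> near P (\<lambda>z. u z = \<phi> (local_param \<Gamma> P z))"
proof -
 obtain \<phi> where \<phi>: "\<phi> meromorphic_on {0}" "near P (\<lambda>z. K (proj_pt \<Gamma> z) = Fin (\<phi> (local_param \<Gamma> P z)))"
  "is_pole \<phi> 0 \<and> K (orb \<Gamma> P) = Infty \<or> (\<exists>c. \<phi> \<midarrow>0\<rightarrow> c \<and> K (orb \<Gamma> P) = Fin c)"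
  using K P unfolding mero_funs_def meromorphic_at_point_def by blast
 have ev': "near P (\<lambda>z. u z = \<phi> (local_param \<Gamma> P z))" using ev \<phi>(2) by eventually_elim simp
 thus "\<exists>\<phi>. \<phi> meromorphic_on {0} \<and> near P (\<lambda>z. u z = \<phi> (local_param \<Gamma> P z))" using \<phi>(1) by blast
 show "K (orb \<Gamma> P) = cusp_val u P"
  using \<phi>(3) cusp_val_Fin[OF punctured_nhds_neq_bot[OF P], of u] cusp_val_Infty[OF punctured_nhds_neq_bot[OF P], of u]
   filterlim_local_param[OF P ev'] by (auto simp: is_pole_def)
qed

lemma mk_mero_unique:
 assumes u: "aut_mero \<Gamma> u" and K: "K \<in> mero_funs \<Gamma>"
  and ev: "\<And>P. P \<in> EHP \<Gamma> ==> near P (\<lambda>z. K (proj_pt \<Gamma> z) = Fin (u z))"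
 shows "K = mk_mero \<Gamma> u"
proof (rule extensionalityI[of _ "RSurf \<Gamma>"])
 show "K \<in> extensional (RSurf \<Gamma>)" using K by (simp add: mero_funs_def)
 show "mk_mero \<Gamma> u \<in> extensional (RSurf \<Gamma>)" by (simp add: mk_mero_def)
 fix p assume "p \<in> RSurf \<Gamma>"
 then obtain P where P: "P \<in> EHP \<Gamma>" "p = orb \<Gamma> P" by (auto simp: RSurf_def)
 show "K p = mk_mero \<Gamma> u p" using mero_fun_orb[OF K ev[OF P(1)] P(1)] mk_mero_orb[OF u P(1)] P(2) by simp
qed

lemma rep_mero_near:
 assumes K: "K \<in> mero_funs \<Gamma>" and P: "P \<in> EHP \<Gamma>"
 shows "near P (\<lambda>z. K (proj_pt \<Gamma> z) = Fin (rep_mero \<Gamma> K z))"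
proof -
 obtain \<phi> where "near P (\<lambda>z. K (proj_pt \<Gamma> z) = Fin (\<phi> (local_param \<Gamma> P z)))"
  using K P unfolding mero_funs_def meromorphic_at_point_def by blast
 thus ?thesis by eventually_elim (simp add: rep_mero_def)
qed

lemma rep_mero_aut: "K \<in> mero_funs \<Gamma> ==> aut_mero \<Gamma> (rep_mero \<Gamma> K)"
 unfolding aut_mero_def
proof (intro conjI ballI allI impI)
 show "rep_mero \<Gamma> K (mob A z) = rep_mero \<Gamma> K z" if "A \<in> \<Gamma>" "Im z > 0" for A z
  using proj_pt_mob[OF that] by (simp add: rep_mero_def)
qed (rule mero_fun_orb(2)[OF _ rep_mero_near])

lemma mk_rep_mero: "K \<in> mero_funs \<Gamma> ==> mk_mero \<Gamma> (rep_mero \<Gamma> K) = K"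
 using mk_mero_unique[OF rep_mero_aut _ rep_mero_near, of K K] by simp

lemma mk_mero_cases:
 assumes "K \<in> mero_funs \<Gamma>" obtains u where "aut_mero \<Gamma> u" "K = mk_mero \<Gamma> u"
 using rep_mero_aut[OF assms] mk_rep_mero[OF assms] by metis

lemma mk_mero_eq_iff:
 assumes "aut_mero \<Gamma> u" "aut_mero \<Gamma> v"
 shows "mk_mero \<Gamma> u = mk_mero \<Gamma> v \<longleftrightarrow> aut_eq \<Gamma> u v"
proof
 assume eq: "mk_mero \<Gamma> u = mk_mero \<Gamma> v"
 show "aut_eq \<Gamma> u v" unfolding aut_eq_def
 proof
  fix P assume "P \<in> EHP \<Gamma>"
  from mk_mero_near[OF assms(1) this] mk_mero_near[OF assms(2) this] show "near P (\<lambda>z. u z = v z)"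
 by eventually_elim (simp add: eq)
 qed
next
 assume e: "aut_eq \<Gamma> u v"
 show "mk_mero \<Gamma> u = mk_mero \<Gamma> v"
 proof (rule mk_mero_unique[OF assms(2) mk_mero_in[OF assms(1)]])
  fix P assume P: "P \<in> EHP \<Gamma>"
  hence "near P (\<lambda>z. u z = v z)" using e by (simp add: aut_eq_def)
  with mk_mero_near[OF assms(1) P] show "near P (\<lambda>z. mk_mero \<Gamma> u (proj_pt \<Gamma> z) = Fin (v z))"
 by eventually_elim simp
 qed
qed

text \<open>The points near which u vanishes and those near which it has no zero form two disjoint
  open sets covering the connected half-plane, so one of them is empty; a cusp follows since its
  punctured neighbourhoods meet the half-plane. This is what makes the ring a field.\<close>

lemma aut_mero_dichotomy:
 assumes u: "aut_mero \<Gamma> u"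
 shows "aut_eq \<Gamma> u (\<lambda>_. 0) \<or> (\<forall>P\<in>EHP \<Gamma>. near P (\<lambda>z. u z ~= 0))"
proof -
 have loc: "near P (\<lambda>z. u z = 0) \<or> near P (\<lambda>z. u z ~= 0)"
  if P: "P \<in> EHP \<Gamma>" for P
 proof -
  obtain \<phi> where \<phi>: "\<phi> meromorphic_on {0}" and ev: "near P (\<lambda>z. u z = \<phi> (local_param \<Gamma> P z))"
   using u P unfolding aut_mero_def by blast
  have "near P (\<lambda>z. \<phi> (local_param \<Gamma> P z) = 0) \<or> near P (\<lambda>z. \<phi> (local_param \<Gamma> P z) ~= 0)"
   using meromorphic_zero_dichotomy[OF \<phi>] eventually_local_param[OF P, of "\<lambda>t. \<phi> t = 0"] eventually_local_param[OF P, of "\<lambda>t. \<phi> t ~= 0"] by simp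
  thus ?thesis
  proof
   assume "near P (\<lambda>z. \<phi> (local_param \<Gamma> P z) = 0)"
   with ev have "near P (\<lambda>z. u z = 0)" by eventually_elim simp
   thus ?thesis ..
  next
   assume "near P (\<lambda>z. \<phi> (local_param \<Gamma> P z) ~= 0)"
   with ev have "near P (\<lambda>z. u z ~= 0)" by eventually_elim simp
   thus ?thesis ..
  qed
 qed
 define S where "S = (\<lambda>Q. {z. Im z > 0 \<and> eventually Q (at z)})"
 have openS: "open (S Q)" for Q :: "complex => bool"
 proof -
  have "\<exists>T. open T \<and> z \<in> T \<and> T \<subseteq> S Q" if zS: "z \<in> S Q" for z
  proof -
   obtain T where T: "open T" "z \<in> T" "\<And>w. w \<in> T ==> w ~= z ==> Q w" using zS unfolding S_def eventually_at_topological by blast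
   have "T \<inter> UHP \<subseteq> S Q"
   proof
    fix w assume w: "w \<in> T \<inter> UHP"
    have "eventually (\<lambda>x. x ~= z) (at w)" by (rule eventually_neq_at_within)
    moreover have "eventually (\<lambda>x. x \<in> T) (at w)" using w T by (intro eventually_at_in_open') auto
    ultimately have "eventually Q (at w)" by eventually_elim (use T in auto)
    thus "w \<in> S Q" using w by (simp add: S_def)
   qed
   thus ?thesis using T zS open_UHP by (intro exI[of _ "T \<inter> UHP"]) (auto simp: S_def)
  qed
  thus ?thesis using open_subopen by blast
 qed
 define Z where "Z = S (\<lambda>z. u z = 0)"
 define N where "N = S (\<lambda>z. u z ~= 0)"
 have cov: "UHP \<subseteq> Z \<union> N"
 proof
  fix z assume "z \<in> UHP"
  thus "z \<in> Z \<union> N" using loc[of "Fin z"] by (auto simp: Z_def N_def S_def filter_at_UHP)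
 qed
 have disj: "Z \<inter> N = {}"
 proof -
  have False if "z \<in> Z" "z \<in> N" for z
  proof -
   have "eventually (\<lambda>z. u z = 0) (at z)" "eventually (\<lambda>z. u z ~= 0) (at z)" using that by (auto simp: Z_def N_def S_def)
   hence "eventually (\<lambda>z. False) (at z)" by eventually_elim simp
   thus False by simp
  qed
  thus ?thesis by blast
 qed
 have "Z \<inter> UHP = {} \<or> N \<inter> UHP = {}"
  using connectedD[OF connected_UHP, of Z N] openS cov disj unfolding Z_def N_def by blast
 moreover have near: False if P: "P \<in> EHP \<Gamma>" and ev: "near P Q" and no: "S Q \<inter> UHP = {}" for P Q
 proof -
  from eventually_eventually_punctured[OF P ev] have "near P (\<lambda>z. False)"
  proof eventually_elim
   case (elim z)
   thus ?case using no by (auto simp: S_def eventually_at_filter eventually_mono)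
  qed
  thus False using punctured_nhds_neq_bot[OF P] by simp
 qed
 ultimately show ?thesis
 using loc by (auto simp: Z_def N_def aut_eq_def)
qed

lemma mero_op_mk:
 assumes u: "aut_mero \<Gamma> u" and v: "aut_mero \<Gamma> v" and w: "aut_mero \<Gamma> (\<lambda>z. opn (u z) (v z))"
  and lim: "\<And>F f g a b. (f \<longlongrightarrow> a) F ==> (g \<longlongrightarrow> b) F ==> ((\<lambda>z. opn (f z) (g z)) \<longlongrightarrow> opn a b) (F :: complex filter)"
 shows "mero_op \<Gamma> opn (mk_mero \<Gamma> u) (mk_mero \<Gamma> v) = mk_mero \<Gamma> (\<lambda>z. opn (u z) (v z))"
 unfolding mero_op_def
proof (rule the_equality, intro conjI ballI allI impI)
 show "mk_mero \<Gamma> (\<lambda>z. opn (u z) (v z)) \<in> mero_funs \<Gamma>" by (rule mk_mero_in[OF w])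
 fix p a b assume "p \<in> RSurf \<Gamma>" and ab: "mk_mero \<Gamma> u p = Fin a \<and> mk_mero \<Gamma> v p = Fin b"
 then obtain P where P: "P \<in> EHP \<Gamma>" "p = orb \<Gamma> P" by (auto simp: RSurf_def)
 note nb = punctured_nhds_neq_bot[OF P(1)]
 have lims: "(f \<longlongrightarrow> c) (punctured_nhds P)" if f: "aut_mero \<Gamma> f" "mk_mero \<Gamma> f p = Fin c" for f c
 using that mk_mero_orb[OF f(1) P(1)] P(2) aut_mero_limit[OF f(1) P(1)] cusp_val_Infty[OF nb] cusp_val_Fin[OF nb] by auto
 have "((\<lambda>z. opn (u z) (v z)) \<longlongrightarrow> opn a b) (punctured_nhds P)" by (intro lim lims u v) (use ab in auto)
 thus "mk_mero \<Gamma> (\<lambda>z. opn (u z) (v z)) p = Fin (opn a b)"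
  using cusp_val_Fin[OF nb] mk_mero_orb[OF w P(1)] P(2) by simp
next
 fix K assume K: "K \<in> mero_funs \<Gamma> \<and> (\<forall>p\<in>RSurf \<Gamma>. \<forall>a b. mk_mero \<Gamma> u p = Fin a \<and> mk_mero \<Gamma> v p = Fin b --> K p = Fin (opn a b))"
 show "K = mk_mero \<Gamma> (\<lambda>z. opn (u z) (v z))"
 proof (rule mk_mero_unique[OF w])
  fix P assume P: "P \<in> EHP \<Gamma>"
  from mk_mero_near[OF u P] mk_mero_near[OF v P] eventually_UHP_punctured[OF P]
  show "near P (\<lambda>z. K (proj_pt \<Gamma> z) = Fin (opn (u z) (v z)))"
  proof eventually_elim
   case (elim z)
   show ?case using elim K by (simp add: RSurf_def)
  qed
 qed (use K in simp)
qed

end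

section \<open>Periodic functions of moderate growth\<close>

text \<open>A sufficiently high power of q decays faster than \<open>exp (A * Im z)\<close> grows;
  the product extends over q = 0 as a bounded function, so the singularity is at most a
  pole.\<close>

lemma periodic_meromorphic:
 assumes h: "h > 0" and hol: "E holomorphic_on {z. Im z > Y}" and per: "\<And>z. Im z > Y ==> E (z + of_real h) = E z"
  and growth: "\<And>z. Im z > Y ==> norm (E z) \<le> C * exp (A * Im z)"
 shows "\<exists>\<psi>. \<psi> meromorphic_on {0} \<and> (\<forall>z. Im z > Y --> E z = \<psi> (qexp h z))"
proof -
 define R where "R = exp (- 2 * pi * Y / h)"
 obtain g where g: "g holomorphic_on (ball 0 R - {0})" "\<And>z. Im z > Y ==> E z = g (qexp h z)"
  using periodic_factor[OF h hol per] unfolding R_def by blast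
 obtain M :: nat where M: "A * h / (2 * pi) \<le> M" using real_arch_simple by blast
 have M': "A \<le> 2 * pi * M / h" using M h by (simp add: field_simps)
 have C: "C \<ge> 0" using order_trans[OF norm_ge_zero growth[of "Complex 0 (Y + 1)"]] by (simp add: zero_le_mult_iff)
 define G where "G = (\<lambda>q. q ^ M * g q)"
 have Ghol: "G holomorphic_on (ball 0 R - {0})" unfolding G_def by (intro holomorphic_intros g)
 define R' where "R' = min R 1"
 have bd: "norm (G q) \<le> C" if q: "q \<in> ball 0 R'" "q ~= 0" for q
 proof -
  define z where "z = of_real h * Ln q / (2 * of_real pi * \<i>)"
  have z: "qexp h z = q" "Im z = - h * ln (norm q) / (2 * pi)" using qexp_surj[OF h q(2)] by (simp_all add: z_def)
  have "ln (norm q) < - 2 * pi * Y / h" using q by (simp add: R'_def R_def) (metis ln_exp ln_less_cancel_iff exp_gt_zero zero_less_norm_iff)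
  hence zY: "Im z > Y" unfolding z(2) using h by (simp add: field_simps)
  have z0: "Im z > 0" using q h by (auto simp: z(2) R'_def divide_neg_pos mult_pos_neg)
  have "norm (G q) = exp (- 2 * pi * Im z / h) ^ M * norm (E z)"
   using g(2)[OF zY] z(1) norm_qexp[of h z] by (simp add: G_def norm_mult norm_power)
  also have "... \<le> exp (- 2 * pi * Im z / h) ^ M * (C * exp (A * Im z))" by (intro mult_left_mono growth zY) auto
  also have "... = C * exp ((A - 2 * pi * M / h) * Im z)"
 by (simp add: exp_of_nat_mult[symmetric] exp_add[symmetric] ring_distribs)
  also have "... \<le> C * 1" using M' z0 C by (intro mult_left_mono) (simp_all add: mult_nonpos_nonneg)
  finally show ?thesis by simp
 qed
 have "R > 0" "R' > 0" by (simp_all add: R_def R'_def)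
 have "\<exists>H. H holomorphic_on ball 0 R \<and> (\<forall>z\<in>ball 0 R - {0}. H z = G z)" using bd \<open>R' > 0\<close> holomorphic_on_extend_bounded[OF Ghol] \<open>R > 0\<close> unfolding eventually_at by auto
 then obtain H where H: "H holomorphic_on ball 0 R" "\<And>q. q \<in> ball 0 R - {0} ==> H q = G q" by blast
 have "H analytic_on {0}" using H(1) \<open>R > 0\<close> by (simp add: analytic_at_ball) blast
 hence "H meromorphic_on {0}" by (rule analytic_on_imp_meromorphic_on)
 hence "(\<lambda>q. H q / q ^ M) meromorphic_on {0}" by (intro meromorphic_intros)
 moreover have "E z = H (qexp h z) / qexp h z ^ M" if z: "Im z > Y" for z
 using z h H(2)[of "qexp h z"] g(2)[OF z] by (auto simp: R_def divide_strict_right_mono qexp_def G_def)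
 ultimately show ?thesis by blast
qed

lemma holomorphic_order_zero:
 assumes "G holomorphic_on ball 0 1" "\<exists>t\<in>ball 0 1. G t ~= 0"
 shows "\<exists>k c d. 0 < d \<and> d < 1 \<and> 0 < c \<and> (\<forall>t. norm t \<le> d --> norm (G t) \<ge> c * norm t ^ k)"
proof -
 have "\<exists>k g. g holomorphic_on ball 0 1 \<and> (\<forall>t\<in>ball 0 1. G t = t ^ k * g t) \<and> g 0 ~= 0"
  using min_order[of "ball 0 1" "{()}" "\<lambda>_. G"] assms by auto
 then obtain k g where g: "g holomorphic_on ball 0 1" "\<And>t. t \<in> ball 0 1 ==> G t = t ^ k * g t" "g 0 ~= 0" by blast
 have "continuous_on (ball 0 1) g" by (rule holomorphic_on_imp_continuous_on[OF g(1)])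
 hence "isCont g 0" by (simp add: continuous_on_eq_continuous_at)
 hence "((\<lambda>t. norm (g t)) \<longlongrightarrow> norm (g 0)) (nhds 0)" unfolding isCont_def tendsto_at_iff_tendsto_nhds by (rule tendsto_norm)
 hence "eventually (\<lambda>t. norm (g t) > norm (g 0) / 2) (nhds 0)" using g(3) by (intro order_tendstoD(1)) auto
 then obtain d where d: "d > 0" "\<And>t. norm t < d ==> norm (g t) > norm (g 0) / 2" unfolding eventually_nhds_metric by auto
 define d' where "d' = min d 1 / 2"
 have "norm (G t) \<ge> norm (g 0) / 2 * norm t ^ k" if "norm t \<le> d'" for t
 proof -
  have "norm (G t) = norm t ^ k * norm (g t)" "norm (g 0) / 2 \<le> norm (g t)" using that d(1) g(2)[of t] d(2)[of t] by (auto simp: d'_def norm_mult norm_power)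
  thus ?thesis by (metis mult.commute mult_left_mono norm_ge_zero zero_le_power)
 qed
 moreover have "0 < d'" "d' < 1" using d(1) by (auto simp: d'_def)
 ultimately show ?thesis using g(3) by (intro exI[of _ k] exI[of _ "norm (g 0) / 2"] exI[of _ d']) auto
qed

context discrete_SL2
begin

section \<open>The function field\<close>

lemma function_field_simps:
 "carrier (function_field \<Gamma>) = mero_funs \<Gamma>" "monoid.mult (function_field \<Gamma>) = mero_op \<Gamma> (*)"
 "ring.add (function_field \<Gamma>) = mero_op \<Gamma> (+)" "monoid.one (function_field \<Gamma>) = mero_const \<Gamma> 1" "ring.zero (function_field \<Gamma>) = mero_const \<Gamma> 0"
 by (simp_all add: function_field_def)

lemma mero_const_eq: "mero_const \<Gamma> c = mk_mero \<Gamma> (\<lambda>_. c)"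
proof (rule extensionalityI[of _ "RSurf \<Gamma>"])
 fix p assume p: "p \<in> RSurf \<Gamma>"
 then obtain P where P: "P \<in> EHP \<Gamma>" "p = orb \<Gamma> P" by (auto simp: RSurf_def)
 show "mero_const \<Gamma> c p = mk_mero \<Gamma> (\<lambda>_. c) p"
  using mk_mero_orb[OF aut_mero_const P(1), of c] cusp_val_Fin[OF punctured_nhds_neq_bot[OF P(1)], of "\<lambda>_. c" c] p P(2)
 by (simp add: mero_const_def)
qed (simp_all add: mero_const_def mk_mero_def)

lemma mk_add: "aut_mero \<Gamma> u ==> aut_mero \<Gamma> v ==> mero_op \<Gamma> (+) (mk_mero \<Gamma> u) (mk_mero \<Gamma> v) = mk_mero \<Gamma> (\<lambda>z. u z + v z)"
 by (rule mero_op_mk) (auto intro: tendsto_add)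

lemma mk_mult: "aut_mero \<Gamma> u ==> aut_mero \<Gamma> v ==> mero_op \<Gamma> (*) (mk_mero \<Gamma> u) (mk_mero \<Gamma> v) = mk_mero \<Gamma> (\<lambda>z. u z * v z)"
 by (rule mero_op_mk) (auto intro: tendsto_mult)

lemma mk_inverse:
 assumes u: "aut_mero \<Gamma> u" and nz: "\<not> aut_eq \<Gamma> u (\<lambda>_. 0)"
 shows "mero_op \<Gamma> (*) (mk_mero \<Gamma> u) (mk_mero \<Gamma> (\<lambda>z. inverse (u z))) = mk_mero \<Gamma> (\<lambda>_. 1)"
proof -

 have "aut_eq \<Gamma> (\<lambda>z. u z * inverse (u z)) (\<lambda>_. 1)"
  unfolding aut_eq_def
 proof
  fix P assume "P \<in> EHP \<Gamma>"
  hence "near P (\<lambda>z. u z ~= 0)" using aut_mero_dichotomy[OF u] nz by blast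
  thus "near P (\<lambda>z. u z * inverse (u z) = 1)" by eventually_elim simp
 qed
 thus ?thesis using mk_mult[OF u aut_mero_inverse[OF u]] mk_mero_eq_iff[OF aut_mero_mult[OF u aut_mero_inverse[OF u]] aut_mero_const] by simp
qed

lemma extended_ex: "\<exists>P. P \<in> EHP \<Gamma>"
 by (rule exI[of _ "Fin \<i>"]) simp

lemma field_function_field: "field (function_field \<Gamma>)"
proof -
 let ?F = "function_field \<Gamma>"
 have "abelian_group ?F"
 proof (rule abelian_groupI, unfold function_field_simps mero_const_eq)
  show "mk_mero \<Gamma> (\<lambda>_. 0) \<in> mero_funs \<Gamma>" by (rule mk_mero_in[OF aut_mero_const])
  fix x y z assume "x \<in> mero_funs \<Gamma>"
  then obtain u where u: "aut_mero \<Gamma> u" "x = mk_mero \<Gamma> u" by (rule mk_mero_cases)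
  show "mero_op \<Gamma> (+) (mk_mero \<Gamma> (\<lambda>_. 0)) x = x" using mk_add[OF aut_mero_const u(1), of 0] u(2) by simp
  show "\<exists>y\<in>mero_funs \<Gamma>. mero_op \<Gamma> (+) y x = mk_mero \<Gamma> (\<lambda>_. 0)" using mk_add[OF aut_mero_uminus[OF u(1)] u(1)] u(2) mk_mero_in[OF aut_mero_uminus[OF u(1)]] by auto
  assume "y \<in> mero_funs \<Gamma>"
  then obtain v where v: "aut_mero \<Gamma> v" "y = mk_mero \<Gamma> v" by (rule mk_mero_cases)
  show "mero_op \<Gamma> (+) x y \<in> mero_funs \<Gamma>" unfolding u v mk_add[OF u(1) v(1)] by (intro mk_mero_in aut_mero_add u v)
  show "mero_op \<Gamma> (+) x y = mero_op \<Gamma> (+) y x" unfolding u v mk_add[OF u(1) v(1)] mk_add[OF v(1) u(1)] by (simp add: add.commute)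
  assume "z \<in> mero_funs \<Gamma>"
  then obtain w where w: "aut_mero \<Gamma> w" "z = mk_mero \<Gamma> w" by (rule mk_mero_cases)
  show "mero_op \<Gamma> (+) (mero_op \<Gamma> (+) x y) z = mero_op \<Gamma> (+) x (mero_op \<Gamma> (+) y z)"
 by (simp add: u(2) v(2) w(2) mk_add u(1) v(1) w(1) aut_mero_add add.assoc)
 qed
 moreover have "comm_monoid ?F"
 proof (rule comm_monoidI, unfold function_field_simps mero_const_eq)
  show "mk_mero \<Gamma> (\<lambda>_. 1) \<in> mero_funs \<Gamma>" by (rule mk_mero_in[OF aut_mero_const])
  fix x y z assume "x \<in> mero_funs \<Gamma>"
  then obtain u where u: "aut_mero \<Gamma> u" "x = mk_mero \<Gamma> u" by (rule mk_mero_cases)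
  show "mero_op \<Gamma> (*) (mk_mero \<Gamma> (\<lambda>_. 1)) x = x" using mk_mult[OF aut_mero_const u(1), of 1] u(2) by simp
  assume "y \<in> mero_funs \<Gamma>"
  then obtain v where v: "aut_mero \<Gamma> v" "y = mk_mero \<Gamma> v" by (rule mk_mero_cases)
  show "mero_op \<Gamma> (*) x y \<in> mero_funs \<Gamma>" unfolding u v mk_mult[OF u(1) v(1)] by (intro mk_mero_in aut_mero_mult u v)
  show "mero_op \<Gamma> (*) x y = mero_op \<Gamma> (*) y x" unfolding u v mk_mult[OF u(1) v(1)] mk_mult[OF v(1) u(1)] by (simp add: mult.commute)
  assume "z \<in> mero_funs \<Gamma>"
  then obtain w where w: "aut_mero \<Gamma> w" "z = mk_mero \<Gamma> w" by (rule mk_mero_cases)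
  show "mero_op \<Gamma> (*) (mero_op \<Gamma> (*) x y) z = mero_op \<Gamma> (*) x (mero_op \<Gamma> (*) y z)"
 by (simp add: u(2) v(2) w(2) mk_mult u(1) v(1) w(1) aut_mero_mult mult.assoc)
 qed
 ultimately have cr: "cring ?F"
 proof (rule cringI)
  fix x y z assume xyz: "x \<in> carrier ?F" "y \<in> carrier ?F" "z \<in> carrier ?F"
  then obtain u v w where u: "aut_mero \<Gamma> u" "x = mk_mero \<Gamma> u" and v: "aut_mero \<Gamma> v" "y = mk_mero \<Gamma> v" and w: "aut_mero \<Gamma> w" "z = mk_mero \<Gamma> w"
   unfolding function_field_simps by (metis mk_mero_cases)
  show "(x \<oplus>\<^bsub>?F\<^esub> y) \<otimes>\<^bsub>?F\<^esub> z = x \<otimes>\<^bsub>?F\<^esub> z \<oplus>\<^bsub>?F\<^esub> y \<otimes>\<^bsub>?F\<^esub> z"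
   unfolding function_field_simps u(2) v(2) w(2)
 by (simp add: mk_mult mk_add u(1) v(1) w(1) aut_mero_mult aut_mero_add distrib_right)
 qed
 show ?thesis
 proof (rule cring.cring_fieldI2[OF cr], unfold function_field_simps mero_const_eq)
  show "mk_mero \<Gamma> (\<lambda>_. 0) ~= mk_mero \<Gamma> (\<lambda>_. 1)" using extended_ex punctured_nhds_neq_bot by (auto simp: aut_eq_def mk_mero_eq_iff aut_mero_const)
  fix a assume a: "a \<in> mero_funs \<Gamma>" "a ~= mk_mero \<Gamma> (\<lambda>_. 0)"
  then obtain u where u: "aut_mero \<Gamma> u" "a = mk_mero \<Gamma> u" by (metis mk_mero_cases)
  hence "\<not> aut_eq \<Gamma> u (\<lambda>_. 0)" using a(2) by (simp add: mk_mero_eq_iff aut_mero_const)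
  from mk_inverse[OF u(1) this] show "\<exists>b\<in>mero_funs \<Gamma>. mero_op \<Gamma> (*) a b = mk_mero \<Gamma> (\<lambda>_. 1)"
   unfolding u(2) using mk_mero_in[OF aut_mero_inverse[OF u(1)]] by blast
 qed
qed

lemma generated_over_C_closed:
 assumes S: "S \<subseteq> mero_funs \<Gamma>"
 defines "G \<equiv> generated_over_C \<Gamma> S"
 shows "mk_mero \<Gamma> (\<lambda>_. c) \<in> G" "\<And>x. x \<in> S ==> x \<in> G"
  "\<And>u v. aut_mero \<Gamma> u ==> aut_mero \<Gamma> v ==> mk_mero \<Gamma> u \<in> G ==> mk_mero \<Gamma> v \<in> G ==> mk_mero \<Gamma> (\<lambda>z. u z + v z) \<in> G"
  "\<And>u v. aut_mero \<Gamma> u ==> aut_mero \<Gamma> v ==> mk_mero \<Gamma> u \<in> G ==> mk_mero \<Gamma> v \<in> G ==> mk_mero \<Gamma> (\<lambda>z. u z * v z) \<in> G"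
  "\<And>u. aut_mero \<Gamma> u ==> \<not> aut_eq \<Gamma> u (\<lambda>_. 0) ==> mk_mero \<Gamma> u \<in> G ==> mk_mero \<Gamma> (\<lambda>z. inverse (u z)) \<in> G"
  "subfield G (function_field \<Gamma>)"
  "\<And>E. subfield E (function_field \<Gamma>) ==> range (mero_const \<Gamma>) \<union> S \<subseteq> E ==> G \<subseteq> E"
proof -
 let ?F = "function_field \<Gamma>"
 interpret F: field ?F by (rule field_function_field)
 have sub: "range (mero_const \<Gamma>) \<union> S \<subseteq> carrier ?F"
  using S mk_mero_in[OF aut_mero_const] by (auto simp: function_field_simps mero_const_eq)
 note G = G_def generated_over_C_def
 show "mk_mero \<Gamma> (\<lambda>_. c) \<in> G" unfolding G mero_const_eq[symmetric] by (intro generate_field.incl) auto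
 show "x \<in> G" if "x \<in> S" for x unfolding G using that by (intro generate_field.incl) auto
 show "subfield G ?F" unfolding G by (rule F.generate_field_is_subfield[OF sub])
 show "G \<subseteq> E" if "subfield E ?F" "range (mero_const \<Gamma>) \<union> S \<subseteq> E" for E unfolding G by (rule F.generate_field_min_subfield1[OF sub that])
 fix u assume u: "aut_mero \<Gamma> u" and uG: "mk_mero \<Gamma> u \<in> G"
 show "mk_mero \<Gamma> (\<lambda>z. u z + v z) \<in> G" if "aut_mero \<Gamma> v" "mk_mero \<Gamma> v \<in> G" for v
  using generate_field.eng_add[of "mk_mero \<Gamma> u" ?F _ "mk_mero \<Gamma> v"] that uG mk_add[OF u that(1)] unfolding G function_field_simps by simp
 show "mk_mero \<Gamma> (\<lambda>z. u z * v z) \<in> G" if "aut_mero \<Gamma> v" "mk_mero \<Gamma> v \<in> G" for v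
  using generate_field.eng_mult[of "mk_mero \<Gamma> u" ?F _ "mk_mero \<Gamma> v"] that uG mk_mult[OF u that(1)] unfolding G function_field_simps by simp
 assume nz: "\<not> aut_eq \<Gamma> u (\<lambda>_. 0)"
 hence "mk_mero \<Gamma> u ~= \<zero>\<^bsub>?F\<^esub>" by (simp add: function_field_simps mero_const_eq mk_mero_eq_iff aut_mero_const u)
 moreover have "inv\<^bsub>?F\<^esub> (mk_mero \<Gamma> u) = mk_mero \<Gamma> (\<lambda>z. inverse (u z))"
 by (rule F.comm_inv_char) (simp_all add: function_field_simps mk_mero_in u aut_mero_inverse mk_inverse[OF u nz] mero_const_eq)
 ultimately show "mk_mero \<Gamma> (\<lambda>z. inverse (u z)) \<in> G"
  using generate_field.m_inv[of "mk_mero \<Gamma> u" ?F] uG unfolding G by metis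
qed

lemma modular_form_nonzero_near:
 assumes chi: "finite_order_character \<Gamma> chi" and g: "g \<in> modular_forms \<Gamma> chi m" "g ~= (\<lambda>_. 0)" and P: "P \<in> EHP \<Gamma>"
 shows "\<exists>p h w \<nu> Gg. uniformizes \<Gamma> P p h \<and> w > 0 \<and> (\<forall>\<xi>. Im \<xi> > 0 --> \<nu> \<xi> ~= 0) \<and>
  (\<forall>f\<in>modular_forms \<Gamma> chi m. \<exists>F. F holomorphic_on ball 0 1 \<and> (\<forall>\<xi>. Im \<xi> > 0 --> f (p \<xi>) = \<nu> \<xi> * F (qexp w \<xi>))) \<and>
  Gg holomorphic_on ball 0 1 \<and> (\<forall>\<xi>. Im \<xi> > 0 --> g (p \<xi>) = \<nu> \<xi> * Gg (qexp w \<xi>)) \<and> (\<exists>t\<in>ball 0 1. Gg t ~= 0)"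
proof -
 obtain p h w \<nu> where un: "uniformizes \<Gamma> P p h" and w: "w > 0" and \<nu>: "\<forall>\<xi>. Im \<xi> > 0 --> \<nu> \<xi> ~= 0"
  and ex: "\<forall>f\<in>modular_forms \<Gamma> chi m. \<exists>F. F holomorphic_on ball 0 1 \<and> (\<forall>\<xi>. Im \<xi> > 0 --> f (p \<xi>) = \<nu> \<xi> * F (qexp w \<xi>))"
  using uniformizer[OF chi P, of m] by blast
 obtain Gg where Gg: "Gg holomorphic_on ball 0 1" "\<And>\<xi>. Im \<xi> > 0 ==> g (p \<xi>) = \<nu> \<xi> * Gg (qexp w \<xi>)" using ex g(1) by blast
 have "\<exists>t\<in>ball 0 1. Gg t ~= 0"
 proof (rule ccontr)
  assume n: "\<not> ?thesis"
  have "g (p \<xi>) = 0" if "Im \<xi> > 0" for \<xi>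
  using that w n Gg(2)[OF that] by (auto simp: norm_qexp)
  hence "near P (\<lambda>z. g z = 0)" using un unfolding uniformizes_def by auto
  from eventually_happens[OF eventually_eventually_punctured[OF P this]] punctured_nhds_neq_bot[OF P]
  obtain z where z: "Im z > 0" "eventually (\<lambda>z. g z = 0) (nhds z)" by auto
  then obtain T where T: "open T" "z \<in> T" "\<And>x. x \<in> T ==> g x = 0" unfolding eventually_nhds by blast
  have ghol: "g holomorphic_on UHP" using g(1) by (simp add: modular_forms_def)
  have "g x = 0" if "x \<in> UHP" for x
 by (rule analytic_continuation_open[of "T \<inter> UHP" UHP g "\<lambda>_. 0"])
     (use T z ghol that open_UHP connected_UHP in auto)
  moreover have "g x = 0" if "x \<notin> UHP" for x using g(1) that by (simp add: modular_forms_def)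
  ultimately show False using g(2) by blast
 qed
 thus ?thesis using un w \<nu> ex Gg by blast
qed

lemma modular_form_eventually_nonzero:
 assumes chi: "finite_order_character \<Gamma> chi" and g: "g \<in> modular_forms \<Gamma> chi m" "g ~= (\<lambda>_. 0)" and P: "P \<in> EHP \<Gamma>"
 shows "near P (\<lambda>z. g z ~= 0)"
proof -
 obtain p h w \<nu> Gg where un: "uniformizes \<Gamma> P p h" and w: "w > 0" and \<nu>: "\<And>\<xi>. Im \<xi> > 0 ==> \<nu> \<xi> ~= 0"
  and Gg: "Gg holomorphic_on ball 0 1" "\<And>\<xi>. Im \<xi> > 0 ==> g (p \<xi>) = \<nu> \<xi> * Gg (qexp w \<xi>)" "\<exists>t\<in>ball 0 1. Gg t ~= 0"
  using modular_form_nonzero_near[OF assms] by blast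
 obtain k c d where kcd: "0 < d" "d < 1" "0 < c" "\<And>t. norm t \<le> d ==> norm (Gg t) \<ge> c * norm t ^ k"
  using holomorphic_order_zero[OF Gg(1,3)] by blast
 define Y where "Y = max 1 (- w * ln d / (2 * pi))"
 have "g (p \<xi>) ~= 0" if \<xi>: "Im \<xi> > Y" for \<xi>
 proof -
  have \<xi>0: "Im \<xi> > 0" "Im \<xi> > - w * ln d / (2 * pi)" using \<xi> by (auto simp: Y_def)
  have "- 2 * pi * Im \<xi> / w < ln d" using \<xi>0(2) w by (simp add: field_simps)
  hence "norm (qexp w \<xi>) < d" unfolding norm_qexp using kcd(1) by (metis exp_less_mono exp_ln)
  hence "norm (Gg (qexp w \<xi>)) \<ge> c * norm (qexp w \<xi>) ^ k" using kcd(4) by simp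
  moreover have "c * norm (qexp w \<xi>) ^ k > 0" using kcd(3) by simp
  ultimately show ?thesis using Gg(2)[OF \<xi>0(1)] \<nu>[OF \<xi>0(1)] by auto
 qed
 moreover have "Y > 0" by (simp add: Y_def)
 ultimately show ?thesis using un unfolding uniformizes_def by blast
qed

lemma modular_quotient_invariant:
 assumes chi: "finite_order_character \<Gamma> chi" and f: "f \<in> modular_forms \<Gamma> chi m" and g: "g \<in> modular_forms \<Gamma> chi m"
  and A: "A \<in> \<Gamma>" "Im z > 0"
 shows "f (mob A z) / g (mob A z) = f z / g z"
using chi A cocyc_nz[of A z] f g by (auto simp: finite_order_character_def modular_forms_def)

text \<open>Numerator and denominator have expansions of period \<open>w\<close>, which may differ
  from the period \<open>h\<close> of the local parameter. The quotient is invariant and hence has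
  period \<open>h\<close>; the order of the zero of the denominator bounds its growth, so it is
  meromorphic in the local parameter.\<close>

lemma aut_mero_quotient:
 assumes chi: "finite_order_character \<Gamma> chi" and f: "f \<in> modular_forms \<Gamma> chi m" and g: "g \<in> modular_forms \<Gamma> chi m" "g ~= (\<lambda>_. 0)"
 shows "aut_mero \<Gamma> (\<lambda>z. f z / g z)"
 unfolding aut_mero_def
proof (intro conjI ballI allI impI)
 show "f (mob A z) / g (mob A z) = f z / g z" if "A \<in> \<Gamma>" "Im z > 0" for A z
 by (rule modular_quotient_invariant[OF chi f g(1) that])
 fix P assume P: "P \<in> EHP \<Gamma>"
 obtain p h w \<nu> G where un: "uniformizes \<Gamma> P p h" and w: "w > 0" and \<nu>: "\<And>\<xi>. Im \<xi> > 0 ==> \<nu> \<xi> ~= 0"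
  and exF: "\<forall>f\<in>modular_forms \<Gamma> chi m. \<exists>F. F holomorphic_on ball 0 1 \<and> (\<forall>\<xi>. Im \<xi> > 0 --> f (p \<xi>) = \<nu> \<xi> * F (qexp w \<xi>))"
  and G: "G holomorphic_on ball 0 1" "\<And>\<xi>. Im \<xi> > 0 ==> g (p \<xi>) = \<nu> \<xi> * G (qexp w \<xi>)" "\<exists>t\<in>ball 0 1. G t ~= 0"
  using modular_form_nonzero_near[OF chi g P] by blast
 obtain F where F: "F holomorphic_on ball 0 1" "\<And>\<xi>. Im \<xi> > 0 ==> f (p \<xi>) = \<nu> \<xi> * F (qexp w \<xi>)" using exF f by blast
 obtain k c d where kcd: "0 < d" "d < 1" "0 < c" "\<And>t. norm t \<le> d ==> norm (G t) \<ge> c * norm t ^ k"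
  using holomorphic_order_zero[OF G(1,3)] by blast
 have cmp: "compact (F ` cball 0 d)"
 by (intro compact_continuous_image holomorphic_on_imp_continuous_on holomorphic_on_subset[OF F(1)]) (use kcd in auto)
 obtain B where B: "\<And>t. norm t \<le> d ==> norm (F t) \<le> B" using compact_imp_bounded[OF cmp] unfolding bounded_iff by (metis image_eqI mem_cball_0)
 have B0: "B \<ge> 0" using order_trans[OF norm_ge_zero B[of 0]] kcd(1) by simp
 define Y where "Y = max 1 (- w * ln d / (2 * pi))"
 have q: "norm (qexp w \<xi>) < d" "Im \<xi> > 0" if \<xi>: "Im \<xi> > Y" for \<xi>
 proof -
  have \<xi>0: "Im \<xi> > 0" "Im \<xi> > - w * ln d / (2 * pi)" using \<xi> by (auto simp: Y_def)
  have "- 2 * pi * Im \<xi> / w < ln d" using \<xi>0(2) w by (simp add: field_simps)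
  thus "norm (qexp w \<xi>) < d" "Im \<xi> > 0" unfolding norm_qexp using kcd(1) \<xi>0(1) by (metis exp_less_mono exp_ln)+
 qed
 have Gnz: "norm (G (qexp w \<xi>)) \<ge> c * norm (qexp w \<xi>) ^ k" "c * norm (qexp w \<xi>) ^ k > 0" "G (qexp w \<xi>) ~= 0" if \<xi>: "Im \<xi> > Y" for \<xi>
 proof -
  show 1: "norm (G (qexp w \<xi>)) \<ge> c * norm (qexp w \<xi>) ^ k" using q(1)[OF \<xi>] kcd(4) by simp
  show 2: "c * norm (qexp w \<xi>) ^ k > 0" using kcd(3) by simp
  show "G (qexp w \<xi>) ~= 0" using 1 2 by auto
 qed
 define E where "E = (\<lambda>\<xi>. F (qexp w \<xi>) / G (qexp w \<xi>))"
 have Eq: "f (p \<xi>) / g (p \<xi>) = E \<xi>" if "Im \<xi> > 0" for \<xi> using F(2)[OF that] G(2)[OF that] \<nu>[OF that] by (simp add: E_def)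
 have h: "h > 0" using un by (simp add: uniformizes_def)
 have "\<exists>\<psi>. \<psi> meromorphic_on {0} \<and> (\<forall>z. Im z > Y --> E z = \<psi> (qexp h z))"
 proof (rule periodic_meromorphic[OF h])
  have qh: "qexp w holomorphic_on {z. Im z > Y}" unfolding qexp_def by (intro holomorphic_intros) (use w in auto)
  have im: "qexp w ` {z. Im z > Y} \<subseteq> ball 0 1" using q(1) kcd(2) by (force simp:)
  show "E holomorphic_on {z. Im z > Y}"
   unfolding E_def using holomorphic_on_compose_gen[OF qh F(1) im] holomorphic_on_compose_gen[OF qh G(1) im] Gnz(3)
 by (auto simp: o_def intro!: holomorphic_on_divide)
  fix \<xi> assume \<xi>: "Im \<xi> > Y"
  have \<xi>0: "Im \<xi> > 0" "Im (\<xi> + of_real h) > 0" using q(2)[OF \<xi>] by auto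
  obtain A where A: "A \<in> \<Gamma>" "p (\<xi> + of_real h) = mob A (p \<xi>)" "Im (p \<xi>) > 0" using un \<xi>0(1) unfolding uniformizes_def by blast
  show "E (\<xi> + of_real h) = E \<xi>"
   using modular_quotient_invariant[OF chi f g(1) A(1,3)] Eq[OF \<xi>0(1)] Eq[OF \<xi>0(2)] A(2) by simp
  have "norm (E \<xi>) \<le> B / (c * norm (qexp w \<xi>) ^ k)"
   unfolding E_def norm_divide using Gnz(1,2)[OF \<xi>] B[of "qexp w \<xi>"] q(1)[OF \<xi>] B0 by (intro frac_le) auto
  also have "... = (B / c) * exp (2 * pi * k / w * Im \<xi>)"
 by (simp add: norm_qexp exp_of_nat_mult[symmetric] exp_minus field_simps)
  finally show "norm (E \<xi>) \<le> (B / c) * exp (2 * pi * k / w * Im \<xi>)" .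
 qed
 then obtain \<psi> where \<psi>: "\<psi> meromorphic_on {0}" "\<And>z. Im z > Y ==> E z = \<psi> (qexp h z)" by blast
 have "f (p \<xi>) / g (p \<xi>) = \<psi> (local_param \<Gamma> P (p \<xi>))" if "Im \<xi> > Y" for \<xi>
  using Eq[OF q(2)[OF that]] \<psi>(2)[OF that] un q(2)[OF that] by (simp add: uniformizes_def)
 moreover have "Y > 0" by (simp add: Y_def)
 ultimately show "\<exists>\<phi>. \<phi> meromorphic_on {0} \<and> near P (\<lambda>z. f z / g z = \<phi> (local_param \<Gamma> P z))" using un \<psi>(1) unfolding uniformizes_def by blast
qed

lemma form_quot_eq:
 assumes chi: "finite_order_character \<Gamma> chi" and f: "f \<in> modular_forms \<Gamma> chi m" and g: "g \<in> modular_forms \<Gamma> chi m" "g ~= (\<lambda>_. 0)"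
 shows "form_quot \<Gamma> f g = mk_mero \<Gamma> (\<lambda>z. f z / g z)"
 unfolding form_quot_def
proof (rule the_equality, intro conjI ballI impI)
 note aut = aut_mero_quotient[OF assms]
 show "mk_mero \<Gamma> (\<lambda>z. f z / g z) \<in> mero_funs \<Gamma>" by (rule mk_mero_in[OF aut])
 fix z assume z: "z \<in> UHP" "g z ~= 0"
 have "isCont f z" "isCont g z"
  using f g(1) z open_UHP holomorphic_on_imp_continuous_on continuous_on_eq_continuous_at
  unfolding modular_forms_def by blast+
 hence "((\<lambda>z. f z / g z) \<longlongrightarrow> f z / g z) (at z)" using z(2) by (intro tendsto_divide) (auto simp: isCont_def)
 thus "mk_mero \<Gamma> (\<lambda>z. f z / g z) (proj_pt \<Gamma> z) = Fin (f z / g z)"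
  using mk_mero_orb[OF aut, of "Fin z"] z(1) cusp_val_Fin[of "Fin z"] by (simp add: filter_at_UHP)
next
 fix K assume K: "K \<in> mero_funs \<Gamma> \<and> (\<forall>z\<in>UHP. g z ~= 0 --> K (proj_pt \<Gamma> z) = Fin (f z / g z))"
 show "K = mk_mero \<Gamma> (\<lambda>z. f z / g z)"
 proof (rule mk_mero_unique[OF aut_mero_quotient[OF assms]])
  fix P assume P: "P \<in> EHP \<Gamma>"
  from modular_form_eventually_nonzero[OF chi g P] eventually_UHP_punctured[OF P]
  show "near P (\<lambda>z. K (proj_pt \<Gamma> z) = Fin (f z / g z))"
 by eventually_elim (use K in auto)
 qed (use K in simp)
qed

end

section \<open>The map to the projective plane\<close>

lemma proj_point_scale: "a ~= 0 ==> proj_point (a *s v) = proj_point v"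
proof -
 assume a: "a ~= 0"
 have "k *s v = (k / a) *s (a *s v)" for k using a by simp
 hence "\<exists>l. k *s v = l *s (a *s v)" for k by blast
 moreover have "\<exists>l. k *s (a *s v) = l *s v" for k by simp
 ultimately show ?thesis unfolding proj_point_def vec.span_singleton by blast
qed

lemma proj_point_eqD:
 assumes "v ~= 0" "proj_point v = proj_point w" shows "\<exists>a. a ~= 0 \<and> v = a *s w"
proof -
 have "v \<in> proj_point v" unfolding proj_point_def by (rule vec.span_base) simp
 then obtain a where "v = a *s w" using assms(2) unfolding proj_point_def vec.span_singleton by blast
 thus ?thesis using assms(1) by simp
qed

lemma proportional_of_minors:
 fixes v w :: "complex^3"
 assumes "v ~= 0" "w ~= 0" "\<And>i j. v $ i * w $ j = v $ j * w $ i"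
 shows "proj_point v = proj_point w"
proof -
 obtain i where i: "w $ i ~= 0" using assms(2) by (auto simp: vec_eq_iff)
 have eq: "v = (v $ i / w $ i) *s w" using assms(3)[of _ i] i by (simp add: vec_eq_iff field_simps)
 moreover have "v $ i / w $ i ~= 0" using eq assms(1) by auto
 ultimately show ?thesis using proj_point_scale by metis
qed

lemma meromorphic_clear_pole:
 assumes "\<phi> meromorphic_on {0}"
 shows "\<exists>N H. H analytic_on {0} \<and> eventually (\<lambda>t. t ^ N * \<phi> t = H t) (at 0)"
proof -
 obtain r where r: "r > 0" "\<phi> analytic_on ball 0 r - {0}" using assms by (auto simp: meromorphic_at_iff isolated_singularity_at_def)
 have hol: "\<phi> holomorphic_on ball 0 r - {0}" by (rule analytic_imp_holomorphic[OF r(2)])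
 have evr: "eventually (\<lambda>t. t \<in> ball 0 r' - {0}) (at 0)" if "r' > 0" for r' :: real using that by (intro eventually_at_in_open) auto
 have "not_essential \<phi> 0" using assms by (simp add: meromorphic_at_iff)
 then consider "is_pole \<phi> 0" | c where "\<phi> \<midarrow>0\<rightarrow> c" by (auto simp: not_essential_def)
 thus ?thesis
 proof cases
  case 1
  from zorder_exist_pole[OF hol open_ball _ 1] r(1) obtain s g where s: "s > 0" "g holomorphic_on cball 0 s"
   "\<forall>w\<in>cball 0 s - {0}. \<phi> w = g w / (w - 0) ^ nat (- zorder \<phi> 0) \<and> g w ~= 0" by auto
  have "g analytic_on {0}" using holomorphic_on_subset[OF s(2) ball_subset_cball] s(1) by (simp add: analytic_at_ball) blast
  moreover have "eventually (\<lambda>t. t ^ nat (- zorder \<phi> 0) * \<phi> t = g t) (at 0)"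
   using evr[OF s(1)] by eventually_elim (use s(3) in auto)
  ultimately show ?thesis by blast
 next
  case 2
  define H where "H = (\<lambda>t. if t = 0 then c else \<phi> t)"
  have "H holomorphic_on ball 0 r" unfolding H_def by (rule removable_singularity[OF hol]) (use 2 in auto)
  hence "H analytic_on {0}" using r(1) by (simp add: analytic_at_ball) blast
  moreover have "eventually (\<lambda>t. t ^ 0 * \<phi> t = H t) (at 0)" using evr[OF r(1)] by eventually_elim (auto simp: H_def)
  ultimately show ?thesis by blast
 qed
qed

lemma analytic_common_ball:
 fixes A B :: "complex => complex"
 assumes "A analytic_on {0}" "B analytic_on {0}"
 shows "\<exists>r>0. A holomorphic_on ball 0 r \<and> B holomorphic_on ball 0 r"
proof -
 obtain r s where "r > 0" "A holomorphic_on ball 0 r" "s > 0" "B holomorphic_on ball 0 s" using assms by (auto simp: analytic_at_ball)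
 thus ?thesis by (intro exI[of _ "min r s"]) (auto intro: holomorphic_on_subset)
qed

definition vec3 :: "cfun => cfun => cfun => complex => complex^3" where
 "vec3 f g h z = vector [f z, g z, h z]"

lemma vec3_sel [simp]: "vec3 f g h z $ 1 = f z" "vec3 f g h z $ 2 = g z" "vec3 f g h z $ 3 = h z"
 by (simp_all add: vec3_def)

lemma vec3_eq_0_iff: "vec3 f g h z = 0 \<longleftrightarrow> (f z, g z, h z) = (0, 0, 0)"
 by (simp add: vec_eq_iff forall_3)

text \<open>Convergence in the projective plane expressed by lifts whose coordinates converge to a
  nonzero vector. The limit is unique because the 2 by 2 minors of two lifts vanish and pass to the
  limit.\<close>

definition P2_limit :: "(complex => complex^3) => riemann_sphere => (complex^3) set => bool" where
 "P2_limit V P L \<longleftrightarrow> (\<exists>\<nu> v. v ~= 0 \<and> L = proj_point v \<and> (\<forall>i. ((\<lambda>z. \<nu> z $ i) \<longlongrightarrow> v $ i) (punctured_nhds P)) \<and>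
   near P (\<lambda>z. V z ~= 0 \<and> proj_point (V z) = proj_point (\<nu> z)))"

lemma P2_limit_unique:
 assumes "P2_limit V P L" "P2_limit V P L'" and nb: "punctured_nhds P ~= bot"
 shows "L = L'"
proof -
 obtain \<nu> v where v: "v ~= 0" "L = proj_point v" "\<And>i. ((\<lambda>z. \<nu> z $ i) \<longlongrightarrow> v $ i) (punctured_nhds P)"
   "near P (\<lambda>z. V z ~= 0 \<and> proj_point (V z) = proj_point (\<nu> z))" using assms(1) unfolding P2_limit_def by blast
 obtain \<mu> w where w: "w ~= 0" "L' = proj_point w" "\<And>i. ((\<lambda>z. \<mu> z $ i) \<longlongrightarrow> w $ i) (punctured_nhds P)"
   "near P (\<lambda>z. V z ~= 0 \<and> proj_point (V z) = proj_point (\<mu> z))" using assms(2) unfolding P2_limit_def by blast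
 have "v $ i * w $ j = v $ j * w $ i" for i j
 proof -
  have "near P (\<lambda>z. \<nu> z $ i * \<mu> z $ j = \<nu> z $ j * \<mu> z $ i)"
   using v(4) w(4)
  proof eventually_elim
   case (elim z)
   obtain a b where a: "a ~= 0" "V z = a *s \<nu> z" and b: "b ~= 0" "V z = b *s \<mu> z"
    using proj_point_eqD[of "V z" "\<nu> z"] proj_point_eqD[of "V z" "\<mu> z"] elim by blast
   have \<nu>: "\<nu> z $ k = (b / a) * \<mu> z $ k" for k
    using arg_cong[OF trans[OF a(2)[symmetric] b(2)], of "\<lambda>x. x $ k"] a(1) by (simp add: field_simps)
   show ?case unfolding \<nu> by simp
  qed
  moreover have "((\<lambda>z. \<nu> z $ i * \<mu> z $ j) \<longlongrightarrow> v $ i * w $ j) (punctured_nhds P)"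
   "((\<lambda>z. \<nu> z $ j * \<mu> z $ i) \<longlongrightarrow> v $ j * w $ i) (punctured_nhds P)" by (intro tendsto_mult v w)+
  ultimately show ?thesis using tendsto_unique[OF nb] tendsto_cong[of "\<lambda>z. \<nu> z $ i * \<mu> z $ j"] by fast
 qed
 thus ?thesis unfolding v(2) w(2) by (rule proportional_of_minors[OF v(1) w(1)])
qed

context discrete_SL2
begin

context
 fixes chi m f g h
 assumes chi: "finite_order_character \<Gamma> chi" and f: "f \<in> modular_forms \<Gamma> chi m" "f ~= (\<lambda>_. 0)"
  and g: "g \<in> modular_forms \<Gamma> chi m" and h: "h \<in> modular_forms \<Gamma> chi m"
begin

text \<open>Multiply 1, g / f and h / f by a power of the local parameter that clears the poles,
  then divide by the largest common power; the result is analytic and nonzero at the centre.\<close>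

lemma local_projective_lift:
 assumes P: "P \<in> EHP \<Gamma>"
 shows "\<exists>\<phi>::complex => complex^3. (\<forall>i. (\<lambda>t. \<phi> t $ i) analytic_on {0}) \<and> \<phi> 0 ~= 0 \<and>
  near P (\<lambda>z. vec3 f g h z ~= 0 \<and> proj_point (vec3 f g h z) = proj_point (\<phi> (local_param \<Gamma> P z)))"
proof -
 obtain \<phi>1 where \<phi>1: "\<phi>1 meromorphic_on {0}" "near P (\<lambda>z. g z / f z = \<phi>1 (local_param \<Gamma> P z))"
  using aut_mero_quotient[OF chi g f] P unfolding aut_mero_def by blast
 obtain \<phi>2 where \<phi>2: "\<phi>2 meromorphic_on {0}" "near P (\<lambda>z. h z / f z = \<phi>2 (local_param \<Gamma> P z))"
  using aut_mero_quotient[OF chi h f] P unfolding aut_mero_def by blast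
 obtain N1 H1 where H1: "H1 analytic_on {0}" "eventually (\<lambda>t. t ^ N1 * \<phi>1 t = H1 t) (at 0)" using meromorphic_clear_pole[OF \<phi>1(1)] by blast
 obtain N2 H2 where H2: "H2 analytic_on {0}" "eventually (\<lambda>t. t ^ N2 * \<phi>2 t = H2 t) (at 0)" using meromorphic_clear_pole[OF \<phi>2(1)] by blast
 obtain r where r: "r > 0" "H1 holomorphic_on ball 0 r" "H2 holomorphic_on ball 0 r" using analytic_common_ball[OF H1(1) H2(1)] by blast
 define u where "u = (\<lambda>n::nat. \<lambda>t. if n = 0 then t ^ (N1 + N2) else if n = 1 then t ^ N2 * H1 t else t ^ N1 * H2 t)"
 have uhol: "u n holomorphic_on ball 0 r" if "n \<in> {0, 1, 2}" for n
  using that r by (auto simp: u_def intro!: holomorphic_intros)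
 have 0: "(0::complex) \<in> ball 0 r" using r by simp
 have "\<exists>n\<in>{0,1,2}. \<exists>t\<in>ball 0 r. u n t ~= 0"
  using r(1) by (intro bexI[of _ 0] bexI[of _ "of_real (r/2)"]) (auto simp: u_def)
 from min_order[OF open_ball connected_ball 0 uhol this] obtain k q where
  q: "\<And>n t. n \<in> {0,1,2} ==> t \<in> ball 0 r ==> u n t = t ^ k * q n t" "\<And>n. n \<in> {0,1,2} ==> q n holomorphic_on ball 0 r"
   "\<exists>n\<in>{0,1,2}. q n 0 ~= 0" by metis
 define \<phi> where "\<phi> = (\<lambda>t. vector [q 0 t, q 1 t, q 2 t] :: complex^3)"
 have "(\<lambda>t. \<phi> t $ i) analytic_on {0}" for i
 proof -
  have "q n analytic_on {0}" if "n \<in> {0,1,2}" for n using q(2)[OF that] r(1) by (simp add: analytic_at_ball) blast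
  thus ?thesis using exhaust_3[of i] by (auto simp: \<phi>_def)
 qed
 moreover have "\<phi> 0 ~= 0" using q(3) by (auto simp: \<phi>_def vec_eq_iff forall_3)
 moreover have "near P (\<lambda>z. vec3 f g h z ~= 0 \<and> proj_point (vec3 f g h z) = proj_point (\<phi> (local_param \<Gamma> P z)))"
 proof -
  have "eventually (\<lambda>t. t \<in> ball 0 r - {0}) (at 0)" using r by (intro eventually_at_in_open) auto
  with H1(2) H2(2) have "eventually (\<lambda>t. t \<in> ball 0 r - {0} \<and> t ^ N1 * \<phi>1 t = H1 t \<and> t ^ N2 * \<phi>2 t = H2 t) (at 0)"
 by eventually_elim auto
  from this[folded eventually_local_param[OF P]] \<phi>1(2) \<phi>2(2) modular_form_eventually_nonzero[OF chi f P]
  show ?thesis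
  proof eventually_elim
   case (elim z)
   define t where "t = local_param \<Gamma> P z"
   have t: "t \<in> ball 0 r" "t ~= 0" "H1 t = t ^ N1 * (g z / f z)" "H2 t = t ^ N2 * (h z / f z)" "f z ~= 0"
    using elim by (auto simp: t_def)
   have qs: "t ^ k * q 0 t = t ^ (N1 + N2)" "t ^ k * q 1 t = t ^ (N1 + N2) * (g z / f z)" "t ^ k * q 2 t = t ^ (N1 + N2) * (h z / f z)"
    proof -
    show "t ^ k * q 0 t = t ^ (N1 + N2)" using q(1)[of 0 t] t(1) by (simp add: u_def)
    have "t ^ k * q 1 t = t ^ N2 * H1 t" "t ^ k * q 2 t = t ^ N1 * H2 t" using q(1)[of 1 t] q(1)[of 2 t] t(1) by (simp_all add: u_def)
    thus "t ^ k * q 1 t = t ^ (N1 + N2) * (g z / f z)" "t ^ k * q 2 t = t ^ (N1 + N2) * (h z / f z)"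
     unfolding t(3,4) by (simp_all add: power_add)
   qed
   have "vec3 f g h z = (f z * t ^ k / t ^ (N1 + N2)) *s \<phi> t"
   proof -
    have "f z * t ^ k / t ^ (N1 + N2) * q n t = f z / t ^ (N1 + N2) * (t ^ k * q n t)" for n by simp
    note e = this[of 0, unfolded qs(1)] this[of 1, unfolded qs(2)] this[of 2, unfolded qs(3)]
    show ?thesis unfolding vec_eq_iff forall_3 vector_smult_component \<phi>_def vector_3 vec3_sel e using t(2,5) by simp
   qed
   moreover have "f z * t ^ k / t ^ (N1 + N2) ~= 0" using t by simp
   moreover have "vec3 f g h z ~= 0" using t(5) by (simp add: vec3_eq_0_iff)
   ultimately show ?case using proj_point_scale[of _ "\<phi> t"] by (simp add: t_def)
  qed
 qed
 ultimately show ?thesis by blast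
qed

lemma P2_limit_local:
 assumes P: "P \<in> EHP \<Gamma>" and an: "\<forall>i. (\<lambda>t. \<phi> t $ i) analytic_on {0}" "\<phi> 0 ~= 0"
  and ev: "near P (\<lambda>z. V z ~= 0 \<and> proj_point (V z) = proj_point (\<phi> (local_param \<Gamma> P z)))"
 shows "P2_limit V P (proj_point (\<phi> 0))"
 unfolding P2_limit_def
proof (rule exI[of _ "\<lambda>z. \<phi> (local_param \<Gamma> P z)"], rule exI[of _ "\<phi> 0"], intro conjI allI)
 fix i
 have "isCont (\<lambda>t. \<phi> t $ i) 0" using an(1) by (intro analytic_at_imp_isCont) auto
 thus "((\<lambda>z. \<phi> (local_param \<Gamma> P z) $ i) \<longlongrightarrow> \<phi> 0 $ i) (punctured_nhds P)"
  using filterlim_local_param[OF P, of "\<lambda>z. \<phi> (local_param \<Gamma> P z) $ i" "\<lambda>t. \<phi> t $ i"] by (simp add: isCont_def)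
qed (use an ev in auto)

lemma vec3_mob:
 assumes "A \<in> \<Gamma>" "Im z > 0"
 shows "\<exists>a. a ~= 0 \<and> vec3 f g h (mob A z) = a *s vec3 f g h z"
proof -
 have "chi A * cocyc A z ^ m ~= 0" using chi assms cocyc_nz[of A z] by (simp add: finite_order_character_def)
 moreover have "vec3 f g h (mob A z) = (chi A * cocyc A z ^ m) *s vec3 f g h z"
  using f(1) g h assms by (simp add: modular_forms_def vec_eq_iff forall_3)
 ultimately show ?thesis by blast
qed

lemma P2_limit_act:
 assumes lim: "P2_limit (vec3 f g h) P L" and A: "A \<in> \<Gamma>" and P: "P \<in> EHP \<Gamma>"
 shows "P2_limit (vec3 f g h) (act A P) L"
proof -
 let ?V = "vec3 f g h"
 have dA: "det A = 1" using A by simp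
 obtain \<nu> v where v: "v ~= 0" "L = proj_point v" "\<And>i. ((\<lambda>z. \<nu> z $ i) \<longlongrightarrow> v $ i) (punctured_nhds P)"
   "near P (\<lambda>z. ?V z ~= 0 \<and> proj_point (?V z) = proj_point (\<nu> z))" using lim unfolding P2_limit_def by blast
 show ?thesis
  unfolding P2_limit_def act_extended(2)[OF A P]
 proof (rule exI[of _ "\<lambda>z. \<nu> (mob (adj2 A) z)"], rule exI[of _ v], intro conjI allI v(1,2))
  fix i
  have "near P (\<lambda>z. \<nu> (mob (adj2 A) (mob A z)) $ i = \<nu> z $ i)"
   using eventually_UHP_punctured[OF P] by eventually_elim (simp add: mob_adj2(2)[OF dA])
  thus "((\<lambda>z. \<nu> (mob (adj2 A) z) $ i) \<longlongrightarrow> v $ i) (filtermap (mob A) (punctured_nhds P))" using v(3)[of i] tendsto_cong by (force simp: filterlim_def filtermap_filtermap)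
 next
  show "eventually (\<lambda>z. ?V z ~= 0 \<and> proj_point (?V z) = proj_point (\<nu> (mob (adj2 A) z))) (filtermap (mob A) (punctured_nhds P))"
   unfolding eventually_filtermap using v(4) eventually_UHP_punctured[OF P]
  proof eventually_elim
   case (elim z)
   obtain a where a: "a ~= 0" "?V (mob A z) = a *s ?V z" using vec3_mob[OF A elim(2)] by blast
   thus ?case using elim proj_point_scale[OF a(1), of "?V z"] mob_adj2(2)[OF dA elim(2)] by simp
  qed
 qed
qed

lemma form_isCont: "u \<in> modular_forms \<Gamma> chi m ==> Im z > 0 ==> isCont u z"
 using open_UHP holomorphic_on_imp_continuous_on continuous_on_eq_continuous_at unfolding modular_forms_def by (metis (no_types, lifting) UHP_iff mem_Collect_eq)

lemma P2_limit_interior: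
 assumes z: "Im z > 0" "vec3 f g h z ~= 0"
 shows "P2_limit (vec3 f g h) (Fin z) (proj_point (vec3 f g h z))"
 unfolding P2_limit_def filter_at_UHP[OF z(1)]
proof (rule exI[of _ "vec3 f g h"], rule exI[of _ "vec3 f g h z"], intro conjI allI z(2) refl)
 have lim: "((\<lambda>w. vec3 f g h w $ i) \<longlongrightarrow> vec3 f g h z $ i) (at z)" for i
  using form_isCont[OF f(1) z(1)] form_isCont[OF g z(1)] form_isCont[OF h z(1)] exhaust_3[of i] by (auto simp: isCont_def)
 thus "((\<lambda>w. vec3 f g h w $ i) \<longlongrightarrow> vec3 f g h z $ i) (at z)" for i .
 obtain i where "vec3 f g h z $ i ~= 0" using z(2) by (auto simp: vec_eq_iff)
 hence "eventually (\<lambda>w. vec3 f g h w $ i ~= 0) (at z)" by (rule tendsto_imp_eventually_ne[OF lim])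
 thus "eventually (\<lambda>w. vec3 f g h w ~= 0 \<and> proj_point (vec3 f g h w) = proj_point (vec3 f g h w)) (at z)"
 by eventually_elim auto
qed

definition P2_map :: "riemann_sphere set => (complex^3) set" where
 "P2_map = restrict (\<lambda>p. SOME L. \<exists>P. P \<in> EHP \<Gamma> \<and> p = orb \<Gamma> P \<and> P2_limit (vec3 f g h) P L) (RSurf \<Gamma>)"

lemma P2_map_orb:
 assumes P: "P \<in> EHP \<Gamma>" and L: "P2_limit (vec3 f g h) P L"
 shows "P2_map (orb \<Gamma> P) = L"
proof -
 obtain P' where P': "P' \<in> EHP \<Gamma>" "orb \<Gamma> P = orb \<Gamma> P'" "P2_limit (vec3 f g h) P' (P2_map (orb \<Gamma> P))" using someI_ex[of "\<lambda>L. \<exists>P'. P' \<in> EHP \<Gamma> \<and> orb \<Gamma> P = orb \<Gamma> P' \<and> P2_limit (vec3 f g h) P' L"] P L by (force simp: P2_map_def RSurf_def)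
 obtain A where A: "A \<in> \<Gamma>" "P = act A P'" using orb_eqD[OF P P'(2)[symmetric]] by blast
 show ?thesis using P2_limit_unique[OF P2_limit_act[OF P'(3) A(1) P'(1), folded A(2)] L punctured_nhds_neq_bot[OF P]] .
qed

lemma holomorphic_P2_map: "holomorphic_to_P2 \<Gamma> P2_map"
 unfolding holomorphic_to_P2_def
proof (intro conjI ballI)
 show "P2_map \<in> extensional (RSurf \<Gamma>)" by (simp add: P2_map_def)
 fix P assume P: "P \<in> EHP \<Gamma>"
 obtain \<phi> :: "complex => complex^3" where \<phi>: "\<forall>i. (\<lambda>t. \<phi> t $ i) analytic_on {0}" "\<phi> 0 ~= 0"
  and ev: "near P (\<lambda>z. vec3 f g h z ~= 0 \<and> proj_point (vec3 f g h z) = proj_point (\<phi> (local_param \<Gamma> P z)))"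
  using local_projective_lift[OF P] by blast
 have "P2_map (orb \<Gamma> P) = proj_point (\<phi> 0)" by (rule P2_map_orb[OF P P2_limit_local[OF P \<phi> ev]])
 moreover have "near P (\<lambda>z. P2_map (proj_pt \<Gamma> z) = proj_point (\<phi> (local_param \<Gamma> P z)))"
  using ev eventually_UHP_punctured[OF P] by eventually_elim (use P2_map_orb[OF _ P2_limit_interior] in simp)
 ultimately show "\<exists>\<phi>::complex => complex^3. (\<forall>i. (\<lambda>t. \<phi> t $ i) analytic_on {0}) \<and> \<phi> 0 ~= 0 \<and> P2_map (orb \<Gamma> P) = proj_point (\<phi> 0) \<and>
    near P (\<lambda>z. P2_map (proj_pt \<Gamma> z) = proj_point (\<phi> (local_param \<Gamma> P z)))"
  using \<phi> by blast
qed

lemma form_map_eq: "form_map \<Gamma> f g h = P2_map"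
 unfolding form_map_def
proof (rule the_equality, intro conjI ballI impI)
 show "holomorphic_to_P2 \<Gamma> P2_map" by (rule holomorphic_P2_map)
 fix z assume "z \<in> UHP" "(f z, g z, h z) ~= (0, 0, 0)"
 hence "P2_map (proj_pt \<Gamma> z) = proj_point (vec3 f g h z)" by (intro P2_map_orb P2_limit_interior) (auto simp: vec3_eq_0_iff)
 thus "P2_map (proj_pt \<Gamma> z) = proj_point (vector [f z, g z, h z])" by (simp add: vec3_def)
next
 fix \<Phi> assume H: "holomorphic_to_P2 \<Gamma> \<Phi> \<and> (\<forall>z\<in>UHP. (f z, g z, h z) ~= (0, 0, 0) --> \<Phi> (proj_pt \<Gamma> z) = proj_point (vector [f z, g z, h z]))"
 show "\<Phi> = P2_map"
 proof (rule extensionalityI[of _ "RSurf \<Gamma>"])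
  show "\<Phi> \<in> extensional (RSurf \<Gamma>)" using H by (simp add: holomorphic_to_P2_def)
  show "P2_map \<in> extensional (RSurf \<Gamma>)" by (simp add: P2_map_def)
  fix p assume "p \<in> RSurf \<Gamma>"
  then obtain P where P: "P \<in> EHP \<Gamma>" "p = orb \<Gamma> P" by (auto simp: RSurf_def)
  then obtain \<phi> :: "complex => complex^3" where \<phi>: "\<forall>i. (\<lambda>t. \<phi> t $ i) analytic_on {0}" "\<phi> 0 ~= 0" "\<Phi> (orb \<Gamma> P) = proj_point (\<phi> 0)"
   and ev: "near P (\<lambda>z. \<Phi> (proj_pt \<Gamma> z) = proj_point (\<phi> (local_param \<Gamma> P z)))"
   using H unfolding holomorphic_to_P2_def by blast
  have "near P (\<lambda>z. vec3 f g h z ~= 0 \<and> proj_point (vec3 f g h z) = proj_point (\<phi> (local_param \<Gamma> P z)))"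
   using ev modular_form_eventually_nonzero[OF chi f P(1)] eventually_UHP_punctured[OF P(1)]
  proof eventually_elim
   case (elim z)
   have "vec3 f g h z ~= 0" using elim(2) by (simp add: vec3_eq_0_iff)
   moreover have "\<Phi> (proj_pt \<Gamma> z) = proj_point (vec3 f g h z)" using H elim(2,3) by (simp add: vec3_def)
   ultimately show ?case using elim(1) by simp
  qed
  from P2_map_orb[OF P(1) P2_limit_local[OF P(1) \<phi>(1,2) this]] show "\<Phi> p = P2_map p" using \<phi>(3) P(2) by simp
 qed
qed

lemma form_curve_contains: "Im z > 0 ==> vec3 f g h z ~= 0 ==> proj_point (vec3 f g h z) \<in> form_curve \<Gamma> f g h"
 unfolding form_curve_def form_map_eq
 by (rule image_eqI[of _ _ "proj_pt \<Gamma> z"]) (auto simp: P2_map_orb[OF _ P2_limit_interior] RSurf_def)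

lemma form_curve_subset:
 assumes "L \<in> form_curve \<Gamma> f g h" "p \<in> homog n" "\<And>z. Im z > 0 ==> p (vec3 f g h z) = 0"
 shows "\<exists>v. v ~= 0 \<and> L = proj_point v \<and> p v = 0"
proof -
 obtain P where P: "P \<in> EHP \<Gamma>" "L = P2_map (orb \<Gamma> P)"
  using assms(1) unfolding form_curve_def form_map_eq by (auto simp: RSurf_def)
 obtain \<phi> :: "complex => complex^3" where \<phi>: "\<forall>i. (\<lambda>t. \<phi> t $ i) analytic_on {0}" "\<phi> 0 ~= 0"
  and ev: "near P (\<lambda>z. vec3 f g h z ~= 0 \<and> proj_point (vec3 f g h z) = proj_point (\<phi> (local_param \<Gamma> P z)))"
  using local_projective_lift[OF P(1)] by blast
 have L: "L = proj_point (\<phi> 0)" using P2_map_orb[OF P(1) P2_limit_local[OF P(1) \<phi> ev]] P(2) by simp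
 have "near P (\<lambda>z. p (\<phi> (local_param \<Gamma> P z)) = 0)"
  using ev eventually_UHP_punctured[OF P(1)]
 proof eventually_elim
  case (elim z)
  then obtain a where a: "a ~= 0" "vec3 f g h z = a *s \<phi> (local_param \<Gamma> P z)" using proj_point_eqD by blast
  thus ?case using assms(3)[OF elim(2)] homog_scaling[OF assms(2), of a "\<phi> (local_param \<Gamma> P z)"] by simp
 qed
 hence ev0: "eventually (\<lambda>t. p (\<phi> t) = 0) (at 0)" using eventually_local_param[OF P(1), of "\<lambda>t. p (\<phi> t) = 0"] by simp
 have cont: "isCont (\<lambda>t. \<phi> t $ i) 0" for i using \<phi>(1) by (intro analytic_at_imp_isCont) auto
 obtain c where c: "p = hform n c" using assms(2) by (auto simp: homog_def)
 have "isCont (\<lambda>t. p (\<phi> t)) 0" unfolding c hform_def case_prod_beta by (intro continuous_intros cont)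
 thus ?thesis using tendsto_unique[OF _ _ tendsto_eventually[OF ev0]] L \<phi>(2) by (auto simp: isCont_def)
qed

end

end

section \<open>The degree of the plane curve\<close>

definition form_comb :: "cfun => cfun => cfun => complex^3 => complex => complex" where
 "form_comb f g h a = (\<lambda>z. a $ 1 * f z + a $ 2 * g z + a $ 3 * h z)"

definition rel_degree :: "cfun => cfun => cfun => nat" where
 "rel_degree f g h = (LEAST n. \<exists>p\<in>homog n. p ~= (\<lambda>_. 0) \<and> (\<forall>z. Im z > 0 --> p (vec3 f g h z) = 0))"

lemma polynomial_on_line:
 assumes "p \<in> polynomial_funs scl" "vector_space scl"
 shows "\<exists>q. \<forall>s. p (a + scl s b) = poly q s"
 using assms(1)
proof induction
 case (lin l)
 interpret vector_space scl by fact
 interpret l: Vector_Spaces.linear scl "(*)" l by fact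
 show ?case by (intro exI[of _ "[:l a, l b:]"]) (simp add: l.add l.scale)
next
 case (const c)
 show ?case by (intro exI[of _ "[:c:]"]) simp
next
 case (add p q)
 then obtain u v where "\<forall>s. p (a + scl s b) = poly u s" "\<forall>s. q (a + scl s b) = poly v s" by blast
 thus ?case by (intro exI[of _ "u + v"]) simp
next
 case (mult p q)
 then obtain u v where "\<forall>s. p (a + scl s b) = poly u s" "\<forall>s. q (a + scl s b) = poly v s" by blast
 thus ?case by (intro exI[of _ "u * v"]) simp
qed

text \<open>Irreducibility of affine space: on the line joining the two points both functions become
  nonzero polynomials in one variable, with finitely many zeros in all.\<close>

lemma polynomial_funs_common_nonzero:
 assumes pq: "p \<in> polynomial_funs scl" "q \<in> polynomial_funs scl" and vs: "vector_space scl" and nz: "p a ~= 0" "q b ~= 0"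
 shows "\<exists>v. p v ~= 0 \<and> q v ~= 0"
proof -
 interpret vector_space scl by fact
 obtain u where u: "\<And>s. p (a + scl s (b - a)) = poly u s" using polynomial_on_line[OF pq(1) vs] by blast
 obtain w where w: "\<And>s. q (a + scl s (b - a)) = poly w s" using polynomial_on_line[OF pq(2) vs] by blast
 have "u * w ~= 0" using u[of 0] w[of 1] nz by auto
 hence "finite {s. poly (u * w) s = 0}" by (rule poly_roots_finite)
 moreover have "infinite (UNIV :: complex set)" by (rule infinite_UNIV_char_0)
 ultimately have "\<exists>s. poly (u * w) s ~= 0" by (metis (mono_tags, lifting) Collect_cong UNIV_def)
 thus ?thesis using u w by (metis mult_eq_0_iff poly_mult)
qed

section \<open>The plane curve of three independent forms\<close>

locale form_triple = finite_area_SL2 +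
 fixes chi m \<Xi> f g h
 assumes chi: "finite_order_character \<Gamma> chi" and sub: "\<Xi> \<subseteq> modular_forms \<Gamma> chi m"
  and fgh: "f \<in> \<Xi>" "g \<in> \<Xi>" "h \<in> \<Xi>" and comb: "\<And>a. form_comb f g h a \<in> \<Xi>"
  and ind: "\<And>a. form_comb f g h a = (\<lambda>_. 0) ==> a = 0"
begin

definition "W = range (form_comb f g h)"
abbreviation "V \<equiv> vec3 f g h"
abbreviation "ch \<equiv> (\<lambda>\<Psi>::cfun => complex => complex. vec3 (\<Psi> f) (\<Psi> g) (\<Psi> h))"

lemma basis_comb: "f \<in> W" "g \<in> W" "h \<in> W"
proof -
 have "f = form_comb f g h (axis 1 1)" "g = form_comb f g h (axis 2 1)" "h = form_comb f g h (axis 3 1)"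
 by (simp_all add: form_comb_def axis_def)
 thus "f \<in> W" "g \<in> W" "h \<in> W" unfolding W_def by auto
qed

lemma forms: "f \<in> modular_forms \<Gamma> chi m" "g \<in> modular_forms \<Gamma> chi m" "h \<in> modular_forms \<Gamma> chi m"
 using sub fgh by auto

lemma f_nz: "f ~= (\<lambda>_. 0)"
proof
 assume "f = (\<lambda>_. 0)"
 hence "form_comb f g h (axis 1 1) = (\<lambda>_. 0)" by (simp add: form_comb_def axis_def)
 from ind[OF this] show False by simp
qed

lemma V_hol: "(\<lambda>z. V z $ i) holomorphic_on UHP"
 using forms exhaust_3[of i] by (auto simp: modular_forms_def)

text \<open>At the centre no point of the half-plane is available. There the nowhere zero member of
  the chart is a combination of the three coordinates, by continuation from the punctured disc, so
  the coordinates cannot all vanish.\<close>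

lemma chart:
 assumes "is_chart W \<Psi>"
 shows "(\<lambda>t. ch \<Psi> t $ i) holomorphic_on ball 0 2"
  "t \<in> ball 0 2 - {0} ==> \<exists>z a. Im z > 0 \<and> a ~= 0 \<and> ch \<Psi> t = a *s V z"
  "t \<in> ball 0 2 ==> ch \<Psi> t ~= 0"
proof -
 show hol: "(\<lambda>t. ch \<Psi> t $ i) holomorphic_on ball 0 2" for i
  using assms basis_comb exhaust_3[of i] by (auto simp: is_chart_def)
 have pt: "\<exists>z a. Im z > 0 \<and> a ~= 0 \<and> (\<forall>F\<in>W. \<Psi> F t = a * F z)" if t: "t \<in> ball 0 2 - {0}" for t
  proof -
  have "\<forall>t\<in>ball 0 2 - {0}. \<exists>z\<in>UHP. \<exists>a. a ~= 0 \<and> (\<forall>F\<in>W. \<Psi> F t = a * F z)"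
   using assms unfolding is_chart_def by simp
  from bspec[OF this t] show ?thesis by auto
 qed
 show "\<exists>z a. Im z > 0 \<and> a ~= 0 \<and> ch \<Psi> t = a *s V z" if t: "t \<in> ball 0 2 - {0}"
 using pt[OF t] basis_comb by (auto simp: vec_eq_iff forall_3)
 show "ch \<Psi> t ~= 0" if t: "t \<in> ball 0 2"
 proof
  assume 0: "ch \<Psi> t = 0"
  obtain b where b: "\<And>t. t \<in> ball 0 2 ==> \<Psi> (form_comb f g h b) t ~= 0" "\<Psi> (form_comb f g h b) holomorphic_on ball 0 2"
   using assms unfolding is_chart_def W_def by blast
  have "\<Psi> (form_comb f g h b) s = b$1 * ch \<Psi> s $ 1 + b$2 * ch \<Psi> s $ 2 + b$3 * ch \<Psi> s $ 3" if s: "s \<in> ball 0 2" for s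
  proof (rule analytic_continuation_open[of "ball 0 2 - {0}" "ball 0 2" "\<Psi> (form_comb f g h b)"])
   have "1 \<in> ball 0 2 - {0 :: complex}" by simp
   thus "ball 0 2 - {0 :: complex} ~= {}" by blast
   fix z :: complex assume z: "z \<in> ball 0 2 - {0}"
   show "\<Psi> (form_comb f g h b) z = b$1 * ch \<Psi> z $ 1 + b$2 * ch \<Psi> z $ 2 + b$3 * ch \<Psi> z $ 3"
   proof -
    obtain x a where "\<And>F. F \<in> W ==> \<Psi> F z = a * F x" using pt[OF z] by blast
    moreover have "form_comb f g h b \<in> W" by (simp add: W_def)
    ultimately show ?thesis using basis_comb by (simp add: form_comb_def algebra_simps)
   qed
  qed (use s b(2) hol in \<open>auto intro!: holomorphic_intros simp del: vec3_sel\<close>)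
  thus False using b(1)[OF t] t 0 by (simp del: vec3_sel)
 qed
qed

lemma vanish_chart:
 assumes "is_chart W \<Psi>" "p \<in> homog n" "\<And>z. Im z > 0 ==> p (V z) = 0" "t \<in> ball 0 2"
 shows "p (ch \<Psi> t) = 0"
proof (rule analytic_continuation_open[of "ball 0 2 - {0}" "ball 0 2" "\<lambda>t. p (ch \<Psi> t)" "\<lambda>_. 0"])
 have "1 \<in> ball 0 2 - {0 :: complex}" by simp
 thus "ball 0 2 - {0 :: complex} ~= {}" by blast
 show "p (ch \<Psi> z) = 0" if zz: "z \<in> ball 0 2 - {0}" for z
 proof -
  obtain x a where "Im x > 0" "ch \<Psi> z = a *s V x" using chart(2)[OF assms(1) zz] by blast
  thus ?thesis using assms(3) homog_scaling[OF assms(2), of a "V x"] by simp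
 qed
 show "(\<lambda>t. p (ch \<Psi> t)) holomorphic_on ball 0 2"
 by (rule holomorphic_homog[OF assms(2) chart(1)[OF assms(1)]])
 show "t \<in> ball 0 2" by fact
qed auto

lemma vanish_from_chart:
 assumes J: "chart_atlas W J" "\<Psi> \<in> J" and p: "p \<in> homog n" "\<And>t. t \<in> ball 0 2 ==> p (ch \<Psi> t) = 0" and z: "Im z > 0"
 shows "p (V z) = 0"
proof -
 obtain x where x: "Im x > 0" "eventually (covers W \<Psi>) (nhds x)" using J by (auto simp: chart_atlas_def)
 then obtain U' where U': "open U'" "x \<in> U'" "\<And>z. z \<in> U' ==> covers W \<Psi> z" unfolding eventually_nhds by blast
 define U where "U = U' \<inter> UHP"
 have U: "open U" "U ~= {}" "U \<subseteq> UHP" using U' x(1) open_UHP by (auto simp: U_def)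
 show ?thesis
 proof (rule analytic_continuation_open[of U UHP "\<lambda>z. p (V z)" "\<lambda>_. 0"])
  fix z assume z: "z \<in> U"
  show "p (V z) = 0"
  proof (cases "V z = 0")
   case True
   thus ?thesis using p(2)[of 0] homog_scaling[OF p(1), of 0 "ch \<Psi> 0"] by simp
  next
   case False
   then obtain t a where t: "t \<in> cball 0 1" "a ~= 0" "\<And>F. F \<in> W ==> \<Psi> F t = a * F z" using basis_comb U'(3)[of z] z by (auto simp: vec3_eq_0_iff covers_def U_def)
   have "ch \<Psi> t = a *s V z" using t(3) basis_comb by (auto simp: vec_eq_iff forall_3)
   thus ?thesis using p(2)[of t] t homog_scaling[OF p(1), of a "V z"] by auto
  qed
 next
  show "(\<lambda>z. p (V z)) holomorphic_on UHP" by (rule holomorphic_homog[OF p(1) V_hol])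
 qed (use U(1-3) z open_UHP connected_UHP in auto)
qed

lemma exists_chart_atlas: "\<exists>J. chart_atlas W J"
proof (rule modular_forms_charts[OF chi])
 show "W \<subseteq> modular_forms \<Gamma> chi m" using comb sub by (auto simp: W_def)
 show "\<exists>F\<in>W. \<exists>z. F z ~= 0" using f_nz basis_comb(1) by auto
qed

lemma plane_curve_charts:
 assumes J: "chart_atlas W J"
 shows "plane_curve (ch ` J)"
proof
 have isc: "is_chart W \<Psi>" if "\<Psi> \<in> J" for \<Psi> using J that by (simp add: chart_atlas_def)
 show "finite (ch ` J)" using J by (simp add: chart_atlas_def)
 obtain z where z: "f z ~= 0" using f_nz by auto
 hence "z \<in> UHP" using forms(1) by (auto simp: modular_forms_def intro: ccontr)
 from chart_atlas_cover[OF J this basis_comb(1) z] show "ch ` J ~= {}" by blast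
 fix \<phi> assume "\<phi> \<in> ch ` J"
 then obtain \<Psi> where \<Psi>: "\<Psi> \<in> J" and \<phi>: "\<phi> = ch \<Psi>" by blast
 show "(\<lambda>t. \<phi> t $ i) holomorphic_on ball 0 2" for i unfolding \<phi> by (rule chart(1)[OF isc[OF \<Psi>]])
 have nz: "\<phi> t ~= 0" if "t \<in> ball 0 2" for t unfolding \<phi> by (rule chart(3)[OF isc[OF \<Psi>] that])
 thus "t \<in> ball 0 2 ==> \<phi> t ~= 0" for t .
 show "\<exists>\<psi>\<in>ch ` J. \<exists>u\<in>cball 0 1. \<exists>a. a ~= 0 \<and> \<phi> t = a *s \<psi> u" if t: "t \<in> ball 0 2" for t
 proof (cases "t = 0")
  case True
  thus ?thesis using \<Psi> by (intro bexI[of _ \<phi>] bexI[of _ t] exI[of _ 1]) (auto simp: \<phi>)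
 next
  case False
  then obtain z a where z: "Im z > 0" "a ~= 0" "\<phi> t = a *s V z" using chart(2)[OF isc[OF \<Psi>], of t] t unfolding \<phi> by blast
  then obtain F where "F \<in> W" "F z ~= 0" using nz[OF t] basis_comb by (auto simp: vec3_eq_0_iff)
  from chart_atlas_cover[OF J _ this] z(1) obtain \<Psi>' u b where b: "\<Psi>' \<in> J" "u \<in> cball 0 1" "b ~= 0" "\<And>F. F \<in> W ==> \<Psi>' F u = b * F z"
   unfolding UHP_iff by blast
  have "\<phi> t = (a / b) *s ch \<Psi>' u" using b(3,4) basis_comb z(3) by (auto simp: vec_eq_iff forall_3)
  thus ?thesis using b(1-3) z(2) by (intro bexI[of _ "ch \<Psi>'"] bexI[of _ u] exI[of _ "a / b"]) auto
 qed
 show "p (\<psi> t) = 0" if p: "p \<in> homog n" "\<psi> \<in> ch ` J" "\<And>t. t \<in> ball 0 2 ==> p (\<phi> t) = 0" "t \<in> ball 0 2" for p n \<psi> t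
 using p(2) vanish_chart[OF isc p(1) vanish_from_chart[OF J \<Psi> p(1)] p(4)] p(3) by (auto simp: \<phi>)
 show "a = 0" if a: "\<And>t. t \<in> ball 0 2 ==> (\<Sum>i\<in>UNIV. a $ i * \<phi> t $ i) = 0" for a
 proof (rule ind, rule ext)
  fix z
  have l: "(\<lambda>v. \<Sum>i\<in>UNIV. a $ i * v $ i) \<in> homog 1" using homog_linear[of "a$1" "a$2" "a$3"] by (simp add: sum_3)
  show "form_comb f g h a z = 0"
  proof (cases "Im z > 0")
   case True
   have "(\<Sum>i\<in>UNIV. a $ i * V z $ i) = 0" by (rule vanish_from_chart[OF J \<Psi> l _ True]) (use a in \<open>simp add: \<phi>\<close>)
   thus ?thesis by (simp add: form_comb_def sum_3)
  next
   case False
   thus ?thesis using comb[of a] sub by (auto simp: modular_forms_def)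
  qed
 qed
qed

abbreviation "relation n p \<equiv> p \<in> homog n \<and> p ~= (\<lambda>_. 0) \<and> (\<forall>z. Im z > 0 --> p (V z) = 0)"

lemma vanish_iff:
 assumes "chart_atlas W J" "p \<in> homog n"
 shows "plane_curve.vanish (ch ` J) p \<longleftrightarrow> (\<forall>z. Im z > 0 --> p (V z) = 0)"
proof -
 interpret plane_curve "ch ` J" by (rule plane_curve_charts[OF assms(1)])
 obtain \<Psi> where \<Psi>: "\<Psi> \<in> J" using J_ne by blast
 have "is_chart W \<Psi>" if "\<Psi> \<in> J" for \<Psi> using assms(1) that by (simp add: chart_atlas_def)
 thus ?thesis using vanish_chart[OF _ assms(2)] vanish_from_chart[OF assms(1) \<Psi> assms(2)] \<Psi> unfolding vanish_def by blast
qed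

lemma rel_degree_relation: "\<exists>p. relation (rel_degree f g h) p"
proof -
 obtain J where J: "chart_atlas W J" using exists_chart_atlas by blast
 from uniform_relation_degree[OF J] obtain k where k: "\<forall>f\<in>W. \<forall>g\<in>W. \<forall>h\<in>W. \<exists>c. (\<exists>x\<in>Mon k. c x ~= 0) \<and> (\<forall>z\<in>UHP. hform k c (vector [f z, g z, h z]) = 0)" ..
 from bspec[OF bspec[OF bspec[OF k]], OF basis_comb] obtain c where
  c: "\<exists>x\<in>Mon k. c x ~= 0" "\<forall>z\<in>UHP. hform k c (V z) = 0" unfolding vec3_def by blast
 have "\<exists>n. \<exists>p\<in>homog n. p ~= (\<lambda>_. 0) \<and> (\<forall>z. Im z > 0 --> p (V z) = 0)" using c hform_eq_0D[of k c] by (metis homogI prod.exhaust UHP_iff)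
 from LeastI_ex[OF this] show ?thesis unfolding rel_degree_def by blast
qed

lemma rel_degree_le: "relation n p ==> rel_degree f g h \<le> n"
 unfolding rel_degree_def by (rule Least_le) blast

lemma minimal_relation:
 assumes J: "chart_atlas W J"
 shows "\<exists>c. plane_curve_min (ch ` J) (rel_degree f g h) c"
proof -
 interpret plane_curve "ch ` J" by (rule plane_curve_charts[OF J])
 obtain c where c: "relation (rel_degree f g h) (hform (rel_degree f g h) c)" using rel_degree_relation by (auto simp: homog_def)
 have "plane_curve_min (ch ` J) (rel_degree f g h) c"
 by unfold_locales (use c vanish_iff[OF J] rel_degree_le homogI in blast)+
 thus ?thesis by blast
qed

end

lemma plane_curve_degree_eq:
 assumes D: "D \<in> polynomial_funs (*s)" "\<exists>a. D a ~= 0"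
  and n: "\<And>a. a ~= 0 ==> D a ~= 0 ==> finite (C \<inter> proj_line a) \<and> card (C \<inter> proj_line a) = n"
 shows "plane_curve_degree C = n"
 unfolding plane_curve_degree_def
proof (rule the_equality)
 have "openin (zariski (*s) UNIV) {a. D a ~= 0}" using D(1) unfolding openin_zariski by auto
 thus "\<exists>U. openin (zariski (*s) UNIV) U \<and> U ~= {} \<and> (\<forall>a\<in>U. a ~= 0 --> finite (C \<inter> proj_line a) \<and> card (C \<inter> proj_line a) = n)"
  using D(2) n by auto
 fix k assume "\<exists>U. openin (zariski (*s) UNIV) U \<and> U ~= {} \<and> (\<forall>a\<in>U. a ~= 0 --> finite (C \<inter> proj_line a) \<and> card (C \<inter> proj_line a) = k)"
 then obtain U where U: "openin (zariski (*s) UNIV) U" "U ~= {}" "\<And>a. a \<in> U ==> a ~= 0 ==> card (C \<inter> proj_line a) = k" by blast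
 obtain p b where p: "p \<in> polynomial_funs (*s)" "p b ~= 0" "\<And>v. p v ~= 0 ==> v \<in> U" using U(1,2) unfolding openin_zariski by blast
 have vs: "vector_space ((*s) :: complex => complex^3 => complex^3)" by (rule vec.vector_space_axioms)
 obtain a where "D a ~= 0" using D(2) by blast
 from polynomial_funs_common_nonzero[OF D(1) p(1) vs this p(2)] obtain e where e: "D e * p e ~= 0" by auto
 \<comment> \<open>A nonzero first coordinate is a third polynomial condition; it ensures that the
   common point of the two open sets is a genuine line.\<close>
 have "(axis 1 1 :: complex^3) $ 1 ~= 0" by simp
 from polynomial_funs_common_nonzero[OF polynomial_funs.mult[OF D(1) p(1)] coord_linear vs e this]
 obtain v where v: "D v ~= 0" "p v ~= 0" "v $ 1 ~= 0" by auto
 hence "v ~= 0" by auto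
 thus "k = n" using n v U(3) p(3) by metis
qed

context form_triple
begin

text \<open>A general line meets the zero set of the minimal relation in exactly \<open>r\<close>
  points and the curve in a subset of these. All of them are attained in charts, so the two
  intersections coincide.\<close>

theorem deg_curve_eq: "deg_curve \<Gamma> f g h = rel_degree f g h"
 unfolding deg_curve_def
proof -
 obtain J where J: "chart_atlas W J" using exists_chart_atlas by blast
 obtain c where "plane_curve_min (ch ` J) (rel_degree f g h) c" using minimal_relation[OF J] by blast
 then interpret M: plane_curve_min "ch ` J" "rel_degree f g h" c .
 define r where "r = rel_degree f g h"
 note f' = chi forms(1) f_nz forms(2,3)
 have rel: "hform r c (V z) = 0" if "Im z > 0" for z using M.rel vanish_iff[OF J homogI, of _ c] that by (simp add: r_def)
 \<comment> \<open>The line avoids the chart centres, so every intersection point occurs at some t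
   different from 0 and comes from a point of the half-plane.\<close>
 define Z where "Z = (\<lambda>\<Psi>. ch \<Psi> 0) ` J"
 have "finite Z" using J by (simp add: Z_def chart_atlas_def)
 moreover have "z ~= 0 \<and> hform r c z = 0" if "z \<in> Z" for z
  using that M.nz M.rel unfolding Z_def M.vanish_def r_def by auto
 ultimately obtain D where D: "D \<in> polynomial_funs (*s)" "\<exists>a. D a ~= 0"
  "\<And>a. a ~= 0 ==> D a ~= 0 ==> (\<forall>z\<in>Z. dot a z ~= 0) \<and>
   (\<exists>e q. dot a e = 0 \<and> dot a q = 0 \<and> hform r c q ~= 0 \<and> card {s. hform r c (e + s *s q) = 0} = r)"
  using M.generic_line[of Z] unfolding r_def[symmetric] by blast
 show "plane_curve_degree (form_curve \<Gamma> f g h) = rel_degree f g h"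
 proof (rule plane_curve_degree_eq[OF D(1,2)])
  fix a assume a: "a ~= 0" "D a ~= 0"
  obtain e q where e: "dot a e = 0" "dot a q = 0" "hform r c q ~= 0" "card {s. hform r c (e + s *s q) = 0} = r"
   and Z: "\<And>z. z \<in> Z ==> dot a z ~= 0" using D(3)[OF a] by blast
  define T where "T = {s. hform r c (e + s *s q) = 0}"
  note lp = M.line_points[OF a(1) e[unfolded r_def], folded r_def]
  note li = M.line_directions_independent[OF e(3,4)[unfolded r_def], folded r_def]
  have nz: "e + s *s q ~= 0" for s using li[of 1 s] by auto
  have inj: "inj_on (\<lambda>s. proj_point (e + s *s q)) T"
  proof (rule inj_onI)
   fix s t assume "proj_point (e + s *s q) = proj_point (e + t *s q)"
   from proj_point_eqD[OF nz this] obtain b where "e + s *s q = b *s (e + t *s q)" by blast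
   hence "(1 - b) *s e + (s - b * t) *s q = 0" by (simp add: algebra_simps)
   from li[OF this] show "s = t" by auto
  qed
  have "form_curve \<Gamma> f g h \<inter> proj_line a = (\<lambda>s. proj_point (e + s *s q)) ` T"
  proof (intro equalityI subsetI)
   fix L assume L: "L \<in> form_curve \<Gamma> f g h \<inter> proj_line a"
   then obtain v w where v: "v ~= 0" "L = proj_point v" "hform r c v = 0" and w: "w ~= 0" "dot a w = 0" "L = proj_point w"
    using form_curve_subset[OF f' _ homogI rel] unfolding proj_line_def dot_def by blast
   obtain b where "v = b *s w" using proj_point_eqD[of v w] v w by auto
   hence "dot a v = 0" using w(2) by (simp add: dot_simps)
   from lp(1)[OF v(1) this v(3)] obtain s b where "b ~= 0" "v = b *s (e + s *s q)" "hform r c (e + s *s q) = 0" by blast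
   thus "L \<in> (\<lambda>s. proj_point (e + s *s q)) ` T" using v(2) proj_point_scale[of b "e + s *s q"] unfolding T_def by blast
  next
   fix L assume "L \<in> (\<lambda>s. proj_point (e + s *s q)) ` T"
   then obtain s where s: "L = proj_point (e + s *s q)" "hform r c (e + s *s q) = 0" by (auto simp: T_def)
   define v where "v = e + s *s q"
   have v: "v ~= 0" "dot a v = 0" "hform r c v = 0" using nz e(1,2) s(2) by (simp_all add: v_def dot_simps)
   obtain \<Psi> t b where t: "\<Psi> \<in> J" "t \<in> cball 0 1" "b ~= 0" "ch \<Psi> t = b *s v" using lp(2)[OF v] by blast
   have "t \<in> ball 0 2 - {0}" using Z[of "ch \<Psi> 0"] t(1,4) v(2) t(2) by (auto simp: Z_def dot_simps)
   moreover have "is_chart W \<Psi>" using J t(1) by (simp add: chart_atlas_def)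
   ultimately obtain z a' where z: "Im z > 0" "a' ~= 0" "ch \<Psi> t = a' *s V z" using chart(2) by blast
   have "proj_point v = proj_point (V z)" using t(3,4) z(2,3) proj_point_scale by metis
   moreover have "V z ~= 0" using z(3) t(3,4) v(1) by auto
   ultimately have "L \<in> form_curve \<Gamma> f g h" using form_curve_contains[OF f' z(1)] s(1) by (simp add: v_def)
   moreover have "L \<in> proj_line a" using v(1,2) s(1) unfolding proj_line_def dot_def v_def by blast
   ultimately show "L \<in> form_curve \<Gamma> f g h \<inter> proj_line a" by blast
  qed
  moreover have "finite T" using e(4) M.r_ge_2 unfolding T_def r_def by (intro card_ge_0_finite) simp
  ultimately show "finite (form_curve \<Gamma> f g h \<inter> proj_line a) \<and> card (form_curve \<Gamma> f g h \<inter> proj_line a) = rel_degree f g h"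
   using card_image[OF inj] e(4) by (simp add: T_def r_def)
 qed
qed

end

section \<open>Curves of maximal degree\<close>

definition mono_fam :: "nat => cfun => cfun => cfun => nat \<times> nat => complex => complex" where
 "mono_fam n f g h x z = f z ^ (n - fst x - snd x) * g z ^ fst x * h z ^ snd x"

lemma hform_vec3: "hform n c (vec3 f g h z) = (\<Sum>x\<in>Mon n. c x * mono_fam n f g h x z)"
 by (simp add: hform_def mono_fam_def case_prod_beta')

lemma not_indep_mono_fam:
 assumes "p \<in> homog n" "p ~= (\<lambda>_. 0)" "\<And>z. p (vec3 f g h z) = 0"
 shows "\<not> indep_fam (Mon n) (mono_fam n f g h)"
proof
 assume i: "indep_fam (Mon n) (mono_fam n f g h)"
 obtain c where c: "p = hform n c" using assms(1) by (auto simp: homog_def)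
 have "c x = 0" if "x \<in> Mon n" for x using indep_famD[OF i _ that, of c] assms(3) by (simp add: c hform_vec3)
 thus False using assms(2) by (auto simp: c hform_def fun_eq_iff intro!: sum.neutral)
qed

lemma homog_polynomial: "p \<in> homog n ==> p \<in> polynomial_funs (*s)"
 by (auto simp: homog_def hform_def[abs_def]
   intro!: polynomial_funs_sum polynomial_funs.mult polynomial_funs_power polynomial_funs.const coord_linear)

lemma homog_raise:
 assumes "p \<in> homog n" "p ~= (\<lambda>_. 0)"
 shows "(\<lambda>v. p v * v $ 1 ^ k) \<in> homog (n + k)" "(\<lambda>v. p v * v $ 1 ^ k) ~= (\<lambda>_. 0)"
proof -
 show "(\<lambda>v. p v * v $ 1 ^ k) \<in> homog (n + k)" using homog_mult[OF assms(1) homog_monomial[of 0 0 k k]] by simp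
 obtain a where "p a ~= 0" using assms(2) by auto
 moreover have "(axis 1 1 :: complex^3) $ 1 ~= 0" by simp
 ultimately obtain v where "p v ~= 0" "v $ 1 ~= 0"
  using polynomial_funs_common_nonzero[OF homog_polynomial[OF assms(1)] coord_linear vec.vector_space_axioms] by blast
 thus "(\<lambda>v. p v * v $ 1 ^ k) ~= (\<lambda>_. 0)" by (auto simp: fun_eq_iff)
qed

lemma eval_polynomial: "(\<lambda>h. h z) \<in> polynomial_funs cfun_scale"
proof (rule polynomial_funs.lin)
 interpret vector_space "(*) :: complex => complex => complex" by unfold_locales (auto simp: algebra_simps)
 show "Vector_Spaces.linear cfun_scale (*) (\<lambda>h. h z)"
 by unfold_locales (auto simp: cfun_scale_def)
qed

lemma mono_fam_polynomial: "(\<lambda>h. mono_fam n f g h x z) \<in> polynomial_funs cfun_scale"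
 unfolding mono_fam_def by (intro polynomial_funs.mult polynomial_funs.const polynomial_funs_power eval_polynomial)

context form_triple
begin

lemma V_zero: "\<not> Im z > 0 ==> V z = 0"
 using forms by (simp add: vec3_eq_0_iff modular_forms_def)

lemma homog_V_zero: "p \<in> homog n ==> n \<ge> 1 ==> \<not> Im z > 0 ==> p (V z) = 0"
 using homog_scaling[of p n 0 0] by (simp add: V_zero power_0_left)

text \<open>A relation of lower degree is raised to degree n by a power of f. For n at least 1 all
  monomials vanish off the half-plane, where forms are 0 by convention, so it does not matter
  whether z ranges over the half-plane or over all of C.\<close>

lemma indep_mono_fam_iff:
 assumes "n \<ge> 1"
 shows "indep_fam (Mon n) (mono_fam n f g h) \<longleftrightarrow> n < rel_degree f g h"
proof
 assume i: "indep_fam (Mon n) (mono_fam n f g h)"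
 show "n < rel_degree f g h"
 proof (rule ccontr)
  assume n: "\<not> n < rel_degree f g h"
  obtain p where p: "relation (rel_degree f g h) p" using rel_degree_relation by blast
  define q where "q = (\<lambda>v. p v * v $ 1 ^ (n - rel_degree f g h))"
  have q: "q \<in> homog n" "q ~= (\<lambda>_. 0)" using homog_raise[of p "rel_degree f g h" "n - rel_degree f g h"] p n by (auto simp: q_def)
  have "q (V z) = 0" for z using p homog_V_zero[OF q(1) assms, of z] by (cases "Im z > 0") (auto simp: q_def)
  thus False using not_indep_mono_fam[OF q] i by blast
 qed
next
 assume n: "n < rel_degree f g h"
 show "indep_fam (Mon n) (mono_fam n f g h)"
  unfolding indep_fam_def
 proof (intro allI impI ballI, rule ccontr)
  fix c x assume c: "\<forall>z. (\<Sum>i\<in>Mon n. c i * mono_fam n f g h i z) = 0" and x: "x \<in> Mon n" "c x ~= 0"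
  have "relation n (hform n c)" using c hform_eq_0D[of n c "fst x" "snd x"] x by (auto simp: hform_vec3 homogI)
  from rel_degree_le[OF this] n show False by simp
 qed
qed

lemma rel_degree_ge_2: "rel_degree f g h \<ge> 2"
proof -
 obtain J where J: "chart_atlas W J" using exists_chart_atlas by blast
 obtain c where "plane_curve_min (ch ` J) (rel_degree f g h) c" using minimal_relation[OF J] by blast
 thus ?thesis by (rule plane_curve_min.r_ge_2)
qed

definition "in_curve w \<longleftrightarrow> aut_mero \<Gamma> w \<and> mk_mero \<Gamma> w \<in> curve_field \<Gamma> f g h"

lemma quot_mero: "u \<in> \<Xi> ==> aut_mero \<Gamma> (\<lambda>z. u z / f z)" "u \<in> \<Xi> ==> form_quot \<Gamma> u f = mk_mero \<Gamma> (\<lambda>z. u z / f z)"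
 using aut_mero_quotient[OF chi _ forms(1) f_nz] form_quot_eq[OF chi _ forms(1) f_nz] sub by auto

lemma curve_gens: "{form_quot \<Gamma> g f, form_quot \<Gamma> h f} \<subseteq> mero_funs \<Gamma>"
 using quot_mero fgh mk_mero_in by simp

lemmas curve_closed = generated_over_C_closed[OF curve_gens, folded curve_field_def]

lemma in_curve_ops:
 "in_curve (\<lambda>_. a)" "in_curve u ==> in_curve v ==> in_curve (\<lambda>z. u z + v z)"
 "in_curve u ==> in_curve v ==> in_curve (\<lambda>z. u z * v z)"
 using curve_closed(1,3,4) unfolding in_curve_def by auto

lemma in_curve_poly2: "in_curve (\<lambda>z. poly2 p (g z / f z) (h z / f z))"
proof -
 have x: "in_curve (\<lambda>z. g z / f z)" "in_curve (\<lambda>z. h z / f z)" using quot_mero fgh curve_closed(2) by (auto simp: in_curve_def)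
 have "in_curve (\<lambda>z. poly q (g z / f z))" for q by (induction q) (simp_all only: poly_0 poly_pCons in_curve_ops x)
 thus ?thesis by (induction p) (simp_all only: poly_0 poly_pCons poly_add poly_mult mult_poly_0 add_0_right in_curve_ops x)
qed

lemma eventually_f: "P \<in> EHP \<Gamma> ==> near P (\<lambda>z. f z ~= 0)"
 by (rule modular_form_eventually_nonzero[OF chi forms(1) f_nz])

text \<open>Dividing by f^(n + 1) leaves a ratio of polynomials in g / f and h / f; the denominator
  is not the zero function since it is nonzero at some point.\<close>

lemma in_curve_of_relation:
 assumes u: "u \<in> \<Xi>" and B: "\<exists>z. Im z > 0 \<and> hform n b (V z) ~= 0"
  and rel: "\<And>z. hform (Suc n) a (V z) + u z * hform n b (V z) = 0"
 shows "mk_mero \<Gamma> (\<lambda>z. u z / f z) \<in> curve_field \<Gamma> f g h"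
proof -
 define q where "q = (\<lambda>n c z. poly2 (dehom n c) (g z / f z) (h z / f z))"
 have q: "in_curve (q k c)" for k c unfolding q_def by (rule in_curve_poly2)
 have hq: "hform k c (V z) = f z ^ k * q k c z" if "f z ~= 0" for k c z using hform_dehom[of "V z" k c] that by (simp add: q_def)
 obtain z0 where z0: "Im z0 > 0" "hform n b (V z0) ~= 0" using B by blast
 have nz: "\<not> aut_eq \<Gamma> (q n b) (\<lambda>_. 0)"
 proof
  assume "aut_eq \<Gamma> (q n b) (\<lambda>_. 0)"
  hence "eventually (\<lambda>z. q n b z = 0) (at z0)" using z0(1) UHP_extended[OF z0(1)] filter_at_UHP unfolding aut_eq_def by metis
  moreover have "eventually (\<lambda>z. f z ~= 0) (at z0)" using eventually_f[OF UHP_extended[OF z0(1)]] by (simp add: filter_at_UHP[OF z0(1)])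
  moreover have "isCont (\<lambda>z. hform n b (V z)) z0"
   using holomorphic_on_imp_continuous_on[OF holomorphic_homog[OF homogI V_hol]] z0(1) open_UHP by (simp add: continuous_on_eq_continuous_at)
  hence "eventually (\<lambda>z. hform n b (V z) ~= 0) (at z0)" using z0(2) tendsto_imp_eventually_ne by (auto simp: isCont_def)
  ultimately have "eventually (\<lambda>z. False) (at z0)" by eventually_elim (use hq in auto)
  thus False by simp
 qed
 have "in_curve (\<lambda>z. inverse (q n b z))" using q[of n b] curve_closed(5)[OF _ nz] unfolding in_curve_def by blast
 hence w: "in_curve (\<lambda>z. (-1) * (q (Suc n) a z * inverse (q n b z)))" by (intro in_curve_ops q)
 have "aut_eq \<Gamma> (\<lambda>z. u z / f z) (\<lambda>z. (-1) * (q (Suc n) a z * inverse (q n b z)))"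
  unfolding aut_eq_def
 proof
  fix P assume P: "P \<in> EHP \<Gamma>"
  have "near P (\<lambda>z. q n b z ~= 0)" using aut_mero_dichotomy[of "q n b"] q nz P unfolding in_curve_def by blast
  with eventually_f[OF P] show "near P (\<lambda>z. u z / f z = (-1) * (q (Suc n) a z * inverse (q n b z)))"
  proof eventually_elim
   case (elim z)
   have "f z ^ n * (f z * q (Suc n) a z + u z * q n b z) = 0" using rel[of z] hq[OF elim(1)] by (simp add: algebra_simps)
   hence "f z * q (Suc n) a z + u z * q n b z = 0" using elim(1) by simp
   thus ?case using elim by (simp add: field_simps add_eq_0_iff)
  qed
 qed
 thus ?thesis using w mk_mero_eq_iff[OF quot_mero(1)[OF u]] unfolding in_curve_def by metis
qed

text \<open>The coefficients of the relations of \<open>f, g, h + e u\<close> can be chosen as polynomials in \<open>e\<close>; the derivative at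
 \<open>e = 0\<close> is linear in \<open>u\<close>.\<close>

lemma quotient_in_curve:
 assumes u: "u \<in> \<Xi>" and dep: "\<And>e. \<not> indep_fam (Mon (rel_degree f g h)) (mono_fam (rel_degree f g h) f g (h + cfun_scale e u))"
 shows "mk_mero \<Gamma> (\<lambda>z. u z / f z) \<in> curve_field \<Gamma> f g h"
proof -
 define L where "L = rel_degree f g h"
 obtain n where n: "L = Suc n" using rel_degree_ge_2 by (metis L_def Suc_pred' less_le_trans zero_less_numeral)
 obtain J where J: "chart_atlas W J" using exists_chart_atlas by blast
 obtain c where "plane_curve_min (ch ` J) L c" using minimal_relation[OF J] unfolding L_def by blast
 then interpret M: plane_curve_min "ch ` J" L c .
 \<comment> \<open>A monomial that really involves h, so that it survives differentiation in the
   third variable.\<close>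
 obtain i0 j0 where k0: "c (i0, Suc j0) ~= 0" "(i0, Suc j0) \<in> Mon L"
 proof -
  have "coeff M.P (degree M.P) ~= 0" using M.P_nz by simp
  then obtain i where "coeff (coeff M.P (degree M.P)) i ~= 0" by (metis poly_eqI coeff_0)
  thus ?thesis using that[of i "degree M.P - 1"] M.degree_P_pos by (auto simp: coeff_dehom Mon_def split: if_splits)
 qed
 define k where "k = (i0, Suc j0)"
 define I where "I = Mon L - {k}"
 have I: "finite I" "k \<notin> I" "insert k I = Mon L" using k0 by (auto simp: I_def k_def)
 \<comment> \<open>The relation of degree L is unique up to scaling and involves the monomial
   \<open>k\<close>; without \<open>k\<close> no relation is left.\<close>
 have ind: "indep_fam I (mono_fam L f g h)"
  unfolding indep_fam_def
 proof (intro allI impI ballI)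
  fix d i assume d: "\<forall>z. (\<Sum>i\<in>I. d i * mono_fam L f g h i z) = 0" and i: "i \<in> I"
  define d' where "d' = d(k := 0)"
  have "hform L d' (V z) = 0" for z
  proof -
   have "hform L d' (V z) = (\<Sum>i\<in>insert k I. d' i * mono_fam L f g h i z)" by (simp only: I(3) hform_vec3)
   also have "... = (\<Sum>i\<in>I. d i * mono_fam L f g h i z)" using I(1,2) by (auto simp: d'_def intro: sum.cong)
   finally show ?thesis using d by simp
  qed
  hence "M.vanish (hform L d')" by (simp add: vanish_iff[OF J homogI])
  from M.relation_unique[OF this] obtain a where a: "\<forall>x\<in>Mon L. d' x = a * c x" by blast
  hence "a = 0" using k0 by (auto simp: d'_def k_def)
  thus "d i = 0" using a i by (auto simp: d'_def I_def)
 qed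
 have "\<exists>co. (\<forall>i\<in>Mon L. co i \<in> polynomial_funs cfun_scale) \<and> co k h ~= 0 \<and>
  (\<forall>h. co k h ~= 0 --> \<not> indep_fam (Mon L) (mono_fam L f g h) --> (\<forall>z. (\<Sum>i\<in>Mon L. co i h * mono_fam L f g h i z) = 0))"
  using polynomial_relation[OF I(1,2), of "\<lambda>i h z. mono_fam L f g h i z" cfun_scale h, OF mono_fam_polynomial ind] unfolding I(3) .
 then obtain co where co: "\<And>i. i \<in> Mon L ==> co i \<in> polynomial_funs cfun_scale" "co k h ~= 0"
  "\<And>h z. co k h ~= 0 ==> \<not> indep_fam (Mon L) (mono_fam L f g h) ==> (\<Sum>i\<in>Mon L. co i h * mono_fam L f g h i z) = 0"
 by blast
 obtain q where q: "\<And>i e. i \<in> Mon L ==> co i (h + cfun_scale e u) = poly (q i) e" by (metis polynomial_on_line[OF co(1) cfun.vector_space_axioms])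
 have qk: "poly (q k) 0 ~= 0" using q[of k 0] co(2) k0 by (simp add: k_def)
 \<comment> \<open>The relation along the line h + e u, as a polynomial in e for each fixed z. It
   vanishes wherever \<open>q k\<close> does not, hence identically.\<close>
 define S where "S = (\<lambda>z. \<Sum>x\<in>Mon L. q x * ([:f z ^ (L - fst x - snd x) * g z ^ fst x:] * [:h z, u z:] ^ snd x))"
 have "S z = 0" for z
 proof -
  have "poly (S z * q k) e = 0" for e
  proof (cases "poly (q k) e = 0")
   case False
   hence "(\<Sum>i\<in>Mon L. co i (h + cfun_scale e u) * mono_fam L f g (h + cfun_scale e u) i z) = 0"
    using co(3) dep q[of k e] k0 by (simp add: L_def k_def)
   also have "(\<Sum>i\<in>Mon L. co i (h + cfun_scale e u) * mono_fam L f g (h + cfun_scale e u) i z) = poly (S z) e"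
    unfolding S_def poly_sum using fun_cong[OF cfun_scale_def[of e u], of z]
 by (intro sum.cong) (auto simp: q mono_fam_def)
   finally show ?thesis by simp
  qed simp
  hence "S z * q k = 0" by (simp add: poly_all_0_iff_0[symmetric])
  thus ?thesis using qk by auto
 qed
 hence dS: "poly (pderiv (S z)) 0 = 0" for z by simp
 define a where "a = (\<lambda>x. poly (pderiv (q x)) 0)"
 \<comment> \<open>Coefficients of the partial derivative in the third variable of the relation at e
   = 0; \<open>a\<close> collects the derivatives of the coefficients themselves.\<close>
 define b where "b = (\<lambda>(i, j). of_nat (Suc j) * poly (q (i, Suc j)) 0)"
 have rel: "hform (Suc n) a (V z) + u z * hform n b (V z) = 0" for z
 proof -
  define t where "t = (\<lambda>x. poly (q x) 0 * (f z ^ (L - fst x - snd x) * g z ^ fst x) * (of_nat (snd x) * h z ^ (snd x - 1)))"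
  have "poly (pderiv (S z)) 0 = (\<Sum>x\<in>Mon L. a x * mono_fam L f g h x z + u z * t x)"
   unfolding S_def higher_pderiv_sum[of 1, simplified] poly_sum
 by (intro sum.cong) (simp_all add: pderiv_mult pderiv_smult pderiv_power pderiv_pCons mono_fam_def a_def t_def algebra_simps)
  also have "... = hform (Suc n) a (V z) + u z * (\<Sum>x\<in>Mon L. t x)" by (simp add: sum.distrib sum_distrib_left hform_vec3 n)
  also have "(\<Sum>x\<in>Mon L. t x) = (\<Sum>x\<in>(\<lambda>(i, j). (i, Suc j)) ` Mon n. t x)"
  proof (rule sum.mono_neutral_right[OF finite_Mon])
   show "\<forall>x\<in>Mon L - (\<lambda>(i, j). (i, Suc j)) ` Mon n. t x = 0"
   proof
    fix x assume x: "x \<in> Mon L - (\<lambda>(i, j). (i, Suc j)) ` Mon n"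
    obtain i j where ij: "x = (i, j)" by (cases x)
    have "j = 0"
    proof (rule ccontr)
     assume "j ~= 0"
     then obtain j' where "j = Suc j'" by (cases j) auto
     thus False using x ij by (auto simp: Mon_def n)
    qed
    thus "t x = 0" by (simp add: t_def ij)
   qed
  qed (auto simp: Mon_def n)
  also have "... = (\<Sum>x\<in>Mon n. t (case x of (i, j) => (i, Suc j)))" by (subst sum.reindex) (auto simp: inj_on_def)
  also have "... = hform n b (V z)" unfolding hform_vec3
 by (intro sum.cong) (auto simp: t_def b_def mono_fam_def n)
  finally show ?thesis using dS[of z] by simp
 qed
 have "(i0, j0) \<in> Mon n" using k0(2) by (simp add: Mon_def n)
 moreover have "b (i0, j0) ~= 0" using qk by (simp add: b_def k_def del: of_nat_Suc)
 ultimately have "\<exists>z. Im z > 0 \<and> hform n b (V z) ~= 0" using hform_eq_0D rel_degree_le[of "hform n b" n] n by (force simp: homogI L_def)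
 thus ?thesis by (rule in_curve_of_relation[OF u _ rel])
qed

text \<open>The generators of the function field have some \<open>f0\<close> as denominator, not f;
  the identity w / f0 = (w / f) (f0 / f)^(-1) changes the denominator. The two fields then agree,
  and the extension has degree 1.\<close>

lemma deg_map_eq_1:
 assumes gen: "determines_function_field \<Gamma> \<Xi>" and q: "\<And>u. u \<in> \<Xi> ==> mk_mero \<Gamma> (\<lambda>z. u z / f z) \<in> curve_field \<Gamma> f g h"
 shows "deg_map \<Gamma> f g h = 1"
proof -
 let ?F = "function_field \<Gamma>"
 interpret F: field ?F by (rule field_function_field)
 have sf: "subfield (curve_field \<Gamma> f g h) ?F" by (rule curve_closed(6))
 obtain B f0 where B: "cfun.independent B" "cfun.span B = \<Xi>" "f0 \<in> B"
  "generated_over_C \<Gamma> ((\<lambda>f. form_quot \<Gamma> f f0) ` (B - {f0})) = carrier ?F"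
  using gen unfolding determines_function_field_def by blast
 have BX: "w \<in> \<Xi>" if "w \<in> B" for w using that B(2) cfun.span_base by blast
 have f0: "f0 \<in> \<Xi>" "f0 ~= (\<lambda>_. 0)" using BX[OF B(3)] B(1,3) cfun.dependent_zero by (auto simp: zero_fun_def)
 have f0m: "f0 \<in> modular_forms \<Gamma> chi m" using f0(1) sub by blast
 have ev0: "near P (\<lambda>z. f0 z ~= 0)" if "P \<in> EHP \<Gamma>" for P
 by (rule modular_form_eventually_nonzero[OF chi f0m f0(2) that])
 have nz: "\<not> aut_eq \<Gamma> (\<lambda>z. f0 z / f z) (\<lambda>_. 0)"
 proof
  obtain P where P: "P \<in> EHP \<Gamma>" using extended_ex by blast
  assume "aut_eq \<Gamma> (\<lambda>z. f0 z / f z) (\<lambda>_. 0)"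
  hence "near P (\<lambda>z. f0 z / f z = 0)" using P by (simp add: aut_eq_def)
  with ev0[OF P] eventually_f[OF P] have "near P (\<lambda>z. False)" by eventually_elim simp
  thus False using punctured_nhds_neq_bot[OF P] by simp
 qed
 have fq: "form_quot \<Gamma> w f0 \<in> curve_field \<Gamma> f g h" "form_quot \<Gamma> w f0 \<in> mero_funs \<Gamma>" if w: "w \<in> \<Xi>" for w
 proof -
  have wm: "w \<in> modular_forms \<Gamma> chi m" using w sub by blast
  have eq: "form_quot \<Gamma> w f0 = mk_mero \<Gamma> (\<lambda>z. w z / f0 z)" by (rule form_quot_eq[OF chi wm f0m f0(2)])
  have am: "aut_mero \<Gamma> (\<lambda>z. w z / f0 z)" by (rule aut_mero_quotient[OF chi wm f0m f0(2)])
  have "in_curve (\<lambda>z. inverse (f0 z / f z))" unfolding in_curve_def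
   using curve_closed(5)[OF quot_mero(1)[OF f0(1)] nz q[OF f0(1)]] quot_mero(1)[OF f0(1)] aut_mero_inverse by blast
  hence c: "in_curve (\<lambda>z. (w z / f z) * inverse (f0 z / f z))"
   using w q quot_mero(1) by (intro in_curve_ops) (auto simp: in_curve_def)
  have "aut_eq \<Gamma> (\<lambda>z. w z / f0 z) (\<lambda>z. (w z / f z) * inverse (f0 z / f z))"
   unfolding aut_eq_def
  proof
   fix P assume P: "P \<in> EHP \<Gamma>"
   show "near P (\<lambda>z. w z / f0 z = (w z / f z) * inverse (f0 z / f z))"
    using eventually_f[OF P] by eventually_elim simp
  qed
  thus "form_quot \<Gamma> w f0 \<in> curve_field \<Gamma> f g h" using c mk_mero_eq_iff[OF am] unfolding eq in_curve_def by metis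
  show "form_quot \<Gamma> w f0 \<in> mero_funs \<Gamma>" unfolding eq by (rule mk_mero_in[OF am])
 qed
 have "(\<lambda>f. form_quot \<Gamma> f f0) ` (B - {f0}) \<subseteq> mero_funs \<Gamma>" using fq(2) BX by blast
 from generated_over_C_closed(7)[OF this sf] have eq: "curve_field \<Gamma> f g h = carrier ?F" using fq(1) BX curve_closed(1) B(4) subfieldE(3)[OF sf] by (auto simp: mero_const_eq)
 show ?thesis unfolding deg_map_def eq
  using F.dimI[OF sf F.dimension_one[OF sf]] unfolding eq over_def .
qed

end

theorem corollary1p5:
  fixes \<Gamma> :: "(real^2^2) set" and chi :: "real^2^2 \<Rightarrow> complex" and m :: nat
    and \<Xi> :: "(complex \<Rightarrow> complex) set" and f g :: "complex \<Rightarrow> complex"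
  assumes "fuchsian_first_kind \<Gamma>"
    and "finite_order_character \<Gamma> chi"
    and "m \<ge> 1"
    and "\<Xi> \<subseteq> modular_forms \<Gamma> chi m"
    and "cfun.subspace \<Xi>"
    and "cfun.dim \<Xi> \<ge> 3"
    and "determines_function_field \<Gamma> \<Xi>"
    and "f \<in> \<Xi>" and "g \<in> \<Xi>"
    and "f \<noteq> g" and "cfun.independent {f, g}"
  shows "let Z = birational_set \<Gamma> \<Xi> f g \<inter> degree_set \<Gamma> \<Xi> f g (max_degree \<Gamma> \<Xi> f g)
         in (\<exists>U. openin (zariski cfun_scale \<Xi>) U \<and> U \<noteq> {} \<and> U \<subseteq> Z) \<and>
            openin (zariski cfun_scale \<Xi>) Z \<and> Z \<noteq> {}"
proof -
 note chi = assms(2) and sub = assms(4) and X = assms(5) and fX = assms(8) and gX = assms(9) and fg = assms(10,11)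
 obtain D where D: "subgroup \<Gamma> SL2R" "discrete \<Gamma>" "fundamental_set \<Gamma> D" "hyperbolic_area D < \<infinity>"
  using assms(1) unfolding fuchsian_first_kind_def by blast
 interpret G: finite_area_SL2 \<Gamma> D by (intro finite_area_SL2.intro discrete_SL2.intro finite_area_SL2_axioms.intro D)
 have comb: "form_comb f g h a = cfun_scale (a$1) f + cfun_scale (a$2) g + cfun_scale (a$3) h" for h a
 by (simp add: form_comb_def cfun_scale_def fun_eq_iff)
 have triple: "form_triple \<Gamma> D chi m \<Xi> f g h" if h: "h \<in> \<Xi> - cfun.span {f, g}" for h
 proof unfold_locales
  show "form_comb f g h a \<in> \<Xi>" for a unfolding comb
   using h fX gX X by (intro cfun.subspace_add cfun.subspace_scale) auto
  show "a = 0" if a: "form_comb f g h a = (\<lambda>_. 0)" for a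
  proof -
   have s: "cfun_scale (a$1) f + cfun_scale (a$2) g + cfun_scale (a$3) h = 0" using a unfolding comb by auto
   have a3: "a$3 = 0"
   proof (rule ccontr)
    assume a3: "a$3 ~= 0"
    have "h z = (- a$1 / a$3) * f z + (- a$2 / a$3) * g z" for z
    proof -
     have "a$1 * f z + a$2 * g z + a$3 * h z = 0" using fun_cong[OF s, of z] by (simp add: cfun_scale_def)
     hence "a$3 * h z = 0 - (a$1 * f z + a$2 * g z)" by (simp only: eq_diff_eq ac_simps)
     hence "a$3 * h z / a$3 = (0 - (a$1 * f z + a$2 * g z)) / a$3" by simp
     thus ?thesis using a3 by (simp add: diff_divide_distrib)
    qed
    hence "h = cfun_scale (- a$1 / a$3) f + cfun_scale (- a$2 / a$3) g" by (simp add: fun_eq_iff cfun_scale_def)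
    moreover have "... \<in> cfun.span {f, g}" by (intro cfun.span_add cfun.span_scale cfun.span_base) auto
    ultimately show False using h by simp
   qed
   have "(\<Sum>v\<in>{f, g}. cfun_scale (if v = f then a$1 else a$2) v) = 0" using s a3 fg(1) by simp
   from cfun.independentD[OF fg(2) _ subset_refl this] show ?thesis using a3 fg(1) by (force simp: vec_eq_iff forall_3)
  qed
 qed (use chi sub h fX gX in auto)
 define d where "d = rel_degree f g"
 define H where "H = \<Xi> - cfun.span {f, g}"
 have deg: "deg_curve \<Gamma> f g h = d h" "d h \<ge> 2" "\<And>n. n \<ge> 1 ==> indep_fam (Mon n) (mono_fam n f g h) \<longleftrightarrow> n < d h" if "h \<in> H" for h
  using form_triple.deg_curve_eq[OF triple] form_triple.rel_degree_ge_2[OF triple] form_triple.indep_mono_fam_iff[OF triple] that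
 by (auto simp: d_def H_def)
 \<comment> \<open>A combination of f and g satisfies a linear relation, which is raised to degree
   n. Thus the independence criterion excludes the span by itself.\<close>
 have span_dep: "\<not> indep_fam (Mon n) (mono_fam n f g h)" if "h \<in> cfun.span {f, g}" "n \<ge> 1" for h n
 proof -
  obtain a b where h: "h = cfun_scale a f + cfun_scale b g"
   using \<open>h \<in> cfun.span {f, g}\<close> unfolding cfun.span_insert cfun.span_singleton cfun.span_empty by (auto simp: algebra_simps)
  define p :: "complex^3 => complex" where "p = (\<lambda>v. a * v$1 + b * v$2 + (-1) * v$3)"
  have p: "p \<in> homog 1" unfolding p_def by (rule homog_linear)
  have "p (axis 3 1) ~= 0" by (simp add: p_def axis_def)
  hence "p ~= (\<lambda>_. 0)" by auto
  from homog_raise[OF p this, of "n - 1"] not_indep_mono_fam[of "\<lambda>v. p v * v $ 1 ^ (n - 1)" n f g h] that(2)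
  show ?thesis by (simp add: p_def h cfun_scale_def)
 qed
 obtain J where "chart_atlas \<Xi> J"
 proof -
  have "f ~= 0" using fg(2) cfun.dependent_zero by auto
  hence "\<exists>F\<in>\<Xi>. \<exists>z. F z ~= 0" using fX by auto
  from G.modular_forms_charts[OF chi sub this] show ?thesis using that by blast
 qed
 from uniform_relation_degree[OF this] obtain k where
  k: "\<forall>f\<in>\<Xi>. \<forall>g\<in>\<Xi>. \<forall>h\<in>\<Xi>. \<exists>c. (\<exists>x\<in>Mon k. c x ~= 0) \<and> (\<forall>z\<in>UHP. hform k c (vector [f z, g z, h z]) = 0)" ..
 \<comment> \<open>One atlas for the whole of \<open>\<Xi>\<close> gives a bound independent of h,
   so the degrees have a maximum.\<close>
 have bound: "d h \<le> k" if h: "h \<in> H" for h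
 proof -
  obtain c where c: "\<exists>x\<in>Mon k. c x ~= 0" "\<forall>z\<in>UHP. hform k c (vec3 f g h z) = 0"
   using k fX gX h unfolding vec3_def H_def by blast
  show ?thesis using c(1) hform_eq_0D[of k c] form_triple.rel_degree_le[OF triple, of h "hform k c" k] c(2) h by (auto simp: homogI d_def H_def)
 qed
 have "\<not> \<Xi> \<subseteq> cfun.span {f, g}"
 proof
  assume "\<Xi> \<subseteq> cfun.span {f, g}"
  from cfun.dim_le_card[OF this] show False using assms(6) card_insert_le_m1[of 2 "{g}" f] by simp
 qed
 hence Hne: "H ~= {}" unfolding H_def by blast
 define L where "L = Max (d ` H)"
 have fin: "finite (d ` H)" by (rule finite_subset[of _ "{..k}"]) (use bound in auto)
 have dL: "d h \<le> L" if "h \<in> H" for h unfolding L_def using fin that by simp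
 obtain h0 where h0: "h0 \<in> H" "d h0 = L" using Max_in[OF fin] Hne by (force simp: L_def)
 have L2: "L \<ge> 2" using deg(2)[OF h0(1)] h0(2) by simp
 have DS: "degree_set \<Gamma> \<Xi> f g l = {h \<in> H. d h = l}" for l using deg(1) by (auto simp: degree_set_def H_def)
 have max: "max_degree \<Gamma> \<Xi> f g = L" unfolding max_degree_def DS
 by (rule Greatest_equality) (use h0 L2 dL in auto)
 define Z where "Z = {h \<in> H. d h = L}"
 have bir: "deg_map \<Gamma> f g h = 1" if h: "h \<in> Z" for h
 proof -
  have hH: "h \<in> \<Xi> - cfun.span {f, g}" and hL: "rel_degree f g h = L" using h by (auto simp: Z_def H_def d_def)
  interpret T: form_triple \<Gamma> D chi m \<Xi> f g h by (rule triple[OF hH])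
  show ?thesis
  proof (rule T.deg_map_eq_1[OF assms(7) T.quotient_in_curve])
   fix u e assume u: "u \<in> \<Xi>"
   define h' where "h' = h + cfun_scale e u"
   \<comment> \<open>In either case the monomials of degree L are dependent: in the span by the
     linear relation, and in \<open>H\<close> because no degree exceeds L.\<close>
   have "h' \<in> cfun.span {f, g} \<or> h' \<in> H" using hH u X unfolding h'_def H_def by (auto intro!: cfun.subspace_add cfun.subspace_scale)
   thus "\<not> indep_fam (Mon (rel_degree f g h)) (mono_fam (rel_degree f g h) f g (h + cfun_scale e u))"
    unfolding hL h'_def[symmetric] using span_dep[of h' L] deg(3)[of h' L] dL[of h'] L2 by auto
  qed
 qed
 have Zeq: "birational_set \<Gamma> \<Xi> f g \<inter> degree_set \<Gamma> \<Xi> f g (max_degree \<Gamma> \<Xi> f g) = Z"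
  using bir unfolding max DS birational_set_def Z_def H_def by blast
 \<comment> \<open>Since the degree is at most L, being maximal means exceeding L - 1, and this is
   independence in degree L - 1, which is at least 1.\<close>
 have Zmem: "h \<in> Z \<longleftrightarrow> indep_fam (Mon (L - 1)) (mono_fam (L - 1) f g h)" if "h \<in> \<Xi>" for h
  using span_dep[of h "L - 1"] deg(3)[of h "L - 1"] dL[of h] L2 that by (cases "h \<in> H") (auto simp: Z_def H_def)
 define S where "S = {p \<in> polynomial_funs cfun_scale. \<forall>h\<in>\<Xi>. p h ~= 0 --> h \<in> Z}"
 have "Z = {v\<in>\<Xi>. \<exists>p\<in>S. p v ~= 0}"
 proof (intro equalityI subsetI)
  fix h assume h: "h \<in> Z"
  hence hX: "h \<in> \<Xi>" by (simp add: Z_def H_def)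
  have "indep_fam (Mon (L - 1)) (\<lambda>i. mono_fam (L - 1) f g h i)" using h Zmem[OF hX] by simp
  from independence_open[OF finite_Mon, of _ "\<lambda>i h z. mono_fam (L - 1) f g h i z" cfun_scale h, OF mono_fam_polynomial this] obtain p where
   p: "p \<in> polynomial_funs cfun_scale" "p h ~= 0" "\<And>h. p h ~= 0 ==> indep_fam (Mon (L - 1)) (mono_fam (L - 1) f g h)" by blast
  show "h \<in> {v\<in>\<Xi>. \<exists>p\<in>S. p v ~= 0}" using p(1,3) Zmem p(2) hX by (auto simp: S_def)
 qed (auto simp: S_def)
 hence "openin (zariski cfun_scale \<Xi>) Z" unfolding openin_zariski by (intro exI[of _ S]) (auto simp: S_def)
 moreover have "Z ~= {}" using h0 by (auto simp: Z_def)
 ultimately show ?thesis unfolding Let_def Zeq by blast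
qed

end
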